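(* Let $L$ be a finite-dimensional restricted Lie algebra over a field $\mathbb{F}$ of prime characteristic $p$, let $\chi$ be a linear form on $L$, and let $I$ be a $p$-ideal of $L$. Then $$\dim_{\mathbb{F}} P_L(S)=\dim_{\mathbb{F}} P_I(\mathbb{F})\cdot\dim_{\mathbb{F}} P_{L/I}(S)$$ holds for every irreducible $L$-module $S$ with $p$-character $\chi$ such that $I\cdot S=0$.
   Context: Let $(L,{}^{[p]})$ be a finite-dimensional restricted Lie algebra over a field $\mathbb{F}$ of prime characteristic $p$. For a linear form $\chi:L\to\mathbb{F}$, the $\chi$-reduced universal enveloping algebra is $u(L,\chi):=U(L)/(x^p-x^{[p]}-\chi(x)^p\cdot 1\mid x\in L)$. An $L$-module $M$ has $p$-character $\chi$ if $x^p\cdot m-x^{[p]}\cdot m=\chi(x)^p m$ for all $x\in L$, $m\in M$, i.e. if it is a $u(L,\chi)$-module. For such $M$, $P_L(M)$ denotes the projective cover of $M$ as a $u(L,\chi)$-module. A $p$-ideal is an ideal closed under the $[p]$-map; then $L/I$ is again a restricted Lie algebra. If $S\neq 0$ has $p$-character $\chi$ and $I\cdot S=0$, then $\chi$ vanishes on $I$ and so induces a linear form on $L/I$, again denoted $\chi$; $P_{L/I}(S)$ is the projective cover of $S$ as a $u(L/I,\chi)$-module. $P_I(\mathbb{F})$ is the projective cover of the one-dimensional trivial $I$-module $\mathbb{F}$ over $u(I,0)$. *)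

theory Defs
  imports
    "Jordan_Normal_Form.VS_Connect"
    "HOL-Algebra.QuotRing"
    "HOL-Computational_Algebra.Primes"
begin

text \<open>
  The ground field is a type \<open>'k::field\<close>; as a ring record it is \<^term>\<open>class_ring\<close>, so that the
  vector space theory for records (\<^const>\<open>vectorspace.dim\<close> etc.) applies. All other structures are
  records with explicit carriers. The inherited fields \<^const>\<open>mult\<close> and \<^const>\<open>one\<close> of vector spaces,
  Lie algebras and modules carry no meaning.
\<close>

section \<open>Restricted Lie algebras\<close>

record ('k, 'l) lie_algebra = "('k, 'l) module" +
  bracket :: "'l \<Rightarrow> 'l \<Rightarrow> 'l"

record ('k, 'l) restricted_lie_algebra = "('k, 'l) lie_algebra" +
  pmap :: "'l \<Rightarrow> 'l"

locale lie_algebra = vectorspace class_ring L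
  for L :: "('k::field, 'l, 'x) lie_algebra_scheme" (structure) +
  assumes bracket_closed:
      "\<lbrakk>x \<in> carrier L; y \<in> carrier L\<rbrakk> \<Longrightarrow> bracket L x y \<in> carrier L"
    and bracket_add_left: "\<lbrakk>x \<in> carrier L; y \<in> carrier L; z \<in> carrier L\<rbrakk>
      \<Longrightarrow> bracket L (x \<oplus> y) z = bracket L x z \<oplus> bracket L y z"
    and bracket_add_right: "\<lbrakk>x \<in> carrier L; y \<in> carrier L; z \<in> carrier L\<rbrakk>
      \<Longrightarrow> bracket L x (y \<oplus> z) = bracket L x y \<oplus> bracket L x z"
    and bracket_smult_left: "\<lbrakk>x \<in> carrier L; y \<in> carrier L\<rbrakk>
      \<Longrightarrow> bracket L (a \<odot> x) y = a \<odot> bracket L x y"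
    and bracket_smult_right: "\<lbrakk>x \<in> carrier L; y \<in> carrier L\<rbrakk>
      \<Longrightarrow> bracket L x (a \<odot> y) = a \<odot> bracket L x y"
    and bracket_self: "x \<in> carrier L \<Longrightarrow> bracket L x x = \<zero>"
    and jacobi: "\<lbrakk>x \<in> carrier L; y \<in> carrier L; z \<in> carrier L\<rbrakk>
      \<Longrightarrow> bracket L x (bracket L y z) \<oplus> bracket L y (bracket L z x)
          \<oplus> bracket L z (bracket L x y) = \<zero>"

text \<open>\<open>ad_coeff L x y n j\<close> is the coefficient of $T^j$ in $(\mathrm{ad}(Tx+y))^n(x) \in L[T]$.\<close>

primrec ad_coeff ::
    "('k, 'l, 'x) lie_algebra_scheme \<Rightarrow> 'l \<Rightarrow> 'l \<Rightarrow> nat \<Rightarrow> nat \<Rightarrow> 'l" where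
  "ad_coeff L x y 0 j = (if j = 0 then x else \<zero>\<^bsub>L\<^esub>)"
| "ad_coeff L x y (Suc n) j =
     (if j = 0 then \<zero>\<^bsub>L\<^esub> else bracket L x (ad_coeff L x y n (j - 1)))
       \<oplus>\<^bsub>L\<^esub> bracket L y (ad_coeff L x y n j)"

text \<open>Jacobson's $s_i(x,y)$: $i\,s_i(x,y)$ is the coefficient of $T^{i-1}$ in
  $(\mathrm{ad}(Tx+y))^{p-1}(x)$, for $1 \le i \le p-1$.\<close>

definition jacobson_s ::
    "('k::field, 'l, 'x) lie_algebra_scheme \<Rightarrow> nat \<Rightarrow> 'l \<Rightarrow> 'l \<Rightarrow> 'l" where
  "jacobson_s L i x y = inverse (of_nat i) \<odot>\<^bsub>L\<^esub> ad_coeff L x y (CHAR('k) - 1) (i - 1)"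

locale restricted_lie_algebra = lie_algebra L
  for L :: "('k::field, 'l, 'x) restricted_lie_algebra_scheme" (structure) +
  assumes char_prime: "prime CHAR('k)"
    and pmap_closed: "x \<in> carrier L \<Longrightarrow> pmap L x \<in> carrier L"
    and ad_pmap: "\<lbrakk>x \<in> carrier L; y \<in> carrier L\<rbrakk>
      \<Longrightarrow> bracket L (pmap L x) y = (bracket L x ^^ CHAR('k)) y"
    and pmap_smult: "x \<in> carrier L \<Longrightarrow> pmap L (a \<odot> x) = a ^ CHAR('k) \<odot> pmap L x"
    and pmap_add: "\<lbrakk>x \<in> carrier L; y \<in> carrier L\<rbrakk>
      \<Longrightarrow> pmap L (x \<oplus> y) = pmap L x \<oplus> pmap L y
          \<oplus> (\<Oplus>i\<in>{1..<CHAR('k)}. jacobson_s L i x y)"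

definition linear_form :: "('k::field, 'l, 'x) module_scheme \<Rightarrow> ('l \<Rightarrow> 'k) \<Rightarrow> bool" where
  "linear_form L \<chi> \<longleftrightarrow>
     (\<forall>x\<in>carrier L. \<forall>y\<in>carrier L. \<chi> (x \<oplus>\<^bsub>L\<^esub> y) = \<chi> x + \<chi> y) \<and>
     (\<forall>a. \<forall>x\<in>carrier L. \<chi> (a \<odot>\<^bsub>L\<^esub> x) = a * \<chi> x)"

definition p_ideal :: "'l set \<Rightarrow> ('k::field, 'l, 'x) restricted_lie_algebra_scheme \<Rightarrow> bool" where
  "p_ideal I L \<longleftrightarrow> VectorSpace.subspace class_ring I L \<and>
     (\<forall>x\<in>carrier L. \<forall>y\<in>I. bracket L x y \<in> I) \<and> (\<forall>y\<in>I. pmap L y \<in> I)"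

text \<open>The quotient $L/I$, in the style of \<^const>\<open>FactRing\<close>: each union below is a union of copies of
  one and the same coset.\<close>

definition quot_lie ::
    "('k, 'l, 'x) restricted_lie_algebra_scheme \<Rightarrow> 'l set \<Rightarrow> ('k, 'l set) restricted_lie_algebra" where
  "quot_lie L I =
     \<lparr>carrier = a_rcosets\<^bsub>L\<^esub> I, mult = undefined, one = undefined,
      zero = I, add = set_add L,
      smult = (\<lambda>a X. \<Union>x\<in>X. I +>\<^bsub>L\<^esub> (a \<odot>\<^bsub>L\<^esub> x)),
      bracket = (\<lambda>X Y. \<Union>x\<in>X. \<Union>y\<in>Y. I +>\<^bsub>L\<^esub> bracket L x y),
      pmap = (\<lambda>X. \<Union>x\<in>X. I +>\<^bsub>L\<^esub> pmap L x)\<rparr>"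

text \<open>The linear form induced on $L/I$ by a linear form vanishing on $I$: the constant value on a
  coset.\<close>

definition quot_form :: "('l \<Rightarrow> 'k) \<Rightarrow> 'l set \<Rightarrow> 'k" where
  "quot_form \<chi> X = the_elem (\<chi> ` X)"

section \<open>The enveloping algebras $U(L)$ and $u(L,\chi)$\<close>

text \<open>The free unital associative algebra on a set \<open>X\<close>: finitely supported functions on the words
  over \<open>X\<close>, with convolution along concatenation as product.\<close>

definition free_algebra :: "'l set \<Rightarrow> ('l list \<Rightarrow> 'k::field) ring" where
  "free_algebra X =
     \<lparr>carrier = {f. finite {w. f w \<noteq> 0} \<and> {w. f w \<noteq> 0} \<subseteq> lists X},
      mult = (\<lambda>f g w. \<Sum>i\<le>length w. f (take i w) * g (drop i w)),
      one = (\<lambda>w. if w = [] then 1 else 0),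
      zero = (\<lambda>w. 0),
      add = (\<lambda>f g w. f w + g w)\<rparr>"

definition monomial :: "'k \<Rightarrow> 'l list \<Rightarrow> 'l list \<Rightarrow> 'k::field" where
  "monomial a w = (\<lambda>v. if v = w then a else 0)"

text \<open>$U(L)$ is the tensor algebra of $L$ modulo $x \otimes y - y \otimes x - [x,y]$. The first two families
  of relations cut the tensor algebra out of the free algebra on the set $L$.\<close>

definition uea_relations :: "('k::field, 'l, 'x) lie_algebra_scheme \<Rightarrow> ('l list \<Rightarrow> 'k) set" where
  "uea_relations L = (let F = free_algebra (carrier L) in
     {monomial 1 [x \<oplus>\<^bsub>L\<^esub> y] \<ominus>\<^bsub>F\<^esub> (monomial 1 [x] \<oplus>\<^bsub>F\<^esub> monomial 1 [y]) | x y.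
        x \<in> carrier L \<and> y \<in> carrier L} \<union>
     {monomial 1 [a \<odot>\<^bsub>L\<^esub> x] \<ominus>\<^bsub>F\<^esub> monomial a [x] | a x. x \<in> carrier L} \<union>
     {monomial 1 [x, y] \<ominus>\<^bsub>F\<^esub> monomial 1 [y, x] \<ominus>\<^bsub>F\<^esub> monomial 1 [bracket L x y] | x y.
        x \<in> carrier L \<and> y \<in> carrier L})"

definition uea_ideal :: "('k::field, 'l, 'x) lie_algebra_scheme \<Rightarrow> ('l list \<Rightarrow> 'k) set" where
  "uea_ideal L = genideal (free_algebra (carrier L)) (uea_relations L)"

definition uea :: "('k::field, 'l, 'x) lie_algebra_scheme \<Rightarrow> ('l list \<Rightarrow> 'k) set ring" where
  "uea L = free_algebra (carrier L) Quot uea_ideal L"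

text \<open>The canonical maps from the Lie algebra and from the ground field into $U(L)$.\<close>

definition uea_gen :: "('k::field, 'l, 'x) lie_algebra_scheme \<Rightarrow> 'l \<Rightarrow> ('l list \<Rightarrow> 'k) set" where
  "uea_gen L x = uea_ideal L +>\<^bsub>free_algebra (carrier L)\<^esub> monomial 1 [x]"

definition uea_scalar :: "('k::field, 'l, 'x) lie_algebra_scheme \<Rightarrow> 'k \<Rightarrow> ('l list \<Rightarrow> 'k) set" where
  "uea_scalar L a = uea_ideal L +>\<^bsub>free_algebra (carrier L)\<^esub> monomial a []"

definition red_uea_ideal ::
    "('k::field, 'l, 'x) restricted_lie_algebra_scheme \<Rightarrow> ('l \<Rightarrow> 'k) \<Rightarrow> ('l list \<Rightarrow> 'k) set set" where
  "red_uea_ideal L \<chi> = genideal (uea L)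
     {uea_gen L x [^]\<^bsub>uea L\<^esub> CHAR('k) \<ominus>\<^bsub>uea L\<^esub> uea_gen L (pmap L x)
        \<ominus>\<^bsub>uea L\<^esub> uea_scalar L (\<chi> x ^ CHAR('k)) | x. x \<in> carrier L}"

definition red_uea ::
    "('k::field, 'l, 'x) restricted_lie_algebra_scheme \<Rightarrow> ('l \<Rightarrow> 'k) \<Rightarrow> ('l list \<Rightarrow> 'k) set set ring" where
  "red_uea L \<chi> = uea L Quot red_uea_ideal L \<chi>"

definition red_uea_scalar ::
    "('k::field, 'l, 'x) restricted_lie_algebra_scheme \<Rightarrow> ('l \<Rightarrow> 'k) \<Rightarrow> 'k \<Rightarrow> ('l list \<Rightarrow> 'k) set set" where
  "red_uea_scalar L \<chi> a = red_uea_ideal L \<chi> +>\<^bsub>uea L\<^esub> uea_scalar L a"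

section \<open>Modules over Lie algebras\<close>

record ('k, 'l, 'm) lie_module = "('k, 'm) module" +
  act :: "'l \<Rightarrow> 'm \<Rightarrow> 'm"

locale lie_module = L: lie_algebra L + M: vectorspace class_ring M
  for L :: "('k::field, 'l, 'x) lie_algebra_scheme"
    and M :: "('k, 'l, 'm, 'y) lie_module_scheme" +
  assumes act_closed: "\<lbrakk>x \<in> carrier L; m \<in> carrier M\<rbrakk> \<Longrightarrow> act M x m \<in> carrier M"
    and act_add_left: "\<lbrakk>x \<in> carrier L; y \<in> carrier L; m \<in> carrier M\<rbrakk>
      \<Longrightarrow> act M (x \<oplus>\<^bsub>L\<^esub> y) m = act M x m \<oplus>\<^bsub>M\<^esub> act M y m"
    and act_add_right: "\<lbrakk>x \<in> carrier L; m \<in> carrier M; n \<in> carrier M\<rbrakk>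
      \<Longrightarrow> act M x (m \<oplus>\<^bsub>M\<^esub> n) = act M x m \<oplus>\<^bsub>M\<^esub> act M x n"
    and act_smult_left: "\<lbrakk>x \<in> carrier L; m \<in> carrier M\<rbrakk>
      \<Longrightarrow> act M (a \<odot>\<^bsub>L\<^esub> x) m = a \<odot>\<^bsub>M\<^esub> act M x m"
    and act_smult_right: "\<lbrakk>x \<in> carrier L; m \<in> carrier M\<rbrakk>
      \<Longrightarrow> act M x (a \<odot>\<^bsub>M\<^esub> m) = a \<odot>\<^bsub>M\<^esub> act M x m"
    and act_bracket: "\<lbrakk>x \<in> carrier L; y \<in> carrier L; m \<in> carrier M\<rbrakk>
      \<Longrightarrow> act M (bracket L x y) m = act M x (act M y m) \<ominus>\<^bsub>M\<^esub> act M y (act M x m)"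

definition has_p_character ::
    "('k::field, 'l, 'x) restricted_lie_algebra_scheme \<Rightarrow> ('l \<Rightarrow> 'k) \<Rightarrow>
     ('k, 'l, 'm, 'y) lie_module_scheme \<Rightarrow> bool" where
  "has_p_character L \<chi> M \<longleftrightarrow> (\<forall>x\<in>carrier L. \<forall>m\<in>carrier M.
     (act M x ^^ CHAR('k)) m \<ominus>\<^bsub>M\<^esub> act M (pmap L x) m = \<chi> x ^ CHAR('k) \<odot>\<^bsub>M\<^esub> m)"

definition irreducible_lie_module ::
    "('k::field, 'l, 'x) lie_algebra_scheme \<Rightarrow> ('k, 'l, 'm, 'y) lie_module_scheme \<Rightarrow> bool" where
  "irreducible_lie_module L M \<longleftrightarrow> lie_module L M \<and> carrier M \<noteq> {\<zero>\<^bsub>M\<^esub>} \<and>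
     (\<forall>N. VectorSpace.subspace class_ring N M \<and> (\<forall>x\<in>carrier L. \<forall>n\<in>N. act M x n \<in> N)
        \<longrightarrow> N = {\<zero>\<^bsub>M\<^esub>} \<or> N = carrier M)"

definition trivial_lie_module :: "('k::field, 'l, 'k) lie_module" where
  "trivial_lie_module =
     \<lparr>carrier = UNIV, mult = (*), one = 1, zero = 0, add = (+), smult = (*), act = (\<lambda>x m. 0)\<rparr>"

text \<open>An \<open>L\<close>-module annihilated by \<open>I\<close>, seen as a module over \<open>quot_lie L I\<close>: a coset acts by the
  common action of its elements.\<close>

definition quot_lie_module :: "('k, 'l, 'm, 'y) lie_module_scheme \<Rightarrow> ('k, 'l set, 'm) lie_module" where
  "quot_lie_module M =
     \<lparr>carrier = carrier M, mult = mult M, one = one M, zero = zero M, add = add M,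
      smult = smult M, act = (\<lambda>X m. the_elem ((\<lambda>x. act M x m) ` X))\<rparr>"

text \<open>The action of the free algebra on an \<open>L\<close>-module, in which a word \<open>x\<^sub>1 \<dots> x\<^sub>n\<close> acts as
  \<open>m \<mapsto> x\<^sub>1 (\<dots> (x\<^sub>n m))\<close>, and the induced action of $u(L,\chi)$ on an \<open>L\<close>-module with \<open>p\<close>-character
  $\chi$. An element \<open>u\<close> of $u(L,\chi)$ is a set of sets, and \<open>\<Union>u\<close> is the set of its representatives in
  the free algebra, which all act in the same way.\<close>

definition free_act :: "('k::field, 'l, 'm, 'y) lie_module_scheme \<Rightarrow> ('l list \<Rightarrow> 'k) \<Rightarrow> 'm \<Rightarrow> 'm" where
  "free_act M f m = (\<Oplus>\<^bsub>M\<^esub>w\<in>{w. f w \<noteq> 0}. f w \<odot>\<^bsub>M\<^esub> foldr (act M) w m)"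

definition red_uea_module ::
    "('k::field, 'l, 'm, 'y) lie_module_scheme \<Rightarrow> (('l list \<Rightarrow> 'k) set set, 'm) module" where
  "red_uea_module M =
     \<lparr>carrier = carrier M, mult = mult M, one = one M, zero = zero M, add = add M,
      smult = (\<lambda>u m. the_elem ((\<lambda>f. free_act M f m) ` \<Union>u))\<rparr>"

section \<open>Projective covers over arbitrary rings\<close>

text \<open>\<^locale>\<open>module\<close> is restricted to commutative rings.\<close>

locale left_module = R: ring R + M: abelian_group M
  for R :: "('r, 'x) ring_scheme" and M :: "('r, 'm, 'y) module_scheme" +
  assumes smult_closed: "\<lbrakk>a \<in> carrier R; m \<in> carrier M\<rbrakk> \<Longrightarrow> a \<odot>\<^bsub>M\<^esub> m \<in> carrier M"
    and smult_l_distr: "\<lbrakk>a \<in> carrier R; b \<in> carrier R; m \<in> carrier M\<rbrakk>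
      \<Longrightarrow> (a \<oplus>\<^bsub>R\<^esub> b) \<odot>\<^bsub>M\<^esub> m = a \<odot>\<^bsub>M\<^esub> m \<oplus>\<^bsub>M\<^esub> b \<odot>\<^bsub>M\<^esub> m"
    and smult_r_distr: "\<lbrakk>a \<in> carrier R; m \<in> carrier M; n \<in> carrier M\<rbrakk>
      \<Longrightarrow> a \<odot>\<^bsub>M\<^esub> (m \<oplus>\<^bsub>M\<^esub> n) = a \<odot>\<^bsub>M\<^esub> m \<oplus>\<^bsub>M\<^esub> a \<odot>\<^bsub>M\<^esub> n"
    and smult_assoc: "\<lbrakk>a \<in> carrier R; b \<in> carrier R; m \<in> carrier M\<rbrakk>
      \<Longrightarrow> (a \<otimes>\<^bsub>R\<^esub> b) \<odot>\<^bsub>M\<^esub> m = a \<odot>\<^bsub>M\<^esub> (b \<odot>\<^bsub>M\<^esub> m)"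
    and smult_one: "m \<in> carrier M \<Longrightarrow> \<one>\<^bsub>R\<^esub> \<odot>\<^bsub>M\<^esub> m = m"

definition left_submodule ::
    "('r, 'x) ring_scheme \<Rightarrow> 'm set \<Rightarrow> ('r, 'm, 'y) module_scheme \<Rightarrow> bool" where
  "left_submodule R N M \<longleftrightarrow> subgroup N (add_monoid M) \<and>
     (\<forall>a\<in>carrier R. \<forall>n\<in>N. a \<odot>\<^bsub>M\<^esub> n \<in> N)"

text \<open>The lifting property. A definition cannot quantify over types, so the test epimorphisms
  \<open>M \<rightarrow> N\<close> live on the types \<open>'p \<Rightarrow> 'r\<close> and \<open>'p\<close>. These are large enough to contain the free module
  on (the carrier of) \<open>P\<close> and \<open>P\<close> itself, so the property passes to epimorphisms of modules of all
  types: see \<open>projective_module_lift\<close> below.\<close>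

definition projective_module ::
    "('r, 'x) ring_scheme \<Rightarrow> ('r, 'p) module \<Rightarrow> bool" where
  "projective_module R P \<longleftrightarrow> left_module R P \<and>
     (\<forall>(M :: ('r, 'p \<Rightarrow> 'r) module) (N :: ('r, 'p) module) g f.
        left_module R M \<and> left_module R N \<and>
        g \<in> LinearCombinations.module_hom R M N \<and> g ` carrier M = carrier N \<and> f \<in> LinearCombinations.module_hom R P N \<longrightarrow>
        (\<exists>h \<in> LinearCombinations.module_hom R P M. \<forall>x\<in>carrier P. g (h x) = f x))"

context left_module
begin

lemma smult_l_null: "m \<in> carrier M \<Longrightarrow> \<zero>\<^bsub>R\<^esub> \<odot>\<^bsub>M\<^esub> m = \<zero>\<^bsub>M\<^esub>"
  by (metis M.add.r_cancel_one R.add.l_one R.zero_closed smult_closed smult_l_distr)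

lemma smult_r_null: "a \<in> carrier R \<Longrightarrow> a \<odot>\<^bsub>M\<^esub> \<zero>\<^bsub>M\<^esub> = \<zero>\<^bsub>M\<^esub>"
  by (metis M.add.r_cancel_one M.add.l_one M.zero_closed smult_closed smult_r_distr)

lemma finsum_smult:
  assumes "finite A" "a \<in> carrier R" "c \<in> A \<rightarrow> carrier M"
  shows "(\<Oplus>\<^bsub>M\<^esub>x\<in>A. a \<odot>\<^bsub>M\<^esub> c x) = a \<odot>\<^bsub>M\<^esub> (\<Oplus>\<^bsub>M\<^esub>x\<in>A. c x)"
  using assms
proof (induction A rule: finite_induct)
  case empty
  then show ?case by (simp add: smult_r_null)
next
  case (insert x A)
  then have c: "c \<in> A \<rightarrow> carrier M" "c x \<in> carrier M" by auto
  moreover have "(\<lambda>x. a \<odot>\<^bsub>M\<^esub> c x) \<in> A \<rightarrow> carrier M"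
    using c insert.prems smult_closed by fastforce
  ultimately show ?case using insert
    by (simp add: smult_closed smult_r_distr M.finsum_closed)
qed

end

text \<open>The free left module on \<open>B\<close>, needed only for \<open>projective_module_lift\<close>.\<close>

definition free_left_module :: "('r, 'x) ring_scheme \<Rightarrow> 'b set \<Rightarrow> ('r, 'b \<Rightarrow> 'r) module" where
  "free_left_module R B =
     \<lparr>carrier = {\<phi>. (\<forall>b. \<phi> b \<in> carrier R) \<and> finite {b. \<phi> b \<noteq> \<zero>\<^bsub>R\<^esub>} \<and> {b. \<phi> b \<noteq> \<zero>\<^bsub>R\<^esub>} \<subseteq> B},
      mult = undefined, one = undefined, zero = (\<lambda>b. \<zero>\<^bsub>R\<^esub>),
      add = (\<lambda>\<phi> \<psi> b. \<phi> b \<oplus>\<^bsub>R\<^esub> \<psi> b), smult = (\<lambda>a \<phi> b. a \<otimes>\<^bsub>R\<^esub> \<phi> b)\<rparr>"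

lemma free_left_module:
  assumes "ring R"
  shows "left_module R (free_left_module R B)"
proof -
  interpret R: ring R by fact
  let ?F = "free_left_module R B"
  have add: "\<phi> \<oplus>\<^bsub>?F\<^esub> \<psi> \<in> carrier ?F" if "\<phi> \<in> carrier ?F" "\<psi> \<in> carrier ?F" for \<phi> \<psi>
  proof -
    have "{b. \<phi> b \<oplus>\<^bsub>R\<^esub> \<psi> b \<noteq> \<zero>\<^bsub>R\<^esub>} \<subseteq> {b. \<phi> b \<noteq> \<zero>\<^bsub>R\<^esub>} \<union> {b. \<psi> b \<noteq> \<zero>\<^bsub>R\<^esub>}" by auto
    then show ?thesis using that unfolding free_left_module_def
      by (auto intro: finite_subset)
  qed
  have "\<exists>\<psi>\<in>carrier ?F. \<psi> \<oplus>\<^bsub>?F\<^esub> \<phi> = \<zero>\<^bsub>?F\<^esub>" if "\<phi> \<in> carrier ?F" for \<phi>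
  proof
    have "{b. \<ominus>\<^bsub>R\<^esub> \<phi> b \<noteq> \<zero>\<^bsub>R\<^esub>} = {b. \<phi> b \<noteq> \<zero>\<^bsub>R\<^esub>}"
      using that unfolding free_left_module_def by auto
    then show "(\<lambda>b. \<ominus>\<^bsub>R\<^esub> \<phi> b) \<in> carrier ?F"
      using that unfolding free_left_module_def by auto
    show "(\<lambda>b. \<ominus>\<^bsub>R\<^esub> \<phi> b) \<oplus>\<^bsub>?F\<^esub> \<phi> = \<zero>\<^bsub>?F\<^esub>"
      using that unfolding free_left_module_def by (auto simp: R.l_neg)
  qed
  then have ab: "abelian_group ?F"
    using add
    by (intro abelian_groupI)
      (auto simp: free_left_module_def R.a_ac intro!: ext)
  have sm: "a \<odot>\<^bsub>?F\<^esub> \<phi> \<in> carrier ?F" if "a \<in> carrier R" "\<phi> \<in> carrier ?F" for a \<phi>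
  proof -
    have "{b. a \<otimes>\<^bsub>R\<^esub> \<phi> b \<noteq> \<zero>\<^bsub>R\<^esub>} \<subseteq> {b. \<phi> b \<noteq> \<zero>\<^bsub>R\<^esub>}" using that by auto
    then show ?thesis using that unfolding free_left_module_def
      by (auto intro: finite_subset)
  qed
  show ?thesis
    by (intro left_module.intro left_module_axioms.intro ab assms sm)
       (auto simp: free_left_module_def R.l_distr R.r_distr R.m_assoc)
qed

context left_module
begin

lemma free_ext_cong:
  assumes "\<phi> \<in> carrier (free_left_module R B)" "c \<in> B \<rightarrow> carrier M"
    and "finite A" "{b. \<phi> b \<noteq> \<zero>\<^bsub>R\<^esub>} \<subseteq> A" "A \<subseteq> B"
  shows "(\<Oplus>\<^bsub>M\<^esub>b\<in>{b. \<phi> b \<noteq> \<zero>\<^bsub>R\<^esub>}. \<phi> b \<odot>\<^bsub>M\<^esub> c b) = (\<Oplus>\<^bsub>M\<^esub>b\<in>A. \<phi> b \<odot>\<^bsub>M\<^esub> c b)"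
  using assms
  by (intro M.add.finprod_mono_neutral_cong_left)
     (auto simp: free_left_module_def Pi_iff smult_closed smult_l_null subset_iff)

lemma free_ext_hom:
  assumes c: "c \<in> B \<rightarrow> carrier M"
  shows "(\<lambda>\<phi>. \<Oplus>\<^bsub>M\<^esub>b\<in>{b. \<phi> b \<noteq> \<zero>\<^bsub>R\<^esub>}. \<phi> b \<odot>\<^bsub>M\<^esub> c b)
           \<in> LinearCombinations.module_hom R (free_left_module R B) M"
proof -
  let ?F = "free_left_module R B"
  let ?S = "\<lambda>\<phi>. {b. \<phi> b \<noteq> \<zero>\<^bsub>R\<^esub>}"
  interpret F: left_module R ?F by (rule free_left_module) (rule R.ring_axioms)
  have D: "\<And>b. \<phi> b \<in> carrier R" "finite (?S \<phi>)" "?S \<phi> \<subseteq> B" if "\<phi> \<in> carrier ?F" for \<phi>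
    using that by (auto simp: free_left_module_def)
  have clo: "(\<lambda>b. \<phi> b \<odot>\<^bsub>M\<^esub> c b) \<in> A \<rightarrow> carrier M" if "\<phi> \<in> carrier ?F" "A \<subseteq> B" for \<phi> A
    using D(1)[OF that(1)] that(2) c by (auto intro!: smult_closed)
  show ?thesis
    unfolding LinearCombinations.module_hom_def
  proof (intro CollectI conjI allI impI Pi_I)
    fix \<phi> assume "\<phi> \<in> carrier ?F"
    then show "(\<Oplus>\<^bsub>M\<^esub>b\<in>?S \<phi>. \<phi> b \<odot>\<^bsub>M\<^esub> c b) \<in> carrier M"
      by (intro M.finsum_closed clo D)
  next
    fix \<phi> \<psi> assume *: "\<phi> \<in> carrier ?F \<and> \<psi> \<in> carrier ?F"
    let ?A = "?S \<phi> \<union> ?S \<psi>"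
    have A: "finite ?A" "?A \<subseteq> B" using * D by auto
    have s: "\<phi> \<oplus>\<^bsub>?F\<^esub> \<psi> \<in> carrier ?F" using * by (intro F.M.a_closed) auto
    have ss: "?S (\<phi> \<oplus>\<^bsub>?F\<^esub> \<psi>) \<subseteq> ?A" by (auto simp: free_left_module_def)
    have "(\<Oplus>\<^bsub>M\<^esub>b\<in>?S (\<phi> \<oplus>\<^bsub>?F\<^esub> \<psi>). (\<phi> \<oplus>\<^bsub>?F\<^esub> \<psi>) b \<odot>\<^bsub>M\<^esub> c b)
       = (\<Oplus>\<^bsub>M\<^esub>b\<in>?A. (\<phi> \<oplus>\<^bsub>?F\<^esub> \<psi>) b \<odot>\<^bsub>M\<^esub> c b)"
      by (rule free_ext_cong[OF s c A(1) ss A(2)])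
    also have "\<dots> = (\<Oplus>\<^bsub>M\<^esub>b\<in>?A. \<phi> b \<odot>\<^bsub>M\<^esub> c b \<oplus>\<^bsub>M\<^esub> \<psi> b \<odot>\<^bsub>M\<^esub> c b)"
    proof (rule M.finsum_cong', rule refl)
      show "(\<lambda>b. \<phi> b \<odot>\<^bsub>M\<^esub> c b \<oplus>\<^bsub>M\<^esub> \<psi> b \<odot>\<^bsub>M\<^esub> c b) \<in> ?A \<rightarrow> carrier M"
        using clo[of \<phi> ?A] clo[of \<psi> ?A] * A(2) by (auto simp: Pi_iff)
      fix b assume "b \<in> ?A"
      then have "c b \<in> carrier M" using A c by auto
      then show "(\<phi> \<oplus>\<^bsub>?F\<^esub> \<psi>) b \<odot>\<^bsub>M\<^esub> c b = \<phi> b \<odot>\<^bsub>M\<^esub> c b \<oplus>\<^bsub>M\<^esub> \<psi> b \<odot>\<^bsub>M\<^esub> c b"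
        using D(1) * by (simp add: free_left_module_def smult_l_distr)
    qed
    also have "\<dots> = (\<Oplus>\<^bsub>M\<^esub>b\<in>?A. \<phi> b \<odot>\<^bsub>M\<^esub> c b) \<oplus>\<^bsub>M\<^esub> (\<Oplus>\<^bsub>M\<^esub>b\<in>?A. \<psi> b \<odot>\<^bsub>M\<^esub> c b)"
      using * A by (intro M.finsum_addf clo) auto
    also have "(\<Oplus>\<^bsub>M\<^esub>b\<in>?A. \<phi> b \<odot>\<^bsub>M\<^esub> c b) = (\<Oplus>\<^bsub>M\<^esub>b\<in>?S \<phi>. \<phi> b \<odot>\<^bsub>M\<^esub> c b)"
      using * A by (intro free_ext_cong[OF _ c, symmetric]) auto
    also have "(\<Oplus>\<^bsub>M\<^esub>b\<in>?A. \<psi> b \<odot>\<^bsub>M\<^esub> c b) = (\<Oplus>\<^bsub>M\<^esub>b\<in>?S \<psi>. \<psi> b \<odot>\<^bsub>M\<^esub> c b)"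
      using * A by (intro free_ext_cong[OF _ c, symmetric]) auto
    finally show "(\<Oplus>\<^bsub>M\<^esub>b\<in>?S (\<phi> \<oplus>\<^bsub>?F\<^esub> \<psi>). (\<phi> \<oplus>\<^bsub>?F\<^esub> \<psi>) b \<odot>\<^bsub>M\<^esub> c b)
       = (\<Oplus>\<^bsub>M\<^esub>b\<in>?S \<phi>. \<phi> b \<odot>\<^bsub>M\<^esub> c b) \<oplus>\<^bsub>M\<^esub> (\<Oplus>\<^bsub>M\<^esub>b\<in>?S \<psi>. \<psi> b \<odot>\<^bsub>M\<^esub> c b)" .
  next
    fix a \<phi> assume *: "a \<in> carrier R \<and> \<phi> \<in> carrier ?F"
    then have s: "a \<odot>\<^bsub>?F\<^esub> \<phi> \<in> carrier ?F" by (intro F.smult_closed) auto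
    have ss: "?S (a \<odot>\<^bsub>?F\<^esub> \<phi>) \<subseteq> ?S \<phi>" using * by (auto simp: free_left_module_def)
    have "(\<Oplus>\<^bsub>M\<^esub>b\<in>?S (a \<odot>\<^bsub>?F\<^esub> \<phi>). (a \<odot>\<^bsub>?F\<^esub> \<phi>) b \<odot>\<^bsub>M\<^esub> c b)
       = (\<Oplus>\<^bsub>M\<^esub>b\<in>?S \<phi>. (a \<odot>\<^bsub>?F\<^esub> \<phi>) b \<odot>\<^bsub>M\<^esub> c b)"
      using * D(2,3) by (intro free_ext_cong[OF s c _ ss]) auto
    also have "\<dots> = (\<Oplus>\<^bsub>M\<^esub>b\<in>?S \<phi>. a \<odot>\<^bsub>M\<^esub> (\<phi> b \<odot>\<^bsub>M\<^esub> c b))"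
    proof (rule M.finsum_cong', rule refl)
      show "(\<lambda>b. a \<odot>\<^bsub>M\<^esub> (\<phi> b \<odot>\<^bsub>M\<^esub> c b)) \<in> ?S \<phi> \<rightarrow> carrier M"
        using clo[of \<phi> "?S \<phi>"] * D(3)[of \<phi>] by (auto simp: Pi_iff intro!: smult_closed[of a])
      fix b assume "b \<in> ?S \<phi>"
      then have "c b \<in> carrier M" using D(3) * c by auto
      then show "(a \<odot>\<^bsub>?F\<^esub> \<phi>) b \<odot>\<^bsub>M\<^esub> c b = a \<odot>\<^bsub>M\<^esub> (\<phi> b \<odot>\<^bsub>M\<^esub> c b)"
        using D(1) * by (simp add: free_left_module_def smult_assoc)
    qed
    also have "\<dots> = a \<odot>\<^bsub>M\<^esub> (\<Oplus>\<^bsub>M\<^esub>b\<in>?S \<phi>. \<phi> b \<odot>\<^bsub>M\<^esub> c b)"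
      using * D(2,3) by (intro finsum_smult clo) auto
    finally show "(\<Oplus>\<^bsub>M\<^esub>b\<in>?S (a \<odot>\<^bsub>?F\<^esub> \<phi>). (a \<odot>\<^bsub>?F\<^esub> \<phi>) b \<odot>\<^bsub>M\<^esub> c b)
       = a \<odot>\<^bsub>M\<^esub> (\<Oplus>\<^bsub>M\<^esub>b\<in>?S \<phi>. \<phi> b \<odot>\<^bsub>M\<^esub> c b)" .
  qed
qed

end

lemma finsum_module_hom:
  assumes M: "left_module R M" and N: "left_module R N"
    and h: "h \<in> LinearCombinations.module_hom R M N"
    and A: "finite A" and \<phi>: "\<phi> \<in> A \<rightarrow> carrier R" and c: "c \<in> A \<rightarrow> carrier M"
  shows "h (\<Oplus>\<^bsub>M\<^esub>x\<in>A. \<phi> x \<odot>\<^bsub>M\<^esub> c x) = (\<Oplus>\<^bsub>N\<^esub>x\<in>A. \<phi> x \<odot>\<^bsub>N\<^esub> h (c x))"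
  using A \<phi> c
proof (induction A rule: finite_induct)
  case empty
  interpret M: left_module R M by fact
  interpret N: left_module R N by fact
  have "h \<zero>\<^bsub>M\<^esub> \<in> carrier N" "h (\<zero>\<^bsub>R\<^esub> \<odot>\<^bsub>M\<^esub> \<zero>\<^bsub>M\<^esub>) = \<zero>\<^bsub>R\<^esub> \<odot>\<^bsub>N\<^esub> h \<zero>\<^bsub>M\<^esub>"
    using h by (auto simp: LinearCombinations.module_hom_def)
  then show ?case by (simp add: M.smult_l_null N.smult_l_null)
next
  case (insert x A)
  interpret M: left_module R M by fact
  interpret N: left_module R N by fact
  have c: "(\<lambda>x. \<phi> x \<odot>\<^bsub>M\<^esub> c x) \<in> A \<rightarrow> carrier M" "c x \<in> carrier M" "\<phi> x \<in> carrier R"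
    using insert.prems by (auto intro!: M.smult_closed)
  moreover have hc: "(\<lambda>x. \<phi> x \<odot>\<^bsub>N\<^esub> h (c x)) \<in> A \<rightarrow> carrier N" "h (c x) \<in> carrier N"
    using insert.prems h by (auto intro!: N.smult_closed simp: LinearCombinations.module_hom_def)
  moreover have "h (u \<oplus>\<^bsub>M\<^esub> v) = h u \<oplus>\<^bsub>N\<^esub> h v" if "u \<in> carrier M" "v \<in> carrier M" for u v
    using h that by (auto simp: LinearCombinations.module_hom_def)
  moreover have "h (\<phi> x \<odot>\<^bsub>M\<^esub> c x) = \<phi> x \<odot>\<^bsub>N\<^esub> h (c x)"
    using h c by (auto simp: LinearCombinations.module_hom_def)
  ultimately show ?case using insert
    by (simp add: M.smult_closed N.smult_closed M.M.finsum_closed)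
qed

lemma projective_module_lift:
  assumes P: "projective_module R P"
    and M: "left_module R M" and N: "left_module R N"
    and g: "g \<in> LinearCombinations.module_hom R M N" "g ` carrier M = carrier N"
    and f: "f \<in> LinearCombinations.module_hom R P N"
  shows "\<exists>h \<in> LinearCombinations.module_hom R P M. \<forall>x\<in>carrier P. g (h x) = f x"
proof -
  interpret P: left_module R P using P by (simp add: projective_module_def)
  interpret M: left_module R M by fact
  let ?F = "free_left_module R (carrier P)"
  let ?S = "\<lambda>\<phi>. {b. \<phi> b \<noteq> \<zero>\<^bsub>R\<^esub>}"
  define e where "e = (\<lambda>\<phi>. \<Oplus>\<^bsub>P\<^esub>b\<in>?S \<phi>. \<phi> b \<odot>\<^bsub>P\<^esub> b)"
  have F: "left_module R ?F" by (rule free_left_module) (rule P.R.ring_axioms)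
  have D: "\<And>b. \<phi> b \<in> carrier R" "finite (?S \<phi>)" "?S \<phi> \<subseteq> carrier P" if "\<phi> \<in> carrier ?F" for \<phi>
    using that by (auto simp: free_left_module_def)
  have e: "e \<in> LinearCombinations.module_hom R ?F P"
    unfolding e_def by (rule P.free_ext_hom) auto
  have "\<exists>\<phi>\<in>carrier ?F. e \<phi> = x" if x: "x \<in> carrier P" for x
  proof (cases "\<one>\<^bsub>R\<^esub> = \<zero>\<^bsub>R\<^esub>")
    case True
    have "e (\<lambda>b. \<zero>\<^bsub>R\<^esub>) = x"
      using P.smult_one[OF x] P.smult_l_null[OF x] True by (simp add: e_def)
    then show ?thesis by (intro bexI[of _ "\<lambda>b. \<zero>\<^bsub>R\<^esub>"]) (auto simp: free_left_module_def)
  next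
    case False
    let ?d = "\<lambda>b. if b = x then \<one>\<^bsub>R\<^esub> else \<zero>\<^bsub>R\<^esub>"
    have "?S ?d = {x}" using False by auto
    then have "e ?d = x" "?d \<in> carrier ?F"
      using x by (auto simp: e_def free_left_module_def P.smult_one)
    then show ?thesis by blast
  qed
  moreover have "e \<phi> \<in> carrier P" if "\<phi> \<in> carrier ?F" for \<phi>
    using e that by (auto simp: LinearCombinations.module_hom_def)
  ultimately have "e ` carrier ?F = carrier P" by auto
  moreover have "(\<lambda>x. x) \<in> LinearCombinations.module_hom R P P"
    by (auto simp: LinearCombinations.module_hom_def)
  ultimately obtain s where s: "s \<in> LinearCombinations.module_hom R P ?F"
    and es: "\<And>x. x \<in> carrier P \<Longrightarrow> e (s x) = x"
    using P F e P.left_module_axioms unfolding projective_module_def by blast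
  define c where "c = (\<lambda>x. SOME m. m \<in> carrier M \<and> g m = f x)"
  have c: "c x \<in> carrier M" "g (c x) = f x" if x: "x \<in> carrier P" for x
  proof -
    have "f x \<in> g ` carrier M" using f x g(2) by (auto simp: LinearCombinations.module_hom_def)
    then have "\<exists>m. m \<in> carrier M \<and> g m = f x" by auto
    then have "c x \<in> carrier M \<and> g (c x) = f x" unfolding c_def by (rule someI_ex)
    then show "c x \<in> carrier M" "g (c x) = f x" by auto
  qed
  define t where "t = (\<lambda>\<phi>. \<Oplus>\<^bsub>M\<^esub>b\<in>?S \<phi>. \<phi> b \<odot>\<^bsub>M\<^esub> c b)"
  have t: "t \<in> LinearCombinations.module_hom R ?F M"
    unfolding t_def using c by (intro M.free_ext_hom) auto
  have gt: "g (t \<phi>) = f (e \<phi>)" if \<phi>: "\<phi> \<in> carrier ?F" for \<phi>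
  proof -
    interpret N: left_module R N by fact
    have "g (t \<phi>) = (\<Oplus>\<^bsub>N\<^esub>b\<in>?S \<phi>. \<phi> b \<odot>\<^bsub>N\<^esub> g (c b))"
      unfolding t_def using D[OF \<phi>] c by (intro finsum_module_hom[OF M N g(1)]) auto
    also have "\<dots> = (\<Oplus>\<^bsub>N\<^esub>b\<in>?S \<phi>. \<phi> b \<odot>\<^bsub>N\<^esub> f b)"
      using D[OF \<phi>] c f
      by (intro N.M.finsum_cong') (auto intro!: N.smult_closed simp: LinearCombinations.module_hom_def)
    also have "\<dots> = f (e \<phi>)"
      unfolding e_def using D[OF \<phi>]
      by (intro finsum_module_hom[OF P.left_module_axioms N f, symmetric]) auto
    finally show ?thesis .
  qed
  have sF: "s x \<in> carrier ?F" if "x \<in> carrier P" for x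
    using s that by (auto simp: LinearCombinations.module_hom_def)
  have "(\<lambda>x. t (s x)) \<in> LinearCombinations.module_hom R P M"
    using s t by (auto simp: LinearCombinations.module_hom_def Pi_iff)
  moreover have "g (t (s x)) = f x" if "x \<in> carrier P" for x
    using gt[OF sF[OF that]] es[OF that] by simp
  ultimately show ?thesis by (intro bexI[of _ "\<lambda>x. t (s x)"]) auto
qed

text \<open>\<open>\<pi>: P \<rightarrow> M\<close> is a projective cover: \<open>P\<close> is projective and \<open>\<pi>\<close> is an essential epimorphism.\<close>

definition projective_cover ::
    "('r, 'x) ring_scheme \<Rightarrow> ('r, 'm) module \<Rightarrow> ('r, 'p) module \<Rightarrow> ('p \<Rightarrow> 'm) \<Rightarrow> bool" where
  "projective_cover R M P \<pi> \<longleftrightarrow>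
     left_module R M \<and> projective_module R P \<and>
     \<pi> \<in> LinearCombinations.module_hom R P M \<and> \<pi> ` carrier P = carrier M \<and>
     (\<forall>N. left_submodule R N P \<and> \<pi> ` N = carrier M \<longrightarrow> N = carrier P)"

text \<open>Restriction of scalars along \<open>\<iota>\<close>, used with \<^const>\<open>red_uea_scalar\<close> to regard a
  $u(L,\chi)$-module as a vector space over the ground field.\<close>

definition restrict_scalars ::
    "('k \<Rightarrow> 'r) \<Rightarrow> ('r, 'm, 'y) module_scheme \<Rightarrow> ('k, 'm) module" where
  "restrict_scalars \<iota> M =
     \<lparr>carrier = carrier M, mult = mult M, one = one M, zero = zero M, add = add M,
      smult = (\<lambda>a m. \<iota> a \<odot>\<^bsub>M\<^esub> m)\<rparr>"

definition red_uea_module_dim ::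
    "('k::field, 'l, 'x) restricted_lie_algebra_scheme \<Rightarrow> ('l \<Rightarrow> 'k) \<Rightarrow>
     (('l list \<Rightarrow> 'k) set set, 'm) module \<Rightarrow> nat" where
  "red_uea_module_dim L \<chi> P =
     vectorspace.dim class_ring (restrict_scalars (red_uea_scalar L \<chi>) P)"

end

theory Submission
  imports Defs
begin

text \<open>
  Coinduction from \<open>I\<close> to \<open>L\<close> is exact because $u(L,\chi)$ has a basis of normal words in which the letters
  from \<open>I\<close> stand first, so by Frobenius reciprocity $P = P_L(S)$ is projective over $u(I,0)$. Every proper
  \<open>I\<close>-submodule $X$ of $P$ satisfies $X + IP \neq P$: the \<open>I\<close>-maps from $Q = P_I(\mathbb{F})$ into $P/X$ for a
  maximal $X$ with $X + IP = P$ vanish, and this propagates from the image of \<open>Q\<close> to the \<open>L\<close>-submodule it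
  generates, which is $P$. Hence copies of $Q$ can be split off $P$ one by one, $P \cong Q^c$ over \<open>I\<close> with
  $c = \dim P - \dim IP$. Finally $P/IP$ is the projective cover of $S$ over $L/I$, so $c = \dim P_{L/I}(S)$.
\<close>

text \<open>Nothing is given about the covers beyond projectivity and essentiality; finite dimension
  and bases have to be earned. The source of both is a PBW theorem in dual form: instead of a basis
  of a quotient of the free algebra, scalar functionals on words are built that obey the
  straightening relations and take prescribed values on normal words. The elements of a coinduced
  module are, through linear forms, families of such functionals, and vectors are compared by
  testing linear forms on them, so that the identities to be checked are identities of scalars. The
  p-map is not additive; Jacobson's formula is what allows the p-character of a coinduced module to
  be decided on basis vectors.

  Copies of the single module Q suffice because the Nakayama-type property of P says that all simple
  I-quotients of P are trivial, even where I acts nontrivially on P. Quotients of P are avoided: a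
  map into P/X is a linear map into P that is I-linear modulo X, and P/IP is modelled on a
  complement of IP.\<close>

section \<open>Iterated commutators in characteristic p\<close>

text \<open>\<open>G a b m\<close> models e^a (ad e)^m(x) e^b. The recursion says that ad e is left
  minus right multiplication by e; these commute, and the formula is the binomial theorem for their
  difference. The bound \<open>N\<close> is there because the recursion may be available only for
  products of limited length.\<close>

lemma alternating_differences:
  fixes G :: "nat \<Rightarrow> nat \<Rightarrow> nat \<Rightarrow> 'a::comm_ring_1"
  assumes "\<And>a b m. a + b + m < N \<Longrightarrow> G a b (Suc m) = G (Suc a) b m - G a (Suc b) m"
    and "a + b + m \<le> N"
  shows "G a b m = (\<Sum>s\<le>m. (-1) ^ (m - s) * of_nat (m choose s) * G (a + s) (b + m - s) 0)"
  using assms(2)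
proof (induction m arbitrary: a b)
  case 0
  then show ?case by simp
next
  case (Suc m)
  let ?g = "\<lambda>s. G (a + s) (b + Suc m - s) 0"
  have "G a b (Suc m) = G (Suc a) b m - G a (Suc b) m"
    using Suc.prems by (intro assms(1)) simp
  also have "G (Suc a) b m = (\<Sum>s\<le>m. (-1) ^ (m - s) * of_nat (m choose s) * ?g (Suc s))"
    using Suc.prems by (subst Suc.IH) (auto intro!: sum.cong)
  also have "\<dots> = (\<Sum>s\<in>{1..Suc m}. (-1) ^ (Suc m - s) * of_nat (m choose (s - 1)) * ?g s)"
    by (rule sum.reindex_bij_witness[of _ "\<lambda>s. s - 1" Suc]) auto
  also have "\<dots> = (\<Sum>s\<le>Suc m. (-1) ^ (Suc m - s) * (if s = 0 then 0 else of_nat (m choose (s - 1))) * ?g s)"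
    by (rule sum.mono_neutral_cong_left) auto
  also have "G a (Suc b) m = (\<Sum>s\<le>m. (-1) ^ (m - s) * of_nat (m choose s) * ?g s)"
    using Suc.prems by (subst Suc.IH) (auto intro!: sum.cong)
  also have "\<dots> = (\<Sum>s\<le>Suc m. (-1) ^ (m - s) * of_nat (m choose s) * ?g s)"
    by (simp add: binomial_eq_0)
  also have "(\<Sum>s\<le>Suc m. (-1) ^ (Suc m - s) * (if s = 0 then 0 else of_nat (m choose (s - 1))) * ?g s)
      - (\<Sum>s\<le>Suc m. (-1) ^ (m - s) * of_nat (m choose s) * ?g s)
    = (\<Sum>s\<le>Suc m. (-1) ^ (Suc m - s) * of_nat (Suc m choose s) * ?g s)"
    unfolding sum_subtractf[symmetric]
  proof (rule sum.cong[OF refl])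
    fix s assume s: "s \<in> {..Suc m}"
    show "(-1) ^ (Suc m - s) * (if s = 0 then 0 else of_nat (m choose (s - 1))) * ?g s
        - (-1) ^ (m - s) * of_nat (m choose s) * ?g s
      = (-1) ^ (Suc m - s) * of_nat (Suc m choose s) * ?g s"
    proof (cases "s = Suc m")
      case True
      then show ?thesis by (simp add: binomial_eq_0)
    next
      case False
      then have "Suc m - s = Suc (m - s)" using s by auto
      then show ?thesis by (cases s) (auto simp: algebra_simps)
    qed
  qed
  finally show ?case .
qed

text \<open>By Pascal's rule two neighbours in row p - 1 add up to an inner entry of row p, which p
  divides; so the row alternates in sign modulo p.\<close>

lemma binomial_char_minus_1:
  assumes p: "prime CHAR('a::comm_ring_1)" and "s < CHAR('a)"
  shows "(of_nat ((CHAR('a) - 1) choose s) :: 'a) = (-1) ^ s"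
  using assms(2)
proof (induction s)
  case (Suc s)
  let ?p = "CHAR('a)"
  have "?p = Suc (?p - 1)" using Suc.prems by simp
  then have "?p choose Suc s = ((?p - 1) choose s) + ((?p - 1) choose Suc s)"
    by (metis binomial_Suc_Suc)
  moreover have "?p dvd (?p choose Suc s)"
    using p Suc.prems by (intro dvd_choose_prime) (auto simp: prime_gt_0_nat)
  ultimately have "(of_nat ((?p - 1) choose s) :: 'a) + of_nat ((?p - 1) choose Suc s) = 0"
    by (metis of_nat_add of_nat_eq_0_iff_char_dvd)
  then show ?case using Suc by (simp add: eq_neg_iff_add_eq_0 add.commute)
qed simp

text \<open>In the model: (ad e)^(p-1)(x) is the sum of all e^s x e^(p-1-s), because signs and
  binomial coefficients cancel. It serves twice, for overlaps with p-th powers in the diamond lemma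
  and for the word coefficients in Jacobson's formula.\<close>

lemma alternating_differences_char:
  fixes G :: "nat \<Rightarrow> nat \<Rightarrow> nat \<Rightarrow> 'a::comm_ring_1"
  assumes p: "prime CHAR('a)"
    and "\<And>a b m. a + b + m < CHAR('a) - 1 \<Longrightarrow> G a b (Suc m) = G (Suc a) b m - G a (Suc b) m"
  shows "G 0 0 (CHAR('a) - 1) = (\<Sum>s<CHAR('a). G s (CHAR('a) - 1 - s) 0)"
proof -
  let ?p = "CHAR('a)"
  have pos: "?p > 0" using p by (simp add: prime_gt_0_nat)
  \<comment> \<open>Read off from the last entry of row p - 1, which treats p = 2 along with odd
    p.\<close>
  have sg: "(-1 :: 'a) ^ (?p - 1) = 1"
    using binomial_char_minus_1[OF p, of "?p - 1"] pos by simp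
  have "G 0 0 (?p - 1) = (\<Sum>s\<le>?p - 1. (-1) ^ (?p - 1 - s) * of_nat ((?p - 1) choose s) * G (0 + s) (0 + (?p - 1) - s) 0)"
    by (rule alternating_differences[where N = "?p - 1"]) (use assms(2) in auto)
  also have "\<dots> = (\<Sum>s\<le>?p - 1. G s (?p - 1 - s) 0)"
  proof (rule sum.cong[OF refl])
    fix s assume "s \<in> {..?p - 1}"
    then have s: "s < ?p" "?p - 1 - s + s = ?p - 1" using pos by auto
    have "(-1 :: 'a) ^ (?p - 1 - s) * of_nat ((?p - 1) choose s) = 1"
      using binomial_char_minus_1[OF p s(1)] sg s(2) by (metis power_add)
    then show "(-1) ^ (?p - 1 - s) * of_nat ((?p - 1) choose s) * G (0 + s) (0 + (?p - 1) - s) 0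
        = G s (?p - 1 - s) 0" by simp
  qed
  also have "{..?p - 1} = {..<?p}" using pos by auto
  finally show ?thesis .
qed

lemma sum_list_swap:
  fixes f :: "'a \<Rightarrow> 'b \<Rightarrow> 'c::comm_monoid_add"
  shows "(\<Sum>x\<leftarrow>xs. \<Sum>y\<leftarrow>ys. f x y) = (\<Sum>y\<leftarrow>ys. \<Sum>x\<leftarrow>xs. f x y)"
  by (induction xs) (simp_all add: sum_list_addf)

section \<open>Linear forms\<close>

lemma linear_formD:
  assumes "linear_form V f"
  shows "x \<in> carrier V \<Longrightarrow> y \<in> carrier V \<Longrightarrow> f (x \<oplus>\<^bsub>V\<^esub> y) = f x + f y"
    and "x \<in> carrier V \<Longrightarrow> f (a \<odot>\<^bsub>V\<^esub> x) = a * f x"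
  using assms by (auto simp: linear_form_def)

lemma linear_form_zero:
  fixes V :: "('k::field, 'v, 'x) module_scheme"
  assumes "vectorspace class_ring V" "linear_form V f"
  shows "f \<zero>\<^bsub>V\<^esub> = 0"
proof -
  interpret vectorspace class_ring V by fact
  have "f (\<zero>\<^bsub>V\<^esub> \<oplus>\<^bsub>V\<^esub> \<zero>\<^bsub>V\<^esub>) = f \<zero>\<^bsub>V\<^esub> + f \<zero>\<^bsub>V\<^esub>"
    by (rule linear_formD(1)[OF assms(2)]) auto
  then show ?thesis by (metis M.zero_closed M.l_zero add_cancel_left_left)
qed

lemma linear_form_finsum:
  fixes V :: "('k::field, 'v, 'x) module_scheme"
  assumes V: "vectorspace class_ring V" and f: "linear_form V f" and "finite A" "g \<in> A \<rightarrow> carrier V"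
  shows "f (\<Oplus>\<^bsub>V\<^esub>i\<in>A. g i) = (\<Sum>i\<in>A. f (g i))"
proof -
  interpret vectorspace class_ring V by fact
  show ?thesis using assms(3,4)
    by (induction A rule: finite_induct)
       (auto simp: linear_form_zero[OF V f] linear_formD(1)[OF f] M.finsum_closed)
qed

lemma linear_form_diff:
  fixes V :: "('k::field, 'v, 'x) module_scheme"
  assumes V: "vectorspace class_ring V" and f: "linear_form V f" and "x \<in> carrier V" "y \<in> carrier V"
  shows "f (x \<ominus>\<^bsub>V\<^esub> y) = f x - f y" "f (\<ominus>\<^bsub>V\<^esub> y) = - f y"
proof -
  interpret vectorspace class_ring V by fact
  have "f (y \<oplus>\<^bsub>V\<^esub> \<ominus>\<^bsub>V\<^esub> y) = f y + f (\<ominus>\<^bsub>V\<^esub> y)" "f (x \<oplus>\<^bsub>V\<^esub> \<ominus>\<^bsub>V\<^esub> y) = f x + f (\<ominus>\<^bsub>V\<^esub> y)"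
    using assms(3,4) by (auto intro!: linear_formD(1)[OF f])
  then show "f (x \<ominus>\<^bsub>V\<^esub> y) = f x - f y" "f (\<ominus>\<^bsub>V\<^esub> y) = - f y"
    using assms(3,4) linear_form_zero[OF V f]
    by (auto simp: M.r_neg a_minus_def eq_neg_iff_add_eq_0 add.commute)
qed

lemma smult_minus_one:
  fixes V :: "('k::field, 'v, 'x) module_scheme"
  assumes V: "vectorspace class_ring V" and x: "x \<in> carrier V"
  shows "(-1) \<odot>\<^bsub>V\<^esub> x = \<ominus>\<^bsub>V\<^esub> x"
proof -
  interpret vectorspace class_ring V by fact
  have "(-1 + 1) \<odot>\<^bsub>V\<^esub> x = (-1) \<odot>\<^bsub>V\<^esub> x \<oplus>\<^bsub>V\<^esub> 1 \<odot>\<^bsub>V\<^esub> x"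
    using smult_l_distr[of "-1" 1 x] x by simp
  moreover have "1 \<odot>\<^bsub>V\<^esub> x = x" using smult_one[OF x] by simp
  moreover have "0 \<odot>\<^bsub>V\<^esub> x = \<zero>\<^bsub>V\<^esub>" using smult_l_null[OF x] by simp
  ultimately have "(-1) \<odot>\<^bsub>V\<^esub> x \<oplus>\<^bsub>V\<^esub> x = \<zero>\<^bsub>V\<^esub>" by simp
  then show ?thesis using x smult_closed[of "-1" x] by (intro M.minus_equality[symmetric]) simp_all
qed

lemma smult_zero:
  fixes V :: "('k::field, 'v, 'x) module_scheme"
  assumes V: "vectorspace class_ring V" and x: "x \<in> carrier V"
  shows "0 \<odot>\<^bsub>V\<^esub> x = \<zero>\<^bsub>V\<^esub>"
proof -
  interpret vectorspace class_ring V by fact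
  show ?thesis using smult_l_null[OF x] by simp
qed

section \<open>The diamond lemma for normal words\<close>

text \<open>Length first, then lexicographic: putting two letters in order descends
  lexicographically, every other right-hand side is shorter, and the order is preserved by
  concatenation on both sides.\<close>

abbreviation word_order :: "(nat list \<times> nat list) set" where
  "word_order \<equiv> lenlex less_than"

lemma word_order_shorter: "length a < length b \<Longrightarrow> (a, b) \<in> word_order"
  by (simp add: lenlex_conv)

lemma word_order_smaller: "i < j \<Longrightarrow> length a = length b \<Longrightarrow> (u @ i # a, u @ j # b) \<in> word_order"
  by (simp add: lenlex_append2 irrefl_def) (simp add: lenlex_conv)

lemma word_order_context: "(z, l) \<in> word_order \<Longrightarrow> (u @ z @ v, u @ l @ v) \<in> word_order"
  by (simp add: lenlex_append2 irrefl_def lenlex_append1)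

text \<open>The basis is an indexed family with its coordinate forms, since the straightening rules
  need a linear order of the letters. The locale is used a second time for the ideal, with the first
  r vectors and the zero form.\<close>

locale lie_basis = restricted_lie_algebra L
  for L :: "('k::field, 'l, 'x) restricted_lie_algebra_scheme" (structure) +
  fixes \<chi> :: "'l \<Rightarrow> 'k" and n :: nat and e :: "nat \<Rightarrow> 'l" and co :: "nat \<Rightarrow> 'l \<Rightarrow> 'k" and p :: nat
  assumes p_char: "p = CHAR('k)"
    and e_closed [simp, intro]: "i < n \<Longrightarrow> e i \<in> carrier L"
    and co_linear: "linear_form L (co k)"
    and co_e: "k < n \<Longrightarrow> i < n \<Longrightarrow> co k (e i) = (if k = i then 1 else 0)"
    and expand: "x \<in> carrier L \<Longrightarrow> x = (\<Oplus>k\<in>{..<n}. co k x \<odot> e k)"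
begin

lemma p_ge_2: "p \<ge> 2" unfolding p_char by (rule prime_ge_2_nat[OF char_prime])

lemma linear_form_expand:
  assumes f: "linear_form L f" and x: "x \<in> carrier L"
  shows "f x = (\<Sum>k<n. co k x * f (e k))"
proof -
  have "f x = f (\<Oplus>k\<in>{..<n}. co k x \<odot> e k)" using expand[OF x] by simp
  also have "\<dots> = (\<Sum>k<n. f (co k x \<odot> e k))"
    by (rule linear_form_finsum[OF vectorspace_axioms f]) auto
  also have "\<dots> = (\<Sum>k<n. co k x * f (e k))"
    by (rule sum.cong) (auto simp: linear_formD(2)[OF f])
  finally show ?thesis .
qed

lemma linear_form_eqI:
  assumes "linear_form L f" "linear_form L g" "\<And>k. k < n \<Longrightarrow> f (e k) = g (e k)" "x \<in> carrier L"
  shows "f x = g x"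
  using linear_form_expand[OF assms(1,4)] linear_form_expand[OF assms(2,4)] assms(3) by simp

lemma bracket_anti:
  assumes "x \<in> carrier L" "y \<in> carrier L"
  shows "bracket L x y = \<ominus> bracket L y x"
proof -
  have "\<zero> = bracket L (x \<oplus> y) (x \<oplus> y)" using assms by (simp add: bracket_self)
  also have "\<dots> = bracket L x y \<oplus> bracket L y x"
    using assms
    by (subst bracket_add_left) (simp_all add: bracket_add_right bracket_closed bracket_self)
  finally have "bracket L x y \<oplus> bracket L y x = \<zero>" by simp
  then show ?thesis using assms by (intro M.minus_equality[symmetric] bracket_closed)
qed

lemma bracket_minus_one:
  assumes "x \<in> carrier L" "y \<in> carrier L"
  shows "bracket L x y = (-1) \<odot> bracket L y x"
  using bracket_anti[OF assms] smult_minus_one[OF vectorspace_axioms] assms by (simp add: bracket_closed)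

text \<open>\<open>ins \<Phi> u x v\<close> is the value at \<open>u x v\<close> of the functional \<open>\<Phi>\<close> on words, the letter \<open>x\<close>
  being expanded in the basis \<open>e\<close>.\<close>

definition ins :: "(nat list \<Rightarrow> 'k) \<Rightarrow> nat list \<Rightarrow> 'l \<Rightarrow> nat list \<Rightarrow> 'k" where
  "ins \<Phi> u x v = (\<Sum>k<n. co k x * \<Phi> (u @ [k] @ v))"

lemma ins_linear: "linear_form L (\<lambda>x. ins \<Phi> u x v)"
  using linear_formD[OF co_linear]
  by (auto simp: linear_form_def ins_def algebra_simps sum.distrib sum_distrib_left)

lemma ins_e: "i < n \<Longrightarrow> ins \<Phi> u (e i) v = \<Phi> (u @ [i] @ v)"
  by (simp add: ins_def co_e if_distrib[of "\<lambda>x. x * _"] sum.delta cong: if_cong)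

lemma ins_bracket_linear:
  assumes "i < n" shows "linear_form L (\<lambda>x. ins \<Phi> u (bracket L x (e i)) v)"
  using assms linear_formD[OF ins_linear]
  by (auto simp: linear_form_def bracket_add_left bracket_smult_left bracket_closed)

lemmas ins_zero = linear_form_zero[OF vectorspace_axioms ins_linear]
lemmas ins_add = linear_formD(1)[OF ins_linear]
lemmas ins_neg = linear_form_diff(2)[OF vectorspace_axioms ins_linear M.zero_closed]

text \<open>With \<open>power_rhs\<close>, the relations of u(L,chi) read as rewriting rules towards
  increasing words: e_j e_i becomes e_i e_j + [e_j,e_i] for i < j, and e_i^p becomes e_i^[p] +
  chi(e_i)^p. A right-hand side is a list of coefficients and words.\<close>

definition swap_rhs :: "nat \<Rightarrow> nat \<Rightarrow> ('k \<times> nat list) list" where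
  "swap_rhs j i = (1, [i, j]) # map (\<lambda>k. (co k (bracket L (e j) (e i)), [k])) [0..<n]"

definition power_rhs :: "nat \<Rightarrow> ('k \<times> nat list) list" where
  "power_rhs i = (\<chi> (e i) ^ p, []) # map (\<lambda>k. (co k (pmap L (e i)), [k])) [0..<n]"

definition rules :: "(nat list \<times> ('k \<times> nat list) list) set" where
  "rules = {([j, i], swap_rhs j i) | i j. i < j \<and> j < n}
     \<union> {(replicate p i, power_rhs i) | i. i < n}"

definition rhs_val :: "('k \<times> nat list) list \<Rightarrow> nat list \<Rightarrow> nat list \<Rightarrow> (nat list \<Rightarrow> 'k) \<Rightarrow> 'k" where
  "rhs_val r u v \<Phi> = (\<Sum>(a, z)\<leftarrow>r. a * \<Phi> (u @ z @ v))"

lemma rhs_val_swap: "rhs_val (swap_rhs j i) u v \<Phi> = \<Phi> (u @ [i, j] @ v) + ins \<Phi> u (bracket L (e j) (e i)) v"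
  by (simp add: rhs_val_def swap_rhs_def ins_def o_def interv_sum_list_conv_sum_set_nat atLeast0LessThan)

lemma rhs_val_power: "rhs_val (power_rhs i) u v \<Phi> = \<chi> (e i) ^ p * \<Phi> (u @ v) + ins \<Phi> u (pmap L (e i)) v"
  by (simp add: rhs_val_def power_rhs_def ins_def o_def interv_sum_list_conv_sum_set_nat atLeast0LessThan)

lemma rulesE:
  assumes "(l, r) \<in> rules"
  obtains (swap) i j where "i < j" "j < n" "l = [j, i]" "r = swap_rhs j i"
    | (power) i where "i < n" "l = replicate p i" "r = power_rhs i"
  using assms unfolding rules_def by blast

text \<open>This makes recursion along the rules well founded. For the power rule it needs p >= 2:
  single letters must be shorter than a p-th power.\<close>

lemma rule_decreasing:
  assumes "(l, r) \<in> rules" "(a, z) \<in> set r"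
  shows "(z, l) \<in> word_order"
  using assms(1)
proof (cases rule: rulesE)
  case (swap i j)
  then have "z = [i, j] \<or> length z < length l" using assms(2) by (auto simp: swap_rhs_def)
  then show ?thesis
    using word_order_smaller[of i j "[j]" "[i]" "[]"] swap word_order_shorter[of z l] by auto
next
  case (power i)
  then have "length z < length l" using assms(2) p_ge_2 by (auto simp: power_rhs_def)
  then show ?thesis by (rule word_order_shorter)
qed

definition normal_word :: "nat list \<Rightarrow> bool" where
  "normal_word w \<longleftrightarrow> \<not> (\<exists>u l r v. w = u @ l @ v \<and> (l, r) \<in> rules)"

text \<open>The induction hypothesis of the diamond lemma: the relations hold at all words below
  \<open>w\<close>, and two competing reductions of \<open>w\<close> itself are to be
  compared.\<close>

definition rel_below :: "nat list \<Rightarrow> (nat list \<Rightarrow> 'k) \<Rightarrow> bool" where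
  "rel_below w \<Phi> \<longleftrightarrow> (\<forall>u l r v. (l, r) \<in> rules \<and> (u @ l @ v, w) \<in> word_order
     \<longrightarrow> \<Phi> (u @ l @ v) = rhs_val r u v \<Phi>)"

section \<open>Resolution of the ambiguities\<close>

context
  fixes w \<Phi> assumes below: "rel_below w \<Phi>"
begin

lemma below_swap:
  "i < j \<Longrightarrow> j < n \<Longrightarrow> (u @ [j, i] @ v, w) \<in> word_order
    \<Longrightarrow> \<Phi> (u @ [j, i] @ v) = \<Phi> (u @ [i, j] @ v) + ins \<Phi> u (bracket L (e j) (e i)) v"
proof -
  assume "i < j" "j < n" and w: "(u @ [j, i] @ v, w) \<in> word_order"
  then have "([j, i], swap_rhs j i) \<in> rules" unfolding rules_def by blast
  then show ?thesis using below w unfolding rel_below_def rhs_val_swap[symmetric] by blast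
qed

lemma below_power:
  "i < n \<Longrightarrow> (u @ replicate p i @ v, w) \<in> word_order
    \<Longrightarrow> \<Phi> (u @ replicate p i @ v) = \<chi> (e i) ^ p * \<Phi> (u @ v) + ins \<Phi> u (pmap L (e i)) v"
proof -
  assume "i < n" and w: "(u @ replicate p i @ v, w) \<in> word_order"
  then have "(replicate p i, power_rhs i) \<in> rules" unfolding rules_def by blast
  then show ?thesis using below w unfolding rel_below_def rhs_val_power[symmetric] by blast
qed

text \<open>Both sides are linear in x, so basis vectors suffice: the swap rule is read forwards for
  i < k and backwards for k < i. The strict length bound keeps both orders of the two letters below
  \<open>w\<close>.\<close>

lemma below_commute:
  assumes len: "length u + length v + 2 < length w" and i: "i < n" and x: "x \<in> carrier L"
  shows "ins \<Phi> u x (i # v) = ins \<Phi> (u @ [i]) x v + ins \<Phi> u (bracket L x (e i)) v"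
  using _ _ _ x
proof (rule linear_form_eqI)
  show "linear_form L (\<lambda>x. ins \<Phi> u x (i # v))" by (rule ins_linear)
  show "linear_form L (\<lambda>x. ins \<Phi> (u @ [i]) x v + ins \<Phi> u (bracket L x (e i)) v)"
    using linear_formD[OF ins_linear] linear_formD[OF ins_bracket_linear[OF i]]
    by (auto simp: linear_form_def algebra_simps)
  fix k assume k: "k < n"
  have short: "(u @ [a, b] @ v, w) \<in> word_order" for a b
    using len by (intro word_order_shorter) simp
  consider "k = i" | "i < k" | "k < i" by linarith
  then show "ins \<Phi> u (e k) (i # v) = ins \<Phi> (u @ [i]) (e k) v + ins \<Phi> u (bracket L (e k) (e i)) v"
  proof cases
    case 1
    then show ?thesis using i by (simp add: ins_e bracket_self ins_zero)
  next
    case 2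
    then show ?thesis using below_swap[OF 2 k short] i k by (simp add: ins_e)
  next
    case 3
    have "ins \<Phi> u (bracket L (e k) (e i)) v = - ins \<Phi> u (bracket L (e i) (e k)) v"
      using i k by (subst bracket_anti) (auto simp: ins_neg bracket_closed)
    then show ?thesis using below_swap[OF 3 i short] i k by (simp add: ins_e)
  qed
qed

text \<open>\<open>below_commute\<close>, with its bracket reversed, is exactly the recursion
  required by \<open>alternating_differences_char\<close>.\<close>

lemma below_ad_power:
  assumes len: "length u + length v + p < length w" and i: "i < n" and x: "x \<in> carrier L"
  shows "(\<Sum>s<p. ins \<Phi> (u @ replicate s i) x (replicate (p - 1 - s) i @ v))
     = ins \<Phi> u ((bracket L (e i) ^^ (p - 1)) x) v"
proof -
  define G where "G a b m = ins \<Phi> (u @ replicate a i) ((bracket L (e i) ^^ m) x) (replicate b i @ v)" for a b m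
  have cl: "(bracket L (e i) ^^ m) x \<in> carrier L" for m
    by (induction m) (auto simp: x i bracket_closed)
  have "G 0 0 (p - 1) = (\<Sum>s<p. G s (p - 1 - s) 0)"
  proof (rule alternating_differences_char[OF char_prime, folded p_char])
    fix a b m assume ab: "a + b + m < p - 1"
    let ?y = "(bracket L (e i) ^^ m) x"
    have "ins \<Phi> (u @ replicate a i) ?y (i # (replicate b i @ v))
        = ins \<Phi> ((u @ replicate a i) @ [i]) ?y (replicate b i @ v)
          + ins \<Phi> (u @ replicate a i) (bracket L ?y (e i)) (replicate b i @ v)"
      using len ab by (intro below_commute i cl) auto
    moreover have "bracket L ?y (e i) = \<ominus> bracket L (e i) ?y"
      using cl i by (intro bracket_anti) auto
    ultimately show "G a b (Suc m) = G (Suc a) b m - G a (Suc b) m"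
      using cl i by (simp add: G_def ins_neg bracket_closed replicate_append_same)
  qed
  then show ?thesis by (simp add: G_def)
qed

text \<open>Both reductions of e_k e_j e_i are continued to e_i e_j e_k. Once the brackets produced
  on the way are commuted past the remaining letter, the two results differ by double brackets that
  cancel by the Jacobi identity.\<close>

lemma ambiguity_swap_swap:
  assumes w: "w = u @ [k, j, i] @ v" and ijk: "i < j" "j < k" "k < n"
  shows "rhs_val (swap_rhs k j) u (i # v) \<Phi> = rhs_val (swap_rhs j i) (u @ [k]) v \<Phi>"
proof -
  let ?b = "bracket L"
  have [simp]: "i < n" "j < n" "k < n" using ijk by auto
  have o1: "(u @ [j, k, i] @ v, w) \<in> word_order" "(u @ [k, i, j] @ v, w) \<in> word_order"
    "(u @ [j, i, k] @ v, w) \<in> word_order" "(u @ [i, k, j] @ v, w) \<in> word_order"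
    using ijk word_order_smaller[of j k "[k, i] @ v" "[j, i] @ v" u]
      word_order_smaller[of i j "[j] @ v" "[i] @ v" "u @ [k]"]
      word_order_smaller[of j k "[i, k] @ v" "[j, i] @ v" u]
      word_order_smaller[of i k "[k, j] @ v" "[j, i] @ v" u] by (auto simp: w)
  have "\<Phi> (u @ [j, k, i] @ v) = \<Phi> (u @ [j, i, k] @ v) + ins \<Phi> (u @ [j]) (?b (e k) (e i)) v"
    using below_swap[of i k "u @ [j]" v] o1 ijk by simp
  moreover have "\<Phi> (u @ [j, i, k] @ v) = \<Phi> (u @ [i, j, k] @ v) + ins \<Phi> u (?b (e j) (e i)) (k # v)"
    using below_swap[of i j u "k # v"] o1 ijk by simp
  moreover have "\<Phi> (u @ [k, i, j] @ v) = \<Phi> (u @ [i, k, j] @ v) + ins \<Phi> u (?b (e k) (e i)) (j # v)"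
    using below_swap[of i k u "j # v"] o1 ijk by simp
  moreover have "\<Phi> (u @ [i, k, j] @ v) = \<Phi> (u @ [i, j, k] @ v) + ins \<Phi> (u @ [i]) (?b (e k) (e j)) v"
    using below_swap[of j k "u @ [i]" v] o1 ijk by simp
  moreover have "ins \<Phi> u x (l # v) = ins \<Phi> (u @ [l]) x v + ins \<Phi> u (?b x (e l)) v"
    if "x \<in> carrier L" "l < n" for x l
    using that by (intro below_commute) (auto simp: w)
  then have "ins \<Phi> u (?b (e a) (e b)) (l # v)
      = ins \<Phi> (u @ [l]) (?b (e a) (e b)) v + ins \<Phi> u (?b (?b (e a) (e b)) (e l)) v"
    if "l < n" "a < n" "b < n" for l a b
    using that by (simp add: bracket_closed)
  moreover have "ins \<Phi> u (?b (?b (e k) (e j)) (e i)) v + ins \<Phi> u (?b (?b (e j) (e i)) (e k)) v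
      = ins \<Phi> u (?b (?b (e k) (e i)) (e j)) v"
  proof -
    \<comment> \<open>\<open>jacobi\<close> nests its brackets on the right; \<open>flip\<close> and
      \<open>f2\<close> bring the three terms into that shape, each use costing a sign.\<close>
    have flip: "ins \<Phi> u (?b (?b (e a) (e b)) (e c)) v = - ins \<Phi> u (?b (e c) (?b (e a) (e b))) v"
      if "a < n" "b < n" "c < n" for a b c
      using that by (subst bracket_anti) (auto simp: bracket_closed ins_neg)
    have "?b (e j) (?b (e k) (e i)) = (-1) \<odot> ?b (e j) (?b (e i) (e k))"
      by (subst bracket_minus_one[of "e k"]) (auto simp: bracket_smult_right bracket_closed)
    then have f2: "ins \<Phi> u (?b (e j) (?b (e k) (e i))) v = - ins \<Phi> u (?b (e j) (?b (e i) (e k))) v"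
      by (simp add: linear_formD(2)[OF ins_linear] bracket_closed)
    have "0 = ins \<Phi> u (?b (e i) (?b (e k) (e j)) \<oplus> ?b (e k) (?b (e j) (e i)) \<oplus> ?b (e j) (?b (e i) (e k))) v"
      by (subst jacobi) (auto simp: ins_zero)
    also have "\<dots> = ins \<Phi> u (?b (e i) (?b (e k) (e j))) v + ins \<Phi> u (?b (e k) (?b (e j) (e i))) v
        + ins \<Phi> u (?b (e j) (?b (e i) (e k))) v"
      by (simp add: ins_add bracket_closed)
    finally have "ins \<Phi> u (?b (e i) (?b (e k) (e j))) v + ins \<Phi> u (?b (e k) (?b (e j) (e i))) v
        + ins \<Phi> u (?b (e j) (?b (e i) (e k))) v = 0" by simp
    moreover have "a + b + c = 0 \<Longrightarrow> - a + - b = c" for a b c :: 'k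
      using Groups.minus_unique[of "a + b" c] by simp
    ultimately show ?thesis using f2 by (simp add: flip)
  qed
  ultimately show ?thesis by (simp add: rhs_val_swap add_ac)
qed

lemma ins_ad_power:
  assumes i: "i < n" and x: "x \<in> carrier L"
  shows "ins \<Phi> u ((bracket L (e i) ^^ (p - 1)) (bracket L (e i) x)) v = ins \<Phi> u (bracket L (pmap L (e i)) x) v"
proof -
  have "(bracket L (e i) ^^ (p - 1)) (bracket L (e i) x) = (bracket L (e i) ^^ Suc (p - 1)) x"
    by (simp only: funpow_Suc_right o_apply)
  also have "Suc (p - 1) = p" using p_ge_2 by simp
  finally show ?thesis using ad_pmap[of "e i" x] i x by (simp add: p_char)
qed

text \<open>Carrying e_j through e_i^p leaves a bracket [e_j,e_i] at each of p positions. These add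
  up to (ad e_i)^(p-1)[e_j,e_i] = -[e_i^[p],e_j], the very term that arises when e_j is commuted
  past e_i^[p]. Here the axiom on ad of the p-map enters.\<close>

lemma ambiguity_swap_power:
  assumes w: "w = u @ [j] @ replicate p i @ v" and ij: "i < j" "j < n"
  shows "rhs_val (swap_rhs j i) u (replicate (p - 1) i @ v) \<Phi> = rhs_val (power_rhs i) (u @ [j]) v \<Phi>"
proof -
  let ?b = "bracket L" and ?r = "\<lambda>s. replicate s i"
  have [simp]: "i < n" "j < n" using ij by auto
  have rep: "?r (s + t) = ?r s @ ?r t" for s t by (rule replicate_add)
  have small: "(u @ ?r (Suc s) @ [j] @ ?r t @ v, w) \<in> word_order" if "s + t = p - 1" for s t
  proof -
    have "length (?r s @ [j] @ ?r t @ v) = length (?r p @ v)" using that p_ge_2 by simp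
    from word_order_smaller[OF ij(1) this, of u] show ?thesis by (simp add: w)
  qed
  \<comment> \<open>The first exchange is the rule under test, so positions are counted from 1; the
    bracket at position 0 is its second term.\<close>
  have "\<Phi> (u @ [i] @ [j] @ ?r (p - 1) @ v) = \<Phi> (u @ ?r (Suc s) @ [j] @ ?r (p - 1 - s) @ v)
      + (\<Sum>a\<in>{1..s}. ins \<Phi> (u @ ?r a) (?b (e j) (e i)) (?r (p - 1 - a) @ v))" if "s \<le> p - 1" for s
    using that
  proof (induction s)
    case (Suc s)
    have t: "p - 1 - s = Suc (p - 1 - Suc s)" using Suc.prems by simp
    have "\<Phi> ((u @ ?r (Suc s)) @ [j, i] @ (?r (p - 1 - Suc s) @ v))
        = \<Phi> ((u @ ?r (Suc s)) @ [i, j] @ (?r (p - 1 - Suc s) @ v))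
          + ins \<Phi> (u @ ?r (Suc s)) (?b (e j) (e i)) (?r (p - 1 - Suc s) @ v)"
      using small[of s "p - 1 - s"] Suc.prems ij t by (intro below_swap) auto
    then have "\<Phi> (u @ ?r (Suc s) @ [j] @ ?r (p - 1 - s) @ v)
        = \<Phi> (u @ ?r (Suc (Suc s)) @ [j] @ ?r (p - 1 - Suc s) @ v)
          + ins \<Phi> (u @ ?r (Suc s)) (?b (e j) (e i)) (?r (p - 1 - Suc s) @ v)"
      unfolding t by (simp add: replicate_app_Cons_same)
    then show ?case using Suc by simp
  qed simp
  from this[of "p - 1"] have 1: "\<Phi> (u @ [i, j] @ ?r (p - 1) @ v) = \<Phi> (u @ ?r p @ [j] @ v)
      + (\<Sum>a\<in>{1..p - 1}. ins \<Phi> (u @ ?r a) (?b (e j) (e i)) (?r (p - 1 - a) @ v))" (is "_ = _ + ?S")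
    using p_ge_2 by simp
  have 2: "\<Phi> (u @ ?r p @ (j # v)) = \<chi> (e i) ^ p * \<Phi> (u @ (j # v)) + ins \<Phi> u (pmap L (e i)) (j # v)"
    using small[of "p - 1" 0] p_ge_2 by (intro below_power) auto
  have "(\<Sum>a<p. ins \<Phi> (u @ ?r a) (?b (e j) (e i)) (?r (p - 1 - a) @ v))
      = ins \<Phi> u (?b (e j) (e i)) (?r (p - 1) @ v) + ?S"
  proof -
    have "{..<p} = insert 0 {1..p - 1}" using p_ge_2 by auto
    then show ?thesis by simp
  qed
  moreover have "(\<Sum>a<p. ins \<Phi> (u @ ?r a) (?b (e j) (e i)) (?r (p - 1 - a) @ v))
      = ins \<Phi> u ((?b (e i) ^^ (p - 1)) (?b (e j) (e i))) v"
    by (rule below_ad_power) (auto simp: w bracket_closed)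
  moreover have "\<dots> = - ins \<Phi> u (?b (pmap L (e i)) (e j)) v"
  proof -
    have hom: "(?b (e i) ^^ m) (a \<odot> x) = a \<odot> (?b (e i) ^^ m) x" "(?b (e i) ^^ m) x \<in> carrier L"
      if "x \<in> carrier L" for m a x
      using that by (induction m) (auto simp: bracket_smult_right bracket_closed)
    have eq: "(?b (e i) ^^ (p - 1)) (?b (e j) (e i)) = (-1) \<odot> (?b (e i) ^^ (p - 1)) (?b (e i) (e j))"
      by (subst bracket_minus_one[of "e j"]) (simp_all add: bracket_closed hom(1))
    have "(?b (e i) ^^ (p - 1)) (?b (e i) (e j)) \<in> carrier L"
      by (rule hom(2)) (simp add: bracket_closed)
    then have "ins \<Phi> u ((?b (e i) ^^ (p - 1)) (?b (e j) (e i))) v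
        = -1 * ins \<Phi> u ((?b (e i) ^^ (p - 1)) (?b (e i) (e j))) v"
      unfolding eq by (rule linear_formD(2)[OF ins_linear])
    then show ?thesis
      unfolding ins_ad_power[OF \<open>i < n\<close> e_closed[OF \<open>j < n\<close>]] by simp
  qed
  ultimately have 3: "?S = - ins \<Phi> u (?b (pmap L (e i)) (e j)) v - ins \<Phi> u (?b (e j) (e i)) (?r (p - 1) @ v)"
    unfolding eq_diff_eq by (simp only: ab_semigroup_add_class.add.commute[of ?S])
  have 4: "ins \<Phi> u (pmap L (e i)) (j # v) = ins \<Phi> (u @ [j]) (pmap L (e i)) v
      + ins \<Phi> u (?b (pmap L (e i)) (e j)) v"
    using p_ge_2 by (intro below_commute) (auto simp: w pmap_closed)
  have "\<Phi> (u @ [i, j] @ ?r (p - 1) @ v) + ins \<Phi> u (?b (e j) (e i)) (?r (p - 1) @ v)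
      = \<chi> (e i) ^ p * \<Phi> ((u @ [j]) @ v) + ins \<Phi> (u @ [j]) (pmap L (e i)) v"
    using 1 2 unfolding 3 4 by simp
  then show ?thesis by (simp only: rhs_val_swap rhs_val_power)
qed

text \<open>The mirror image, with e_i travelling left through e_j^p. No sign appears now, since (ad
  e_j)^(p-1)[e_j,e_i] is already [e_j^[p],e_i].\<close>

lemma ambiguity_power_swap:
  assumes w: "w = u @ replicate p j @ [i] @ v" and ij: "i < j" "j < n"
  shows "rhs_val (power_rhs j) u (i # v) \<Phi> = rhs_val (swap_rhs j i) (u @ replicate (p - 1) j) v \<Phi>"
proof -
  let ?b = "bracket L" and ?r = "\<lambda>s. replicate s j"
  have [simp]: "i < n" "j < n" using ij by auto
  have small: "(u @ ?r s @ [i] @ ?r t @ v, w) \<in> word_order" if st: "s + t = p" and t0: "t > 0" for s t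
  proof -
    have len: "length (?r t @ v) = length (?r (t - 1) @ i # v)" using that by simp
    obtain t' where t': "t = Suc t'" using t0 gr0_implies_Suc by blast
    have "?r p = ?r s @ ?r t" unfolding st[symmetric] by (rule replicate_add)
    then have "?r p = ?r s @ j # ?r (t - 1)" by (simp add: t')
    then have "w = (u @ ?r s) @ j # (?r (t - 1) @ i # v)" unfolding w by simp
    then show ?thesis using word_order_smaller[OF ij(1) len, of "u @ ?r s"] by simp
  qed
  \<comment> \<open>The induction counts the letters already passed from the right, hence the index
    set; position p - 1 is supplied by the rule under test.\<close>
  have "\<Phi> (u @ ?r (p - 1) @ [i, j] @ v) = \<Phi> (u @ ?r (p - 1 - t) @ [i] @ ?r (Suc t) @ v)
      + (\<Sum>a\<in>{p - 1 - t..<p - 1}. ins \<Phi> (u @ ?r a) (?b (e j) (e i)) (?r (p - 1 - a) @ v))" if "t \<le> p - 1" for t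
    using that
  proof (induction t)
    case (Suc t)
    let ?s = "p - 1 - Suc t"
    have t: "p - 1 - t = Suc ?s" using Suc.prems by simp
    have r: "?r (Suc ?s) = ?r ?s @ [j]" by (simp add: replicate_append_same)
    have "\<Phi> ((u @ ?r ?s) @ [j, i] @ (?r (Suc t) @ v))
        = \<Phi> ((u @ ?r ?s) @ [i, j] @ (?r (Suc t) @ v))
          + ins \<Phi> (u @ ?r ?s) (?b (e j) (e i)) (?r (Suc t) @ v)"
      using small[of "p - 1 - t" "Suc t"] Suc.prems ij unfolding t r by (intro below_swap) auto
    then have "\<Phi> (u @ ?r (p - 1 - t) @ [i] @ ?r (Suc t) @ v)
        = \<Phi> (u @ ?r ?s @ [i] @ ?r (Suc (Suc t)) @ v)
          + ins \<Phi> (u @ ?r ?s) (?b (e j) (e i)) (?r (Suc t) @ v)"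
      unfolding t r by simp
    moreover have "{?s..<p - 1} = insert ?s {p - 1 - t..<p - 1}" using Suc.prems by auto
    moreover have "p - 1 - ?s = Suc t" using Suc.prems by simp
    ultimately show ?case using Suc t by (simp add: algebra_simps)
  qed simp
  from this[of "p - 1"] have 1: "\<Phi> (u @ ?r (p - 1) @ [i, j] @ v) = \<Phi> (u @ [i] @ ?r p @ v)
      + (\<Sum>a\<in>{0..<p - 1}. ins \<Phi> (u @ ?r a) (?b (e j) (e i)) (?r (p - 1 - a) @ v))" (is "_ = _ + ?S")
    using p_ge_2 by simp
  have 2: "\<Phi> ((u @ [i]) @ ?r p @ v) = \<chi> (e j) ^ p * \<Phi> ((u @ [i]) @ v) + ins \<Phi> (u @ [i]) (pmap L (e j)) v"
    using small[of 0 p] p_ge_2 by (intro below_power) auto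
  have "(\<Sum>a<p. ins \<Phi> (u @ ?r a) (?b (e j) (e i)) (?r (p - 1 - a) @ v))
      = ins \<Phi> (u @ ?r (p - 1)) (?b (e j) (e i)) v + ?S"
  proof -
    have "{..<p} = insert (p - 1) {0..<p - 1}" using p_ge_2 by auto
    then show ?thesis by simp
  qed
  moreover have "(\<Sum>a<p. ins \<Phi> (u @ ?r a) (?b (e j) (e i)) (?r (p - 1 - a) @ v))
      = ins \<Phi> u ((?b (e j) ^^ (p - 1)) (?b (e j) (e i))) v"
    by (rule below_ad_power) (auto simp: w bracket_closed)
  moreover have "\<dots> = ins \<Phi> u (?b (pmap L (e j)) (e i)) v"
    by (rule ins_ad_power) auto
  ultimately have 3: "?S = ins \<Phi> u (?b (pmap L (e j)) (e i)) v - ins \<Phi> (u @ ?r (p - 1)) (?b (e j) (e i)) v"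
    unfolding eq_diff_eq by (simp only: ab_semigroup_add_class.add.commute[of ?S])
  have 4: "ins \<Phi> u (pmap L (e j)) (i # v) = ins \<Phi> (u @ [i]) (pmap L (e j)) v
      + ins \<Phi> u (?b (pmap L (e j)) (e i)) v"
    using p_ge_2 by (intro below_commute) (auto simp: w pmap_closed)
  have "\<Phi> ((u @ ?r (p - 1)) @ [i, j] @ v) + ins \<Phi> (u @ ?r (p - 1)) (?b (e j) (e i)) v
      = \<chi> (e j) ^ p * \<Phi> (u @ i # v) + ins \<Phi> u (pmap L (e j)) (i # v)"
    using 1 2 unfolding 3 4 by simp
  then show ?thesis by (simp only: rhs_val_swap rhs_val_power)
qed

text \<open>The two reductions differ only in the side on which e_i^[p] stands relative to the s
  spare letters, and e_i^[p] commutes with e_i because (ad e_i)^p kills e_i.\<close>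

lemma ambiguity_power_power:
  assumes w: "w = u @ replicate (s + p) i @ v" and i: "i < n"
  shows "rhs_val (power_rhs i) u (replicate s i @ v) \<Phi> = rhs_val (power_rhs i) (u @ replicate s i) v \<Phi>"
proof -
  have zero: "bracket L (pmap L (e i)) (e i) = \<zero>"
  proof -
    have "(bracket L (e i) ^^ Suc (p - 1)) (e i) = \<zero>"
    proof -
      have "(bracket L (e i) ^^ m) \<zero> = \<zero>" for m
      proof (induction m)
        case (Suc m)
        have "bracket L (e i) (0 \<odot> \<zero>) = 0 \<odot> bracket L (e i) \<zero>"
          using i by (intro bracket_smult_right) auto
        then show ?case using Suc i by (simp add: smult_zero[OF vectorspace_axioms] bracket_closed)
      qed simp
      then show ?thesis using i by (simp only: funpow_Suc_right o_apply) (simp add: bracket_self)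
    qed
    then show ?thesis using ad_pmap[of "e i" "e i"] i p_ge_2 by (simp add: p_char[symmetric])
  qed
  have "t \<le> s \<Longrightarrow> ins \<Phi> u (pmap L (e i)) (replicate s i @ v)
      = ins \<Phi> (u @ replicate t i) (pmap L (e i)) (replicate (s - t) i @ v)" for t
  proof (induction t)
    case (Suc t)
    then have t: "s - t = Suc (s - Suc t)" by simp
    have "ins \<Phi> (u @ replicate t i) (pmap L (e i)) (i # (replicate (s - Suc t) i @ v))
        = ins \<Phi> ((u @ replicate t i) @ [i]) (pmap L (e i)) (replicate (s - Suc t) i @ v)
          + ins \<Phi> (u @ replicate t i) (bracket L (pmap L (e i)) (e i)) (replicate (s - Suc t) i @ v)"
      using i p_ge_2 Suc.prems by (intro below_commute) (auto simp: w pmap_closed)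
    then show ?case using Suc unfolding t by (simp add: zero ins_zero replicate_append_same)
  qed simp
  from this[of s] show ?thesis by (simp add: rhs_val_power)
qed

text \<open>Reductions at separate places commute: performing both, in either order, gives the same
  double sum over the two right-hand sides.\<close>

lemma ambiguity_disjoint:
  assumes w: "w = u @ l @ m @ l' @ v" and rl: "(l, r) \<in> rules" and rl': "(l', r') \<in> rules"
  shows "rhs_val r u (m @ l' @ v) \<Phi> = rhs_val r' (u @ l @ m) v \<Phi>"
proof -
  have "rhs_val r u (m @ l' @ v) \<Phi> = (\<Sum>(a, z)\<leftarrow>r. \<Sum>(b, y)\<leftarrow>r'. a * (b * \<Phi> (u @ z @ m @ y @ v)))"
    unfolding rhs_val_def
  proof (rule arg_cong[of _ _ sum_list], rule map_cong[OF refl], clarify)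
    fix a z assume az: "(a, z) \<in> set r"
    have "((u @ z @ m) @ l' @ v, w) \<in> word_order"
      using word_order_context[OF rule_decreasing[OF rl az], of u "m @ l' @ v"] by (simp add: w)
    then have "\<Phi> ((u @ z @ m) @ l' @ v) = rhs_val r' (u @ z @ m) v \<Phi>"
      using below rl' unfolding rel_below_def by blast
    then show "a * \<Phi> (u @ z @ m @ l' @ v) = (\<Sum>(b, y)\<leftarrow>r'. a * (b * \<Phi> (u @ z @ m @ y @ v)))"
      by (simp add: rhs_val_def sum_list_const_mult[symmetric] case_prod_unfold)
  qed
  also have "\<dots> = (\<Sum>(b, y)\<leftarrow>r'. \<Sum>(a, z)\<leftarrow>r. a * (b * \<Phi> (u @ z @ m @ y @ v)))"
    unfolding case_prod_unfold by (rule sum_list_swap)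
  also have "\<dots> = rhs_val r' (u @ l @ m) v \<Phi>"
    unfolding rhs_val_def
  proof (rule arg_cong[of _ _ sum_list], rule map_cong[OF refl], clarify)
    fix b y assume by': "(b, y) \<in> set r'"
    have "(u @ l @ (m @ y @ v), w) \<in> word_order"
      using word_order_context[OF rule_decreasing[OF rl' by'], of "u @ l @ m" v] by (simp add: w)
    then have "\<Phi> (u @ l @ (m @ y @ v)) = rhs_val r u (m @ y @ v) \<Phi>"
      using below rl unfolding rel_below_def by blast
    then show "(\<Sum>(a, z)\<leftarrow>r. a * (b * \<Phi> (u @ z @ m @ y @ v))) = b * \<Phi> ((u @ l @ m) @ y @ v)"
      by (simp add: rhs_val_def sum_list_const_mult[symmetric] case_prod_unfold mult.left_commute)
  qed
  finally show ?thesis .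
qed

text \<open>A swap word has two distinct letters and a power word only one. So overlapping left-hand
  sides either coincide, share one letter of a swap word, or share a stretch of equal letters of two
  power words; each case is settled above.\<close>

lemma ambiguity_ordered:
  assumes w: "w = u @ l @ v" "w = u' @ l' @ v'" and rl: "(l, r) \<in> rules" and rl': "(l', r') \<in> rules"
    and len: "length u \<le> length u'"
  shows "rhs_val r u v \<Phi> = rhs_val r' u' v' \<Phi>"
proof -
  have "\<exists>x. u' = u @ x \<and> l @ v = x @ l' @ v' \<or> u = u' @ x \<and> x @ l @ v = l' @ v'"
    using w append_eq_append_conv2[of u "l @ v" u' "l' @ v'"] by auto
  then obtain x where x: "u' = u @ x" "l @ v = x @ l' @ v'" using len by auto
  then have "\<exists>y. l = x @ y \<and> y @ v = l' @ v' \<or> x = l @ y \<and> v = y @ l' @ v'"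
    using append_eq_append_conv2[of l v x "l' @ v'"] by auto
  then consider (disjoint) m where "x = l @ m" "v = m @ l' @ v'"
    | (overlap) y where "l = x @ y" "y \<noteq> []" "y @ v = l' @ v'"
    by (metis append_Nil append_Nil2)
  then show ?thesis
  proof cases
    case disjoint
    then show ?thesis using ambiguity_disjoint[OF _ rl rl', of u m v'] w x by simp
  next
    case overlap
    obtain q where q: "p = Suc (Suc q)" using p_ge_2 by (metis add_2_eq_Suc le_Suc_ex)
    from rl show ?thesis
    proof (cases rule: rulesE)
      case (swap i j)
      from rl' show ?thesis
      proof (cases rule: rulesE)
        case (swap i' j')
        show ?thesis
        proof (cases x)
          case Nil
          then show ?thesis using overlap swap \<open>l = [j, i]\<close> \<open>r = swap_rhs j i\<close> x by auto
        next
          case (Cons a x')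
          then have "x = [j]" "y = [i]" using overlap \<open>l = [j, i]\<close> by (auto simp: Cons_eq_append_conv)
          then show ?thesis
            using overlap swap \<open>l = [j, i]\<close> \<open>r = swap_rhs j i\<close> \<open>i < j\<close> \<open>j < n\<close> w x
              ambiguity_swap_swap[of u j i i' v'] by auto
        qed
      next
        case (power i')
        have "x \<noteq> []" using overlap power \<open>l = [j, i]\<close> \<open>i < j\<close> by (auto simp: q)
        then have "x = [j]" "y = [i]" using overlap \<open>l = [j, i]\<close> by (auto simp: Cons_eq_append_conv)
        then show ?thesis
          using overlap power \<open>l = [j, i]\<close> \<open>r = swap_rhs j i\<close> \<open>i < j\<close> \<open>j < n\<close> w x
            ambiguity_swap_power[of u j i v'] by (auto simp: q)
      qed
    next
      case (power j)
      \<comment> \<open>The power word is cut where the second left-hand side begins: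
        \<open>s\<close> letters before it and \<open>t\<close> letters from there on.\<close>
      obtain s t where st: "x = replicate s j" "y = replicate t j" "p = s + t"
      proof
        have xy: "x @ y = replicate p j" using overlap(1) power(2) by simp
        then have "set x \<subseteq> {j}" "set y \<subseteq> {j}" by (metis le_sup_iff set_append set_replicate_conv_if empty_subsetI subset_refl)+
        then show "x = replicate (length x) j" "y = replicate (length y) j"
          by (auto intro!: replicate_length_same[symmetric])
        show "p = length x + length y" using arg_cong[OF xy, of length] by simp
      qed
      have t: "t > 0" using st overlap by auto
      from rl' show ?thesis
      proof (cases rule: rulesE)
        case (swap i' j')
        have "t = 1"
        proof (rule ccontr)
          assume "t \<noteq> 1"
          then obtain t' where "t = Suc (Suc t')" using t by (metis One_nat_def gr0_implies_Suc not_gr_zero)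
          then show False using overlap st swap by auto
        qed
        then show ?thesis using overlap st swap power w x ambiguity_power_swap[of u j i' v'] by auto
      next
        case (power j')
        obtain t' where t': "t = Suc t'" using t gr0_implies_Suc by blast
        have jj: "j = j'" using overlap(3) st(2) power(2) by (auto simp: t' q)
        have "replicate t j @ v = replicate t j @ replicate s j @ v'"
          using overlap(3) st power(2) jj by (metis append.assoc replicate_add add.commute)
        then have v: "v = replicate s j @ v'" by simp
        have "w = u @ replicate (s + p) j @ v'" using w x st power jj by (simp add: replicate_add)
        then show ?thesis
          using ambiguity_power_power[of u s j v'] v x st power jj \<open>r = power_rhs j\<close> by simp
      qed
    qed
  qed
qed

lemma ambiguity:
  assumes "w = u @ l @ v" "w = u' @ l' @ v'" "(l, r) \<in> rules" "(l', r') \<in> rules"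
  shows "rhs_val r u v \<Phi> = rhs_val r' u' v' \<Phi>"
proof (cases "length u \<le> length u'")
  case True
  then show ?thesis by (rule ambiguity_ordered[OF assms])
next
  case False
  then have "length u' \<le> length u" by simp
  then show ?thesis by (rule ambiguity_ordered[OF assms(2,1,4,3), symmetric])
qed

end

text \<open>Bergman's diamond lemma for the monomials \<open>e\<^sub>1\<^bsup>a\<^sub>1\<^esup> \<dots> e\<^sub>n\<^bsup>a\<^sub>n\<^esup>\<close> with \<open>a\<^sub>i < p\<close>, in dual form.\<close>

theorem functional_on_normal_words:
  "\<exists>\<Phi>. (\<forall>w. normal_word w \<longrightarrow> \<Phi> w = \<psi> w) \<and>
     (\<forall>u l r v. (l, r) \<in> rules \<longrightarrow> \<Phi> (u @ l @ v) = rhs_val r u v \<Phi>)"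
proof -
  \<comment> \<open>Recursion needs one reduction per word, so an arbitrary site is fixed. That any
    other site yields the same value is what the ambiguity lemmas provide.\<close>
  define ch where "ch w = (SOME (u, l, r, v). w = u @ l @ v \<and> (l, r) \<in> rules)" for w
  define F where "F f w = (if normal_word w then \<psi> w else case ch w of (u, l, r, v) \<Rightarrow> rhs_val r u v f)" for f w
  define \<Phi> where "\<Phi> = wfrec word_order F"
  have wf: "wf word_order" by (rule wf_lenlex[OF wf_less_than])
  have unfold: "\<Phi> w = F (cut \<Phi> word_order w) w" for w
    unfolding \<Phi>_def by (rule wfrec[OF wf])
  have ch: "w = u @ l @ v \<and> (l, r) \<in> rules" if "\<not> normal_word w" "ch w = (u, l, r, v)" for w u l r v
  proof -
    have "\<exists>x. case x of (u, l, r, v) \<Rightarrow> w = u @ l @ v \<and> (l, r) \<in> rules"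
      using that(1) unfolding normal_word_def by auto
    then have "case ch w of (u, l, r, v) \<Rightarrow> w = u @ l @ v \<and> (l, r) \<in> rules"
      unfolding ch_def by (rule someI_ex)
    then show ?thesis using that(2) by simp
  qed
  \<comment> \<open>The recursion sees \<open>\<Phi>\<close> only below the current word, which is
    enough because right-hand sides are smaller.\<close>
  have cut: "rhs_val r u v (cut \<Phi> word_order (u @ l @ v)) = rhs_val r u v \<Phi>" if "(l, r) \<in> rules" for u l r v
    unfolding rhs_val_def
    using word_order_context[OF rule_decreasing[OF that], of _ _ u v]
    by (intro arg_cong[of _ _ sum_list] map_cong refl) (auto simp: cut_def)
  have chosen: "\<Phi> w = rhs_val r u v \<Phi>" if "\<not> normal_word w" "ch w = (u, l, r, v)" for w u l r v
    using ch[OF that] that cut[of l r u v] unfold[of w] by (simp add: F_def)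
  have "\<Phi> (u @ l @ v) = rhs_val r u v \<Phi>" if "(l, r) \<in> rules" "w = u @ l @ v" for w u l r v
    using wf that
  proof (induction w arbitrary: u l r v rule: wf_induct_rule)
    case (less w)
    then have nn: "\<not> normal_word w" unfolding normal_word_def by blast
    obtain u' l' r' v' where c: "ch w = (u', l', r', v')" by (metis prod_cases4)
    have "rel_below w \<Phi>" unfolding rel_below_def using less.IH by blast
    then have "rhs_val r' u' v' \<Phi> = rhs_val r u v \<Phi>"
      using ch[OF nn c] less.prems by (intro ambiguity) auto
    then show ?case using chosen[OF nn c] less.prems by simp
  qed
  moreover have "\<Phi> w = \<psi> w" if "normal_word w" for w
    using unfold[of w] that by (simp add: F_def)
  ultimately show ?thesis by blast
qed

end

section \<open>Subspaces and linear maps\<close>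

abbreviation "vsp V \<equiv> vectorspace class_ring V"
abbreviation "fdim V \<equiv> vectorspace.fin_dim class_ring V"
abbreviation "vdim V \<equiv> vectorspace.dim class_ring V"
abbreviation "ssp W V \<equiv> VectorSpace.subspace class_ring W V"
abbreviation "lhom V U \<equiv> LinearCombinations.module_hom class_ring V U"

lemma ssp_iff:
  fixes V :: "('k::field, 'v, 'x) module_scheme"
  assumes "vsp V"
  shows "ssp W V \<longleftrightarrow> W \<subseteq> carrier V \<and> \<zero>\<^bsub>V\<^esub> \<in> W \<and> (\<forall>x\<in>W. \<forall>y\<in>W. x \<oplus>\<^bsub>V\<^esub> y \<in> W)
     \<and> (\<forall>a. \<forall>x\<in>W. a \<odot>\<^bsub>V\<^esub> x \<in> W)"
  using assms vectorspace.axioms(1)[OF assms]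
  by (auto simp: subspace_def submodule_def)

lemma sspI:
  fixes V :: "('k::field, 'v, 'x) module_scheme"
  assumes "vsp V" "W \<subseteq> carrier V" "\<zero>\<^bsub>V\<^esub> \<in> W"
    "\<And>x y. x \<in> W \<Longrightarrow> y \<in> W \<Longrightarrow> x \<oplus>\<^bsub>V\<^esub> y \<in> W" "\<And>a x. x \<in> W \<Longrightarrow> a \<odot>\<^bsub>V\<^esub> x \<in> W"
  shows "ssp W V"
  using assms by (simp add: ssp_iff)

lemma sspD:
  fixes V :: "('k::field, 'v, 'x) module_scheme"
  assumes "ssp W V"
  shows "vsp V" "W \<subseteq> carrier V" "\<zero>\<^bsub>V\<^esub> \<in> W" "x \<in> W \<Longrightarrow> y \<in> W \<Longrightarrow> x \<oplus>\<^bsub>V\<^esub> y \<in> W"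
    "x \<in> W \<Longrightarrow> a \<odot>\<^bsub>V\<^esub> x \<in> W" "x \<in> W \<Longrightarrow> y \<in> W \<Longrightarrow> x \<ominus>\<^bsub>V\<^esub> y \<in> W"
    "x \<in> W \<Longrightarrow> x \<in> carrier V" "vsp (V\<lparr>carrier := W\<rparr>)"
proof -
  show V: "vsp V" using assms by (simp add: subspace_def)
  show W: "W \<subseteq> carrier V" "\<zero>\<^bsub>V\<^esub> \<in> W" "x \<in> W \<Longrightarrow> y \<in> W \<Longrightarrow> x \<oplus>\<^bsub>V\<^esub> y \<in> W"
    "x \<in> W \<Longrightarrow> a \<odot>\<^bsub>V\<^esub> x \<in> W" for x y a
    using assms by (simp_all add: ssp_iff[OF V])
  show "x \<in> W \<Longrightarrow> x \<in> carrier V" using W by auto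
  show "vsp (V\<lparr>carrier := W\<rparr>)" by (rule vectorspace.subspace_is_vs[OF V assms])
  assume "x \<in> W" "y \<in> W"
  then have "x \<oplus>\<^bsub>V\<^esub> ((-1) \<odot>\<^bsub>V\<^esub> y) \<in> W" using W by simp
  then show "x \<ominus>\<^bsub>V\<^esub> y \<in> W"
    using smult_minus_one[OF V] W(1) \<open>y \<in> W\<close> by (auto simp: a_minus_def)
qed

lemma ssp_sub:
  fixes V :: "('k::field, 'v, 'x) module_scheme"
  assumes "ssp W V" "ssp U V" "U \<subseteq> W"
  shows "ssp U (V\<lparr>carrier := W\<rparr>)"
  using assms(3) sspD[OF assms(2)] sspD(8)[OF assms(1)] by (intro sspI) auto

lemma ssp_sub_iff:
  fixes V :: "('k::field, 'v, 'x) module_scheme"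
  assumes "ssp W V"
  shows "ssp U (V\<lparr>carrier := W\<rparr>) \<longleftrightarrow> ssp U V \<and> U \<subseteq> W"
  using assms by (auto simp: ssp_iff[OF sspD(8)[OF assms]] ssp_iff[OF sspD(1)[OF assms]])

lemma span_ssp:
  fixes V :: "('k::field, 'v, 'x) module_scheme"
  assumes "vsp V" "A \<subseteq> carrier V"
  shows "ssp (LinearCombinations.module.span class_ring V A) V" "A \<subseteq> LinearCombinations.module.span class_ring V A"
    "ssp W V \<Longrightarrow> A \<subseteq> W \<Longrightarrow> LinearCombinations.module.span class_ring V A \<subseteq> W"
proof -
  interpret vectorspace class_ring V by fact
  show "ssp (span A) V" by (rule span_is_subspace[OF assms(2)])
  show "A \<subseteq> span A" by (rule in_own_span[OF assms(2)])
  show "ssp W V \<Longrightarrow> A \<subseteq> W \<Longrightarrow> span A \<subseteq> W" by (rule span_is_subset) auto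
qed

text \<open>The coordinate forms are part of the output: W is cut out by those with index at least
  r. Complements, separating hyperplanes and comparisons of dimensions later on are all taken from
  this one lemma.\<close>

lemma adapted_basis:
  fixes V :: "('k::field, 'v, 'x) module_scheme"
  assumes V: "vsp V" and fd: "fdim V" and W: "ssp W V"
  obtains r n :: nat and e :: "nat \<Rightarrow> 'v" and co :: "nat \<Rightarrow> 'v \<Rightarrow> 'k"
  where "r \<le> n" "\<And>i. i < n \<Longrightarrow> e i \<in> carrier V" "\<And>k. linear_form V (co k)"
    "\<And>i k. i < n \<Longrightarrow> k < n \<Longrightarrow> co k (e i) = (if k = i then 1 else 0)"
    "\<And>x. x \<in> carrier V \<Longrightarrow> x = (\<Oplus>\<^bsub>V\<^esub>k\<in>{..<n}. co k x \<odot>\<^bsub>V\<^esub> e k)"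
    "\<And>i. i < r \<Longrightarrow> e i \<in> W"
    "\<And>x. x \<in> carrier V \<Longrightarrow> x \<in> W \<longleftrightarrow> (\<forall>k. r \<le> k \<and> k < n \<longrightarrow> co k x = 0)"
    "vdim V = n" "vdim (V\<lparr>carrier := W\<rparr>) = r" "fdim (V\<lparr>carrier := W\<rparr>)"
proof -
  interpret vectorspace class_ring V by fact
  interpret W: vectorspace class_ring "V\<lparr>carrier := W\<rparr>" by (rule sspD(8)[OF W])
  have subm: "submodule class_ring W V" using W by simp
  note Wc = sspD(2)[OF W]
  \<comment> \<open>Independent sets have at most dim V elements, so a maximal one inside W exists;
    maximality makes it span W.\<close>
  have "\<exists>A. finite A \<and> maximal A (\<lambda>S. S \<subseteq> W \<and> lin_indpt S)"
  proof (rule maximal_exists)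
    fix S assume "S \<subseteq> W \<and> lin_indpt S"
    then show "finite S \<and> card S \<le> dim" using li_le_dim[OF fd, of S] Wc by blast
  next
    show "{} \<subseteq> W \<and> lin_indpt {}" unfolding lin_dep_def by blast
  qed
  then obtain A where fA: "finite A" and mA: "maximal A (\<lambda>S. S \<subseteq> W \<and> lin_indpt S)" by (elim exE conjE)
  have "A \<subseteq> W \<and> lin_indpt A" by (rule conjunct1[OF mA[unfolded maximal_def]])
  with fA have A: "finite A" "A \<subseteq> W" "lin_indpt A" by simp_all
  have mx: "B = A" if "A \<subseteq> B" "B \<subseteq> W" "lin_indpt B" for B
    using conjunct2[OF mA[unfolded maximal_def]] that by metis
  have Ac: "A \<subseteq> carrier V" using A Wc by auto
  have spA: "span A = W"
  proof
    show "span A \<subseteq> W" by (rule span_is_subset[OF A(2) subm])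
    show "W \<subseteq> span A"
    proof
      fix w assume w: "w \<in> W"
      show "w \<in> span A"
      proof (rule ccontr)
        assume n: "w \<notin> span A"
        then have "w \<notin> A" using in_own_span[OF Ac] by auto
        then have "lin_indpt (A \<union> {w})"
          using lin_dep_iff_in_span[OF Ac A(3)] w Wc n by auto
        from mx[OF _ _ this] show False using w A \<open>w \<notin> A\<close> by auto
      qed
    qed
  qed
  obtain B where B: "finite B" "basis B" using finite_basis_exists[OF fd] by auto
  have Bc: "B \<subseteq> carrier V" "span B = carrier V" using B by (auto simp: basis_def)
  \<comment> \<open>By exchange \<open>A\<close> is completed to a spanning set with so few vectors
    that, by counting, the result is a basis.\<close>
  obtain C where C: "finite C" "C \<subseteq> carrier V" "C \<inter> A = {}"
      "int (card C) \<le> int (card B) - int (card A)" "span (A \<union> C) = span B"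
    using replacement[OF A(1) B(1) Bc(1) A(3)] Ac Bc(2) by auto
  have basis: "basis (A \<union> C)"
  proof (rule dim_gen_is_basis)
    show "finite (A \<union> C)" "A \<union> C \<subseteq> carrier V" "gen_set (A \<union> C)"
      using A C Ac Bc by auto
    have "card (A \<union> C) = card A + card C" using A C by (intro card_Un_disjoint) auto
    then show "card (A \<union> C) \<le> dim" using C(4) dim_basis[OF B] by simp
  qed
  define r where "r = card A"
  define n where "n = card (A \<union> C)"
  have n: "n = r + card C" unfolding n_def r_def using A C by (intro card_Un_disjoint) auto
  obtain eA where eA: "bij_betw eA {..<r} A"
    using ex_bij_betw_nat_finite[OF A(1)] by (auto simp: r_def atLeast0LessThan)
  obtain eC where eC: "bij_betw eC {..<card C} C"
    using ex_bij_betw_nat_finite[OF C(1)] by (auto simp: atLeast0LessThan)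
  define e where "e i = (if i < r then eA i else eC (i - r))" for i
  have e1: "bij_betw e {..<r} A" using eA by (rule bij_betw_cong[THEN iffD1, rotated]) (simp add: e_def)
  have "bij_betw (\<lambda>i. i - r) {r..<n} {..<card C}"
    by (rule bij_betw_byWitness[where f' = "\<lambda>i. i + r"]) (auto simp: n)
  from bij_betw_trans[OF this eC] have e2: "bij_betw e {r..<n} C"
    by (rule bij_betw_cong[THEN iffD1, rotated]) (simp add: e_def)
  have "bij_betw e ({..<r} \<union> {r..<n}) (A \<union> C)"
    using C(3) by (intro bij_betw_combine e1 e2) auto
  moreover have "{..<r} \<union> {r..<n} = {..<n}" using n by auto
  ultimately have e: "bij_betw e {..<n} (A \<union> C)" by simp
  have ei: "e i \<in> A \<union> C" if "i < n" for i using e that by (auto simp: bij_betw_def)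
  have inj: "e i = e j \<longleftrightarrow> i = j" if "i < n" "j < n" for i j
    using e that by (auto simp: bij_betw_def inj_on_def)
  have fAC: "finite (A \<union> C)" and ACc: "A \<union> C \<subseteq> carrier V" using A C Ac by auto
  have ex1: "\<exists>!a. a \<in> (A \<union> C) \<rightarrow>\<^sub>E UNIV \<and> lincomb a (A \<union> C) = v" if "v \<in> carrier V" for v
    using basis_criterion[OF fAC ACc] basis that by simp
  define cf where "cf v = (THE a. a \<in> (A \<union> C) \<rightarrow>\<^sub>E UNIV \<and> lincomb a (A \<union> C) = v)" for v
  have cf: "cf v \<in> (A \<union> C) \<rightarrow>\<^sub>E UNIV" "lincomb (cf v) (A \<union> C) = v" if "v \<in> carrier V" for v
    using theI'[OF ex1[OF that]] by (auto simp: cf_def)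
  have uniq: "cf v x = a x" if "v \<in> carrier V" "lincomb a (A \<union> C) = v" "x \<in> A \<union> C" for v a x
  proof -
    have "lincomb (restrict a (A \<union> C)) (A \<union> C) = v"
      using that(2) ACc by (subst lincomb_cong[of _ _ _ a]) auto
    then have "cf v = restrict a (A \<union> C)"
      unfolding cf_def by (intro the1_equality[OF ex1[OF that(1)]] conjI) simp_all
    then show ?thesis using that(3) by simp
  qed
  \<comment> \<open>The value 0 from index n on makes \<open>co k\<close> a linear form for every k,
    without a side condition.\<close>
  define co where "co k v = (if k < n then cf v (e k) else 0)" for k v
  have rei: "lincomb a (A \<union> C) = (\<Oplus>\<^bsub>V\<^esub>k\<in>{..<n}. a (e k) \<odot>\<^bsub>V\<^esub> e k)" for a
  proof -
    have "lincomb a (A \<union> C) = (\<Oplus>\<^bsub>V\<^esub>v\<in>e ` {..<n}. a v \<odot>\<^bsub>V\<^esub> v)"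
      using e by (simp add: lincomb_def bij_betw_def)
    also have "\<dots> = (\<Oplus>\<^bsub>V\<^esub>k\<in>{..<n}. a (e k) \<odot>\<^bsub>V\<^esub> e k)"
      using e ei ACc by (intro M.finsum_reindex) (auto simp: bij_betw_def)
    finally show ?thesis .
  qed
  have ec: "e j \<in> carrier V" if "j < n" for j using ei[OF that] ACc by auto
  have expand: "x = (\<Oplus>\<^bsub>V\<^esub>k\<in>{..<n}. co k x \<odot>\<^bsub>V\<^esub> e k)" if x: "x \<in> carrier V" for x
  proof -
    have "x = (\<Oplus>\<^bsub>V\<^esub>k\<in>{..<n}. cf x (e k) \<odot>\<^bsub>V\<^esub> e k)"
      using cf(2)[OF x] rei[of "cf x"] by simp
    also have "\<dots> = (\<Oplus>\<^bsub>V\<^esub>k\<in>{..<n}. co k x \<odot>\<^bsub>V\<^esub> e k)"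
      using ec by (intro M.finsum_cong') (auto simp: co_def)
    finally show ?thesis .
  qed
  have lin: "linear_form V (co k)" for k
    unfolding linear_form_def
  proof (intro conjI ballI allI)
    fix x y assume xy: "x \<in> carrier V" "y \<in> carrier V"
    have "lincomb (\<lambda>v. cf x v + cf y v) (A \<union> C) = lincomb (cf x) (A \<union> C) \<oplus>\<^bsub>V\<^esub> lincomb (cf y) (A \<union> C)"
      using lincomb_sum[OF fAC ACc, of "cf x" "cf y"] by simp
    then show "co k (x \<oplus>\<^bsub>V\<^esub> y) = co k x + co k y"
      using uniq[of "x \<oplus>\<^bsub>V\<^esub> y" "\<lambda>v. cf x v + cf y v"] xy cf ei by (simp add: co_def)
  next
    fix a x assume x: "x \<in> carrier V"
    have "lincomb (\<lambda>v. a * cf x v) (A \<union> C) = a \<odot>\<^bsub>V\<^esub> lincomb (cf x) (A \<union> C)"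
      using lincomb_smult[of "A \<union> C" "cf x" a] fAC ACc by simp
    then show "co k (a \<odot>\<^bsub>V\<^esub> x) = a * co k x"
      using uniq[of "a \<odot>\<^bsub>V\<^esub> x" "\<lambda>v. a * cf x v"] x cf ei by (simp add: co_def)
  qed
  have dual: "co k (e i) = (if k = i then 1 else 0)" if "i < n" "k < n" for i k
  proof -
    have "lincomb (\<lambda>v. if v = e i then 1 else 0) (A \<union> C)
        = (\<Oplus>\<^bsub>V\<^esub>k\<in>{..<n}. if i = k then e k else \<zero>\<^bsub>V\<^esub>)"
      unfolding rei
      by (rule M.finsum_cong') (use inj that ec smult_zero[OF V] smult_one in auto)
    also have "\<dots> = e i"
      by (rule M.finsum_singleton) (use that ec in auto)
    finally show ?thesis
      using uniq[of "e i" "\<lambda>v. if v = e i then 1 else 0" "e k"] that ec ei inj by (auto simp: co_def)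
  qed
  have eW: "e i \<in> W" if "i < r" for i
    using e1 A(2) that by (auto simp: bij_betw_def)
  have mem: "x \<in> W \<longleftrightarrow> (\<forall>k. r \<le> k \<and> k < n \<longrightarrow> co k x = 0)" if x: "x \<in> carrier V" for x
  proof
    assume "x \<in> W"
    then obtain a where a: "lincomb a A = x" using spA finite_in_span[OF A(1) Ac] by auto
    have lx: "lincomb (\<lambda>v. if v \<in> A then a v else 0) (A \<union> C) = x"
    proof -
      have "lincomb (\<lambda>v. if v \<in> A then a v else 0) (A \<union> C)
          = lincomb (\<lambda>v. if v \<in> A then a v else 0) A \<oplus>\<^bsub>V\<^esub> lincomb (\<lambda>v. if v \<in> A then a v else 0) C"
        using A C Ac by (intro lincomb_union) auto
      also have "lincomb (\<lambda>v. if v \<in> A then a v else 0) C = \<zero>\<^bsub>V\<^esub>"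
        unfolding lincomb_def
        by (rule M.add.finprod_one_eqI) (use C smult_zero[OF V] in auto)
      also have "lincomb (\<lambda>v. if v \<in> A then a v else 0) A = lincomb a A"
        using Ac by (intro lincomb_cong) auto
      finally show ?thesis using a x by simp
    qed
    have eA: "e k \<notin> A" if "r \<le> k" "k < n" for k
      using bij_betw_apply[OF e2, of k] C(3) that by auto
    show "\<forall>k. r \<le> k \<and> k < n \<longrightarrow> co k x = 0"
      using uniq[OF x lx ei] eA by (simp add: co_def)
  next
    assume z: "\<forall>k. r \<le> k \<and> k < n \<longrightarrow> co k x = 0"
    have *: "co k x \<odot>\<^bsub>V\<^esub> e k \<in> W" if "k < n" for k
    proof (cases "k < r")
      case True then show ?thesis using eW sspD(5)[OF W] by simp
    next
      case False
      then have "co k x \<odot>\<^bsub>V\<^esub> e k = \<zero>\<^bsub>V\<^esub>" using z that ec by (simp add: smult_zero[OF V])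
      then show ?thesis using sspD(3)[OF W] by simp
    qed
    have "finite F \<Longrightarrow> F \<subseteq> {..<n} \<Longrightarrow> (\<Oplus>\<^bsub>V\<^esub>k\<in>F. co k x \<odot>\<^bsub>V\<^esub> e k) \<in> W" for F
    proof (induction F rule: finite_induct)
      case empty then show ?case using sspD(3)[OF W] by simp
    next
      case (insert k F)
      then have "(\<lambda>k. co k x \<odot>\<^bsub>V\<^esub> e k) \<in> insert k F \<rightarrow> carrier V" using * Wc by auto
      then show ?case using insert * sspD(4)[OF W] by (simp add: Pi_iff)
    qed
    then show "x \<in> W" using expand[OF x] by (metis finite_lessThan order_refl)
  qed
  have d: "vdim V = n" using dim_basis[OF fAC basis] by (simp add: n_def)
  have "W.basis A"
    using span_li_not_depend[OF A(2) subm] A spA by (auto simp: W.basis_def)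
  then have dW: "vdim (V\<lparr>carrier := W\<rparr>) = r" and fW: "fdim (V\<lparr>carrier := W\<rparr>)"
    using W.dim_basis[OF A(1)] A(1) by (auto simp: r_def W.fin_dim_def W.basis_def)
  show ?thesis
    by (rule that[of r n e co, OF _ ec lin dual expand eW mem d dW fW]) (simp_all add: n)
qed

lemma fdim_sub:
  fixes V :: "('k::field, 'v, 'x) module_scheme"
  assumes "fdim V" "ssp W V"
  shows "fdim (V\<lparr>carrier := W\<rparr>)"
  using adapted_basis[OF sspD(1)[OF assms(2)] assms] by metis

lemma vdim_sub_mono:
  fixes V :: "('k::field, 'v, 'x) module_scheme"
  assumes "fdim V" "ssp W V" "ssp U V" "U \<subseteq> W"
  shows "vdim (V\<lparr>carrier := U\<rparr>) \<le> vdim (V\<lparr>carrier := W\<rparr>)"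
    "vdim (V\<lparr>carrier := U\<rparr>) = vdim (V\<lparr>carrier := W\<rparr>) \<Longrightarrow> U = W"
proof -
  have U: "ssp U (V\<lparr>carrier := W\<rparr>)" by (rule ssp_sub[OF assms(2,3,4)])
  obtain r n and co :: "nat \<Rightarrow> 'v \<Rightarrow> 'k" where "r \<le> n" "vdim (V\<lparr>carrier := W\<rparr>) = n"
    "vdim (V\<lparr>carrier := W\<rparr>\<lparr>carrier := U\<rparr>) = r"
    "\<And>x. x \<in> carrier (V\<lparr>carrier := W\<rparr>) \<Longrightarrow> x \<in> U \<longleftrightarrow> (\<forall>k. r \<le> k \<and> k < n \<longrightarrow> co k x = 0)"
    by (rule adapted_basis[OF sspD(8)[OF assms(2)] fdim_sub[OF assms(1,2)] U]) (rule that; assumption)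
  then show "vdim (V\<lparr>carrier := U\<rparr>) \<le> vdim (V\<lparr>carrier := W\<rparr>)"
    "vdim (V\<lparr>carrier := U\<rparr>) = vdim (V\<lparr>carrier := W\<rparr>) \<Longrightarrow> U = W"
    using assms(4) by auto
qed

text \<open>A spanning set is recognised by the subspaces that contain it, which spares the handling
  of linear combinations.\<close>

lemma fdimI:
  fixes V :: "('k::field, 'v, 'x) module_scheme"
  assumes V: "vsp V" and "finite G" "G \<subseteq> carrier V"
    and "\<And>W. ssp W V \<Longrightarrow> G \<subseteq> W \<Longrightarrow> W = carrier V"
  shows "fdim V"
proof -
  interpret vectorspace class_ring V by fact
  show ?thesis unfolding fin_dim_def
    using assms(2,3) assms(4)[OF span_ssp(1,2)[OF V assms(3)]] by auto
qed

lemma linear_mapI: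
  fixes V :: "('k::field, 'v, 'x) module_scheme" and U :: "('k, 'u, 'y) module_scheme"
  assumes "vsp V" "vsp U" "g \<in> lhom V U"
  shows "linear_map class_ring V U g"
  using assms by (simp add: linear_map_def mod_hom_def mod_hom_axioms_def vectorspace_def)

lemma lhomI:
  fixes V :: "('k::field, 'v, 'x) module_scheme" and U :: "('k, 'u, 'y) module_scheme"
  assumes "\<And>x. x \<in> carrier V \<Longrightarrow> g x \<in> carrier U"
    "\<And>x y. x \<in> carrier V \<Longrightarrow> y \<in> carrier V \<Longrightarrow> g (x \<oplus>\<^bsub>V\<^esub> y) = g x \<oplus>\<^bsub>U\<^esub> g y"
    "\<And>a x. x \<in> carrier V \<Longrightarrow> g (a \<odot>\<^bsub>V\<^esub> x) = a \<odot>\<^bsub>U\<^esub> g x"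
  shows "g \<in> lhom V U"
  using assms by (auto simp: LinearCombinations.module_hom_def)

lemma lhomD:
  fixes V :: "('k::field, 'v, 'x) module_scheme" and U :: "('k, 'u, 'y) module_scheme"
  assumes "g \<in> lhom V U"
  shows "x \<in> carrier V \<Longrightarrow> g x \<in> carrier U"
    "x \<in> carrier V \<Longrightarrow> y \<in> carrier V \<Longrightarrow> g (x \<oplus>\<^bsub>V\<^esub> y) = g x \<oplus>\<^bsub>U\<^esub> g y"
    "x \<in> carrier V \<Longrightarrow> g (a \<odot>\<^bsub>V\<^esub> x) = a \<odot>\<^bsub>U\<^esub> g x"
  using assms by (auto simp: LinearCombinations.module_hom_def)

lemma lhom_zero:
  fixes V :: "('k::field, 'v, 'x) module_scheme" and U :: "('k, 'u, 'y) module_scheme"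
  assumes "vsp V" "vsp U" "g \<in> lhom V U"
  shows "g \<zero>\<^bsub>V\<^esub> = \<zero>\<^bsub>U\<^esub>"
    "x \<in> carrier V \<Longrightarrow> y \<in> carrier V \<Longrightarrow> g (x \<ominus>\<^bsub>V\<^esub> y) = g x \<ominus>\<^bsub>U\<^esub> g y"
proof -
  interpret linear_map class_ring V U g by (rule linear_mapI[OF assms])
  show "g \<zero>\<^bsub>V\<^esub> = \<zero>\<^bsub>U\<^esub>" by simp
  show "x \<in> carrier V \<Longrightarrow> y \<in> carrier V \<Longrightarrow> g (x \<ominus>\<^bsub>V\<^esub> y) = g x \<ominus>\<^bsub>U\<^esub> g y" by simp
qed

lemma vdim_surj:
  fixes V :: "('k::field, 'v, 'x) module_scheme" and U :: "('k, 'u, 'y) module_scheme"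
  assumes "vsp V" "vsp U" "g \<in> lhom V U" "g ` carrier V = carrier U" "fdim V"
  shows "vdim V = vdim U + vdim (V\<lparr>carrier := {x \<in> carrier V. g x = \<zero>\<^bsub>U\<^esub>}\<rparr>)" "fdim U"
    "ssp {x \<in> carrier V. g x = \<zero>\<^bsub>U\<^esub>} V"
proof -
  interpret linear_map class_ring V U g by (rule linear_mapI[OF assms(1-3)])
  show "vdim V = vdim U + vdim (V\<lparr>carrier := {x \<in> carrier V. g x = \<zero>\<^bsub>U\<^esub>}\<rparr>)"
    using rank_nullity[OF assms(5)] assms(4) by (simp add: mod_hom.im_def mod_hom.ker_def im_def ker_def)
  show "fdim U" by (rule surj_fin_dim[OF assms(5,4)])
  show "ssp {x \<in> carrier V. g x = \<zero>\<^bsub>U\<^esub>} V" using kerT_is_subspace by (simp add: ker_def)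
qed

lemma vdim_zero:
  fixes V :: "('k::field, 'v, 'x) module_scheme"
  assumes "vsp V"
  shows "vdim (V\<lparr>carrier := {\<zero>\<^bsub>V\<^esub>}\<rparr>) = 0"
proof -
  interpret vectorspace class_ring V by fact
  have s: "ssp {\<zero>\<^bsub>V\<^esub>} V"
    by (rule sspI[OF assms]) (use smult_r_null in auto)
  interpret Z: vectorspace class_ring "V\<lparr>carrier := {\<zero>\<^bsub>V\<^esub>}\<rparr>" by (rule sspD(8)[OF s])
  have "Z.span {\<zero>\<^bsub>V\<^esub>} = {\<zero>\<^bsub>V\<^esub>}"
    using Z.in_own_span[of "{\<zero>\<^bsub>V\<^esub>}"] Z.span_is_subset2[of "{\<zero>\<^bsub>V\<^esub>}"] by auto
  then show ?thesis using Z.dim0I by simp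
qed

lemma vdim_iso:
  fixes V :: "('k::field, 'v, 'x) module_scheme" and U :: "('k, 'u, 'y) module_scheme"
  assumes "vsp V" "vsp U" "g \<in> lhom V U" "bij_betw g (carrier V) (carrier U)" "fdim V"
  shows "vdim V = vdim U"
proof -
  interpret linear_map class_ring V U g by (rule linear_mapI[OF assms(1-3)])
  show ?thesis using dim_eq[OF assms(5)] assms(4) by (auto simp: bij_betw_def)
qed

lemma image_ssp:
  fixes V :: "('k::field, 'v, 'x) module_scheme" and U :: "('k, 'u, 'y) module_scheme"
  assumes "vsp V" "vsp U" "g \<in> lhom V U" "ssp W V"
  shows "ssp (g ` W) U"
proof (rule sspI[OF assms(2)])
  note W = sspD[OF assms(4)] and g = lhomD[OF assms(3)]
  show "g ` W \<subseteq> carrier U" using W g by auto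
  show "\<zero>\<^bsub>U\<^esub> \<in> g ` W" using lhom_zero(1)[OF assms(1-3)] W(3) by (metis imageI)
  fix x y assume "x \<in> g ` W" "y \<in> g ` W"
  then obtain x' y' where "x = g x'" "y = g y'" "x' \<in> W" "y' \<in> W" by auto
  then show "x \<oplus>\<^bsub>U\<^esub> y \<in> g ` W" using g(2)[of x' y'] W by (metis imageI)
next
  note W = sspD[OF assms(4)] and g = lhomD[OF assms(3)]
  fix a x assume "x \<in> g ` W"
  then obtain x' where "x = g x'" "x' \<in> W" by auto
  then show "a \<odot>\<^bsub>U\<^esub> x \<in> g ` W" using g(3)[of x' a] W by (metis imageI)
qed

section \<open>Jacobson's formula\<close>

text \<open>Word functionals are scalar valued, so vectors of a module are reached only through
  linear forms, and this property makes such tests conclusive. Finite-dimensional spaces have it,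
  and coinduced modules inherit it by evaluation at words.\<close>

definition separated :: "('k::field, 'm, 'x) module_scheme \<Rightarrow> bool" where
  "separated M \<longleftrightarrow> (\<forall>v\<in>carrier M. (\<forall>\<mu>. linear_form M \<mu> \<longrightarrow> \<mu> v = 0) \<longrightarrow> v = \<zero>\<^bsub>M\<^esub>)"

lemma separated_eqI:
  fixes M :: "('k::field, 'm, 'x) module_scheme"
  assumes "vsp M" "separated M" "v \<in> carrier M" "w \<in> carrier M" "\<And>\<mu>. linear_form M \<mu> \<Longrightarrow> \<mu> v = \<mu> w"
  shows "v = w"
proof -
  interpret vectorspace class_ring M by fact
  have "\<forall>\<mu>. linear_form M \<mu> \<longrightarrow> \<mu> (v \<ominus>\<^bsub>M\<^esub> w) = 0"
    by (simp add: assms(3-5) linear_form_diff(1)[OF assms(1)])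
  moreover have "v \<ominus>\<^bsub>M\<^esub> w \<in> carrier M" using assms by simp
  ultimately have "v \<ominus>\<^bsub>M\<^esub> w = \<zero>\<^bsub>M\<^esub>" using assms(2) unfolding separated_def by blast
  then show ?thesis using assms(3,4) by simp
qed

lemma fdim_separated:
  fixes V :: "('k::field, 'v, 'x) module_scheme"
  assumes V: "vsp V" and "fdim V"
  shows "separated V"
proof -
  interpret vectorspace class_ring V by fact
  have "ssp (carrier V) V" by (rule sspI[OF V]) auto
  then obtain n e and co :: "nat \<Rightarrow> 'v \<Rightarrow> 'k" where e: "\<And>i. i < n \<Longrightarrow> e i \<in> carrier V" and co: "\<And>k. linear_form V (co k)"
    and ex: "\<And>x. x \<in> carrier V \<Longrightarrow> x = (\<Oplus>\<^bsub>V\<^esub>k\<in>{..<n}. co k x \<odot>\<^bsub>V\<^esub> e k)"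
    by (rule adapted_basis[OF V assms(2)]) (rule that; assumption)
  show ?thesis unfolding separated_def
  proof (intro ballI impI)
    fix v assume v: "v \<in> carrier V" "\<forall>\<mu>. linear_form V \<mu> \<longrightarrow> \<mu> v = 0"
    have "(\<Oplus>\<^bsub>V\<^esub>k\<in>{..<n}. co k v \<odot>\<^bsub>V\<^esub> e k) = \<zero>\<^bsub>V\<^esub>"
    proof (rule M.add.finprod_one_eqI)
      fix k assume "k \<in> {..<n}"
      moreover have "co k v = 0" using v(2) co by blast
      ultimately show "co k v \<odot>\<^bsub>V\<^esub> e k = \<zero>\<^bsub>V\<^esub>" using e smult_zero[OF V] by simp
    qed
    then show "v = \<zero>\<^bsub>V\<^esub>" using ex[OF v(1)] by simp
  qed
qed

context lie_module
begin

lemma linear_form_act: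
  assumes "linear_form M \<mu>" "x \<in> carrier L"
  shows "linear_form M (\<lambda>m. \<mu> (act M x m))"
  using assms act_closed act_add_right act_smult_right linear_formD[OF assms(1)]
  by (auto simp: linear_form_def)

lemma linear_form_act_left:
  assumes "linear_form M \<mu>" "m \<in> carrier M"
  shows "linear_form L (\<lambda>x. \<mu> (act M x m))"
  using assms act_closed act_add_left act_smult_left linear_formD[OF assms(1)]
  by (auto simp: linear_form_def)

lemma linear_form_act_bracket:
  assumes "linear_form M \<mu>" "x \<in> carrier L" "y \<in> carrier L" "m \<in> carrier M"
  shows "\<mu> (act M (bracket L x y) m) = \<mu> (act M x (act M y m)) - \<mu> (act M y (act M x m))"
  using assms by (simp add: act_bracket act_closed linear_form_diff(1)[OF M.vectorspace_axioms])

lemma act_zero_left: "m \<in> carrier M \<Longrightarrow> act M \<zero>\<^bsub>L\<^esub> m = \<zero>\<^bsub>M\<^esub>"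
  using act_smult_left[of "\<zero>\<^bsub>L\<^esub>" m 0] smult_zero[OF L.vectorspace_axioms] smult_zero[OF M.vectorspace_axioms]
    act_closed by simp

lemma act_zero_right: "x \<in> carrier L \<Longrightarrow> act M x \<zero>\<^bsub>M\<^esub> = \<zero>\<^bsub>M\<^esub>"
  using act_smult_right[of x "\<zero>\<^bsub>M\<^esub>" 0] smult_zero[OF M.vectorspace_axioms] act_closed by simp

end

text \<open>\<open>True\<close> stands for x and \<open>False\<close> for y: the sum of these words
  is the coefficient of T^j in (Tx+y)^n for noncommuting x and y.\<close>

definition sign_words :: "nat \<Rightarrow> nat \<Rightarrow> bool list set" where
  "sign_words n j = {w. length w = n \<and> length (filter (\<lambda>b. b) w) = j}"

lemma finite_sign_words: "finite (sign_words n j)"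
  by (rule finite_subset[OF _ finite_lists_length_eq[of "UNIV :: bool set" n]])
    (auto simp: sign_words_def)

text \<open>A bracket is a left minus a right multiplication, so words have to be split off both at
  the front and at the end.\<close>

lemma sign_words_Suc_Cons:
  "sign_words (Suc n) (Suc j) = (Cons True) ` sign_words n j \<union> (Cons False) ` sign_words n (Suc j)"
  "sign_words (Suc n) 0 = (Cons False) ` sign_words n 0"
proof -
  have *: "w \<in> (Cons b) ` A \<longleftrightarrow> (\<exists>v. w = b # v \<and> v \<in> A)" for w b and A :: "bool list set" by auto
  show "sign_words (Suc n) (Suc j) = (Cons True) ` sign_words n j \<union> (Cons False) ` sign_words n (Suc j)"
    "sign_words (Suc n) 0 = (Cons False) ` sign_words n 0"
    by (auto simp: sign_words_def * length_Suc_conv split: if_splits)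
qed

lemma sign_words_Suc_snoc:
  "sign_words (Suc n) (Suc j) = (\<lambda>w. w @ [True]) ` sign_words n j \<union> (\<lambda>w. w @ [False]) ` sign_words n (Suc j)"
  "sign_words (Suc n) 0 = (\<lambda>w. w @ [False]) ` sign_words n 0"
proof -
  have *: "w \<in> (\<lambda>w. w @ [b]) ` A \<longleftrightarrow> (\<exists>v. w = v @ [b] \<and> v \<in> A)" for w b and A :: "bool list set" by auto
  show "sign_words (Suc n) (Suc j) = (\<lambda>w. w @ [True]) ` sign_words n j \<union> (\<lambda>w. w @ [False]) ` sign_words n (Suc j)"
    "sign_words (Suc n) 0 = (\<lambda>w. w @ [False]) ` sign_words n 0"
    by (auto simp: sign_words_def * length_Suc_conv_rev split: if_splits)
qed

lemma sum_sign_words_Cons: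
  fixes f :: "bool list \<Rightarrow> 'a::comm_monoid_add"
  shows "sum f (sign_words (Suc n) (Suc j))
    = (\<Sum>w\<in>sign_words n j. f (True # w)) + (\<Sum>w\<in>sign_words n (Suc j). f (False # w))"
  unfolding sign_words_Suc_Cons
  by (subst sum.union_disjoint) (auto simp: finite_sign_words sum.reindex inj_on_def)

lemma sum_sign_words_snoc:
  fixes f :: "bool list \<Rightarrow> 'a::comm_monoid_add"
  shows "sum f (sign_words (Suc n) (Suc j))
    = (\<Sum>w\<in>sign_words n j. f (w @ [True])) + (\<Sum>w\<in>sign_words n (Suc j). f (w @ [False]))"
  unfolding sign_words_Suc_snoc
  by (subst sum.union_disjoint) (auto simp: finite_sign_words sum.reindex inj_on_def)

text \<open>The coefficient of the word \<open>w\<close> in $(\mathrm{ad}(Tx+y))^n(x)$, with \<open>True\<close> for \<open>x\<close> and \<open>False\<close> for \<open>y\<close>.\<close>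

primrec ad_word :: "nat \<Rightarrow> bool list \<Rightarrow> 'a::comm_ring_1" where
  "ad_word 0 w = (if hd w then 1 else 0)"
| "ad_word (Suc n) w = ad_word n (tl w) - ad_word n (butlast w)"

text \<open>Every term of (ad(Tx+y))^n(x) contains the x it started from. This settles the boundary
  case j = 0 of \<open>act_ad_coeff\<close>.\<close>

lemma ad_word_all_False:
  "length w = Suc n \<Longrightarrow> filter (\<lambda>b. b) w = [] \<Longrightarrow> ad_word n w = 0"
proof (induction n arbitrary: w)
  case 0
  then show ?case by (cases w) auto
next
  case (Suc n)
  have "filter (\<lambda>b. b) (tl w) = []" "filter (\<lambda>b. b) (butlast w) = []"
    using Suc.prems by (cases w; auto simp: filter_empty_conv dest: in_set_butlastD split: if_splits)+
  then show ?case using Suc.IH[of "tl w"] Suc.IH[of "butlast w"] Suc.prems(1) by simp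
qed

text \<open>Peeling letters off both ends of w gives an alternating sum over its positions, a
  position contributing when it carries x. At length p all weights become 1, so occurrences of x are
  counted. Division by i in the definition of s_i then leaves every word with coefficient 1.\<close>

lemma ad_word_char:
  fixes w :: "bool list"
  assumes p: "prime CHAR('a::comm_ring_1)" and w: "length w = CHAR('a)"
  shows "(ad_word (CHAR('a) - 1) w :: 'a) = of_nat (length (filter (\<lambda>b. b) w))"
proof -
  \<comment> \<open>\<open>a\<close> and \<open>b\<close> count the letters removed on the left and
    on the right. The index \<open>b\<close> is determined by the other two and is carried only to
    fit the shape of the recursion.\<close>
  define G :: "nat \<Rightarrow> nat \<Rightarrow> nat \<Rightarrow> 'a" where "G a b m = ad_word m (take (Suc m) (drop a w))" for a b m
  have pos: "CHAR('a) > 0" using p by (simp add: prime_gt_0_nat)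
  have "G 0 0 (CHAR('a) - 1) = (\<Sum>s<CHAR('a). G s (CHAR('a) - 1 - s) 0)"
  proof (rule alternating_differences_char[OF p])
    fix a b m assume ab: "a + b + m < CHAR('a) - 1"
    have "tl (take (Suc (Suc m)) (drop a w)) = take (Suc m) (drop (Suc a) w)"
      by (metis tl_take diff_Suc_1 tl_drop drop_Suc)
    moreover have "butlast (take (Suc (Suc m)) (drop a w)) = take (Suc m) (drop a w)"
      using ab w by (simp add: butlast_take)
    ultimately show "G a b (Suc m) = G (Suc a) b m - G a (Suc b) m" by (simp add: G_def)
  qed
  moreover have "G 0 0 (CHAR('a) - 1) = ad_word (CHAR('a) - 1) w" using w pos by (simp add: G_def)
  moreover have "(\<Sum>s<CHAR('a). G s (CHAR('a) - 1 - s) 0) = (\<Sum>s<length w. if w ! s then 1 else 0)"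
    unfolding w by (rule sum.cong) (use w in \<open>auto simp: G_def hd_drop_conv_nth hd_take\<close>)
  moreover have "(\<Sum>s<length w. if w ! s then 1 else (0::'a)) = of_nat (length (filter (\<lambda>b. b) w))"
    by (simp add: length_filter_conv_card sum.If_cases Int_def)
  ultimately show ?thesis by simp
qed

context
  fixes L :: "('k::field, 'l, 'x) restricted_lie_algebra_scheme" and M :: "('k, 'l, 'm, 'y) lie_module_scheme"
    and x y :: 'l
  assumes RL: "restricted_lie_algebra L" and LM: "lie_module L M" and x: "x \<in> carrier L" and y: "y \<in> carrier L"
begin

interpretation restricted_lie_algebra L by (fact RL)
interpretation lie_module L M by (fact LM)

abbreviation wact :: "bool list \<Rightarrow> 'm \<Rightarrow> 'm" where
  "wact w m \<equiv> foldr (\<lambda>b. act M (if b then x else y)) w m"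

lemma ad_coeff_closed: "ad_coeff L x y n j \<in> carrier L"
  by (induction n arbitrary: j) (auto simp: x y bracket_closed)

text \<open>Form and vector vary in the induction: of the two halves of a bracket, multiplication on
  the left is absorbed into \<open>\<mu>\<close> and multiplication on the right into
  \<open>m\<close>.\<close>

lemma act_ad_coeff:
  assumes "linear_form M \<mu>" "m \<in> carrier M"
  shows "\<mu> (act M (ad_coeff L x y n j) m) = (\<Sum>w\<in>sign_words (Suc n) (Suc j). ad_word n w * \<mu> (wact w m))"
  using assms
proof (induction n arbitrary: j m \<mu>)
  case 0
  show ?case
  proof (cases j)
    case 0
    have "sign_words (Suc 0) (Suc 0) = {[True]}" by (auto simp: sign_words_def length_Suc_conv split: if_splits)
    then show ?thesis using 0 by simp
  next
    case (Suc j')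
    have "sign_words (Suc 0) (Suc (Suc j')) = {}" by (auto simp: sign_words_def length_Suc_conv split: if_splits)
    then show ?thesis using Suc 0 linear_form_zero[OF M.vectorspace_axioms 0(1)] by (simp add: act_zero_left)
  qed
next
  case (Suc n)
  let ?A = "ad_coeff L x y n" and ?W = "\<lambda>j. sign_words (Suc n) j"
  note mu = Suc.prems(1) and m = Suc.prems(2)
  have lx: "linear_form M (\<lambda>v. \<mu> (act M x v))" and ly: "linear_form M (\<lambda>v. \<mu> (act M y v))"
    using mu x y by (auto intro: linear_form_act)
  have xm: "act M x m \<in> carrier M" and ym: "act M y m \<in> carrier M" using x y m by (auto intro: act_closed)
  have Y: "\<mu> (act M (bracket L y (?A j)) m)
     = (\<Sum>w\<in>?W (Suc j). ad_word n w * \<mu> (wact (False # w) m)) - (\<Sum>w\<in>?W (Suc j). ad_word n w * \<mu> (wact (w @ [False]) m))"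
    using Suc.IH[OF ly m, of j] Suc.IH[OF mu ym, of j] mu m y
    by (simp add: linear_form_act_bracket ad_coeff_closed)
  have X: "\<mu> (act M (if j = 0 then \<zero>\<^bsub>L\<^esub> else bracket L x (?A (j - 1))) m)
     = (\<Sum>w\<in>?W j. ad_word n w * \<mu> (wact (True # w) m)) - (\<Sum>w\<in>?W j. ad_word n w * \<mu> (wact (w @ [True]) m))"
  proof (cases j)
    case 0
    have "ad_word n w = (0::'k)" if "w \<in> ?W 0" for w
      using that by (intro ad_word_all_False) (auto simp: sign_words_def)
    then show ?thesis using 0 m linear_form_zero[OF M.vectorspace_axioms mu] by (simp add: act_zero_left)
  next
    case (Suc j')
    then show ?thesis
      using Suc.IH[OF lx m, of j'] Suc.IH[OF mu xm, of j'] mu m x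
      by (simp add: linear_form_act_bracket ad_coeff_closed)
  qed
  have "\<mu> (act M (ad_coeff L x y (Suc n) j) m)
      = \<mu> (act M (if j = 0 then \<zero>\<^bsub>L\<^esub> else bracket L x (?A (j - 1))) m) + \<mu> (act M (bracket L y (?A j)) m)"
    using mu m x y
    by (simp add: act_add_left act_closed bracket_closed ad_coeff_closed linear_formD(1)[OF mu])
  also have "\<dots> = (\<Sum>w\<in>sign_words (Suc (Suc n)) (Suc j). ad_word n (tl w) * \<mu> (wact w m))
      - (\<Sum>w\<in>sign_words (Suc (Suc n)) (Suc j). ad_word n (butlast w) * \<mu> (wact w m))"
    unfolding X Y sum_sign_words_Cons[of "\<lambda>w. ad_word n (tl w) * \<mu> (wact w m)"]
      sum_sign_words_snoc[of "\<lambda>w. ad_word n (butlast w) * \<mu> (wact w m)"] by simp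
  finally show ?case by (simp add: left_diff_distrib sum_subtractf)
qed

lemma act_add_power:
  assumes "linear_form M \<mu>" "m \<in> carrier M"
  shows "\<mu> ((act M (x \<oplus>\<^bsub>L\<^esub> y) ^^ n) m) = (\<Sum>j\<le>n. \<Sum>w\<in>sign_words n j. \<mu> (wact w m))"
  using assms
proof (induction n arbitrary: \<mu>)
  case 0
  have "sign_words 0 0 = {[]}" by (auto simp: sign_words_def)
  then show ?case by simp
next
  case (Suc n)
  let ?s = "x \<oplus>\<^bsub>L\<^esub> y" and ?v = "(act M (x \<oplus>\<^bsub>L\<^esub> y) ^^ n) m"
  note mu = Suc.prems(1) and m = Suc.prems(2)
  have v: "?v \<in> carrier M"
    using m x y by (induction n) (auto simp: act_closed)
  have e: "sign_words n (Suc n) = {}" by (auto simp: sign_words_def dest: arg_cong[of _ _ "\<lambda>a. a \<le> n"])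
  have "\<mu> ((act M ?s ^^ Suc n) m) = \<mu> (act M x ?v) + \<mu> (act M y ?v)"
    using v x y by (simp add: act_add_left act_closed linear_formD(1)[OF mu])
  also have "\<dots> = (\<Sum>j\<le>n. \<Sum>w\<in>sign_words n j. \<mu> (wact (True # w) m))
      + (\<Sum>j\<le>n. \<Sum>w\<in>sign_words n j. \<mu> (wact (False # w) m))"
    using Suc.IH[OF linear_form_act[OF mu x] m] Suc.IH[OF linear_form_act[OF mu y] m] by simp
  also have "(\<Sum>j\<le>n. \<Sum>w\<in>sign_words n j. \<mu> (wact (False # w) m))
      = (\<Sum>j\<le>Suc n. \<Sum>w\<in>sign_words n j. \<mu> (wact (False # w) m))" by (simp add: e)
  also have "\<dots> = (\<Sum>w\<in>sign_words n 0. \<mu> (wact (False # w) m))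
      + (\<Sum>j\<le>n. \<Sum>w\<in>sign_words n (Suc j). \<mu> (wact (False # w) m))" by (rule sum.atMost_Suc_shift)
  also have "(\<Sum>w\<in>sign_words n 0. \<mu> (wact (False # w) m)) = (\<Sum>w\<in>sign_words (Suc n) 0. \<mu> (wact w m))"
    unfolding sign_words_Suc_Cons(2) by (simp add: sum.reindex)
  also have "(\<Sum>j\<le>n. \<Sum>w\<in>sign_words n j. \<mu> (wact (True # w) m))
      + ((\<Sum>w\<in>sign_words (Suc n) 0. \<mu> (wact w m)) + (\<Sum>j\<le>n. \<Sum>w\<in>sign_words n (Suc j). \<mu> (wact (False # w) m)))
      = (\<Sum>w\<in>sign_words (Suc n) 0. \<mu> (wact w m)) + (\<Sum>j\<le>n. \<Sum>w\<in>sign_words (Suc n) (Suc j). \<mu> (wact w m))"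
    by (simp only: sum_sign_words_Cons sum.distrib add_ac)
  also have "\<dots> = (\<Sum>j\<le>Suc n. \<Sum>w\<in>sign_words (Suc n) j. \<mu> (wact w m))" by (rule sum.atMost_Suc_shift[symmetric])
  finally show ?case .
qed

lemma wact_replicate: "wact (replicate n b) m = (act M (if b then x else y) ^^ n) m"
  by (induction n) auto

text \<open>Jacobson's formula $(x+y)^p = x^p + y^p + \sum_{i=1}^{p-1} s_i(x,y)$, tested on linear forms.\<close>

lemma jacobson_formula:
  assumes mu: "linear_form M \<mu>" and m: "m \<in> carrier M"
  shows "\<mu> ((act M (x \<oplus>\<^bsub>L\<^esub> y) ^^ CHAR('k)) m)
     = \<mu> ((act M x ^^ CHAR('k)) m) + \<mu> ((act M y ^^ CHAR('k)) m)
       + \<mu> (act M (\<Oplus>\<^bsub>L\<^esub>i\<in>{1..<CHAR('k)}. jacobson_s L i x y) m)"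
proof -
  let ?p = "CHAR('k)" and ?S = "\<lambda>j. \<Sum>w\<in>sign_words CHAR('k) j. \<mu> (wact w m)"
  have p: "?p > 0" using char_prime by (simp add: prime_gt_0_nat)
  have jcl: "jacobson_s L i x y \<in> carrier L" for i by (simp add: jacobson_s_def ad_coeff_closed)
  have s: "\<mu> (act M (jacobson_s L i x y) m) = ?S i" if i: "1 \<le> i" "i < ?p" for i
  proof -
    have "\<mu> (act M (ad_coeff L x y (?p - 1) (i - 1)) m) = (\<Sum>w\<in>sign_words ?p i. ad_word (?p - 1) w * \<mu> (wact w m))"
      using act_ad_coeff[OF mu m, of "?p - 1" "i - 1"] p i by simp
    also have "\<dots> = (\<Sum>w\<in>sign_words ?p i. of_nat i * \<mu> (wact w m))"
    proof (rule sum.cong[OF refl])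
      fix w assume "w \<in> sign_words ?p i"
      then have "(ad_word (?p - 1) w :: 'k) = of_nat i"
        using ad_word_char[OF char_prime, of w] by (simp add: sign_words_def)
      then show "ad_word (?p - 1) w * \<mu> (wact w m) = of_nat i * \<mu> (wact w m)" by simp
    qed
    finally have "\<mu> (act M (ad_coeff L x y (?p - 1) (i - 1)) m) = of_nat i * ?S i"
      by (simp add: sum_distrib_left)
    \<comment> \<open>i is invertible for 0 < i < p, so the factor i from
      \<open>ad_word_char\<close> cancels the inverse in s_i.\<close>
    moreover have "(of_nat i :: 'k) \<noteq> 0"
      using i by (auto simp: of_nat_eq_0_iff_char_dvd dest: dvd_imp_le)
    ultimately show ?thesis
      using m by (simp add: jacobson_s_def act_smult_left act_closed ad_coeff_closed linear_formD(2)[OF mu])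
  qed
  have "\<mu> (act M (\<Oplus>\<^bsub>L\<^esub>i\<in>{1..<?p}. jacobson_s L i x y) m) = (\<Sum>i\<in>{1..<?p}. ?S i)"
    using linear_form_finsum[OF vectorspace_axioms linear_form_act_left[OF mu m], of "{1..<?p}" "\<lambda>i. jacobson_s L i x y"] s jcl
    by simp
  moreover have "?S 0 = \<mu> ((act M y ^^ ?p) m)"
  proof -
    have "sign_words ?p 0 = {replicate ?p False}"
    proof (intro equalityI subsetI)
      fix w assume "w \<in> sign_words ?p 0"
      then have "length w = ?p" "\<forall>b\<in>set w. b = False" by (auto simp: sign_words_def filter_empty_conv)
      then show "w \<in> {replicate ?p False}" using replicate_length_same[of w False] by simp
    qed (simp add: sign_words_def)
    then show ?thesis by (simp add: wact_replicate)
  qed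
  moreover have "?S ?p = \<mu> ((act M x ^^ ?p) m)"
  proof -
    have "sign_words ?p ?p = {replicate ?p True}"
    proof (intro equalityI subsetI)
      fix w assume "w \<in> sign_words ?p ?p"
      then have w: "length w = ?p" "length (filter (\<lambda>b. b) w) = length w" by (auto simp: sign_words_def)
      have "\<forall>b\<in>set w. b = True" using length_filter_less[of _ w "\<lambda>b. b"] w(2) by fastforce
      then show "w \<in> {replicate ?p True}" using replicate_length_same[of w True] w by simp
    qed (simp add: sign_words_def)
    then show ?thesis by (simp add: wact_replicate)
  qed
  moreover have "(\<Sum>j\<le>?p. ?S j) = ?S 0 + (\<Sum>i\<in>{1..<?p}. ?S i) + ?S ?p"
  proof -
    have "{..?p} = insert 0 (insert ?p {1..<?p})" using p by auto
    then show ?thesis using p by simp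
  qed
  ultimately show ?thesis using act_add_power[OF mu m, of ?p] by simp
qed

end

lemma p_character_eq_iff:
  assumes "lie_module L M" "restricted_lie_algebra L" "x \<in> carrier L" "m \<in> carrier M"
  shows "(act M x ^^ CHAR('k::field)) m \<ominus>\<^bsub>M\<^esub> act M (pmap L x) m = \<chi> x ^ CHAR('k) \<odot>\<^bsub>M\<^esub> m
     \<longleftrightarrow> (act M x ^^ CHAR('k)) m = act M (pmap L x) m \<oplus>\<^bsub>M\<^esub> \<chi> x ^ CHAR('k) \<odot>\<^bsub>M\<^esub> m"
proof -
  interpret restricted_lie_algebra L by fact
  interpret lie_module L M by fact
  have "(act M x ^^ k) m \<in> carrier M" for k by (induction k) (auto simp: assms act_closed)
  moreover have "act M (pmap L x) m \<in> carrier M" using assms by (simp add: act_closed pmap_closed)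
  moreover have "\<chi> x ^ CHAR('k) \<odot>\<^bsub>M\<^esub> m \<in> carrier M" using assms by simp
  moreover have "a \<ominus>\<^bsub>M\<^esub> b = c \<longleftrightarrow> a = b \<oplus>\<^bsub>M\<^esub> c"
    if "a \<in> carrier M" "b \<in> carrier M" "c \<in> carrier M" for a b c
    using that by (metis M.M.a_comm M.M.minus_eq M.M.r_neg2 M.M.a_inv_closed M.M.r_neg1)
  ultimately show ?thesis by blast
qed

text \<open>The power (x+y)^p in the action and the p-map of x+y have the same correction terms
  s_i(x,y), and the scalars add by (a+b)^p = a^p + b^p. With the case of multiples this makes the
  p-character equation define a subspace of L.\<close>

lemma p_character_add:
  fixes L :: "('k::field, 'l, 'x) restricted_lie_algebra_scheme" and M :: "('k, 'l, 'm, 'y) lie_module_scheme"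
  assumes RL: "restricted_lie_algebra L" and LM: "lie_module L M" and sep: "separated M" and chi: "linear_form L \<chi>"
    and x: "x \<in> carrier L" "\<And>m. m \<in> carrier M \<Longrightarrow> (act M x ^^ CHAR('k)) m = act M (pmap L x) m \<oplus>\<^bsub>M\<^esub> \<chi> x ^ CHAR('k) \<odot>\<^bsub>M\<^esub> m"
    and y: "y \<in> carrier L" "\<And>m. m \<in> carrier M \<Longrightarrow> (act M y ^^ CHAR('k)) m = act M (pmap L y) m \<oplus>\<^bsub>M\<^esub> \<chi> y ^ CHAR('k) \<odot>\<^bsub>M\<^esub> m"
    and m: "m \<in> carrier M"
  shows "(act M (x \<oplus>\<^bsub>L\<^esub> y) ^^ CHAR('k)) m
    = act M (pmap L (x \<oplus>\<^bsub>L\<^esub> y)) m \<oplus>\<^bsub>M\<^esub> \<chi> (x \<oplus>\<^bsub>L\<^esub> y) ^ CHAR('k) \<odot>\<^bsub>M\<^esub> m"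
proof (rule separated_eqI)
  interpret R: restricted_lie_algebra L by fact
  interpret lie_module L M by fact
  show "vsp M" by (rule M.vectorspace_axioms)
  show "separated M" by fact
  have s: "x \<oplus>\<^bsub>L\<^esub> y \<in> carrier L" using x y by simp
  have pow: "(act M z ^^ k) m \<in> carrier M" if "z \<in> carrier L" for z k
    by (induction k) (auto simp: that m act_closed)
  show "(act M (x \<oplus>\<^bsub>L\<^esub> y) ^^ CHAR('k)) m \<in> carrier M" by (rule pow[OF s])
  show "act M (pmap L (x \<oplus>\<^bsub>L\<^esub> y)) m \<oplus>\<^bsub>M\<^esub> \<chi> (x \<oplus>\<^bsub>L\<^esub> y) ^ CHAR('k) \<odot>\<^bsub>M\<^esub> m \<in> carrier M"
    using s m by (simp add: act_closed R.pmap_closed)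
  fix \<mu> assume mu: "linear_form M \<mu>"
  let ?J = "\<Oplus>\<^bsub>L\<^esub>i\<in>{1..<CHAR('k)}. jacobson_s L i x y"
  have jcl: "jacobson_s L i x y \<in> carrier L" for i
    using ad_coeff_closed[OF RL LM x(1) y(1)] by (simp add: jacobson_s_def)
  then have J: "?J \<in> carrier L" by (intro R.M.finsum_closed) auto
  have sm: "a \<odot>\<^bsub>M\<^esub> m \<in> carrier M" for a using m by simp
  have chis: "\<chi> (x \<oplus>\<^bsub>L\<^esub> y) ^ CHAR('k) = \<chi> x ^ CHAR('k) + \<chi> y ^ CHAR('k)"
    using linear_formD(1)[OF chi x(1) y(1)] freshmans_dream[OF R.char_prime refl] by simp
  have "\<mu> (act M (pmap L (x \<oplus>\<^bsub>L\<^esub> y)) m \<oplus>\<^bsub>M\<^esub> \<chi> (x \<oplus>\<^bsub>L\<^esub> y) ^ CHAR('k) \<odot>\<^bsub>M\<^esub> m)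
      = \<mu> (act M (pmap L x) m) + \<mu> (act M (pmap L y) m) + \<mu> (act M ?J m)
        + (\<chi> x ^ CHAR('k) * \<mu> m + \<chi> y ^ CHAR('k) * \<mu> m)"
    using x(1) y(1) m J sm s
    by (simp add: R.pmap_add act_add_left act_closed R.pmap_closed linear_formD[OF mu] chis ring_distribs)
  also have "\<dots> = \<mu> ((act M x ^^ CHAR('k)) m) + \<mu> ((act M y ^^ CHAR('k)) m) + \<mu> (act M ?J m)"
    using x y m sm by (simp add: act_closed R.pmap_closed linear_formD[OF mu])
  also have "\<dots> = \<mu> ((act M (x \<oplus>\<^bsub>L\<^esub> y) ^^ CHAR('k)) m)"
    using jacobson_formula[OF RL LM x(1) y(1) mu m] by simp
  finally show "\<mu> ((act M (x \<oplus>\<^bsub>L\<^esub> y) ^^ CHAR('k)) m)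
      = \<mu> (act M (pmap L (x \<oplus>\<^bsub>L\<^esub> y)) m \<oplus>\<^bsub>M\<^esub> \<chi> (x \<oplus>\<^bsub>L\<^esub> y) ^ CHAR('k) \<odot>\<^bsub>M\<^esub> m)" by simp
qed

lemma p_character_smult:
  fixes L :: "('k::field, 'l, 'x) restricted_lie_algebra_scheme" and M :: "('k, 'l, 'm, 'y) lie_module_scheme"
  assumes RL: "restricted_lie_algebra L" and LM: "lie_module L M" and chi: "linear_form L \<chi>"
    and x: "x \<in> carrier L" "\<And>m. m \<in> carrier M \<Longrightarrow> (act M x ^^ CHAR('k)) m = act M (pmap L x) m \<oplus>\<^bsub>M\<^esub> \<chi> x ^ CHAR('k) \<odot>\<^bsub>M\<^esub> m"
    and m: "m \<in> carrier M"
  shows "(act M (a \<odot>\<^bsub>L\<^esub> x) ^^ CHAR('k)) m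
    = act M (pmap L (a \<odot>\<^bsub>L\<^esub> x)) m \<oplus>\<^bsub>M\<^esub> \<chi> (a \<odot>\<^bsub>L\<^esub> x) ^ CHAR('k) \<odot>\<^bsub>M\<^esub> m"
proof -
  interpret R: restricted_lie_algebra L by fact
  interpret lie_module L M by fact
  have cl: "(act M x ^^ k) m \<in> carrier M" for k by (induction k) (auto simp: x m act_closed)
  have ass: "a \<odot>\<^bsub>M\<^esub> (b \<odot>\<^bsub>M\<^esub> v) = (a * b) \<odot>\<^bsub>M\<^esub> v" if "v \<in> carrier M" for a b v
    using M.smult_assoc1[of a b v] that by simp
  have "(act M (a \<odot>\<^bsub>L\<^esub> x) ^^ k) m = a ^ k \<odot>\<^bsub>M\<^esub> (act M x ^^ k) m" for k
  proof (induction k)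
    case 0
    then show ?case using M.smult_one[OF m] by simp
  next
    case (Suc k)
    then show ?case using cl[of k] x(1)
      by (simp add: act_smult_left act_smult_right act_closed ass mult.commute)
  qed
  also have "a ^ CHAR('k) \<odot>\<^bsub>M\<^esub> (act M x ^^ CHAR('k)) m
      = a ^ CHAR('k) \<odot>\<^bsub>M\<^esub> act M (pmap L x) m \<oplus>\<^bsub>M\<^esub> a ^ CHAR('k) \<odot>\<^bsub>M\<^esub> (\<chi> x ^ CHAR('k) \<odot>\<^bsub>M\<^esub> m)"
    using x m M.smult_r_distr[of "a ^ CHAR('k)"] by (simp add: act_closed R.pmap_closed)
  also have "\<dots> = act M (pmap L (a \<odot>\<^bsub>L\<^esub> x)) m \<oplus>\<^bsub>M\<^esub> \<chi> (a \<odot>\<^bsub>L\<^esub> x) ^ CHAR('k) \<odot>\<^bsub>M\<^esub> m"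
    using x m linear_formD(2)[OF chi x(1)]
    by (simp add: R.pmap_smult act_smult_left R.pmap_closed ass power_mult_distrib)
  finally show ?thesis .
qed

section \<open>Words acting on modules\<close>

abbreviation word_act :: "('k, 'l, 'm, 'y) lie_module_scheme \<Rightarrow> (nat \<Rightarrow> 'l) \<Rightarrow> nat list \<Rightarrow> 'm \<Rightarrow> 'm" where
  "word_act M e w m \<equiv> foldr (\<lambda>i. act M (e i)) w m"

context lie_basis
begin

text \<open>A linear form on u(L,chi), recorded by its values on words in the basis letters. Value 0
  at words with foreign letters is a convention that makes it determined by its values at the normal
  words in the letters below n.\<close>

definition word_functional :: "(nat list \<Rightarrow> 'k) \<Rightarrow> bool" where
  "word_functional \<Phi> \<longleftrightarrow> (\<forall>w. \<not> set w \<subseteq> {..<n} \<longrightarrow> \<Phi> w = 0) \<and>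
     (\<forall>u l r v. (l, r) \<in> rules \<longrightarrow> \<Phi> (u @ l @ v) = rhs_val r u v \<Phi>)"

lemma word_functional_below: "word_functional \<Phi> \<Longrightarrow> rel_below w \<Phi>"
  unfolding word_functional_def rel_below_def by blast

lemma word_functional_commute:
  assumes "word_functional \<Phi>" "i < n" "x \<in> carrier L"
  shows "ins \<Phi> u x (i # v) = ins \<Phi> (u @ [i]) x v + ins \<Phi> u (bracket L x (e i)) v"
  \<comment> \<open>All relations hold, so any word longer than those involved can play the
    bound.\<close>
  by (rule below_commute[OF word_functional_below[OF assms(1), of "replicate (length u + length v + 3) 0"]])
    (use assms in auto)

lemma word_functional_power:
  assumes "word_functional \<Phi>" "i < n"
  shows "\<Phi> (u @ replicate p i @ v) = \<chi> (e i) ^ p * \<Phi> (u @ v) + ins \<Phi> u (pmap L (e i)) v"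
  by (rule below_power[OF word_functional_below[OF assms(1), of "replicate (Suc (length (u @ replicate p i @ v))) 0"]])
    (use assms in \<open>auto intro: word_order_shorter\<close>)

text \<open>Rules contain only letters below n, so a foreign letter sits in the context and kills
  both sides of a relation alike.\<close>

lemma word_functional_truncate:
  assumes "\<And>u l r v. (l, r) \<in> rules \<Longrightarrow> set u \<subseteq> {..<n} \<Longrightarrow> set v \<subseteq> {..<n}
    \<Longrightarrow> \<Phi> (u @ l @ v) = rhs_val r u v \<Phi>"
  shows "word_functional (\<lambda>w. if set w \<subseteq> {..<n} then \<Phi> w else 0)"
  unfolding word_functional_def
proof (intro conjI allI impI)
  let ?\<Phi> = "\<lambda>w. if set w \<subseteq> {..<n} then \<Phi> w else 0"
  show "\<not> set w \<subseteq> {..<n} \<Longrightarrow> ?\<Phi> w = 0" for w by simp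
  fix u l r v assume lr: "(l, r) \<in> rules"
  then have l: "set l \<subseteq> {..<n}" by (cases rule: rulesE) auto
  have z: "set z \<subseteq> {..<n}" if "(a, z) \<in> set r" for a z
    using lr that by (cases rule: rulesE) (auto simp: swap_rhs_def power_rhs_def)
  show "?\<Phi> (u @ l @ v) = rhs_val r u v ?\<Phi>"
  proof (cases "set u \<subseteq> {..<n} \<and> set v \<subseteq> {..<n}")
    case True
    have "rhs_val r u v ?\<Phi> = rhs_val r u v \<Phi>"
      unfolding rhs_val_def by (intro arg_cong[of _ _ sum_list] map_cong refl) (use True z in auto)
    then show ?thesis using assms[OF lr, of u v] True l by simp
  next
    case False
    have "rhs_val r u v ?\<Phi> = (\<Sum>_\<leftarrow>r. 0)"
    proof -
      have "a * ?\<Phi> (u @ z @ v) = 0" for a z using False by auto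
      then show ?thesis
        unfolding rhs_val_def by (intro arg_cong[of _ _ sum_list] map_cong refl) (simp only: case_prod_unfold)
    qed
    moreover have "?\<Phi> (u @ l @ v) = 0" using False by auto
    ultimately show ?thesis by simp
  qed
qed

text \<open>The uniqueness half of the diamond lemma: rewriting expresses every value by values at
  normal words.\<close>

lemma word_functional_eqI:
  assumes "word_functional \<Phi>" "word_functional \<Psi>"
    and "\<And>w. normal_word w \<Longrightarrow> set w \<subseteq> {..<n} \<Longrightarrow> \<Phi> w = \<Psi> w"
  shows "\<Phi> w = \<Psi> w"
proof (induction w rule: wf_induct_rule[OF wf_lenlex[OF wf_less_than]])
  case (1 w)
  show ?case
  proof (cases "normal_word w \<or> \<not> set w \<subseteq> {..<n}")
    case True
    then show ?thesis using assms unfolding word_functional_def by metis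
  next
    case False
    then obtain u l r v where w: "w = u @ l @ v" "(l, r) \<in> rules" unfolding normal_word_def by blast
    have "rhs_val r u v \<Phi> = rhs_val r u v \<Psi>"
      unfolding rhs_val_def
      using 1 word_order_context[OF rule_decreasing[OF w(2)], of _ _ u v]
      by (intro arg_cong[of _ _ sum_list] map_cong refl) (auto simp: w(1))
    then show ?thesis using assms(1,2) w unfolding word_functional_def by metis
  qed
qed

lemma normal_word_sublist:
  assumes "normal_word (a @ b @ c)"
  shows "normal_word b"
  unfolding normal_word_def
proof
  assume "\<exists>u l r v. b = u @ l @ v \<and> (l, r) \<in> rules"
  then obtain u l r v where "b = u @ l @ v" "(l, r) \<in> rules" by blast
  then have "a @ b @ c = (a @ u) @ l @ (v @ c)" "(l, r) \<in> rules" by auto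
  then show False using assms unfolding normal_word_def by blast
qed

lemma normal_word_sorted:
  assumes "normal_word w" "set w \<subseteq> {..<n}"
  shows "sorted w"
  using assms
proof (induction w)
  case (Cons j w)
  have s: "sorted w"
    using Cons.IH normal_word_sublist[of "[j]" w "[]"] Cons.prems by simp
  show ?case
  proof (cases w)
    case (Cons i w')
    have "\<not> i < j"
    proof
      assume "i < j"
      then have "([j, i], swap_rhs j i) \<in> rules" using Cons.prems unfolding rules_def by auto
      moreover have "j # w = [] @ [j, i] @ w'" using Cons by simp
      ultimately show False using \<open>normal_word (j # w)\<close> unfolding normal_word_def by blast
    qed
    then show ?thesis using s Cons by auto
  qed simp
qed simp

text \<open>A normal word is sorted: a block of the smallest letter followed by larger letters, and
  a block longer than p would contain a power word. This crude bound already makes the set of normal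
  words finite.\<close>

lemma normal_word_length:
  assumes "normal_word w" "set w \<subseteq> {s..<n}"
  shows "length w \<le> (n - s) * p"
  using assms
proof (induction "n - s" arbitrary: s w)
  case 0
  then show ?case by (cases w) auto
next
  case (Suc d)
  let ?a = "takeWhile (\<lambda>i. i = s) w" and ?b = "dropWhile (\<lambda>i. i = s) w"
  have sn: "s < n" using Suc.hyps by simp
  have srt: "sorted w" using Suc.prems by (intro normal_word_sorted) auto
  have na: "normal_word ?b" using normal_word_sublist[of ?a ?b "[]"] Suc.prems(1) by simp
  have "s < i" if "i \<in> set ?b" for i
  proof -
    have b: "?b \<noteq> []" using that by (metis empty_iff list.set(1))
    then have "hd ?b \<noteq> s" using hd_dropWhile[OF b] by simp
    moreover have "hd ?b \<in> set w" using b set_dropWhileD hd_in_set by metis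
    ultimately have "s < hd ?b" using Suc.prems(2) by fastforce
    moreover have "hd ?b \<le> i"
      using sorted_dropWhile[OF srt, of "\<lambda>i. i = s"] that b by (cases ?b) auto
    ultimately show ?thesis by simp
  qed
  then have "set ?b \<subseteq> {Suc s..<n}" using Suc.prems(2) set_dropWhileD by fastforce
  then have lb: "length ?b \<le> (n - Suc s) * p" using Suc.hyps(1)[of "Suc s" ?b] Suc.hyps(2) na by simp
  have ra: "?a = replicate (length ?a) s"
    by (rule replicate_length_same[symmetric]) (auto dest: set_takeWhileD)
  have la: "length ?a \<le> p"
  proof (rule ccontr)
    assume "\<not> length ?a \<le> p"
    then obtain q where q: "length ?a = p + q" by (metis nat_le_linear le_Suc_ex)
    then have "w = [] @ replicate p s @ (replicate q s @ ?b)"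
      using ra by (metis append.assoc append_Nil replicate_add takeWhile_dropWhile_id)
    moreover have "(replicate p s, power_rhs s) \<in> rules" using sn unfolding rules_def by blast
    ultimately show False using Suc.prems(1) unfolding normal_word_def by blast
  qed
  have "length w = length ?a + length ?b" by (metis length_append takeWhile_dropWhile_id)
  also have "\<dots> \<le> p + (n - Suc s) * p" using la lb by simp
  also have "\<dots> = (n - s) * p" using sn by (metis Suc_diff_Suc mult_Suc)
  finally show ?case .
qed

lemma finite_normal_words: "finite {w. normal_word w \<and> set w \<subseteq> {..<n}}"
  by (rule finite_subset[OF _ finite_lists_length_le[of "{..<n}" "n * p"]])
    (use normal_word_length[of _ 0] in \<open>auto simp: atLeast0LessThan\<close>)

lemma subspace_eq_carrier:
  assumes W: "ssp W L" and e: "\<And>k. k < n \<Longrightarrow> e k \<in> W" and x: "x \<in> carrier L"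
  shows "x \<in> W"
proof -
  have "F \<subseteq> {..<n} \<Longrightarrow> (\<Oplus>k\<in>F. co k x \<odot> e k) \<in> W" if "finite F" for F
    using that
  proof (induction F rule: finite_induct)
    case (insert k F)
    then have "(\<lambda>k. co k x \<odot> e k) \<in> F \<rightarrow> carrier L" "co k x \<odot> e k \<in> carrier L" by auto
    then show ?case using insert e sspD(4,5)[OF W] by simp
  qed (simp add: sspD(3)[OF W])
  then show ?thesis using expand[OF x] by (metis finite_lessThan order_refl)
qed

section \<open>Modules with a p-character\<close>

context
  fixes M :: "('k, 'l, 'm, 'y) lie_module_scheme"
  assumes LM: "lie_module L M"
begin

interpretation lie_module L M by (fact LM)

lemma word_act_closed: "set w \<subseteq> {..<n} \<Longrightarrow> m \<in> carrier M \<Longrightarrow> word_act M e w m \<in> carrier M"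
  by (induction w) (auto intro!: act_closed)

lemma word_act_hom: "set w \<subseteq> {..<n} \<Longrightarrow> word_act M e w \<in> lhom M M"
  by (rule lhomI, simp add: word_act_closed)
    (induction w, auto simp: act_add_right act_smult_right word_act_closed)+

lemma power_act:
  assumes pc: "has_p_character L \<chi> M" and x: "x \<in> carrier L" and m: "m \<in> carrier M"
  shows "(act M x ^^ p) m = act M (pmap L x) m \<oplus>\<^bsub>M\<^esub> \<chi> x ^ p \<odot>\<^bsub>M\<^esub> m"
  using p_character_eq_iff[OF LM restricted_lie_algebra_axioms x m, of \<chi>] pc x m
  unfolding p_char has_p_character_def by blast

lemma swap_act:
  assumes x: "x \<in> carrier L" "y \<in> carrier L" and m: "m \<in> carrier M"
  shows "act M x (act M y m) = act M y (act M x m) \<oplus>\<^bsub>M\<^esub> act M (bracket L x y) m"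
proof -
  have "act M x (act M y m) \<in> carrier M" "act M y (act M x m) \<in> carrier M" using x m by (auto intro!: act_closed)
  then show ?thesis
    unfolding act_bracket[OF x m] by (metis M.M.a_comm M.M.minus_eq M.M.r_neg2 M.M.a_inv_closed M.M.r_neg1 M.M.a_closed)
qed

lemma act_mem_ssp:
  assumes W: "ssp W M" and e: "\<And>k. k < n \<Longrightarrow> act M (e k) m \<in> W" and m: "m \<in> carrier M" and x: "x \<in> carrier L"
  shows "act M x m \<in> W"
proof -
  have "ssp {x \<in> carrier L. act M x m \<in> W} L"
    using sspD(3-5)[OF W] m
    by (intro sspI vectorspace_axioms) (auto simp: act_add_left act_smult_left act_zero_left)
  from subspace_eq_carrier[OF this _ x] e show ?thesis by auto
qed

lemma word_act_replicate: "word_act M e (replicate k i) m = (act M (e i) ^^ k) m"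
  by (induction k) auto

text \<open>Matrix coefficients of modules with p-character \<open>\<chi>\<close> are word
  functionals: the rules hold as operators on M, and the context of a rewriting site goes into the
  form on the left and the vector on the right.\<close>

lemma module_functional:
  assumes pc: "has_p_character L \<chi> M" and mu: "linear_form M \<mu>" and m: "m \<in> carrier M"
  shows "word_functional (\<lambda>w. if set w \<subseteq> {..<n} then \<mu> (word_act M e w m) else 0)"
proof (rule word_functional_truncate)
  fix u l r v assume lr: "(l, r) \<in> rules" and u: "set u \<subseteq> {..<n}" and v: "set v \<subseteq> {..<n}"
  let ?v = "word_act M e v m" and ?\<nu> = "\<lambda>m'. \<mu> (word_act M e u m')" and ?\<Phi> = "\<lambda>w. \<mu> (word_act M e w m)"
  have vc: "?v \<in> carrier M" using v m by (rule word_act_closed)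
  have lin: "linear_form M ?\<nu>"
    using lhomD[OF word_act_hom[OF u]] linear_formD[OF mu] by (auto simp: linear_form_def)
  have ins: "ins ?\<Phi> u x v = ?\<nu> (act M x ?v)" if "x \<in> carrier L" for x
    using linear_form_expand[OF linear_form_act_left[OF lin vc] that] by (simp add: ins_def)
  from lr show "?\<Phi> (u @ l @ v) = rhs_val r u v ?\<Phi>"
  proof (cases rule: rulesE)
    case (swap i j)
    then have [simp]: "e i \<in> carrier L" "e j \<in> carrier L" by auto
    show ?thesis
      using swap_act[of "e j" "e i" ?v] vc
      by (simp add: swap rhs_val_swap ins bracket_closed act_closed linear_formD(1)[OF lin])
  next
    case (power i)
    then show ?thesis
      using power_act[OF pc _ vc, of "e i"] vc
      by (simp add: rhs_val_power ins pmap_closed act_closed word_act_replicate linear_formD[OF lin])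
  qed
qed

text \<open>Straightening inside a module. The part of the word to the left of a rewriting site is
  absorbed by replacing \<open>W\<close> by its preimage \<open>?T\<close> under that part, so that
  only the site itself has to be treated.\<close>

lemma word_act_mem_ssp:
  assumes pc: "has_p_character L \<chi> M" and m: "m \<in> carrier M" and W: "ssp W M"
    and nw: "\<And>w. normal_word w \<Longrightarrow> set w \<subseteq> {..<n} \<Longrightarrow> word_act M e w m \<in> W"
  shows "set w \<subseteq> {..<n} \<Longrightarrow> word_act M e w m \<in> W"
proof (induction w rule: wf_induct_rule[OF wf_lenlex[OF wf_less_than]])
  case (1 w)
  show ?case
  proof (cases "normal_word w")
    case True
    then show ?thesis using nw 1 by simp
  next
    case False
    then obtain u l r v where w: "w = u @ l @ v" "(l, r) \<in> rules" unfolding normal_word_def by blast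
    have u: "set u \<subseteq> {..<n}" and v: "set v \<subseteq> {..<n}" using 1(2) w by auto
    let ?v = "word_act M e v m" and ?T = "{m' \<in> carrier M. word_act M e u m' \<in> W}"
    have vc: "?v \<in> carrier M" using v m by (rule word_act_closed)
    have T: "ssp ?T M"
      using sspD(3-5)[OF W] lhomD[OF word_act_hom[OF u]] lhom_zero(1)[OF M.vectorspace_axioms M.vectorspace_axioms word_act_hom[OF u]]
      by (intro sspI M.vectorspace_axioms) auto
    have small: "word_act M e z ?v \<in> ?T" if "(z, l) \<in> word_order" "set z \<subseteq> {..<n}" for z
    proof -
      have "word_act M e (u @ z @ v) m \<in> W"
        using word_order_context[OF that(1), of u v] that(2) u v w by (intro 1(1)) simp_all
      then show ?thesis using word_act_closed[OF that(2) vc] by simp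
    qed
    have "length l \<ge> 2" using w(2) p_ge_2 by (cases rule: rulesE) auto
    then have letter: "act M (e k) ?v \<in> ?T" if "k < n" for k
      using small[of "[k]"] that by (simp add: word_order_shorter)
    from w(2) have "word_act M e l ?v \<in> ?T"
    proof (cases rule: rulesE)
      case (swap i j)
      have "act M (bracket L (e j) (e i)) ?v \<in> ?T"
        by (rule act_mem_ssp[OF T letter vc bracket_closed]) (use swap in auto)
      moreover have "act M (e i) (act M (e j) ?v) \<in> ?T"
        using small[of "[i, j]"] word_order_smaller[of i j "[j]" "[i]" "[]"] swap by simp
      ultimately show ?thesis using sspD(4)[OF T] swap_act[of "e j" "e i" ?v] vc swap by simp
    next
      case (power i)
      have "act M (pmap L (e i)) ?v \<in> ?T"
        by (rule act_mem_ssp[OF T letter vc pmap_closed]) (use power in auto)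
      moreover have "?v \<in> ?T" using small[of "[]"] power p_ge_2 by (simp add: word_order_shorter)
      ultimately show ?thesis
        using sspD(4,5)[OF T] power_act[OF pc _ vc, of "e i"] power by (simp add: word_act_replicate)
    qed
    then show ?thesis by (simp add: w(1))
  qed
qed

text \<open>A cyclic module over u(L,chi) is spanned by finitely many normal words applied to its
  generator. This is where the finite dimension of the covers P and Q comes from.\<close>

lemma fdim_generated:
  assumes pc: "has_p_character L \<chi> M" and m: "m \<in> carrier M"
    and gen: "\<And>W. ssp W M \<Longrightarrow> m \<in> W \<Longrightarrow> (\<And>x w. x \<in> carrier L \<Longrightarrow> w \<in> W \<Longrightarrow> act M x w \<in> W) \<Longrightarrow> W = carrier M"
  shows "fdim M"
proof (rule fdimI[OF M.vectorspace_axioms])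
  let ?N = "{w. normal_word w \<and> set w \<subseteq> {..<n}}" and ?A = "{word_act M e w m | w. set w \<subseteq> {..<n}}"
  let ?U = "LinearCombinations.module.span class_ring M ?A"
  show "finite ((\<lambda>w. word_act M e w m) ` ?N)" using finite_normal_words by simp
  show "(\<lambda>w. word_act M e w m) ` ?N \<subseteq> carrier M" using word_act_closed m by auto
  have Ac: "?A \<subseteq> carrier M" using word_act_closed m by auto
  note U = span_ssp[OF M.vectorspace_axioms Ac]
  have Ucl: "act M x u \<in> ?U" if x: "x \<in> carrier L" and u: "u \<in> ?U" for x u
  proof -
    have "ssp {u \<in> carrier M. act M x u \<in> ?U} M"
      using sspD(3-5)[OF U(1)] x
      by (intro sspI M.vectorspace_axioms) (auto simp: act_add_right act_smult_right act_zero_right)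
    moreover have "act M x (word_act M e w m) \<in> ?U" if w: "set w \<subseteq> {..<n}" for w
    proof (rule act_mem_ssp[OF U(1) _ word_act_closed[OF w m] x])
      fix k assume "k < n"
      then have "word_act M e (k # w) m \<in> ?A" using w by fastforce
      then show "act M (e k) (word_act M e w m) \<in> ?U" using U(2) by auto
    qed
    then have "?A \<subseteq> {u \<in> carrier M. act M x u \<in> ?U}" using Ac by auto
    ultimately have "?U \<subseteq> {u \<in> carrier M. act M x u \<in> ?U}" by (rule U(3))
    then show ?thesis using u by auto
  qed
  have "word_act M e [] m \<in> ?A" by (intro CollectI exI[of _ "[]"]) simp
  then have "m \<in> ?U" using U(2) by auto
  then have Ueq: "?U = carrier M" using gen[OF U(1)] Ucl by blast
  fix W assume W: "ssp W M" "(\<lambda>w. word_act M e w m) ` ?N \<subseteq> W"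
  have "?A \<subseteq> W" using word_act_mem_ssp[OF pc m W(1)] W(2) by auto
  then show "W = carrier M" using U(3)[OF W(1)] Ueq sspD(2)[OF W(1)] by auto
qed

text \<open>The elements of L that satisfy the p-character equation form a subspace, so the basis
  decides. Without additivity of the p-map this rests on \<open>p_character_add\<close>.\<close>

lemma p_character_from_basis:
  assumes sep: "separated M" and chi: "linear_form L \<chi>"
    and b: "\<And>i m. i < n \<Longrightarrow> m \<in> carrier M
      \<Longrightarrow> (act M (e i) ^^ p) m = act M (pmap L (e i)) m \<oplus>\<^bsub>M\<^esub> \<chi> (e i) ^ p \<odot>\<^bsub>M\<^esub> m"
  shows "has_p_character L \<chi> M"
proof -
  let ?H = "{x \<in> carrier L. \<forall>m\<in>carrier M. (act M x ^^ p) m = act M (pmap L x) m \<oplus>\<^bsub>M\<^esub> \<chi> x ^ p \<odot>\<^bsub>M\<^esub> m}"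
  have "ssp ?H L"
  proof (rule sspI[OF vectorspace_axioms])
    show "?H \<subseteq> carrier L" by auto
    fix x y assume "x \<in> ?H" "y \<in> ?H"
    then show "x \<oplus> y \<in> ?H"
      using p_character_add[OF restricted_lie_algebra_axioms LM sep chi, of x y] by (simp add: p_char)
  next
    fix a x assume "x \<in> ?H"
    then show "a \<odot> x \<in> ?H"
      using p_character_smult[OF restricted_lie_algebra_axioms LM chi, of x] by (simp add: p_char)
  next
    \<comment> \<open>The zero vector is treated on its own: the p-map, \<open>\<chi>\<close> and a
      p-th power of the zero action all vanish there, since p > 0.\<close>
    have zc: "\<zero> \<in> carrier L" by simp
    have "pmap L (0 \<odot> \<zero>) = 0 ^ p \<odot> pmap L \<zero>" unfolding p_char by (rule pmap_smult) simp
    then have pz: "pmap L \<zero> = \<zero>"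
      using smult_zero[OF vectorspace_axioms pmap_closed[OF zc]]
        smult_zero[OF vectorspace_axioms zc] p_ge_2 by (simp add: power_0_left)
    have cz: "\<chi> \<zero> ^ p = 0" using linear_form_zero[OF vectorspace_axioms chi] p_ge_2 by simp
    show "\<zero> \<in> ?H"
    proof (intro CollectI conjI ballI)
      fix m assume m: "m \<in> carrier M"
      obtain q where q: "p = Suc q" using p_ge_2 by (cases p) auto
      have "(act M \<zero> ^^ q) m \<in> carrier M" by (induction q) (auto simp: m act_closed)
      then have "(act M \<zero> ^^ p) m = \<zero>\<^bsub>M\<^esub>" by (simp add: q act_zero_left)
      then show "(act M \<zero> ^^ p) m = act M (pmap L \<zero>) m \<oplus>\<^bsub>M\<^esub> \<chi> \<zero> ^ p \<odot>\<^bsub>M\<^esub> m"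
        unfolding pz cz act_zero_left[OF m] smult_zero[OF M.vectorspace_axioms m] by simp
    qed simp
  qed
  moreover have "e k \<in> ?H" if "k < n" for k
    by (intro CollectI conjI ballI b[OF that] e_closed[OF that])
  ultimately have H: "x \<in> ?H" if "x \<in> carrier L" for x
    by (rule subspace_eq_carrier[OF _ _ that])
  show ?thesis
    unfolding has_p_character_def
  proof (intro ballI)
    fix x m assume x: "x \<in> carrier L" and m: "m \<in> carrier M"
    show "(act M x ^^ CHAR('k)) m \<ominus>\<^bsub>M\<^esub> act M (pmap L x) m = \<chi> x ^ CHAR('k) \<odot>\<^bsub>M\<^esub> m"
      by (rule iffD2[OF p_character_eq_iff[OF LM restricted_lie_algebra_axioms x m]])
        (use H[OF x] m in \<open>unfold p_char, blast\<close>)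
  qed
qed

end

end

section \<open>Ideals and coinduced modules\<close>

definition lie_hom :: "('k::field, 'l, 'x) lie_algebra_scheme \<Rightarrow> ('k, 'l, 'm, 'y) lie_module_scheme \<Rightarrow>
    ('k, 'l, 'n, 'z) lie_module_scheme \<Rightarrow> ('m \<Rightarrow> 'n) set" where
  "lie_hom L M N = {h \<in> lhom M N. \<forall>x\<in>carrier L. \<forall>m\<in>carrier M. h (act M x m) = act N x (h m)}"

lemma lie_homD:
  assumes "h \<in> lie_hom L M N"
  shows "h \<in> lhom M N" "x \<in> carrier L \<Longrightarrow> m \<in> carrier M \<Longrightarrow> h (act M x m) = act N x (h m)"
  using assms by (auto simp: lie_hom_def)

lemma finsum_subspace:
  fixes V :: "('k::field, 'v, 'x) module_scheme"
  assumes W: "ssp W V" and f: "f \<in> A \<rightarrow> W"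
  shows "finsum (V\<lparr>carrier := W\<rparr>) f A = finsum V f A"
proof -
  interpret V: vectorspace class_ring V by (rule sspD(1)[OF W])
  interpret W: vectorspace class_ring "V\<lparr>carrier := W\<rparr>" by (rule sspD(8)[OF W])
  show ?thesis
  proof (cases "finite A")
    case True
    then show ?thesis using f
    proof (induction A rule: finite_induct)
      case (insert a A)
      then have "f \<in> A \<rightarrow> carrier V" "f a \<in> carrier V" using sspD(2)[OF W] by auto
      then show ?case using insert by simp
    qed simp
  qed simp
qed

lemma p_idealD:
  assumes "p_ideal I L"
  shows "ssp I L" "x \<in> carrier L \<Longrightarrow> y \<in> I \<Longrightarrow> bracket L x y \<in> I" "y \<in> I \<Longrightarrow> pmap L y \<in> I"
  using assms by (auto simp: p_ideal_def)

text \<open>The operations are inherited; what needs an argument is that the terms s_i(x,y) computed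
  in the ideal are those of L and stay in I.\<close>

lemma restricted_lie_algebra_ideal:
  fixes L :: "('k::field, 'l, 'x) restricted_lie_algebra_scheme"
  assumes RL: "restricted_lie_algebra L" and I: "p_ideal I L"
  shows "restricted_lie_algebra (L\<lparr>carrier := I\<rparr>)"
proof -
  interpret restricted_lie_algebra L by fact
  let ?I = "L\<lparr>carrier := I\<rparr>"
  note I1 = p_idealD[OF I]
  have Ic: "x \<in> I \<Longrightarrow> x \<in> carrier L" for x using sspD(2)[OF I1(1)] by auto
  have ad: "ad_coeff ?I x y k j = ad_coeff L x y k j" for x y k j
    by (induction k arbitrary: j) auto
  have js: "jacobson_s ?I i x y = jacobson_s L i x y" for i x y by (simp add: jacobson_s_def ad)
  have adI: "ad_coeff L x y k j \<in> I" if "x \<in> I" "y \<in> I" for x y k j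
    using that sspD(3,4)[OF I1(1)] I1(2)[OF Ic] by (induction k arbitrary: j) auto
  have js_I: "jacobson_s L i x y \<in> I" if "x \<in> I" "y \<in> I" for i x y
    using adI[OF that] sspD(5)[OF I1(1)] by (simp add: jacobson_s_def)
  have sum: "(\<Oplus>\<^bsub>?I\<^esub>i\<in>A. jacobson_s ?I i x y) = (\<Oplus>\<^bsub>L\<^esub>i\<in>A. jacobson_s L i x y)"
    if "x \<in> I" "y \<in> I" for x y and A :: "nat set"
    unfolding js using js_I[OF that] by (intro finsum_subspace[OF I1(1)]) auto
  have "lie_algebra ?I"
    using I1(2) Ic bracket_add_left bracket_add_right bracket_smult_left bracket_smult_right bracket_self jacobi
    by (intro lie_algebra.intro lie_algebra_axioms.intro sspD(8)[OF I1(1)]) auto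
  then show ?thesis
  proof (intro restricted_lie_algebra.intro restricted_lie_algebra_axioms.intro)
    show "prime CHAR('k)" by (rule char_prime)
    fix x assume x: "x \<in> carrier ?I"
    show "pmap ?I x \<in> carrier ?I" using x I1(3) by simp
    show "pmap ?I (a \<odot>\<^bsub>?I\<^esub> x) = a ^ CHAR('k) \<odot>\<^bsub>?I\<^esub> pmap ?I x" for a using x Ic pmap_smult by simp
    fix y assume y: "y \<in> carrier ?I"
    show "bracket ?I (pmap ?I x) y = (bracket ?I x ^^ CHAR('k)) y" using x y Ic ad_pmap by simp
    show "pmap ?I (x \<oplus>\<^bsub>?I\<^esub> y) = pmap ?I x \<oplus>\<^bsub>?I\<^esub> pmap ?I y \<oplus>\<^bsub>?I\<^esub> (\<Oplus>\<^bsub>?I\<^esub>i\<in>{1..<CHAR('k)}. jacobson_s ?I i x y)"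
      using x y sum[of x y] Ic pmap_add by simp
  qed
qed

text \<open>The letters of I come first in the order, so that a sorted word splits into a word over
  I followed by a word in the other letters. As chi vanishes on I, the sublocale for I carries the
  zero form.\<close>

locale lie_basis_ideal = lie_basis L \<chi> n e co p
  for L :: "('k::field, 'l, 'x) restricted_lie_algebra_scheme" (structure)
    and \<chi> :: "'l \<Rightarrow> 'k" and n :: nat and e :: "nat \<Rightarrow> 'l" and co :: "nat \<Rightarrow> 'l \<Rightarrow> 'k" and p :: nat +
  fixes I :: "'l set" and r :: nat
  assumes \<chi>_linear: "linear_form L \<chi>"
    and ideal: "p_ideal I L"
    and r_le: "r \<le> n"
    and e_I: "i < r \<Longrightarrow> e i \<in> I"
    and mem_I: "x \<in> carrier L \<Longrightarrow> x \<in> I \<longleftrightarrow> (\<forall>k. r \<le> k \<and> k < n \<longrightarrow> co k x = 0)"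
    and \<chi>_I: "x \<in> I \<Longrightarrow> \<chi> x = 0"
begin

abbreviation LI :: "('k, 'l, 'x) restricted_lie_algebra_scheme" where
  "LI \<equiv> L\<lparr>carrier := I\<rparr>"

lemmas I_ssp = p_idealD(1)[OF ideal]
lemma I_carrier: "x \<in> I \<Longrightarrow> x \<in> carrier L" using sspD(2)[OF I_ssp] by auto

lemma co_I: "x \<in> I \<Longrightarrow> r \<le> k \<Longrightarrow> k < n \<Longrightarrow> co k x = 0"
  using mem_I[OF I_carrier] by blast

lemma expand_I:
  assumes x: "x \<in> I"
  shows "x = (\<Oplus>\<^bsub>LI\<^esub>k\<in>{..<r}. co k x \<odot>\<^bsub>LI\<^esub> e k)"
proof -
  have "(\<Oplus>\<^bsub>LI\<^esub>k\<in>{..<r}. co k x \<odot>\<^bsub>LI\<^esub> e k) = (\<Oplus>k\<in>{..<r}. co k x \<odot> e k)"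
    using e_I sspD(5)[OF I_ssp] by (simp add: finsum_subspace[OF I_ssp] Pi_iff)
  also have "\<dots> = (\<Oplus>k\<in>{..<n}. co k x \<odot> e k)"
    by (rule M.add.finprod_mono_neutral_cong_left)
      (use r_le co_I[OF x] smult_zero[OF vectorspace_axioms] in auto)
  also have "\<dots> = x" using expand[OF I_carrier[OF x]] by simp
  finally show ?thesis by simp
qed

sublocale I: lie_basis LI "\<lambda>_. 0" r e co p
proof (intro lie_basis.intro restricted_lie_algebra_ideal[OF restricted_lie_algebra_axioms ideal] lie_basis_axioms.intro)
  show "p = CHAR('k)" by (rule p_char)
  show "e i \<in> carrier LI" if "i < r" for i using e_I that by simp
  show "linear_form LI (co k)" for k using co_linear I_carrier by (auto simp: linear_form_def)
  show "co k (e i) = (if k = i then 1 else 0)" if "k < r" "i < r" for k i using co_e that r_le by simp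
  show "x = (\<Oplus>\<^bsub>LI\<^esub>k\<in>{..<r}. co k x \<odot>\<^bsub>LI\<^esub> e k)" if "x \<in> carrier LI" for x using expand_I that by simp
qed

lemma ins_I:
  assumes "x \<in> I" shows "ins \<Phi> u x v = I.ins \<Phi> u x v"
  unfolding ins_def I.ins_def
  by (rule sum.mono_neutral_right) (use assms co_I r_le in auto)

lemma I_rule: "(l, s) \<in> rules \<Longrightarrow> set l \<subseteq> {..<r} \<Longrightarrow> \<exists>s'. (l, s') \<in> I.rules"
  using p_ge_2 by (auto simp: rules_def I.rules_def)

lemma rule_I: "(l, s) \<in> I.rules \<Longrightarrow> \<exists>s'. (l, s') \<in> rules"
  using r_le by (fastforce simp: rules_def I.rules_def)

text \<open>Brackets and p-map of letters from I stay in I and the scalar term is 0^p = 0. Hence a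
  rule of L whose left-hand side lies over I is a rule of I.\<close>

lemma rhs_val_I:
  assumes "(l, s) \<in> rules" "(l, s') \<in> I.rules"
  shows "rhs_val s u v \<Phi> = I.rhs_val s' u v \<Phi>"
  using assms(2)
proof (cases rule: I.rulesE)
  case (swap i j)
  from assms(1) have "s = swap_rhs j i"
  proof (cases rule: rulesE)
    case (power k)
    then have "j = k" "i = k" using swap p_ge_2 by (metis in_set_replicate list.set_intros)+
    then show ?thesis using swap by simp
  qed (use swap in auto)
  moreover have "bracket L (e j) (e i) \<in> I"
    using p_idealD(2)[OF ideal] swap e_I I_carrier by simp
  ultimately show ?thesis using swap by (simp add: rhs_val_swap I.rhs_val_swap ins_I)
next
  case (power i)
  from assms(1) have "s = power_rhs i"
  proof (cases rule: rulesE)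
    case (swap i' j)
    then have "j = i" "i' = i" using power p_ge_2 by (metis in_set_replicate list.set_intros)+
    then show ?thesis using swap by simp
  next
    case (power k)
    then show ?thesis using \<open>l = replicate p i\<close> p_ge_2 by (metis not_numeral_le_zero replicate_eq_replicate)
  qed
  then show ?thesis
    using power p_idealD(3)[OF ideal e_I] p_ge_2
    by (simp add: rhs_val_power I.rhs_val_power ins_I \<chi>_I[OF e_I] power_0_left)
qed

text \<open>No left-hand side can straddle the seam: a swap word decreases and a power word is
  constant, while letters before the seam are smaller than those behind it. In terms of words, this
  is freeness of u(L,chi) as a left module over u(I,0).\<close>

lemma normal_word_append:
  assumes a: "I.normal_word a" "set a \<subseteq> {..<r}" and b: "normal_word b" "set b \<subseteq> {r..<n}"
  shows "normal_word (a @ b)"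
  unfolding normal_word_def
proof
  assume "\<exists>u l s v. a @ b = u @ l @ v \<and> (l, s) \<in> rules"
  then obtain u l s v where eq: "a @ b = u @ l @ v" and lr: "(l, s) \<in> rules" by blast
  then obtain x where x: "a = u @ x \<and> x @ b = l @ v \<or> a @ x = u \<and> b = x @ l @ v"
    by (auto simp: append_eq_append_conv2)
  then consider (right) "b = x @ l @ v" | (left) y where "a = u @ l @ y" | (mid) y where "a = u @ x" "l = x @ y" "b = y @ v"
    by (auto simp: append_eq_append_conv2)
  then show False
  proof cases
    case right
    then show False using b(1) lr unfolding normal_word_def by blast
  next
    case left
    then have "set l \<subseteq> {..<r}" using a(2) by auto
    then show False using I_rule[OF lr] left a(1) unfolding I.normal_word_def by blast
  next
    case mid
    have xl: "\<And>i. i \<in> set x \<Longrightarrow> i < r" "\<And>i. i \<in> set y \<Longrightarrow> r \<le> i" using a(2) b(2) mid by auto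
    show False
    proof (cases "x = [] \<or> y = []")
      case True
      then show False
      proof
        assume "x = []"
        then have "b = [] @ l @ v" using mid by simp
        then show False using b(1) lr unfolding normal_word_def by blast
      next
        assume "y = []"
        then have "a = u @ l @ []" "set l \<subseteq> {..<r}" using mid xl by auto
        then show False using I_rule[OF lr] a(1) unfolding I.normal_word_def by blast
      qed
    next
      case False
      then obtain i x' j y' where xy: "x = i # x'" "y = j # y'" by (meson list.exhaust)
      have ij: "i < r" "r \<le> j" using xl xy by auto
      from lr show False
      proof (cases rule: rulesE)
        case (swap i' j')
        then have "x' @ j # y' = [i']" "i = j'" using mid xy by auto
        then show False using swap ij by (cases x') auto
      next
        case (power k)
        then have "i \<in> set (replicate p k)" "j \<in> set (replicate p k)" using mid xy by (metis Un_iff list.set_intros(1) set_append)+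
        then show False using ij by (auto split: if_splits)
      qed
    qed
  qed
qed

lemma normal_word_split:
  assumes v: "normal_word v" "set v \<subseteq> {..<n}"
  shows "I.normal_word (takeWhile (\<lambda>i. i < r) v)" "normal_word (dropWhile (\<lambda>i. i < r) v)"
    "set (takeWhile (\<lambda>i. i < r) v) \<subseteq> {..<r}" "set (dropWhile (\<lambda>i. i < r) v) \<subseteq> {r..<n}"
proof -
  let ?a = "takeWhile (\<lambda>i. i < r) v" and ?b = "dropWhile (\<lambda>i. i < r) v"
  have na: "normal_word ?a" using normal_word_sublist[of "[]" ?a ?b] v by simp
  show "normal_word ?b" using normal_word_sublist[of ?a ?b "[]"] v by simp
  show "set ?a \<subseteq> {..<r}" by (auto dest: set_takeWhileD)
  show "I.normal_word ?a" using na rule_I unfolding normal_word_def I.normal_word_def by blast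
  have srt: "sorted ?b" by (rule sorted_dropWhile[OF normal_word_sorted[OF v]])
  show "set ?b \<subseteq> {r..<n}"
  proof (cases ?b)
    case (Cons c b')
    then have "\<not> c < r" using hd_dropWhile[of "\<lambda>i. i < r" v] by (metis list.sel(1) list.distinct(1))
    then have "r \<le> i" if "i \<in> set ?b" for i using srt Cons that by auto
    then show ?thesis using v(2) set_dropWhileD by fastforce
  qed (metis empty_subsetI list.set(1))
qed

end

lemma vspI:
  fixes V :: "('k::field, 'v, 'x) module_scheme"
  assumes "\<zero>\<^bsub>V\<^esub> \<in> carrier V"
    and "\<And>v w. v \<in> carrier V \<Longrightarrow> w \<in> carrier V \<Longrightarrow> v \<oplus>\<^bsub>V\<^esub> w \<in> carrier V"
    and "\<And>v. v \<in> carrier V \<Longrightarrow> \<exists>w\<in>carrier V. v \<oplus>\<^bsub>V\<^esub> w = \<zero>\<^bsub>V\<^esub>"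
    and "\<And>a v. v \<in> carrier V \<Longrightarrow> a \<odot>\<^bsub>V\<^esub> v \<in> carrier V"
    and "\<And>v w. v \<in> carrier V \<Longrightarrow> w \<in> carrier V \<Longrightarrow> v \<oplus>\<^bsub>V\<^esub> w = w \<oplus>\<^bsub>V\<^esub> v"
    and "\<And>v w x. v \<in> carrier V \<Longrightarrow> w \<in> carrier V \<Longrightarrow> x \<in> carrier V \<Longrightarrow> (v \<oplus>\<^bsub>V\<^esub> w) \<oplus>\<^bsub>V\<^esub> x = v \<oplus>\<^bsub>V\<^esub> (w \<oplus>\<^bsub>V\<^esub> x)"
    and "\<And>v. v \<in> carrier V \<Longrightarrow> v \<oplus>\<^bsub>V\<^esub> \<zero>\<^bsub>V\<^esub> = v"
    and "\<And>a b v. v \<in> carrier V \<Longrightarrow> (a * b) \<odot>\<^bsub>V\<^esub> v = a \<odot>\<^bsub>V\<^esub> (b \<odot>\<^bsub>V\<^esub> v)"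
    and "\<And>v. v \<in> carrier V \<Longrightarrow> 1 \<odot>\<^bsub>V\<^esub> v = v"
    and "\<And>a b v. v \<in> carrier V \<Longrightarrow> (a + b) \<odot>\<^bsub>V\<^esub> v = a \<odot>\<^bsub>V\<^esub> v \<oplus>\<^bsub>V\<^esub> b \<odot>\<^bsub>V\<^esub> v"
    and "\<And>a v w. v \<in> carrier V \<Longrightarrow> w \<in> carrier V \<Longrightarrow> a \<odot>\<^bsub>V\<^esub> (v \<oplus>\<^bsub>V\<^esub> w) = a \<odot>\<^bsub>V\<^esub> v \<oplus>\<^bsub>V\<^esub> a \<odot>\<^bsub>V\<^esub> w"
  shows "vsp V"
proof (rule vs_criteria)
  show "field (class_ring :: 'k ring)" by (rule class_field.field_axioms)
qed (use assms in simp_all)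

lemma vspD:
  fixes V :: "('k::field, 'v, 'x) module_scheme"
  assumes "vsp V"
  shows "v \<in> carrier V \<Longrightarrow> (a * b) \<odot>\<^bsub>V\<^esub> v = a \<odot>\<^bsub>V\<^esub> (b \<odot>\<^bsub>V\<^esub> v)"
    "v \<in> carrier V \<Longrightarrow> 1 \<odot>\<^bsub>V\<^esub> v = v"
    "v \<in> carrier V \<Longrightarrow> (a + b) \<odot>\<^bsub>V\<^esub> v = a \<odot>\<^bsub>V\<^esub> v \<oplus>\<^bsub>V\<^esub> b \<odot>\<^bsub>V\<^esub> v"
    "v \<in> carrier V \<Longrightarrow> w \<in> carrier V \<Longrightarrow> a \<odot>\<^bsub>V\<^esub> (v \<oplus>\<^bsub>V\<^esub> w) = a \<odot>\<^bsub>V\<^esub> v \<oplus>\<^bsub>V\<^esub> a \<odot>\<^bsub>V\<^esub> w"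
proof -
  interpret vectorspace class_ring V by fact
  show "v \<in> carrier V \<Longrightarrow> (a * b) \<odot>\<^bsub>V\<^esub> v = a \<odot>\<^bsub>V\<^esub> (b \<odot>\<^bsub>V\<^esub> v)"
    using smult_assoc1[of a b v] by simp
  show "v \<in> carrier V \<Longrightarrow> 1 \<odot>\<^bsub>V\<^esub> v = v" using smult_one[of v] by simp
  show "v \<in> carrier V \<Longrightarrow> (a + b) \<odot>\<^bsub>V\<^esub> v = a \<odot>\<^bsub>V\<^esub> v \<oplus>\<^bsub>V\<^esub> b \<odot>\<^bsub>V\<^esub> v"
    using smult_l_distr[of a b v] by simp
  show "v \<in> carrier V \<Longrightarrow> w \<in> carrier V \<Longrightarrow> a \<odot>\<^bsub>V\<^esub> (v \<oplus>\<^bsub>V\<^esub> w) = a \<odot>\<^bsub>V\<^esub> v \<oplus>\<^bsub>V\<^esub> a \<odot>\<^bsub>V\<^esub> w"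
    using smult_r_distr[of a v w] by simp
qed

section \<open>Operations on word functionals\<close>

context lie_basis
begin

text \<open>(x Phi)(w) = Phi(w x) is a left action: multiplication on the right of the argument
  reverses the order once more. The identity is linear in y, and for a basis vector it is
  \<open>word_functional_commute\<close>.\<close>

lemma word_functional_bracket:
  assumes \<Phi>: "word_functional \<Phi>" and x: "x \<in> carrier L" and y: "y \<in> carrier L"
  shows "ins \<Phi> w (bracket L x y) [] = ins (\<lambda>w. ins \<Phi> w y []) w x [] - ins (\<lambda>w. ins \<Phi> w x []) w y []"
proof (rule linear_form_eqI[where f = "\<lambda>y. ins \<Phi> w (bracket L x y) []", OF _ _ _ y])
  show "linear_form L (\<lambda>y. ins \<Phi> w (bracket L x y) [])"
    using x linear_formD[OF ins_linear]
    by (auto simp: linear_form_def bracket_add_right bracket_smult_right bracket_closed)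
  have "linear_form L (\<lambda>y. ins (\<lambda>w. ins \<Phi> w y []) w x [])"
    unfolding ins_def[of "\<lambda>w. ins \<Phi> w _ []"] linear_form_def
    by (auto simp: ins_add linear_formD(2)[OF ins_linear] algebra_simps sum.distrib sum_distrib_left)
  then show "linear_form L (\<lambda>y. ins (\<lambda>w. ins \<Phi> w y []) w x [] - ins (\<lambda>w. ins \<Phi> w x []) w y [])"
    using ins_linear[of "\<lambda>w. ins \<Phi> w x []" w "[]"] unfolding linear_form_def by (auto simp: algebra_simps)
  fix i assume i: "i < n"
  have "ins (\<lambda>w. ins \<Phi> w (e i) []) w x [] = ins \<Phi> w x [i]" using i by (simp add: ins_e) (simp add: ins_def)
  then show "ins \<Phi> w (bracket L x (e i)) [] = ins (\<lambda>w. ins \<Phi> w (e i) []) w x [] - ins (\<lambda>w. ins \<Phi> w x []) w (e i) []"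
    using word_functional_commute[OF \<Phi> i x, of w "[]"] i by (simp add: ins_e)
qed

text \<open>A letter appended on the right stands behind every rewriting site and merely becomes
  part of the context.\<close>

lemma word_functional_shift:
  assumes \<Phi>: "word_functional \<Phi>"
  shows "word_functional (\<lambda>w. ins \<Phi> w x [])"
  unfolding word_functional_def
proof (intro conjI allI impI)
  show "\<not> set w \<subseteq> {..<n} \<Longrightarrow> ins \<Phi> w x [] = 0" for w
    using \<Phi> unfolding ins_def word_functional_def by (intro sum.neutral) auto
  fix u l s v assume l: "(l, s) \<in> rules"
  have "ins \<Phi> (u @ l @ v) x [] = (\<Sum>k<n. co k x * (\<Sum>(a, z)\<leftarrow>s. a * \<Phi> (u @ z @ v @ [k])))"
    using \<Phi> l unfolding word_functional_def rhs_val_def ins_def by (intro sum.cong) auto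
  also have "\<dots> = (\<Sum>k<n. \<Sum>(a, z)\<leftarrow>s. a * (co k x * \<Phi> (u @ z @ v @ [k])))"
    by (simp add: sum_list_const_mult[symmetric] case_prod_unfold mult.left_commute)
  also have "\<dots> = (\<Sum>(a, z)\<leftarrow>s. \<Sum>k<n. a * (co k x * \<Phi> (u @ z @ v @ [k])))"
    by (induction s) (auto simp: sum.distrib)
  also have "\<dots> = rhs_val s u v (\<lambda>w. ins \<Phi> w x [])"
    by (simp add: rhs_val_def ins_def sum_distrib_left)
  finally show "ins \<Phi> (u @ l @ v) x [] = rhs_val s u v (\<lambda>w. ins \<Phi> w x [])" .
qed

lemma word_functional_combine:
  "word_functional \<Phi> \<Longrightarrow> word_functional \<Psi> \<Longrightarrow> word_functional (\<lambda>w. \<Phi> w + \<Psi> w)"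
  "word_functional \<Phi> \<Longrightarrow> word_functional (\<lambda>w. a * \<Phi> w)"
  "word_functional (\<lambda>w. 0)"
proof -
  have "rhs_val s u v (\<lambda>w. \<Phi> w + \<Psi> w) = rhs_val s u v \<Phi> + rhs_val s u v \<Psi>"
    "rhs_val s u v (\<lambda>w. a * \<Phi> w) = a * rhs_val s u v \<Phi>" "rhs_val s u v (\<lambda>w. 0) = 0" for s u v
    unfolding rhs_val_def by (induction s) (auto simp: algebra_simps)
  then show "word_functional \<Phi> \<Longrightarrow> word_functional \<Psi> \<Longrightarrow> word_functional (\<lambda>w. \<Phi> w + \<Psi> w)"
    "word_functional \<Phi> \<Longrightarrow> word_functional (\<lambda>w. a * \<Phi> w)" "word_functional (\<lambda>w. 0)"
    unfolding word_functional_def by auto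
qed

end

section \<open>Coinduced modules and Frobenius reciprocity\<close>

context lie_basis_ideal
begin

text \<open>The coinduced module $\mathrm{Hom}_{u(I,0)}(u(L,\chi), M)$; a homomorphism is given by its values
  on the words in the basis letters.\<close>

definition coind :: "('k, 'l, 'm, 'y) lie_module_scheme \<Rightarrow> ('k, 'l, nat list \<Rightarrow> 'm) lie_module" where
  "coind M =
     \<lparr>carrier = {\<phi>. (\<forall>w. \<phi> w \<in> carrier M) \<and> (\<forall>w. \<not> set w \<subseteq> {..<n} \<longrightarrow> \<phi> w = \<zero>\<^bsub>M\<^esub>) \<and>
        (\<forall>\<mu>. linear_form M \<mu> \<longrightarrow> word_functional (\<lambda>w. \<mu> (\<phi> w))) \<and>
        (\<forall>i w. i < r \<longrightarrow> \<phi> (i # w) = act M (e i) (\<phi> w))},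
      mult = undefined, one = undefined, zero = (\<lambda>w. \<zero>\<^bsub>M\<^esub>), add = (\<lambda>\<phi> \<psi> w. \<phi> w \<oplus>\<^bsub>M\<^esub> \<psi> w),
      smult = (\<lambda>a \<phi> w. a \<odot>\<^bsub>M\<^esub> \<phi> w),
      act = (\<lambda>x \<phi> w. \<Oplus>\<^bsub>M\<^esub>k\<in>{..<n}. co k x \<odot>\<^bsub>M\<^esub> \<phi> (w @ [k]))\<rparr>"

lemma coind_simps:
  "\<zero>\<^bsub>coind M\<^esub> w = \<zero>\<^bsub>M\<^esub>" "(\<phi> \<oplus>\<^bsub>coind M\<^esub> \<psi>) w = \<phi> w \<oplus>\<^bsub>M\<^esub> \<psi> w" "(a \<odot>\<^bsub>coind M\<^esub> \<phi>) w = a \<odot>\<^bsub>M\<^esub> \<phi> w"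
  by (simp_all add: coind_def)

context
  fixes M :: "('k, 'l, 'm, 'y) lie_module_scheme"
  assumes LM: "lie_module LI M" and sep: "separated M"
begin

interpretation M: lie_module LI M by (fact LM)

lemmas M_vsp = M.M.vectorspace_axioms

lemma coindD:
  assumes "\<phi> \<in> carrier (coind M)"
  shows "\<phi> w \<in> carrier M" "\<not> set w \<subseteq> {..<n} \<Longrightarrow> \<phi> w = \<zero>\<^bsub>M\<^esub>"
    "linear_form M \<mu> \<Longrightarrow> word_functional (\<lambda>w. \<mu> (\<phi> w))"
    "i < r \<Longrightarrow> \<phi> (i # w) = act M (e i) (\<phi> w)"
  using assms by (auto simp: coind_def)

lemma coind_vsp: "vsp (coind M)"
proof -
  \<comment> \<open>All functions into M form a vector space under the pointwise operations; the
    conditions in \<open>coind\<close> cut out a subspace of it.\<close>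
  let ?F = "(coind M)\<lparr>carrier := {\<phi>. \<forall>w. \<phi> w \<in> carrier M}\<rparr>"
  have "vsp ?F"
  proof (rule vspI)
    fix \<phi> assume f: "\<phi> \<in> carrier ?F"
    then show "\<exists>\<psi>\<in>carrier ?F. \<phi> \<oplus>\<^bsub>?F\<^esub> \<psi> = \<zero>\<^bsub>?F\<^esub>"
      by (intro bexI[of _ "\<lambda>w. \<ominus>\<^bsub>M\<^esub> \<phi> w"]) (auto simp: coind_def M.M.M.r_neg)
  qed (auto simp: coind_def vspD[OF M_vsp] M.M.M.a_ac intro!: M.M.M.a_comm)
  then have "ssp (carrier (coind M)) ?F"
  proof (rule sspI)
    show "carrier (coind M) \<subseteq> carrier ?F" by (auto simp: coind_def)
    have "word_functional (\<lambda>w. \<mu> \<zero>\<^bsub>M\<^esub>)" if "linear_form M \<mu>" for \<mu>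
      using linear_form_zero[OF M_vsp that] word_functional_combine(3) by simp
    then show "\<zero>\<^bsub>?F\<^esub> \<in> carrier (coind M)"
      using M.act_zero_right e_I by (auto simp: coind_def)
  next
    fix \<phi> \<psi> assume f: "\<phi> \<in> carrier (coind M)" "\<psi> \<in> carrier (coind M)"
    note D = coindD[OF f(1)] coindD[OF f(2)]
    have "word_functional (\<lambda>w. \<mu> (\<phi> w \<oplus>\<^bsub>M\<^esub> \<psi> w))" if "linear_form M \<mu>" for \<mu>
      using word_functional_combine(1)[OF D(3)[OF that] D(7)[OF that]] D
      by (simp add: linear_formD(1)[OF that])
    then show "\<phi> \<oplus>\<^bsub>?F\<^esub> \<psi> \<in> carrier (coind M)"
      using D e_I by (auto simp: coind_def M.act_add_right)
  next
    fix a \<phi> assume f: "\<phi> \<in> carrier (coind M)"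
    note D = coindD[OF f]
    have "word_functional (\<lambda>w. \<mu> (a \<odot>\<^bsub>M\<^esub> \<phi> w))" if "linear_form M \<mu>" for \<mu>
      using word_functional_combine(2)[OF D(3)[OF that]] D by (simp add: linear_formD(2)[OF that])
    then show "a \<odot>\<^bsub>?F\<^esub> \<phi> \<in> carrier (coind M)"
      using D e_I by (auto simp: coind_def M.act_smult_right)
  qed
  from sspD(8)[OF this] show ?thesis by (simp add: coind_def)
qed

lemma coind_eqI:
  assumes "\<phi> \<in> carrier (coind M)" "\<psi> \<in> carrier (coind M)"
    "\<And>\<mu> w. linear_form M \<mu> \<Longrightarrow> \<mu> (\<phi> w) = \<mu> (\<psi> w)"
  shows "\<phi> = \<psi>"
proof
  show "\<phi> w = \<psi> w" for w
    by (rule separated_eqI[OF M_vsp sep coindD(1)[OF assms(1)] coindD(1)[OF assms(2)] assms(3)])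
qed

text \<open>Under a linear form the action becomes right translation of a word functional. The
  module axioms below are all checked in this form.\<close>

lemma coind_act_eval:
  assumes "\<phi> \<in> carrier (coind M)" "linear_form M \<mu>"
  shows "\<mu> (act (coind M) x \<phi> w) = ins (\<lambda>w. \<mu> (\<phi> w)) w x []"
proof -
  have "act (coind M) x \<phi> w = (\<Oplus>\<^bsub>M\<^esub>k\<in>{..<n}. co k x \<odot>\<^bsub>M\<^esub> \<phi> (w @ [k]))" by (simp add: coind_def)
  also have "\<mu> \<dots> = (\<Sum>k<n. \<mu> (co k x \<odot>\<^bsub>M\<^esub> \<phi> (w @ [k])))"
    using coindD(1)[OF assms(1)] by (intro linear_form_finsum[OF M_vsp assms(2)]) auto
  finally show ?thesis using coindD(1)[OF assms(1)] by (simp add: ins_def linear_formD(2)[OF assms(2)])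
qed

lemma coind_act_closed:
  assumes f: "\<phi> \<in> carrier (coind M)"
  shows "act (coind M) x \<phi> \<in> carrier (coind M)"
proof -
  note D = coindD[OF f]
  let ?x = "act (coind M) x \<phi>"
  have cl: "?x w \<in> carrier M" for w
    unfolding coind_def using D(1) by (auto intro!: M.M.M.finsum_closed)
  have "word_functional (\<lambda>w. \<mu> (?x w))" if "linear_form M \<mu>" for \<mu>
    unfolding coind_act_eval[OF f that] by (rule word_functional_shift[OF D(3)[OF that]])
  moreover have "?x w = \<zero>\<^bsub>M\<^esub>" if "\<not> set w \<subseteq> {..<n}" for w
    unfolding coind_def using D(2)[of "w @ _"] that
    by simp
  moreover have "?x (i # w) = act M (e i) (?x w)" if i: "i < r" for i w
  proof (rule separated_eqI[OF M_vsp sep cl])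
    show "act M (e i) (?x w) \<in> carrier M" using cl e_I[OF i] by (auto intro: M.act_closed)
    fix \<mu> assume mu: "linear_form M \<mu>"
    have mi: "linear_form M (\<lambda>m. \<mu> (act M (e i) m))" using e_I[OF i] by (intro M.linear_form_act[OF mu]) simp
    show "\<mu> (?x (i # w)) = \<mu> (act M (e i) (?x w))"
      using coind_act_eval[OF f mi, of x w] D(4)[OF i] by (simp add: coind_act_eval[OF f mu]) (simp add: ins_def)
  qed
  ultimately show ?thesis using cl by (auto simp: coind_def)
qed

lemma coind_eval_linear: "linear_form M \<mu> \<Longrightarrow> linear_form (coind M) (\<lambda>\<phi>. \<mu> (\<phi> w))"
  using coindD(1) by (auto simp: linear_form_def coind_simps)

lemma coind_separated: "separated (coind M)"
  unfolding separated_def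
proof (intro ballI impI)
  fix \<phi> assume f: "\<phi> \<in> carrier (coind M)" and z: "\<forall>\<mu>. linear_form (coind M) \<mu> \<longrightarrow> \<mu> \<phi> = 0"
  interpret C: vectorspace class_ring "coind M" by (rule coind_vsp)
  show "\<phi> = \<zero>\<^bsub>coind M\<^esub>"
  proof (rule coind_eqI[OF f])
    show "\<zero>\<^bsub>coind M\<^esub> \<in> carrier (coind M)" by simp
    fix \<mu> w assume mu: "linear_form M \<mu>"
    show "\<mu> (\<phi> w) = \<mu> (\<zero>\<^bsub>coind M\<^esub> w)"
      using z coind_eval_linear[OF mu, of w] linear_form_zero[OF M_vsp mu] by (auto simp: coind_simps)
  qed
qed

lemma coind_lie_module: "lie_module L (coind M)"
proof -
  interpret C: vectorspace class_ring "coind M" by (rule coind_vsp)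
  note cl = coind_act_closed and ev = coind_act_eval
  show ?thesis
  proof (intro lie_module.intro lie_algebra_axioms coind_vsp lie_module_axioms.intro)
    fix x \<phi> assume x: "x \<in> carrier L" and f: "\<phi> \<in> carrier (coind M)"
    show "act (coind M) x \<phi> \<in> carrier (coind M)" by (rule cl[OF f])
    show "act (coind M) (a \<odot> x) \<phi> = a \<odot>\<^bsub>coind M\<^esub> act (coind M) x \<phi>" for a
      by (rule coind_eqI) (use x f coindD(1)[OF cl[OF f]] in \<open>simp_all add: cl coind_simps ev linear_formD(2)[OF ins_linear] linear_formD(2)[of M]\<close>)
    show "act (coind M) x (a \<odot>\<^bsub>coind M\<^esub> \<phi>) = a \<odot>\<^bsub>coind M\<^esub> act (coind M) x \<phi>" for a
      by (rule coind_eqI) (use x f coindD(1)[OF cl[OF f]] coindD(1)[OF f] in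
          \<open>simp_all add: cl coind_simps ev linear_formD(2)[of M] ins_def sum_distrib_left mult.left_commute\<close>)
    fix y assume y: "y \<in> carrier L"
    show "act (coind M) (x \<oplus> y) \<phi> = act (coind M) x \<phi> \<oplus>\<^bsub>coind M\<^esub> act (coind M) y \<phi>"
      by (rule coind_eqI) (use x y f coindD(1)[OF cl[OF f]] in \<open>simp_all add: cl coind_simps ev ins_add linear_formD(1)[of M]\<close>)
    show "act (coind M) (bracket L x y) \<phi> = act (coind M) x (act (coind M) y \<phi>) \<ominus>\<^bsub>coind M\<^esub> act (coind M) y (act (coind M) x \<phi>)"
    proof (rule coind_eqI)
      fix \<mu> w assume mu: "linear_form M \<mu>"
      have "\<mu> ((act (coind M) x (act (coind M) y \<phi>) \<ominus>\<^bsub>coind M\<^esub> act (coind M) y (act (coind M) x \<phi>)) w)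
          = \<mu> (act (coind M) x (act (coind M) y \<phi>) w) - \<mu> (act (coind M) y (act (coind M) x \<phi>) w)"
        by (rule linear_form_diff(1)[OF coind_vsp coind_eval_linear[OF mu]]) (auto intro!: cl f)
      then show "\<mu> (act (coind M) (bracket L x y) \<phi> w)
          = \<mu> ((act (coind M) x (act (coind M) y \<phi>) \<ominus>\<^bsub>coind M\<^esub> act (coind M) y (act (coind M) x \<phi>)) w)"
        using word_functional_bracket[OF coindD(3)[OF f mu] x y] by (simp add: ev[OF f mu] ev[OF cl[OF f] mu])
    qed (auto intro!: cl f C.M.minus_closed)
  next
    fix x \<phi> \<psi> assume x: "x \<in> carrier L" and f: "\<phi> \<in> carrier (coind M)" "\<psi> \<in> carrier (coind M)"
    have s: "\<phi> \<oplus>\<^bsub>coind M\<^esub> \<psi> \<in> carrier (coind M)" using f by simp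
    show "act (coind M) x (\<phi> \<oplus>\<^bsub>coind M\<^esub> \<psi>) = act (coind M) x \<phi> \<oplus>\<^bsub>coind M\<^esub> act (coind M) x \<psi>"
    proof (rule coind_eqI)
      fix \<mu> w assume mu: "linear_form M \<mu>"
      show "\<mu> (act (coind M) x (\<phi> \<oplus>\<^bsub>coind M\<^esub> \<psi>) w) = \<mu> ((act (coind M) x \<phi> \<oplus>\<^bsub>coind M\<^esub> act (coind M) x \<psi>) w)"
        using coindD(1)[OF f(1)] coindD(1)[OF f(2)] coindD(1)[OF cl[OF f(1)]] coindD(1)[OF cl[OF f(2)]]
        by (simp add: ev[OF s mu] ev[OF f(1) mu] ev[OF f(2) mu] coind_simps linear_formD(1)[OF mu])
          (simp add: ins_def sum.distrib algebra_simps)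
    qed (use s f cl in auto)
  qed
qed

text \<open>For a basis vector, the p-th power of the action appends e_i^p to the argument, so the
  equation is the power rule at the end of a word.\<close>

lemma coind_p_character: "has_p_character L \<chi> (coind M)"
proof (rule p_character_from_basis[OF coind_lie_module coind_separated \<chi>_linear])
  interpret C: lie_module L "coind M" by (rule coind_lie_module)
  fix i \<phi> assume i: "i < n" and f: "\<phi> \<in> carrier (coind M)"
  have cl: "(act (coind M) (e i) ^^ k) \<phi> \<in> carrier (coind M)" for k
    by (induction k) (auto simp: f coind_act_closed)
  have ev: "\<mu> ((act (coind M) (e i) ^^ k) \<phi> w) = \<mu> (\<phi> (w @ replicate k i))" if mu: "linear_form M \<mu>" for \<mu> k w
  proof (induction k arbitrary: w)
    case (Suc k)
    have "\<mu> ((act (coind M) (e i) ^^ Suc k) \<phi> w) = \<mu> ((act (coind M) (e i) ^^ k) \<phi> (w @ [i]))"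
      using i by (simp add: coind_act_eval[OF cl mu] ins_e)
    then show ?case using Suc by simp
  qed simp
  show "(act (coind M) (e i) ^^ p) \<phi> = act (coind M) (pmap L (e i)) \<phi> \<oplus>\<^bsub>coind M\<^esub> \<chi> (e i) ^ p \<odot>\<^bsub>coind M\<^esub> \<phi>"
  proof (rule coind_eqI[OF cl])
    show "act (coind M) (pmap L (e i)) \<phi> \<oplus>\<^bsub>coind M\<^esub> \<chi> (e i) ^ p \<odot>\<^bsub>coind M\<^esub> \<phi> \<in> carrier (coind M)"
      using f coind_act_closed by simp
    fix \<mu> w assume mu: "linear_form M \<mu>"
    have "\<mu> ((act (coind M) (pmap L (e i)) \<phi> \<oplus>\<^bsub>coind M\<^esub> \<chi> (e i) ^ p \<odot>\<^bsub>coind M\<^esub> \<phi>) w)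
        = ins (\<lambda>w. \<mu> (\<phi> w)) w (pmap L (e i)) [] + \<chi> (e i) ^ p * \<mu> (\<phi> w)"
      using coindD(1)[OF f] coindD(1)[OF coind_act_closed[OF f]]
      by (simp add: coind_simps linear_formD[OF mu] coind_act_eval[OF f mu])
    then show "\<mu> ((act (coind M) (e i) ^^ p) \<phi> w) = \<mu> ((act (coind M) (pmap L (e i)) \<phi> \<oplus>\<^bsub>coind M\<^esub> \<chi> (e i) ^ p \<odot>\<^bsub>coind M\<^esub> \<phi>) w)"
      using word_functional_power[OF coindD(3)[OF f mu] i, of w "[]"] by (simp add: ev[OF mu])
  qed
qed

text \<open>Evaluation at the empty word is the counit of Frobenius reciprocity. It is I-linear
  because a one-letter word is both appended and prefixed to the empty word, and prefixing letters
  of I is the action on M.\<close>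

lemma coind_eval_act:
  assumes f: "\<phi> \<in> carrier (coind M)" and y: "y \<in> I"
  shows "act (coind M) y \<phi> [] = act M y (\<phi> [])"
proof (rule separated_eqI[OF M_vsp sep coindD(1)[OF coind_act_closed[OF f]]])
  show "act M y (\<phi> []) \<in> carrier M" using y coindD(1)[OF f] by (intro M.act_closed) auto
  fix \<mu> assume mu: "linear_form M \<mu>"
  show "\<mu> (act (coind M) y \<phi> []) = \<mu> (act M y (\<phi> []))"
    unfolding coind_act_eval[OF f mu] ins_I[OF y]
  proof (rule I.linear_form_eqI[where f = "\<lambda>y. I.ins (\<lambda>w. \<mu> (\<phi> w)) [] y []"])
    show "linear_form LI (\<lambda>y. I.ins (\<lambda>w. \<mu> (\<phi> w)) [] y [])" by (rule I.ins_linear)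
    show "linear_form LI (\<lambda>y. \<mu> (act M y (\<phi> [])))" by (rule M.linear_form_act_left[OF mu coindD(1)[OF f]])
    show "y \<in> carrier LI" using y by simp
    show "I.ins (\<lambda>w. \<mu> (\<phi> w)) [] (e k) [] = \<mu> (act M (e k) (\<phi> []))" if "k < r" for k
      using that coindD(4)[OF f that, of "[]"] by (simp add: I.ins_e)
  qed
qed

end

text \<open>The adjoint of an I-map f takes x to the function w -> f(w x); I-linearity of f is the
  condition on first letters.\<close>

lemma coind_frobenius:
  fixes P :: "('k, 'l, 'p, 'z) lie_module_scheme" and M :: "('k, 'l, 'm, 'y) lie_module_scheme"
  assumes LM: "lie_module LI M" and sep: "separated M" and LP: "lie_module L P" and pc: "has_p_character L \<chi> P"
    and f: "f \<in> lie_hom LI P M"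
  shows "(\<lambda>x w. if set w \<subseteq> {..<n} then f (word_act P e w x) else \<zero>\<^bsub>M\<^esub>) \<in> lie_hom L P (coind M)"
proof -
  interpret M: lie_module LI M by fact
  interpret P: lie_module L P by fact
  let ?F = "\<lambda>x w. if set w \<subseteq> {..<n} then f (word_act P e w x) else \<zero>\<^bsub>M\<^esub>"
  note M_vsp = M.M.vectorspace_axioms
  note fh = lhomD[OF lie_homD(1)[OF f]] and fa = lie_homD(2)[OF f]
  note wh = lhomD[OF word_act_hom[OF LP]]
  have muf: "linear_form P (\<lambda>v. \<mu> (f v))" if "linear_form M \<mu>" for \<mu>
    using fh linear_formD[OF that] by (auto simp: linear_form_def)
  have F: "?F x \<in> carrier (coind M)" if x: "x \<in> carrier P" for x
  proof -
    have "word_functional (\<lambda>w. \<mu> (?F x w))" if mu: "linear_form M \<mu>" for \<mu>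
      using module_functional[OF LP pc muf[OF mu] x] linear_form_zero[OF M_vsp mu]
      by (simp add: if_distrib[of \<mu>] cong: if_cong)
    moreover have "?F x (i # w) = act M (e i) (?F x w)" if "i < r" for i w
      using that r_le e_I[OF that] fa[of "e i" "word_act P e w x"] wh(1)[OF _ x] M.act_zero_right by auto
    ultimately show ?thesis using fh(1) wh(1)[OF _ x] by (auto simp: coind_def)
  qed
  interpret C: lie_module L "coind M" by (rule coind_lie_module[OF LM sep])
  have "?F (act P x v) = act (coind M) x (?F v)" if x: "x \<in> carrier L" and v: "v \<in> carrier P" for x v
  proof (rule coind_eqI[OF LM sep F])
    show "act P x v \<in> carrier P" using x v by (rule P.act_closed)
    show "act (coind M) x (?F v) \<in> carrier (coind M)" using x F[OF v] by (rule C.act_closed)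
    fix \<mu> w assume mu: "linear_form M \<mu>"
    show "\<mu> (?F (act P x v) w) = \<mu> (act (coind M) x (?F v) w)"
    proof (cases "set w \<subseteq> {..<n}")
      case True
      have lw: "linear_form P (\<lambda>v. \<mu> (f (word_act P e w v)))"
        using wh[OF True] linear_formD[OF muf[OF mu]] by (auto simp: linear_form_def)
      show ?thesis
        using linear_form_expand[OF P.linear_form_act_left[OF lw v] x] True
        by (simp add: coind_act_eval[OF LM sep F[OF v] mu] ins_def)
    next
      case False
      then show ?thesis
        using linear_form_zero[OF M_vsp mu] by (simp add: coind_act_eval[OF LM sep F[OF v] mu] ins_def)
    qed
  qed
  moreover have "?F \<in> lhom P (coind M)"
    by (rule lhomI, rule F) (auto simp: coind_simps fh wh intro!: ext)
  ultimately show ?thesis by (simp add: lie_hom_def)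
qed

lemma coind_map:
  fixes M :: "('k, 'l, 'm, 'y) lie_module_scheme" and M' :: "('k, 'l, 'm2, 'z) lie_module_scheme"
  assumes LM: "lie_module LI M" "separated M" and LM': "lie_module LI M'" "separated M'" and h: "h \<in> lie_hom LI M M'"
  shows "(\<lambda>\<phi> w. h (\<phi> w)) \<in> lie_hom L (coind M) (coind M')"
proof -
  interpret M: lie_module LI M by (rule LM)
  interpret M': lie_module LI M' by (rule LM')
  note hh = lhomD[OF lie_homD(1)[OF h]] and ha = lie_homD(2)[OF h]
  have h0: "h \<zero>\<^bsub>M\<^esub> = \<zero>\<^bsub>M'\<^esub>" by (rule lhom_zero(1)[OF M.M.vectorspace_axioms M'.M.vectorspace_axioms lie_homD(1)[OF h]])
  have muh: "linear_form M (\<lambda>v. \<mu> (h v))" if "linear_form M' \<mu>" for \<mu>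
    using hh linear_formD[OF that] by (auto simp: linear_form_def)
  have F: "(\<lambda>w. h (\<phi> w)) \<in> carrier (coind M')" if f: "\<phi> \<in> carrier (coind M)" for \<phi>
  proof -
    have "word_functional (\<lambda>w. \<mu> (h (\<phi> w)))" if "linear_form M' \<mu>" for \<mu>
      by (rule coindD(3)[OF LM f muh[OF that]])
    then show ?thesis using coindD(1,2,4)[OF LM f] hh(1) h0 ha e_I by (auto simp: coind_def)
  qed
  have "(\<lambda>w. h (act (coind M) x \<phi> w)) = act (coind M') x (\<lambda>w. h (\<phi> w))"
    if x: "x \<in> carrier L" and f: "\<phi> \<in> carrier (coind M)" for x \<phi>
  proof (rule coind_eqI[OF LM'])
    show "(\<lambda>w. h (act (coind M) x \<phi> w)) \<in> carrier (coind M')"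
      by (rule F[OF coind_act_closed[OF LM f]])
    show "act (coind M') x (\<lambda>w. h (\<phi> w)) \<in> carrier (coind M')"
      by (rule coind_act_closed[OF LM' F[OF f]])
    fix \<mu> w assume mu: "linear_form M' \<mu>"
    show "\<mu> (h (act (coind M) x \<phi> w)) = \<mu> (act (coind M') x (\<lambda>w. h (\<phi> w)) w)"
      by (simp add: coind_act_eval[OF LM f muh[OF mu]] coind_act_eval[OF LM' F[OF f] mu])
  qed
  moreover have "(\<lambda>\<phi> w. h (\<phi> w)) \<in> lhom (coind M) (coind M')"
    by (rule lhomI) (auto simp: F coind_simps hh coindD(1)[OF LM] intro!: ext)
  ultimately show ?thesis by (simp add: lie_hom_def)
qed

text \<open>Exactness of coinduction. By freeness a preimage may be chosen at will on normal words
  in letters outside I; letters of I in front are then governed by the action on M, and the diamond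
  lemma extends the values from normal words to all words.\<close>

lemma coind_map_surj:
  fixes M :: "('k, 'l, 'm, 'y) lie_module_scheme" and M' :: "('k, 'l, 'm2, 'z) lie_module_scheme"
  assumes LM: "lie_module LI M" "separated M" and LM': "lie_module LI M'" "separated M'"
    and pc: "has_p_character LI (\<lambda>_. 0) M"
    and h: "h \<in> lie_hom LI M M'" and surj: "h ` carrier M = carrier M'"
  shows "(\<lambda>\<phi> w. h (\<phi> w)) ` carrier (coind M) = carrier (coind M')"
proof
  note hom = lhomD[OF lie_homD(1)[OF coind_map[OF LM LM' h]]]
  show "(\<lambda>\<phi> w. h (\<phi> w)) ` carrier (coind M) \<subseteq> carrier (coind M')" using hom(1) by auto
  interpret M: lie_module LI M by (rule LM)
  interpret M': lie_module LI M' by (rule LM')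
  note M_vsp = M.M.vectorspace_axioms
  note hh = lhomD[OF lie_homD(1)[OF h]] and ha = lie_homD(2)[OF h]
  show "carrier (coind M') \<subseteq> (\<lambda>\<phi> w. h (\<phi> w)) ` carrier (coind M)"
  proof
    fix \<phi>' assume f': "\<phi>' \<in> carrier (coind M')"
    note D' = coindD[OF LM' f']
    let ?N = "{v. normal_word v \<and> set v \<subseteq> {..<n}}"
    \<comment> \<open>Functionals dual to the normal words. They spread prescribed vectors over all
      words by the finite sum that defines \<open>\<phi>\<close>.\<close>
    have "\<exists>\<Phi>. word_functional \<Phi> \<and> (\<forall>w. normal_word w \<longrightarrow> set w \<subseteq> {..<n} \<longrightarrow> \<Phi> w = (if w = v then 1 else 0))" for v
    proof -
      obtain \<Phi> where P: "\<forall>w. normal_word w \<longrightarrow> \<Phi> w = (if w = v then 1 else 0)"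
          "\<And>u l s v. (l, s) \<in> rules \<Longrightarrow> \<Phi> (u @ l @ v) = rhs_val s u v \<Phi>"
        using functional_on_normal_words[of "\<lambda>w. if w = v then 1 else 0"] by auto
      from P(1) word_functional_truncate[of \<Phi>, OF P(2)] show ?thesis by fastforce
    qed
    then obtain D where wfD: "\<And>v. word_functional (D v)"
      and Dn: "\<And>v w. normal_word w \<Longrightarrow> set w \<subseteq> {..<n} \<Longrightarrow> D v w = (if w = v then 1 else 0)" by metis
    define m where "m w = (SOME x. x \<in> carrier M \<and> h x = \<phi>' w)" for w
    have m: "m w \<in> carrier M" "h (m w) = \<phi>' w" for w
    proof -
      have "\<exists>x. x \<in> carrier M \<and> h x = \<phi>' w" using surj D'(1)[of w] by (metis imageE)
      from someI_ex[OF this] show "m w \<in> carrier M" "h (m w) = \<phi>' w" by (auto simp: m_def)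
    qed
    \<comment> \<open>Only the part of \<open>v\<close> behind its leading letters from I gets a
      chosen preimage; the leading letters act on it. Choosing freely at every normal word would
      violate the condition on first letters.\<close>
    define \<psi> where "\<psi> v = word_act M e (takeWhile (\<lambda>i. i < r) v) (m (dropWhile (\<lambda>i. i < r) v))" for v
    have wcl: "word_act M e a x \<in> carrier M" if "set a \<subseteq> {..<r}" "x \<in> carrier M" for a x
      by (rule I.word_act_closed[OF LM(1) that])
    have \<psi>: "\<psi> v \<in> carrier M" for v
      unfolding \<psi>_def by (rule wcl) (auto dest: set_takeWhileD simp: m)
    define \<phi> where "\<phi> w = (\<Oplus>\<^bsub>M\<^esub>v\<in>?N. D v w \<odot>\<^bsub>M\<^esub> \<psi> v)" for w
    have cl: "\<phi> w \<in> carrier M" for w unfolding \<phi>_def using \<psi> by (auto intro!: M.M.M.finsum_closed)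
    have mu\<phi>: "\<mu> (\<phi> w) = (\<Sum>v\<in>?N. D v w * \<mu> (\<psi> v))" if mu: "linear_form M \<mu>" for \<mu> w
    proof -
      have "\<mu> (\<phi> w) = (\<Sum>v\<in>?N. \<mu> (D v w \<odot>\<^bsub>M\<^esub> \<psi> v))"
        unfolding \<phi>_def using \<psi> finite_normal_words by (intro linear_form_finsum[OF M_vsp mu]) auto
      then show ?thesis using \<psi> by (simp add: linear_formD(2)[OF mu])
    qed
    have wf\<phi>: "word_functional (\<lambda>w. \<mu> (\<phi> w))" if mu: "linear_form M \<mu>" for \<mu>
    proof -
      have "word_functional (\<lambda>w. \<Sum>v\<in>F. D v w * \<mu> (\<psi> v))" if "finite F" for F
        using that
      proof (induction F rule: finite_induct)
        case (insert v F)
        then show ?case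
          using word_functional_combine(1)[OF word_functional_combine(2)[OF wfD[of v], of "\<mu> (\<psi> v)"] insert.IH]
          by (simp add: mult.commute)
      qed (simp add: word_functional_combine(3))
      then show ?thesis unfolding mu\<phi>[OF mu] using finite_normal_words by blast
    qed
    have \<phi>n: "\<phi> v = \<psi> v" if v: "normal_word v" "set v \<subseteq> {..<n}" for v
    proof (rule separated_eqI[OF M_vsp LM(2) cl \<psi>])
      fix \<mu> assume mu: "linear_form M \<mu>"
      have "\<mu> (\<phi> v) = (\<Sum>v'\<in>?N. if v = v' then \<mu> (\<psi> v') else 0)"
        unfolding mu\<phi>[OF mu] using v by (intro sum.cong) (auto simp: Dn)
      also have "\<dots> = \<mu> (\<psi> v)" using v finite_normal_words by (simp add: sum.delta')
      finally show "\<mu> (\<phi> v) = \<mu> (\<psi> v)" .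
    qed
    have \<phi>0: "\<phi> w = \<zero>\<^bsub>M\<^esub>" if "\<not> set w \<subseteq> {..<n}" for w
    proof (rule separated_eqI[OF M_vsp LM(2) cl])
      show "\<zero>\<^bsub>M\<^esub> \<in> carrier M" by simp
      fix \<mu> assume mu: "linear_form M \<mu>"
      show "\<mu> (\<phi> w) = \<mu> \<zero>\<^bsub>M\<^esub>"
        using wf\<phi>[OF mu] that linear_form_zero[OF M_vsp mu] unfolding word_functional_def by simp
    qed
    \<comment> \<open>For fixed \<open>b\<close> both sides are functionals of \<open>a\<close> for
      the rules of I. They agree at normal \<open>a\<close>, where \<open>a @ b\<close> is normal
      and has its prescribed value, hence at all words \<open>a\<close> over I.\<close>
    have split: "\<phi> (a @ b) = word_act M e a (m b)"
      if a: "set a \<subseteq> {..<r}" and b: "normal_word b" "set b \<subseteq> {r..<n}" for a b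
    proof (rule separated_eqI[OF M_vsp LM(2) cl wcl[OF a m(1)]])
      fix \<mu> assume mu: "linear_form M \<mu>"
      have "I.word_functional (\<lambda>a. if set a \<subseteq> {..<r} then \<mu> (\<phi> (a @ b)) else 0)"
      proof (rule I.word_functional_truncate)
        fix u l s v assume l: "(l, s) \<in> I.rules"
        obtain s' where s': "(l, s') \<in> rules" using rule_I[OF l] by blast
        have "\<mu> (\<phi> (u @ l @ (v @ b))) = rhs_val s' u (v @ b) (\<lambda>w. \<mu> (\<phi> w))"
          using wf\<phi>[OF mu] s' unfolding word_functional_def by blast
        then show "\<mu> (\<phi> ((u @ l @ v) @ b)) = I.rhs_val s u v (\<lambda>a. \<mu> (\<phi> (a @ b)))"
          unfolding rhs_val_I[OF s' l] by (simp add: I.rhs_val_def)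
      qed
      moreover have "I.word_functional (\<lambda>a. if set a \<subseteq> {..<r} then \<mu> (word_act M e a (m b)) else 0)"
        by (rule I.module_functional[OF LM(1) pc mu m(1)])
      ultimately have "(\<lambda>a. if set a \<subseteq> {..<r} then \<mu> (\<phi> (a @ b)) else 0) a
          = (\<lambda>a. if set a \<subseteq> {..<r} then \<mu> (word_act M e a (m b)) else 0) a"
      proof (rule I.word_functional_eqI)
        fix a assume na: "I.normal_word a" and a: "set a \<subseteq> {..<r}"
        have "normal_word (a @ b)" by (rule normal_word_append[OF na a b])
        moreover have "set (a @ b) \<subseteq> {..<n}" using a b r_le by auto
        moreover have "takeWhile (\<lambda>i. i < r) (a @ b) = a \<and> dropWhile (\<lambda>i. i < r) (a @ b) = b"
        proof -
          have "takeWhile (\<lambda>i. i < r) b = []" "dropWhile (\<lambda>i. i < r) b = b" using b by (cases b; auto)+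
          then show ?thesis using a by (auto simp: subset_iff)
        qed
        ultimately show "(if set a \<subseteq> {..<r} then \<mu> (\<phi> (a @ b)) else 0) = (if set a \<subseteq> {..<r} then \<mu> (word_act M e a (m b)) else 0)"
          using \<phi>n[of "a @ b"] by (simp add: \<psi>_def)
      qed
      then show "\<mu> (\<phi> (a @ b)) = \<mu> (word_act M e a (m b))" using a by simp
    qed
    have wf_cons: "word_functional (\<lambda>w. \<mu> (\<phi> (i # w)))" if mu: "linear_form M \<mu>" and i: "i < n" for \<mu> i
      using wf\<phi>[OF mu] i unfolding word_functional_def rhs_val_def
      by (auto simp del: append.simps simp add: append.simps(2)[symmetric])
    \<comment> \<open>Both sides are word functionals in \<open>w\<close>, so normal
      \<open>w\<close> suffices. There \<open>split\<close> applies even though \<open>i # w\<close>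
      need not be normal.\<close>
    have consI: "\<phi> (i # w) = act M (e i) (\<phi> w)" if i: "i < r" for i w
    proof (rule separated_eqI[OF M_vsp LM(2) cl])
      show "act M (e i) (\<phi> w) \<in> carrier M" using cl e_I[OF i] by (auto intro: M.act_closed)
      fix \<mu> assume mu: "linear_form M \<mu>"
      have mi: "linear_form M (\<lambda>m. \<mu> (act M (e i) m))" using e_I[OF i] by (intro M.linear_form_act[OF mu]) simp
      have "(\<lambda>w. \<mu> (\<phi> (i # w))) w = (\<lambda>w. \<mu> (act M (e i) (\<phi> w))) w"
      proof (rule word_functional_eqI[OF wf_cons[OF mu] wf\<phi>[OF mi]])
        show "i < n" using i r_le by simp
        fix v assume v: "normal_word v" "set v \<subseteq> {..<n}"
        let ?a = "takeWhile (\<lambda>i. i < r) v" and ?b = "dropWhile (\<lambda>i. i < r) v"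
        note sp = normal_word_split[OF v]
        have "\<phi> ((i # ?a) @ ?b) = word_act M e (i # ?a) (m ?b)" using sp i by (intro split) auto
        moreover have "\<phi> (?a @ ?b) = word_act M e ?a (m ?b)" using sp by (intro split) auto
        ultimately show "\<mu> (\<phi> (i # v)) = \<mu> (act M (e i) (\<phi> v))" by simp
      qed
      then show "\<mu> (\<phi> (i # w)) = \<mu> (act M (e i) (\<phi> w))" by simp
    qed
    have f: "\<phi> \<in> carrier (coind M)" using cl \<phi>0 wf\<phi> consI by (auto simp: coind_def)
    have "(\<lambda>w. h (\<phi> w)) = \<phi>'"
    proof (rule coind_eqI[OF LM' hom(1)[OF f] f'])
      fix \<mu> w assume mu: "linear_form M' \<mu>"
      have "(\<lambda>w. \<mu> (h (\<phi> w))) w = (\<lambda>w. \<mu> (\<phi>' w)) w"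
      proof (rule word_functional_eqI[OF coindD(3)[OF LM' hom(1)[OF f] mu] D'(3)[OF mu]])
        fix v assume v: "normal_word v" "set v \<subseteq> {..<n}"
        let ?a = "takeWhile (\<lambda>i. i < r) v" and ?b = "dropWhile (\<lambda>i. i < r) v"
        have "h (word_act M e a x) = word_act M' e a (h x)" if "set a \<subseteq> {..<r}" "x \<in> carrier M" for a x
          using that by (induction a) (auto simp: ha e_I wcl)
        moreover have "\<phi>' (a @ b) = word_act M' e a (\<phi>' b)" if "set a \<subseteq> {..<r}" for a b
          using that by (induction a) (auto simp: D'(4))
        ultimately show "\<mu> (h (\<phi> v)) = \<mu> (\<phi>' v)"
          using normal_word_split(3)[OF v] m unfolding \<phi>n[OF v] \<psi>_def by (metis takeWhile_dropWhile_id)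
      qed
      then show "\<mu> (h (\<phi> w)) = \<mu> (\<phi>' w)" by simp
    qed
    then show "\<phi>' \<in> (\<lambda>\<phi> w. h (\<phi> w)) ` carrier (coind M)" using f by blast
  qed
qed

text \<open>A lifting problem over I is turned by coinduction into one over L, solved there, and
  brought back by evaluation at the empty word. Lifting over L enters as an assumption about these
  two coinduced modules only, independent of how projectivity is encoded.\<close>

theorem frobenius_lift:
  fixes M :: "('k, 'l, 'm, 'y) lie_module_scheme" and M' :: "('k, 'l, 'm2, 'z) lie_module_scheme"
    and P :: "('k, 'l, 'p, 'u) lie_module_scheme"
  assumes LM: "lie_module LI M" "separated M" and LM': "lie_module LI M'" "separated M'"
    and pc: "has_p_character LI (\<lambda>_. 0) M"
    and h: "h \<in> lie_hom LI M M'" "h ` carrier M = carrier M'"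
    and LP: "lie_module L P" "has_p_character L \<chi> P" and f: "f \<in> lie_hom LI P M'"
    and lift: "\<And>G F. G \<in> lie_hom L (coind M) (coind M') \<Longrightarrow> G ` carrier (coind M) = carrier (coind M') \<Longrightarrow>
      F \<in> lie_hom L P (coind M') \<Longrightarrow> \<exists>H\<in>lie_hom L P (coind M). \<forall>x\<in>carrier P. G (H x) = F x"
  shows "\<exists>g\<in>lie_hom LI P M. \<forall>x\<in>carrier P. h (g x) = f x"
proof -
  let ?F = "\<lambda>x w. if set w \<subseteq> {..<n} then f (word_act P e w x) else \<zero>\<^bsub>M'\<^esub>"
  obtain H where H: "H \<in> lie_hom L P (coind M)" "\<And>x. x \<in> carrier P \<Longrightarrow> (\<lambda>w. h (H x w)) = ?F x"
    using lift[OF coind_map[OF LM LM' h(1)] coind_map_surj[OF LM LM' pc h] coind_frobenius[OF LM' LP f]] by blast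
  note Hh = lhomD[OF lie_homD(1)[OF H(1)]] and Ha = lie_homD(2)[OF H(1)]
  have "(\<lambda>x. H x []) \<in> lhom P M"
    by (rule lhomI) (auto simp: Hh coind_simps coindD(1)[OF LM])
  moreover have "H (act P y x) [] = act M y (H x [])" if "y \<in> I" "x \<in> carrier P" for x y
    using Ha[of y x] coind_eval_act[OF LM Hh(1) that(1)] that I_carrier by simp
  ultimately have "(\<lambda>x. H x []) \<in> lie_hom LI P M" by (simp add: lie_hom_def)
  moreover have "h (H x []) = f x" if "x \<in> carrier P" for x
    using fun_cong[OF H(2)[OF that], of "[]"] by simp
  ultimately show ?thesis by (intro bexI[of _ "\<lambda>x. H x []"]) auto
qed

end

section \<open>Lie modules and modules over $u(L,\chi)$\<close>

lemma free_algebra_carrier: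
  "f \<in> carrier (free_algebra X) \<longleftrightarrow> finite {w. f w \<noteq> 0} \<and> {w. f w \<noteq> 0} \<subseteq> lists X"
  by (simp add: free_algebra_def)

lemma free_algebra_simps:
  "(f \<oplus>\<^bsub>free_algebra X\<^esub> g) w = f w + g w" "\<zero>\<^bsub>free_algebra X\<^esub> w = 0"
  "(f \<otimes>\<^bsub>free_algebra X\<^esub> g) w = (\<Sum>i\<le>length w. f (take i w) * g (drop i w))"
  "\<one>\<^bsub>free_algebra X\<^esub> = monomial 1 []"
  by (auto simp: free_algebra_def monomial_def)

lemma monomial_closed [simp]: "w \<in> lists X \<Longrightarrow> monomial a w \<in> carrier (free_algebra X)"
  by (auto simp: free_algebra_def monomial_def)

lemma monomial_mult: "monomial a u \<otimes>\<^bsub>free_algebra X\<^esub> monomial b v = monomial (a * b) (u @ v)"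
proof
  fix w
  show "(monomial a u \<otimes>\<^bsub>free_algebra X\<^esub> monomial b v) w = monomial (a * b) (u @ v) w"
  proof (cases "w = u @ v")
    case True
    have "(monomial a u \<otimes>\<^bsub>free_algebra X\<^esub> monomial b v) w
        = (\<Sum>i\<le>length w. if i = length u then a * b else 0)"
      unfolding free_algebra_simps
    proof (rule sum.cong[OF refl])
      fix i assume "i \<in> {..length w}"
      then have "take i w = u \<longleftrightarrow> i = length u"
        using True by (metis append_eq_conv_conj atMost_iff length_take min.absorb2)
      then show "monomial a u (take i w) * monomial b v (drop i w) = (if i = length u then a * b else 0)"
        using True by (auto simp: monomial_def)
    qed
    then show ?thesis using True by (simp add: monomial_def)
  next
    case False
    have "monomial a u (take i w) * monomial b v (drop i w) = 0" for i
      using False append_take_drop_id[of i w] by (auto simp: monomial_def)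
    then show ?thesis using False by (simp add: free_algebra_simps monomial_def)
  qed
qed

lemma monomial_add: "monomial a w \<oplus>\<^bsub>free_algebra X\<^esub> monomial b w = monomial (a + b) w"
  by (rule ext) (simp add: free_algebra_simps monomial_def)

lemma free_algebra_mult_closed:
  fixes f g :: "'l list \<Rightarrow> 'k::field"
  assumes f: "f \<in> carrier (free_algebra X)" and g: "g \<in> carrier (free_algebra X)"
  shows "f \<otimes>\<^bsub>free_algebra X\<^esub> g \<in> carrier (free_algebra X)"
proof -
  let ?S = "(\<lambda>(u, v). u @ v) ` ({w. f w \<noteq> 0} \<times> {w. g w \<noteq> 0})"
  have "{w. (f \<otimes>\<^bsub>free_algebra X\<^esub> g) w \<noteq> 0} \<subseteq> ?S"
  proof
    fix w assume "w \<in> {w. (f \<otimes>\<^bsub>free_algebra X\<^esub> g) w \<noteq> 0}"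
    then obtain i where "f (take i w) * g (drop i w) \<noteq> 0"
      unfolding free_algebra_simps by (metis (mono_tags, lifting) mem_Collect_eq sum.neutral)
    then have "(take i w, drop i w) \<in> {w. f w \<noteq> 0} \<times> {w. g w \<noteq> 0}" by auto
    then show "w \<in> ?S" by (metis (no_types, lifting) append_take_drop_id case_prod_conv image_eqI)
  qed
  moreover have "finite ?S" using f g by (auto simp: free_algebra_carrier)
  moreover have "?S \<subseteq> lists X"
    using f g by (auto simp: free_algebra_carrier subset_iff in_lists_conv_set)
  ultimately show ?thesis unfolding free_algebra_carrier using finite_subset by blast
qed

lemma free_algebra_assoc:
  fixes f g h :: "'l list \<Rightarrow> 'k::field"
  shows "f \<otimes>\<^bsub>free_algebra X\<^esub> g \<otimes>\<^bsub>free_algebra X\<^esub> h = f \<otimes>\<^bsub>free_algebra X\<^esub> (g \<otimes>\<^bsub>free_algebra X\<^esub> h)"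
proof
  fix w :: "'l list"
  let ?n = "length w"
  have "(f \<otimes>\<^bsub>free_algebra X\<^esub> g \<otimes>\<^bsub>free_algebra X\<^esub> h) w
      = (\<Sum>i\<le>?n. \<Sum>j\<le>i. f (take j w) * g (take (i - j) (drop j w)) * h (drop i w))"
    unfolding free_algebra_simps by (intro sum.cong refl) (auto simp: sum_distrib_right drop_take min_def intro!: sum.cong)
  also have "\<dots> = (\<Sum>(i, j)\<in>Sigma {..?n} (\<lambda>i. {..i}). f (take j w) * g (take (i - j) (drop j w)) * h (drop i w))"
    by (rule sum.Sigma) auto
  \<comment> \<open>A pair of cuts j <= i of the word is described by the first cut and the distance
    k = i - j.\<close>
  also have "\<dots> = (\<Sum>(j, k)\<in>Sigma {..?n} (\<lambda>j. {..?n - j}). f (take j w) * g (take k (drop j w)) * h (drop (j + k) w))"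
    by (rule sum.reindex_bij_witness[of _ "\<lambda>(j, k). (j + k, j)" "\<lambda>(i, j). (j, i - j)"]) auto
  also have "\<dots> = (\<Sum>j\<le>?n. \<Sum>k\<le>?n - j. f (take j w) * g (take k (drop j w)) * h (drop (j + k) w))"
    by (rule sum.Sigma[symmetric]) auto
  also have "\<dots> = (f \<otimes>\<^bsub>free_algebra X\<^esub> (g \<otimes>\<^bsub>free_algebra X\<^esub> h)) w"
    unfolding free_algebra_simps
    by (intro sum.cong refl) (auto simp: sum_distrib_left mult.assoc add.commute intro!: sum.cong)
  finally show "(f \<otimes>\<^bsub>free_algebra X\<^esub> g \<otimes>\<^bsub>free_algebra X\<^esub> h) w
    = (f \<otimes>\<^bsub>free_algebra X\<^esub> (g \<otimes>\<^bsub>free_algebra X\<^esub> h)) w" .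
qed

lemma ring_free_algebra: "ring (free_algebra X :: ('l list \<Rightarrow> 'k::field) ring)"
proof (rule ringI)
  let ?F = "free_algebra X :: ('l list \<Rightarrow> 'k) ring"
  have add: "f \<oplus>\<^bsub>?F\<^esub> g \<in> carrier ?F" if "f \<in> carrier ?F" "g \<in> carrier ?F" for f g
  proof -
    have sub: "{w. f w + g w \<noteq> 0} \<subseteq> {w. f w \<noteq> 0} \<union> {w. g w \<noteq> 0}" by auto
    have fg: "finite ({w. f w \<noteq> 0} \<union> {w. g w \<noteq> 0})" "{w. f w \<noteq> 0} \<union> {w. g w \<noteq> 0} \<subseteq> lists X"
      using that unfolding free_algebra_carrier by simp_all
    show ?thesis unfolding free_algebra_carrier free_algebra_simps
      using finite_subset[OF sub fg(1)] subset_trans[OF sub fg(2)] by (rule conjI)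
  qed
  show "abelian_group ?F"
  proof (rule abelian_groupI)
    fix f assume f: "f \<in> carrier ?F"
    show "\<exists>g\<in>carrier ?F. g \<oplus>\<^bsub>?F\<^esub> f = \<zero>\<^bsub>?F\<^esub>"
      by (rule bexI[of _ "\<lambda>w. - f w"], rule ext)
        (use f in \<open>simp_all add: free_algebra_simps free_algebra_carrier\<close>)
  next
    show "\<zero>\<^bsub>?F\<^esub> \<in> carrier ?F" by (simp add: free_algebra_carrier free_algebra_simps)
  qed (auto simp: add free_algebra_simps algebra_simps intro!: ext)
  have one: "f \<otimes>\<^bsub>?F\<^esub> monomial 1 [] = f" "monomial 1 [] \<otimes>\<^bsub>?F\<^esub> f = f" for f :: "'l list \<Rightarrow> 'k"
  proof -
    show "f \<otimes>\<^bsub>?F\<^esub> monomial 1 [] = f"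
    proof
      fix w
      have "(f \<otimes>\<^bsub>?F\<^esub> monomial 1 []) w = (\<Sum>i\<le>length w. if i = length w then f w else 0)"
        unfolding free_algebra_simps by (rule sum.cong) (auto simp: monomial_def)
      then show "(f \<otimes>\<^bsub>?F\<^esub> monomial 1 []) w = f w" by simp
    qed
    show "monomial 1 [] \<otimes>\<^bsub>?F\<^esub> f = f"
    proof
      fix w
      have "(monomial 1 [] \<otimes>\<^bsub>?F\<^esub> f) w = (\<Sum>i\<le>length w. if i = 0 then f w else 0)"
        unfolding free_algebra_simps by (rule sum.cong) (auto simp: monomial_def)
      then show "(monomial 1 [] \<otimes>\<^bsub>?F\<^esub> f) w = f w" by simp
    qed
  qed
  show "monoid ?F"
    by (rule monoidI) (auto simp: free_algebra_mult_closed free_algebra_assoc free_algebra_simps(4) one)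
  show "(f \<oplus>\<^bsub>?F\<^esub> g) \<otimes>\<^bsub>?F\<^esub> h = f \<otimes>\<^bsub>?F\<^esub> h \<oplus>\<^bsub>?F\<^esub> g \<otimes>\<^bsub>?F\<^esub> h"
    "h \<otimes>\<^bsub>?F\<^esub> (f \<oplus>\<^bsub>?F\<^esub> g) = h \<otimes>\<^bsub>?F\<^esub> f \<oplus>\<^bsub>?F\<^esub> h \<otimes>\<^bsub>?F\<^esub> g" for f g h
    by (auto simp: free_algebra_simps algebra_simps sum.distrib intro!: ext)
qed

lemma free_algebra_induct [consumes 1, case_names zero monomial add]:
  assumes f: "f \<in> carrier (free_algebra X :: ('l list \<Rightarrow> 'k::field) ring)"
    and zero: "P \<zero>\<^bsub>free_algebra X :: ('l list \<Rightarrow> 'k) ring\<^esub>"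
    and mon: "\<And>a w. w \<in> lists X \<Longrightarrow> P (monomial a w)"
    and add: "\<And>f g. f \<in> carrier (free_algebra X) \<Longrightarrow> g \<in> carrier (free_algebra X) \<Longrightarrow> P f \<Longrightarrow> P g
      \<Longrightarrow> P (f \<oplus>\<^bsub>free_algebra X\<^esub> g)"
  shows "P f"
proof -
  have "finite {w. f w \<noteq> 0}" "{w. f w \<noteq> 0} \<subseteq> lists X" using f by (auto simp: free_algebra_carrier)
  then show ?thesis
  proof (induction "{w. f w \<noteq> 0}" arbitrary: f rule: finite_induct)
    case empty
    then have "f = \<zero>\<^bsub>free_algebra X\<^esub>" by (auto simp: free_algebra_simps intro!: ext)
    then show ?case using zero by simp
  next
    case (insert w S)
    let ?g = "f(w := 0)"
    have S: "S = {v. ?g v \<noteq> 0}" using insert(2,4) by auto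
    have w: "w \<in> lists X" using insert(4,5) by auto
    have gl: "{v. ?g v \<noteq> 0} \<subseteq> lists X" using insert(5) by auto
    have "P ?g" by (rule insert(3)[OF S gl])
    moreover have "?g \<in> carrier (free_algebra X)" using insert(1) S gl by (simp add: free_algebra_carrier)
    moreover have "f = monomial (f w) w \<oplus>\<^bsub>free_algebra X\<^esub> ?g"
      by (auto simp: free_algebra_simps monomial_def intro!: ext)
    ultimately show ?case using add[of "monomial (f w) w" ?g] mon[OF w] w by simp
  qed
qed

lemma (in abelian_group) minus_eq_iff:
  "a \<in> carrier G \<Longrightarrow> b \<in> carrier G \<Longrightarrow> c \<in> carrier G \<Longrightarrow> a \<ominus> b = c \<longleftrightarrow> a = b \<oplus> c"
  by (metis a_comm minus_eq r_neg2 a_inv_closed r_neg1)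

lemma coset_eq_iff:
  assumes "ideal J R" "a \<in> carrier R" "b \<in> carrier R"
  shows "J +>\<^bsub>R\<^esub> a = J +>\<^bsub>R\<^esub> b \<longleftrightarrow> a \<ominus>\<^bsub>R\<^esub> b \<in> J"
proof -
  interpret ideal J R by fact
  have "a \<in> J +>\<^bsub>R\<^esub> b \<longleftrightarrow> a \<ominus>\<^bsub>R\<^esub> b \<in> J" using assms by (intro a_rcos_module_minus ring_axioms)
  moreover have "J +>\<^bsub>R\<^esub> a = J +>\<^bsub>R\<^esub> b \<longleftrightarrow> a \<in> J +>\<^bsub>R\<^esub> b"
    using a_repr_independence'[of a b] a_rcos_self[of a] assms by auto
  ultimately show ?thesis by simp
qed

section \<open>The reduced enveloping algebra\<close>

text \<open>The construction of u(L,chi) is studied from the Lie algebra axioms and closure under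
  the p-map. The quotient L/I therefore enters by \<open>quot_lie_algebra\<close> and
  \<open>quot_pmap_closed\<close>.\<close>

locale red_algebra = lie_algebra L
  for L :: "('k::field, 'l, 'x) restricted_lie_algebra_scheme" (structure) +
  fixes \<chi> :: "'l \<Rightarrow> 'k"
  assumes pmap_closed': "x \<in> carrier L \<Longrightarrow> pmap L x \<in> carrier L"
begin

abbreviation F :: "('l list \<Rightarrow> 'k) ring" where "F \<equiv> free_algebra (carrier L)"
abbreviation A :: "('l list \<Rightarrow> 'k) set set ring" where "A \<equiv> red_uea L \<chi>"

sublocale F: ring F by (rule ring_free_algebra)

text \<open>The composite of both quotient maps. Elements of u(L,chi) are nested sets; below they
  are handled through representatives in the free algebra.\<close>

definition \<kappa> :: "('l list \<Rightarrow> 'k) \<Rightarrow> ('l list \<Rightarrow> 'k) set set" where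
  "\<kappa> f = red_uea_ideal L \<chi> +>\<^bsub>uea L\<^esub> (uea_ideal L +>\<^bsub>F\<^esub> f)"

lemma uea_relations_closed: "uea_relations L \<subseteq> carrier F"
  unfolding uea_relations_def Let_def by (auto simp: bracket_closed)

lemma uea_ideal: "ideal (uea_ideal L) F"
  unfolding uea_ideal_def by (rule F.genideal_ideal[OF uea_relations_closed])

lemma uea_hom: "ring_hom_ring F (uea L) ((+>\<^bsub>F\<^esub>) (uea_ideal L))"
  unfolding uea_def by (rule ideal.rcos_ring_hom_ring[OF uea_ideal])

sublocale U: ring "uea L" unfolding uea_def by (rule ideal.quotient_is_ring[OF uea_ideal])

lemma uea_carrier: "u \<in> carrier (uea L) \<longleftrightarrow> (\<exists>f\<in>carrier F. u = uea_ideal L +>\<^bsub>F\<^esub> f)"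
  by (auto simp: uea_def FactRing_def A_RCOSETS_def')

lemma pow_monomial: "x \<in> carrier L \<Longrightarrow> monomial 1 [x] [^]\<^bsub>F\<^esub> (k::nat) = monomial 1 (replicate k x)"
  by (induction k) (simp_all add: free_algebra_simps(4) monomial_mult replicate_append_same)

text \<open>Lifts the generators of the second ideal to the free algebra, so that the two successive
  quotients can be treated like one.\<close>

lemma red_gen:
  assumes x: "x \<in> carrier L"
  shows "uea_gen L x [^]\<^bsub>uea L\<^esub> CHAR('k) \<ominus>\<^bsub>uea L\<^esub> uea_gen L (pmap L x) \<ominus>\<^bsub>uea L\<^esub> uea_scalar L (\<chi> x ^ CHAR('k))
    = uea_ideal L +>\<^bsub>F\<^esub> (monomial 1 (replicate CHAR('k) x) \<ominus>\<^bsub>F\<^esub> monomial 1 [pmap L x] \<ominus>\<^bsub>F\<^esub> monomial (\<chi> x ^ CHAR('k)) [])"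
    (is "?u = ?v")
    and "uea_gen L x [^]\<^bsub>uea L\<^esub> CHAR('k) \<ominus>\<^bsub>uea L\<^esub> uea_gen L (pmap L x) \<ominus>\<^bsub>uea L\<^esub> uea_scalar L (\<chi> x ^ CHAR('k))
      \<in> carrier (uea L)"
proof -
  interpret h: ring_hom_ring F "uea L" "(+>\<^bsub>F\<^esub>) (uea_ideal L)" by (rule uea_hom)
  have hom: "uea_ideal L +>\<^bsub>F\<^esub> (a \<ominus>\<^bsub>F\<^esub> b \<ominus>\<^bsub>F\<^esub> c)
      = (uea_ideal L +>\<^bsub>F\<^esub> a) \<ominus>\<^bsub>uea L\<^esub> (uea_ideal L +>\<^bsub>F\<^esub> b) \<ominus>\<^bsub>uea L\<^esub> (uea_ideal L +>\<^bsub>F\<^esub> c)"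
    if "a \<in> carrier F" "b \<in> carrier F" "c \<in> carrier F" for a b c
    using that by (simp add: a_minus_def)
  have "monomial (1::'k) [x] \<in> carrier F" using x by simp
  then have "uea_ideal L +>\<^bsub>F\<^esub> monomial 1 (replicate CHAR('k) x) = uea_gen L x [^]\<^bsub>uea L\<^esub> CHAR('k)"
    unfolding uea_gen_def pow_monomial[OF x, symmetric] by (rule h.hom_nat_pow)
  note pw = this[symmetric]
  have "replicate k x \<in> lists (carrier L)" for k by (induction k) (auto simp: x)
  then have "monomial (1::'k) (replicate CHAR('k) x) \<in> carrier F" by (rule monomial_closed)
  moreover have "monomial (1::'k) [pmap L x] \<in> carrier F" "monomial (\<chi> x ^ CHAR('k)) [] \<in> carrier F"
    using pmap_closed'[OF x] by simp_all
  ultimately show "?u = ?v" "?u \<in> carrier (uea L)"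
    unfolding pw uea_gen_def[of L "pmap L x"] uea_scalar_def
    by (rule hom[symmetric], simp only: hom[symmetric] h.hom_closed F.minus_closed)
qed

lemma red_uea_ideal: "ideal (red_uea_ideal L \<chi>) (uea L)"
  unfolding red_uea_ideal_def
  by (rule U.genideal_ideal) (use red_gen(2) in blast)

sublocale A: ring A unfolding red_uea_def by (rule ideal.quotient_is_ring[OF red_uea_ideal])

lemma \<kappa>_hom: "ring_hom_ring F A \<kappa>"
proof -
  interpret h: ring_hom_ring F "uea L" "(+>\<^bsub>F\<^esub>) (uea_ideal L)" by (rule uea_hom)
  interpret k: ring_hom_ring "uea L" A "(+>\<^bsub>uea L\<^esub>) (red_uea_ideal L \<chi>)"
    unfolding red_uea_def by (rule ideal.rcos_ring_hom_ring[OF red_uea_ideal])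
  show ?thesis
    by (rule ring_hom_ringI[OF F.ring_axioms A.ring_axioms]) (simp_all add: \<kappa>_def)
qed

sublocale \<kappa>: ring_hom_ring F A \<kappa> by (rule \<kappa>_hom)

lemma \<kappa>_surj: "a \<in> carrier A \<Longrightarrow> \<exists>f\<in>carrier F. a = \<kappa> f"
  by (auto simp: red_uea_def FactRing_def A_RCOSETS_def' uea_carrier \<kappa>_def)

lemma \<kappa>_eqI:
  assumes "f \<in> carrier F" "g \<in> carrier F" "f \<ominus>\<^bsub>F\<^esub> g \<in> uea_ideal L"
  shows "\<kappa> f = \<kappa> g"
  using coset_eq_iff[OF uea_ideal assms(1,2)] assms(3) by (simp add: \<kappa>_def)

lemma \<kappa>_relation:
  assumes "f \<in> carrier F" "g \<in> carrier F" "f \<ominus>\<^bsub>F\<^esub> g \<in> uea_relations L"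
  shows "\<kappa> f = \<kappa> g"
  using \<kappa>_eqI[OF assms(1,2)] assms(3) F.genideal_self[OF uea_relations_closed] by (auto simp: uea_ideal_def)

lemma \<kappa>_minus:
  "a \<in> carrier F \<Longrightarrow> b \<in> carrier F \<Longrightarrow> \<kappa> (a \<ominus>\<^bsub>F\<^esub> b) = \<kappa> a \<ominus>\<^bsub>A\<^esub> \<kappa> b"
  by (simp add: a_minus_def)

lemma \<kappa>_gen_add:
  assumes x: "x \<in> carrier L" and y: "y \<in> carrier L"
  shows "\<kappa> (monomial 1 [x \<oplus> y]) = \<kappa> (monomial 1 [x]) \<oplus>\<^bsub>A\<^esub> \<kappa> (monomial 1 [y])"
proof -
  have cl: "monomial (1::'k) [x] \<in> carrier F" "monomial (1::'k) [y] \<in> carrier F" "monomial (1::'k) [x \<oplus> y] \<in> carrier F"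
    using x y by simp_all
  have "monomial 1 [x \<oplus> y] \<ominus>\<^bsub>F\<^esub> (monomial 1 [x] \<oplus>\<^bsub>F\<^esub> monomial 1 [y]) \<in> uea_relations L"
    unfolding uea_relations_def Let_def using x y by blast
  from \<kappa>_relation[OF cl(3) F.a_closed[OF cl(1,2)] this] show ?thesis
    unfolding \<kappa>.hom_add[OF cl(1,2)] .
qed

lemma \<kappa>_gen_smult:
  assumes x: "x \<in> carrier L"
  shows "\<kappa> (monomial 1 [a \<odot> x]) = \<kappa> (monomial a [x])"
proof (rule \<kappa>_relation)
  show "monomial 1 [a \<odot> x] \<in> carrier F" "monomial a [x] \<in> carrier F" using x by simp_all
  show "monomial 1 [a \<odot> x] \<ominus>\<^bsub>F\<^esub> monomial a [x] \<in> uea_relations L"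
    unfolding uea_relations_def Let_def using x by blast
qed

lemma \<kappa>_gen_bracket:
  assumes x: "x \<in> carrier L" and y: "y \<in> carrier L"
  shows "\<kappa> (monomial 1 [bracket L x y]) = \<kappa> (monomial 1 [x, y]) \<ominus>\<^bsub>A\<^esub> \<kappa> (monomial 1 [y, x])"
proof -
  have cl: "monomial (1::'k) [x, y] \<in> carrier F" "monomial (1::'k) [y, x] \<in> carrier F"
    "monomial (1::'k) [bracket L x y] \<in> carrier F"
    using x y by (simp_all add: bracket_closed)
  have "monomial 1 [x, y] \<ominus>\<^bsub>F\<^esub> monomial 1 [y, x] \<ominus>\<^bsub>F\<^esub> monomial 1 [bracket L x y] \<in> uea_relations L"
    unfolding uea_relations_def Let_def using x y by blast
  from \<kappa>_relation[OF F.minus_closed[OF cl(1,2)] cl(3) this] show ?thesis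
    unfolding \<kappa>_minus[OF cl(1,2)] by (rule sym)
qed

lemma \<kappa>_gen_power:
  assumes x: "x \<in> carrier L"
  shows "\<kappa> (monomial 1 (replicate CHAR('k) x)) = \<kappa> (monomial 1 [pmap L x]) \<oplus>\<^bsub>A\<^esub> \<kappa> (monomial (\<chi> x ^ CHAR('k)) [])"
proof -
  let ?m = "monomial 1 (replicate CHAR('k) x)" and ?q = "monomial (1::'k) [pmap L x]" and ?s = "monomial (\<chi> x ^ CHAR('k)) []"
  have "replicate k x \<in> lists (carrier L)" for k by (induction k) (auto simp: x)
  then have cl: "?m \<in> carrier F" "?q \<in> carrier F" "?s \<in> carrier F"
    using pmap_closed'[OF x] by (simp_all only: monomial_closed lists.Nil lists.Cons)
  let ?G = "{uea_gen L x [^]\<^bsub>uea L\<^esub> CHAR('k) \<ominus>\<^bsub>uea L\<^esub> uea_gen L (pmap L x)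
        \<ominus>\<^bsub>uea L\<^esub> uea_scalar L (\<chi> x ^ CHAR('k)) | x. x \<in> carrier L}"
  have "?G \<subseteq> carrier (uea L)"
    using red_gen(2) by blast
  then have "?G \<subseteq> red_uea_ideal L \<chi>" unfolding red_uea_ideal_def by (rule U.genideal_self)
  moreover have "uea_ideal L +>\<^bsub>F\<^esub> (?m \<ominus>\<^bsub>F\<^esub> ?q \<ominus>\<^bsub>F\<^esub> ?s) \<in> ?G"
    unfolding red_gen(1)[OF x, symmetric] by (intro CollectI exI[of _ x] conjI refl x)
  ultimately have mem: "uea_ideal L +>\<^bsub>F\<^esub> (?m \<ominus>\<^bsub>F\<^esub> ?q \<ominus>\<^bsub>F\<^esub> ?s) \<in> red_uea_ideal L \<chi>" by (rule subsetD)
  interpret J: ideal "red_uea_ideal L \<chi>" "uea L" by (rule red_uea_ideal)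
  have "\<kappa> (?m \<ominus>\<^bsub>F\<^esub> ?q \<ominus>\<^bsub>F\<^esub> ?s) = red_uea_ideal L \<chi>"
    unfolding \<kappa>_def by (rule J.a_rcos_const[OF mem])
  then have z: "\<kappa> (?m \<ominus>\<^bsub>F\<^esub> ?q \<ominus>\<^bsub>F\<^esub> ?s) = \<zero>\<^bsub>A\<^esub>" by (simp only: red_uea_def FactRing_def ring.simps)
  have "\<kappa> (?m \<ominus>\<^bsub>F\<^esub> ?q \<ominus>\<^bsub>F\<^esub> ?s) = \<kappa> ?m \<ominus>\<^bsub>A\<^esub> \<kappa> ?q \<ominus>\<^bsub>A\<^esub> \<kappa> ?s"
    by (simp only: \<kappa>_minus cl F.minus_closed)
  from this[symmetric] z have "\<kappa> ?m \<ominus>\<^bsub>A\<^esub> \<kappa> ?q \<ominus>\<^bsub>A\<^esub> \<kappa> ?s = \<zero>\<^bsub>A\<^esub>" by (rule trans)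
  then have "\<kappa> ?m \<ominus>\<^bsub>A\<^esub> \<kappa> ?q = \<kappa> ?s"
    by (subst (asm) A.minus_eq_iff) (use cl in \<open>simp_all only: \<kappa>.hom_closed A.minus_closed A.zero_closed A.r_zero\<close>)
  then show ?thesis
    by (rule iffD1[OF A.minus_eq_iff, rotated 3]) (use cl in auto)
qed

end

lemma vsp_cong:
  fixes V :: "('k::field, 'v, 'x) module_scheme" and U :: "('k, 'v, 'y) module_scheme"
  assumes V: "vsp V" and eq: "carrier U = carrier V" "add U = add V" "zero U = zero V"
    and sm: "\<And>a v. v \<in> carrier V \<Longrightarrow> a \<odot>\<^bsub>U\<^esub> v = a \<odot>\<^bsub>V\<^esub> v"
  shows "vsp U"
proof -
  interpret vectorspace class_ring V by fact
  have cl: "a \<odot>\<^bsub>V\<^esub> v \<in> carrier V" if "v \<in> carrier V" for a v using smult_closed[of a v] that by simp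
  show ?thesis
  proof (rule vspI)
    fix v assume "v \<in> carrier U"
    then show "\<exists>w\<in>carrier U. v \<oplus>\<^bsub>U\<^esub> w = \<zero>\<^bsub>U\<^esub>"
      unfolding eq by (intro bexI[of _ "\<ominus>\<^bsub>V\<^esub> v"]) (auto simp: M.r_neg)
  qed (simp_all add: eq sm cl vspD[OF V] M.a_ac)
qed

context left_module
begin

lemma smult_l_minus:
  assumes "a \<in> carrier R" "b \<in> carrier R" "m \<in> carrier M"
  shows "(a \<ominus>\<^bsub>R\<^esub> b) \<odot>\<^bsub>M\<^esub> m = a \<odot>\<^bsub>M\<^esub> m \<ominus>\<^bsub>M\<^esub> b \<odot>\<^bsub>M\<^esub> m"
proof -
  have d: "a \<ominus>\<^bsub>R\<^esub> b \<in> carrier R" using assms by simp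
  have "a = b \<oplus>\<^bsub>R\<^esub> (a \<ominus>\<^bsub>R\<^esub> b)"
    using iffD1[OF R.minus_eq_iff[OF assms(1,2) d] refl] .
  then have "a \<odot>\<^bsub>M\<^esub> m = b \<odot>\<^bsub>M\<^esub> m \<oplus>\<^bsub>M\<^esub> (a \<ominus>\<^bsub>R\<^esub> b) \<odot>\<^bsub>M\<^esub> m"
    using smult_l_distr[OF assms(2) d assms(3)] by argo
  from iffD2[OF M.minus_eq_iff this] show ?thesis
    using assms d by (simp only: smult_closed)
qed

end

section \<open>From modules over the algebra to Lie modules\<close>

context red_algebra
begin

text \<open>Covers are given as modules over u(L,chi), whereas all arguments concern L-modules. This
  is the bridge: scalars act through the constants of the algebra and L through its
  generators.\<close>

definition lie_of :: "(('l list \<Rightarrow> 'k) set set, 'p, 'y) module_scheme \<Rightarrow> ('k, 'l, 'p) lie_module" where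
  "lie_of X = \<lparr>carrier = carrier X, mult = mult X, one = one X, zero = zero X, add = add X,
     smult = (\<lambda>a m. \<kappa> (monomial a []) \<odot>\<^bsub>X\<^esub> m), act = (\<lambda>x m. \<kappa> (monomial 1 [x]) \<odot>\<^bsub>X\<^esub> m)\<rparr>"

lemma lie_of_simps [simp]:
  "carrier (lie_of X) = carrier X" "zero (lie_of X) = zero X" "add (lie_of X) = add X"
  "a \<odot>\<^bsub>lie_of X\<^esub> m = \<kappa> (monomial a []) \<odot>\<^bsub>X\<^esub> m" "act (lie_of X) x m = \<kappa> (monomial 1 [x]) \<odot>\<^bsub>X\<^esub> m"
  by (simp_all add: lie_of_def)

lemma lie_of_minus: "a_inv (lie_of X) = a_inv X" "a_minus (lie_of X) = a_minus X"
  by (simp_all add: fun_eq_iff a_inv_def m_inv_def a_minus_def)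

lemma \<kappa>_monomial_mult:
  "u \<in> lists (carrier L) \<Longrightarrow> v \<in> lists (carrier L)
    \<Longrightarrow> \<kappa> (monomial (a * b) (u @ v)) = \<kappa> (monomial a u) \<otimes>\<^bsub>A\<^esub> \<kappa> (monomial b v)"
  unfolding monomial_mult[symmetric, of _ _ _ _ "carrier L"] by (rule \<kappa>.hom_mult) simp_all

lemma \<kappa>_monomial_closed: "w \<in> lists (carrier L) \<Longrightarrow> \<kappa> (monomial a w) \<in> carrier A"
  by (rule \<kappa>.hom_closed) simp

context
  fixes X :: "(('l list \<Rightarrow> 'k) set set, 'p, 'y) module_scheme"
  assumes X: "left_module A X"
begin

interpretation X: left_module A X by (fact X)

lemma \<kappa>_smult_mult:
  "u \<in> lists (carrier L) \<Longrightarrow> v \<in> lists (carrier L) \<Longrightarrow> m \<in> carrier X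
    \<Longrightarrow> \<kappa> (monomial a u) \<odot>\<^bsub>X\<^esub> (\<kappa> (monomial b v) \<odot>\<^bsub>X\<^esub> m) = \<kappa> (monomial (a * b) (u @ v)) \<odot>\<^bsub>X\<^esub> m"
  by (simp only: \<kappa>_monomial_mult X.smult_assoc \<kappa>_monomial_closed)

lemma lie_of_vsp: "vsp (lie_of X)"
proof (rule vspI)
  fix v assume v: "v \<in> carrier (lie_of X)"
  show "\<exists>w\<in>carrier (lie_of X). v \<oplus>\<^bsub>lie_of X\<^esub> w = \<zero>\<^bsub>lie_of X\<^esub>"
    using v by (intro bexI[of _ "\<ominus>\<^bsub>X\<^esub> v"]) (auto simp: X.M.r_neg)
  show "a \<odot>\<^bsub>lie_of X\<^esub> v \<in> carrier (lie_of X)" for a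
    using v by (simp add: X.smult_closed \<kappa>_monomial_closed)
  show "(a * b) \<odot>\<^bsub>lie_of X\<^esub> v = a \<odot>\<^bsub>lie_of X\<^esub> (b \<odot>\<^bsub>lie_of X\<^esub> v)" for a b
    using \<kappa>_smult_mult[of "[]" "[]" v a b] v by simp
  show "1 \<odot>\<^bsub>lie_of X\<^esub> v = v"
    using \<kappa>.hom_one X.smult_one v by (simp add: free_algebra_simps(4)[symmetric, of "carrier L"])
  show "(a + b) \<odot>\<^bsub>lie_of X\<^esub> v = a \<odot>\<^bsub>lie_of X\<^esub> v \<oplus>\<^bsub>lie_of X\<^esub> b \<odot>\<^bsub>lie_of X\<^esub> v" for a b
  proof -
    have "\<kappa> (monomial (a + b) []) = \<kappa> (monomial a []) \<oplus>\<^bsub>A\<^esub> \<kappa> (monomial b [])"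
      unfolding monomial_add[symmetric, of _ _ _ "carrier L"] by (rule \<kappa>.hom_add) simp_all
    then show ?thesis using v by (simp add: X.smult_l_distr \<kappa>_monomial_closed)
  qed
  show "a \<odot>\<^bsub>lie_of X\<^esub> (v \<oplus>\<^bsub>lie_of X\<^esub> w) = a \<odot>\<^bsub>lie_of X\<^esub> v \<oplus>\<^bsub>lie_of X\<^esub> a \<odot>\<^bsub>lie_of X\<^esub> w"
    if "w \<in> carrier (lie_of X)" for a w
    using v that by (simp add: X.smult_r_distr \<kappa>_monomial_closed)
qed (auto simp: X.M.a_ac)

lemma lie_of_lie_module: "lie_module L (lie_of X)"
proof (intro lie_module.intro lie_algebra_axioms lie_of_vsp lie_module_axioms.intro)
  fix x m assume x: "x \<in> carrier L" and m: "m \<in> carrier (lie_of X)"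
  have mX: "m \<in> carrier X" using m by simp
  show "act (lie_of X) x m \<in> carrier (lie_of X)"
    using x m by (simp add: X.smult_closed \<kappa>_monomial_closed)
  show "act (lie_of X) (a \<odot> x) m = a \<odot>\<^bsub>lie_of X\<^esub> act (lie_of X) x m" for a
    using \<kappa>_smult_mult[of "[]" "[x]" m a 1] x mX by (simp add: \<kappa>_gen_smult)
  show "act (lie_of X) x (a \<odot>\<^bsub>lie_of X\<^esub> m) = a \<odot>\<^bsub>lie_of X\<^esub> act (lie_of X) x m" for a
    using \<kappa>_smult_mult[of "[]" "[x]" m a 1] \<kappa>_smult_mult[of "[x]" "[]" m 1 a] x mX by simp
  fix y assume y: "y \<in> carrier L"
  show "act (lie_of X) (x \<oplus> y) m = act (lie_of X) x m \<oplus>\<^bsub>lie_of X\<^esub> act (lie_of X) y m"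
    using x y m by (simp add: \<kappa>_gen_add X.smult_l_distr \<kappa>_monomial_closed)
  show "act (lie_of X) (bracket L x y) m
      = act (lie_of X) x (act (lie_of X) y m) \<ominus>\<^bsub>lie_of X\<^esub> act (lie_of X) y (act (lie_of X) x m)"
    using \<kappa>_smult_mult[of "[x]" "[y]" m 1 1] \<kappa>_smult_mult[of "[y]" "[x]" m 1 1] x y mX
    by (simp add: \<kappa>_gen_bracket X.smult_l_minus \<kappa>_monomial_closed lie_of_minus)
next
  fix x m m' assume "x \<in> carrier L" "m \<in> carrier (lie_of X)" "m' \<in> carrier (lie_of X)"
  then show "act (lie_of X) x (m \<oplus>\<^bsub>lie_of X\<^esub> m') = act (lie_of X) x m \<oplus>\<^bsub>lie_of X\<^esub> act (lie_of X) x m'"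
    by (simp add: X.smult_r_distr \<kappa>_monomial_closed)
qed

lemma lie_of_p_character: "has_p_character L \<chi> (lie_of X)"
  unfolding has_p_character_def
proof (intro ballI)
  fix x m assume x: "x \<in> carrier L" and m: "m \<in> carrier (lie_of X)"
  have rep: "replicate k x \<in> lists (carrier L)" for k by (induction k) (auto simp: x)
  have pow: "(act (lie_of X) x ^^ k) m = \<kappa> (monomial 1 (replicate k x)) \<odot>\<^bsub>X\<^esub> m" for k
  proof (induction k)
    case 0
    then show ?case using vspD(2)[OF lie_of_vsp m] by simp
  next
    case (Suc k)
    then show ?case using \<kappa>_smult_mult[of "[x]" "replicate k x" m 1 1] x m rep[of k] by simp
  qed
  have cl: "\<kappa> (monomial (1::'k) [pmap L x]) \<in> carrier A" "\<kappa> (monomial (\<chi> x ^ CHAR('k)) []) \<in> carrier A"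
    using pmap_closed'[OF x] by (auto intro: \<kappa>_monomial_closed)
  have mX: "m \<in> carrier X" using m by simp
  have "(act (lie_of X) x ^^ CHAR('k)) m = act (lie_of X) (pmap L x) m \<oplus>\<^bsub>X\<^esub> \<chi> x ^ CHAR('k) \<odot>\<^bsub>lie_of X\<^esub> m"
    unfolding pow \<kappa>_gen_power[OF x] X.smult_l_distr[OF cl mX] by simp
  then show "(act (lie_of X) x ^^ CHAR('k)) m \<ominus>\<^bsub>lie_of X\<^esub> act (lie_of X) (pmap L x) m = \<chi> x ^ CHAR('k) \<odot>\<^bsub>lie_of X\<^esub> m"
    unfolding lie_of_minus
    by (intro iffD2[OF X.M.minus_eq_iff])
      (use cl mX \<kappa>_monomial_closed[OF rep] in \<open>simp_all add: pow X.smult_closed\<close>)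
qed

text \<open>Every element of the algebra is represented by a combination of words in the generators,
  so closure under scalars and generators is closure under the algebra.\<close>

lemma lie_of_submodule:
  assumes N: "ssp N (lie_of X)" and act: "\<And>x m. x \<in> carrier L \<Longrightarrow> m \<in> N \<Longrightarrow> act (lie_of X) x m \<in> N"
  shows "left_submodule A N X"
proof -
  have NX: "N \<subseteq> carrier X" using sspD(2)[OF N] by simp
  have sub: "subgroup N (add_monoid X)"
  proof (rule subgroup.intro)
    show "N \<subseteq> carrier (add_monoid X)" using NX by simp
    show "x \<otimes>\<^bsub>add_monoid X\<^esub> y \<in> N" if "x \<in> N" "y \<in> N" for x y using sspD(4)[OF N that] by simp
    show "\<one>\<^bsub>add_monoid X\<^esub> \<in> N" using sspD(3)[OF N] by simp
    show "inv\<^bsub>add_monoid X\<^esub> x \<in> N" if x: "x \<in> N" for x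
    proof -
      have "(-1) \<odot>\<^bsub>lie_of X\<^esub> x \<in> N" by (rule sspD(5)[OF N x])
      also have "(-1) \<odot>\<^bsub>lie_of X\<^esub> x = \<ominus>\<^bsub>lie_of X\<^esub> x"
        using x NX by (intro smult_minus_one[OF lie_of_vsp]) auto
      finally show ?thesis unfolding lie_of_minus by (simp add: a_inv_def)
    qed
  qed
  have "\<kappa> f \<odot>\<^bsub>X\<^esub> m \<in> N" if f: "f \<in> carrier F" and m: "m \<in> N" for f m
    using f
  proof (induction f rule: free_algebra_induct)
    case zero
    then show ?case using m NX sspD(3)[OF N] by (auto simp: X.smult_l_null subset_iff)
  next
    case (monomial a w)
    then have "\<kappa> (monomial 1 w) \<odot>\<^bsub>X\<^esub> m \<in> N"
    proof (induction w)
      case Nil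
      then show ?case using m NX vspD(2)[OF lie_of_vsp, of m] by auto
    next
      case (Cons x w)
      then show ?case using act[of x "\<kappa> (monomial 1 w) \<odot>\<^bsub>X\<^esub> m"] \<kappa>_smult_mult[of "[x]" w m 1 1] m NX by auto
    qed
    then have "a \<odot>\<^bsub>lie_of X\<^esub> (\<kappa> (monomial 1 w) \<odot>\<^bsub>X\<^esub> m) \<in> N" by (rule sspD(5)[OF N])
    then show ?case using \<kappa>_smult_mult[of "[]" w m a 1] monomial m NX by auto
  next
    case (add f g)
    then show ?case using sspD(4)[OF N, of "\<kappa> f \<odot>\<^bsub>X\<^esub> m" "\<kappa> g \<odot>\<^bsub>X\<^esub> m"] m NX
      by (auto simp: X.smult_l_distr subset_iff)
  qed
  then show ?thesis unfolding left_submodule_def using sub \<kappa>_surj by blast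
qed

end

lemma module_hom_lie_hom:
  assumes X: "left_module A X" and Y: "left_module A Y"
  shows "LinearCombinations.module_hom A X Y = lie_hom L (lie_of X) (lie_of Y)"
proof (intro equalityI subsetI)
  interpret X: left_module A X by fact
  interpret Y: left_module A Y by fact
  {
    fix h assume "h \<in> LinearCombinations.module_hom A X Y"
    then show "h \<in> lie_hom L (lie_of X) (lie_of Y)"
      unfolding lie_hom_def LinearCombinations.module_hom_def
      by (auto simp: \<kappa>_monomial_closed)
  next
    fix h assume h: "h \<in> lie_hom L (lie_of X) (lie_of Y)"
    note hl = lhomD[OF lie_homD(1)[OF h], simplified] and ha = lie_homD(2)[OF h, simplified]
    have "h (\<kappa> f \<odot>\<^bsub>X\<^esub> m) = \<kappa> f \<odot>\<^bsub>Y\<^esub> h m" if f: "f \<in> carrier F" and m: "m \<in> carrier X" for f m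
      using f
    proof (induction f rule: free_algebra_induct)
      case zero
      have "h \<zero>\<^bsub>X\<^esub> = \<zero>\<^bsub>Y\<^esub>"
        using lhom_zero(1)[OF lie_of_vsp[OF X] lie_of_vsp[OF Y] lie_homD(1)[OF h]] by simp
      then show ?case using m hl(1)[OF m] by (simp add: X.smult_l_null Y.smult_l_null)
    next
      case (monomial a w)
      then have "h (\<kappa> (monomial 1 w) \<odot>\<^bsub>X\<^esub> m) = \<kappa> (monomial 1 w) \<odot>\<^bsub>Y\<^esub> h m"
      proof (induction w)
        case Nil
        then show ?case using hl(3)[OF m] by simp
      next
        case (Cons x w)
        then have "h (\<kappa> (monomial 1 [x]) \<odot>\<^bsub>X\<^esub> (\<kappa> (monomial 1 w) \<odot>\<^bsub>X\<^esub> m)) = \<kappa> (monomial 1 [x]) \<odot>\<^bsub>Y\<^esub> (\<kappa> (monomial 1 w) \<odot>\<^bsub>Y\<^esub> h m)"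
          using ha[of x "\<kappa> (monomial 1 w) \<odot>\<^bsub>X\<^esub> m"] m by (simp add: X.smult_closed \<kappa>_monomial_closed)
        then show ?case
          using Cons \<kappa>_smult_mult[OF X, of "[x]" w m 1 1] \<kappa>_smult_mult[OF Y, of "[x]" w "h m" 1 1] m hl(1)[OF m] by simp
      qed
      then have "h (\<kappa> (monomial a []) \<odot>\<^bsub>X\<^esub> (\<kappa> (monomial 1 w) \<odot>\<^bsub>X\<^esub> m)) = \<kappa> (monomial a []) \<odot>\<^bsub>Y\<^esub> (\<kappa> (monomial 1 w) \<odot>\<^bsub>Y\<^esub> h m)"
        using hl(3)[of "\<kappa> (monomial 1 w) \<odot>\<^bsub>X\<^esub> m" a] monomial m by (simp add: X.smult_closed \<kappa>_monomial_closed)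
      then show ?case
        using monomial \<kappa>_smult_mult[OF X, of "[]" w m a 1] \<kappa>_smult_mult[OF Y, of "[]" w "h m" a 1] m hl(1)[OF m] by simp
    next
      case (add f g)
      then show ?case using m hl(1)[OF m] hl(2)[of "\<kappa> f \<odot>\<^bsub>X\<^esub> m" "\<kappa> g \<odot>\<^bsub>X\<^esub> m"]
        by (simp add: X.smult_l_distr Y.smult_l_distr X.smult_closed)
    qed
    then have "\<forall>a\<in>carrier A. \<forall>m\<in>carrier X. h (a \<odot>\<^bsub>X\<^esub> m) = a \<odot>\<^bsub>Y\<^esub> h m" using \<kappa>_surj by blast
    then show "h \<in> LinearCombinations.module_hom A X Y"
      unfolding LinearCombinations.module_hom_def using hl(1,2) by auto
  }
qed

context
  fixes M :: "('k, 'l, 'm, 'y) lie_module_scheme"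
  assumes LM: "lie_module L M"
begin

interpretation lie_module L M by (fact LM)

lemma foldr_act_closed: "w \<in> lists (carrier L) \<Longrightarrow> m \<in> carrier M \<Longrightarrow> foldr (act M) w m \<in> carrier M"
  by (induction w) (auto simp: act_closed)

lemma foldr_act_linear:
  "w \<in> lists (carrier L) \<Longrightarrow> m \<in> carrier M \<Longrightarrow> m' \<in> carrier M
    \<Longrightarrow> foldr (act M) w (m \<oplus>\<^bsub>M\<^esub> m') = foldr (act M) w m \<oplus>\<^bsub>M\<^esub> foldr (act M) w m'"
  "w \<in> lists (carrier L) \<Longrightarrow> m \<in> carrier M
    \<Longrightarrow> foldr (act M) w (a \<odot>\<^bsub>M\<^esub> m) = a \<odot>\<^bsub>M\<^esub> foldr (act M) w m"
  by (induction w) (auto simp: act_add_right act_smult_right foldr_act_closed)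

text \<open>Supports change under addition; over a common finite superset the action becomes
  additive in \<open>f\<close>.\<close>

lemma free_act_superset:
  assumes "f \<in> carrier F" "m \<in> carrier M" "finite B" "{w. f w \<noteq> 0} \<subseteq> B" "B \<subseteq> lists (carrier L)"
  shows "free_act M f m = (\<Oplus>\<^bsub>M\<^esub>w\<in>B. f w \<odot>\<^bsub>M\<^esub> foldr (act M) w m)"
  unfolding free_act_def
  by (rule M.M.add.finprod_mono_neutral_cong_left)
    (use assms foldr_act_closed smult_zero[OF M.vectorspace_axioms] in \<open>auto simp: subset_iff\<close>)

lemma free_act_closed: "f \<in> carrier F \<Longrightarrow> m \<in> carrier M \<Longrightarrow> free_act M f m \<in> carrier M"
  unfolding free_act_def
  by (rule M.M.finsum_closed) (auto simp: free_algebra_carrier subset_iff foldr_act_closed)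

lemma free_act_zero: "free_act M \<zero>\<^bsub>F\<^esub> m = \<zero>\<^bsub>M\<^esub>"
  by (simp add: free_act_def free_algebra_simps)

lemma free_act_monomial:
  assumes "w \<in> lists (carrier L)" "m \<in> carrier M"
  shows "free_act M (monomial a w) m = a \<odot>\<^bsub>M\<^esub> foldr (act M) w m"
proof -
  have "free_act M (monomial a w) m = (\<Oplus>\<^bsub>M\<^esub>v\<in>{w}. monomial a w v \<odot>\<^bsub>M\<^esub> foldr (act M) v m)"
    by (rule free_act_superset[OF monomial_closed]) (use assms in \<open>auto simp: monomial_def\<close>)
  then show ?thesis using foldr_act_closed[OF assms] by (simp add: monomial_def)
qed

lemma free_act_add:
  assumes "f \<in> carrier F" "g \<in> carrier F" "m \<in> carrier M"
  shows "free_act M (f \<oplus>\<^bsub>F\<^esub> g) m = free_act M f m \<oplus>\<^bsub>M\<^esub> free_act M g m"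
proof -
  let ?B = "{w. f w \<noteq> 0} \<union> {w. g w \<noteq> 0}"
  have B: "finite ?B" "?B \<subseteq> lists (carrier L)" using assms by (auto simp: free_algebra_carrier)
  have cl: "foldr (act M) w m \<in> carrier M" if "w \<in> ?B" for w
    using that B(2) assms(3) by (intro foldr_act_closed) auto
  have "free_act M (f \<oplus>\<^bsub>F\<^esub> g) m = (\<Oplus>\<^bsub>M\<^esub>w\<in>?B. (f \<oplus>\<^bsub>F\<^esub> g) w \<odot>\<^bsub>M\<^esub> foldr (act M) w m)"
    by (rule free_act_superset[OF F.a_closed[OF assms(1,2)] assms(3) B(1) _ B(2)]) (auto simp: free_algebra_simps)
  also have "\<dots> = (\<Oplus>\<^bsub>M\<^esub>w\<in>?B. f w \<odot>\<^bsub>M\<^esub> foldr (act M) w m \<oplus>\<^bsub>M\<^esub> g w \<odot>\<^bsub>M\<^esub> foldr (act M) w m)"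
    by (rule M.M.finsum_cong') (use cl in \<open>auto simp: free_algebra_simps vspD(3)[OF M.vectorspace_axioms]\<close>)
  also have "\<dots> = (\<Oplus>\<^bsub>M\<^esub>w\<in>?B. f w \<odot>\<^bsub>M\<^esub> foldr (act M) w m) \<oplus>\<^bsub>M\<^esub> (\<Oplus>\<^bsub>M\<^esub>w\<in>?B. g w \<odot>\<^bsub>M\<^esub> foldr (act M) w m)"
    by (rule M.M.finsum_addf) (use cl in auto)
  also have "(\<Oplus>\<^bsub>M\<^esub>w\<in>?B. f w \<odot>\<^bsub>M\<^esub> foldr (act M) w m) = free_act M f m"
    by (rule free_act_superset[OF assms(1,3) B(1) _ B(2), symmetric]) auto
  also have "(\<Oplus>\<^bsub>M\<^esub>w\<in>?B. g w \<odot>\<^bsub>M\<^esub> foldr (act M) w m) = free_act M g m"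
    by (rule free_act_superset[OF assms(2,3) B(1) _ B(2), symmetric]) auto
  finally show ?thesis .
qed

lemma free_act_minus:
  assumes "f \<in> carrier F" "g \<in> carrier F" "m \<in> carrier M"
  shows "free_act M (f \<ominus>\<^bsub>F\<^esub> g) m = free_act M f m \<ominus>\<^bsub>M\<^esub> free_act M g m"
proof -
  have d: "f \<ominus>\<^bsub>F\<^esub> g \<in> carrier F" using assms by simp
  have "f = g \<oplus>\<^bsub>F\<^esub> (f \<ominus>\<^bsub>F\<^esub> g)" using iffD1[OF F.minus_eq_iff[OF assms(1,2) d] refl] .
  then have "free_act M f m = free_act M g m \<oplus>\<^bsub>M\<^esub> free_act M (f \<ominus>\<^bsub>F\<^esub> g) m"
    using free_act_add[OF assms(2) d assms(3)] by argo
  from iffD2[OF M.M.minus_eq_iff this] show ?thesis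
    using free_act_closed assms d by simp
qed

lemma free_act_linear:
  assumes "f \<in> carrier F" "m \<in> carrier M" "m' \<in> carrier M"
  shows "free_act M f (m \<oplus>\<^bsub>M\<^esub> m') = free_act M f m \<oplus>\<^bsub>M\<^esub> free_act M f m'"
  using assms(1)
proof (induction f rule: free_algebra_induct)
  case (monomial a w)
  then show ?case
    using assms by (simp add: free_act_monomial foldr_act_linear foldr_act_closed vspD(4)[OF M.vectorspace_axioms])
next
  case (add f g)
  then show ?case using assms by (simp add: free_act_add free_act_closed M.M.a_ac)
qed (simp add: free_act_zero)

lemma free_act_mult:
  assumes f: "f \<in> carrier F" and g: "g \<in> carrier F" and m: "m \<in> carrier M"
  shows "free_act M (f \<otimes>\<^bsub>F\<^esub> g) m = free_act M f (free_act M g m)"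
  using f
proof (induction f rule: free_algebra_induct)
  case zero
  then show ?case using g by (simp add: free_act_zero)
next
  case (monomial a u)
  show ?case using g
  proof (induction g rule: free_algebra_induct)
    case zero
    have "foldr (act M) u \<zero>\<^bsub>M\<^esub> = \<zero>\<^bsub>M\<^esub>" using monomial by (induction u) (auto simp: act_zero_right)
    then show ?case
      using monomial m free_act_monomial[OF monomial M.M.zero_closed, of a] M.smult_r_null[of a] by (simp add: free_act_zero)
  next
    case (monomial b v)
    then show ?case
      using \<open>u \<in> lists (carrier L)\<close> m
      by (simp add: monomial_mult free_act_monomial foldr_act_closed foldr_act_linear vspD(1)[OF M.vectorspace_axioms])
  next
    case (add g h)
    have cl: "monomial a u \<in> carrier F" using monomial by simp
    show ?case
      unfolding F.r_distr[OF add(1,2) cl] free_act_add[OF add(1,2) m]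
        free_act_add[OF F.m_closed[OF cl add(1)] F.m_closed[OF cl add(2)] m] add(3,4)
      by (rule free_act_linear[OF cl free_act_closed[OF add(1) m] free_act_closed[OF add(2) m], symmetric])
  qed
next
  case (add f h)
  show ?case
    unfolding F.l_distr[OF add(1,2) g] free_act_add[OF F.m_closed[OF add(1) g] F.m_closed[OF add(2) g] m]
      free_act_add[OF add(1,2) free_act_closed[OF g m]] add(3,4) by (rule refl)
qed

end

end

lemma mem_coset_iff:
  assumes "ideal J R" "a \<in> carrier R"
  shows "b \<in> J +>\<^bsub>R\<^esub> a \<longleftrightarrow> b \<in> carrier R \<and> J +>\<^bsub>R\<^esub> b = J +>\<^bsub>R\<^esub> a"
proof -
  interpret ideal J R by fact
  show ?thesis
    using a_repr_independence'[of b a] a_rcos_self[of b] assms(2) a_r_coset_subset_G[of J a] a_subset by auto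
qed

section \<open>From Lie modules to modules over the algebra\<close>

context red_algebra
begin

context
  fixes M :: "('k, 'l, 'm, 'y) lie_module_scheme"
  assumes LM: "lie_module L M" and pc: "has_p_character L \<chi> M"
begin

interpretation lie_module L M by (fact LM)

text \<open>The ideals of relations are known only as least ideals. Showing that an annihilator is
  an ideal containing the generators bounds them without a description of their elements.\<close>

definition free_ann :: "('l list \<Rightarrow> 'k) set" where
  "free_ann = {f \<in> carrier F. \<forall>m\<in>carrier M. free_act M f m = \<zero>\<^bsub>M\<^esub>}"

lemma free_act_zero_right: "f \<in> carrier F \<Longrightarrow> free_act M f \<zero>\<^bsub>M\<^esub> = \<zero>\<^bsub>M\<^esub>"
  using free_act_mult[OF LM, of f "\<zero>\<^bsub>F\<^esub>" "\<zero>\<^bsub>M\<^esub>"] by (simp add: free_act_zero[OF LM])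

lemma minus_self: "a \<in> carrier M \<Longrightarrow> a \<ominus>\<^bsub>M\<^esub> a = \<zero>\<^bsub>M\<^esub>"
  by (simp add: a_minus_def M.M.r_neg)

lemma free_ann_ideal: "ideal free_ann F"
proof (rule idealI[OF F.ring_axioms])
  show "subgroup free_ann (add_monoid F)"
  proof (rule subgroup.intro)
    show "free_ann \<subseteq> carrier (add_monoid F)" by (auto simp: free_ann_def)
    show "x \<otimes>\<^bsub>add_monoid F\<^esub> y \<in> free_ann" if "x \<in> free_ann" "y \<in> free_ann" for x y
      using that by (simp add: free_ann_def free_act_add[OF LM])
    show "\<one>\<^bsub>add_monoid F\<^esub> \<in> free_ann" by (simp add: free_ann_def free_act_zero[OF LM])
    show "inv\<^bsub>add_monoid F\<^esub> x \<in> free_ann" if x: "x \<in> free_ann" for x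
    proof -
      have xF: "x \<in> carrier F" using x by (simp add: free_ann_def)
      have "\<zero>\<^bsub>F\<^esub> \<ominus>\<^bsub>F\<^esub> x = \<ominus>\<^bsub>F\<^esub> x" using xF by (simp add: a_minus_def)
      moreover have "free_act M (\<zero>\<^bsub>F\<^esub> \<ominus>\<^bsub>F\<^esub> x) m = \<zero>\<^bsub>M\<^esub>" if "m \<in> carrier M" for m
        using x that by (simp add: free_act_minus[OF LM F.zero_closed xF] free_act_zero[OF LM] free_ann_def minus_self)
      ultimately have "\<ominus>\<^bsub>F\<^esub> x \<in> free_ann" using xF by (simp add: free_ann_def)
      then show ?thesis by (simp add: a_inv_def)
    qed
  qed
  fix a x assume "a \<in> free_ann" "x \<in> carrier F"
  then show "x \<otimes>\<^bsub>F\<^esub> a \<in> free_ann" "a \<otimes>\<^bsub>F\<^esub> x \<in> free_ann"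
    by (simp_all add: free_ann_def free_act_mult[OF LM] free_act_zero_right free_act_closed[OF LM])
qed

lemma uea_ideal_free_ann: "uea_ideal L \<subseteq> free_ann"
  unfolding uea_ideal_def
proof (rule F.genideal_minimal[OF free_ann_ideal])
  note simps = free_act_minus[OF LM] free_act_add[OF LM] free_act_monomial[OF LM] minus_self
    vspD(2)[OF M.vectorspace_axioms] act_closed
  have "monomial 1 [x \<oplus> y] \<ominus>\<^bsub>F\<^esub> (monomial 1 [x] \<oplus>\<^bsub>F\<^esub> monomial 1 [y]) \<in> free_ann"
    if "x \<in> carrier L" "y \<in> carrier L" for x y
    using that by (simp add: free_ann_def simps act_add_left)
  moreover have "monomial 1 [a \<odot> x] \<ominus>\<^bsub>F\<^esub> monomial a [x] \<in> free_ann" if "x \<in> carrier L" for a x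
    using that by (simp add: free_ann_def simps act_smult_left)
  moreover have "monomial 1 [x, y] \<ominus>\<^bsub>F\<^esub> monomial 1 [y, x] \<ominus>\<^bsub>F\<^esub> monomial 1 [bracket L x y] \<in> free_ann"
    if "x \<in> carrier L" "y \<in> carrier L" for x y
    using that by (simp add: free_ann_def simps act_bracket bracket_closed)
  ultimately show "uea_relations L \<subseteq> free_ann"
    unfolding uea_relations_def Let_def by (intro Un_least subsetI; elim CollectE exE conjE; simp only:)
qed

text \<open>The second ideal lives in U(L), so the annihilator is pushed forward: its image is an
  ideal there, and the p-character equation says that the generators belong to it.\<close>

lemma red_uea_ideal_free_ann: "red_uea_ideal L \<chi> \<subseteq> (+>\<^bsub>F\<^esub>) (uea_ideal L) ` free_ann"
  unfolding red_uea_ideal_def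
proof (rule U.genideal_minimal)
  interpret h: ring_hom_ring F "uea L" "(+>\<^bsub>F\<^esub>) (uea_ideal L)" by (rule uea_hom)
  interpret I: ideal free_ann F by (rule free_ann_ideal)
  let ?h = "(+>\<^bsub>F\<^esub>) (uea_ideal L)"
  note IF = I.Icarr
  show "ideal (?h ` free_ann) (uea L)"
  proof (rule idealI[OF U.ring_axioms])
    show "subgroup (?h ` free_ann) (add_monoid (uea L))"
    proof (rule subgroup.intro)
      show "?h ` free_ann \<subseteq> carrier (add_monoid (uea L))" using IF by auto
      fix x y assume "x \<in> ?h ` free_ann" "y \<in> ?h ` free_ann"
      then obtain f g where fg: "x = ?h f" "y = ?h g" "f \<in> free_ann" "g \<in> free_ann" by auto
      then have "x \<otimes>\<^bsub>add_monoid (uea L)\<^esub> y = ?h (f \<oplus>\<^bsub>F\<^esub> g)" using IF by simp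
      then show "x \<otimes>\<^bsub>add_monoid (uea L)\<^esub> y \<in> ?h ` free_ann" using I.a_closed[OF fg(3,4)] by (rule image_eqI)
    next
      have "\<one>\<^bsub>add_monoid (uea L)\<^esub> = ?h \<zero>\<^bsub>F\<^esub>" by simp
      then show "\<one>\<^bsub>add_monoid (uea L)\<^esub> \<in> ?h ` free_ann" using I.zero_closed by (rule image_eqI)
    next
      fix x assume "x \<in> ?h ` free_ann"
      then obtain f where f: "x = ?h f" "f \<in> free_ann" by auto
      then have "inv\<^bsub>add_monoid (uea L)\<^esub> x = ?h (\<ominus>\<^bsub>F\<^esub> f)"
        using IF h.hom_a_inv[of f] by (simp add: a_inv_def)
      then show "inv\<^bsub>add_monoid (uea L)\<^esub> x \<in> ?h ` free_ann" using I.a_inv_closed[OF f(2)] by (rule image_eqI)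
    qed
    fix a x assume "a \<in> ?h ` free_ann" "x \<in> carrier (uea L)"
    then obtain f g where fg: "a = ?h f" "x = ?h g" "f \<in> free_ann" "g \<in> carrier F" by (auto simp: uea_carrier)
    have e: "x \<otimes>\<^bsub>uea L\<^esub> a = ?h (g \<otimes>\<^bsub>F\<^esub> f)" "a \<otimes>\<^bsub>uea L\<^esub> x = ?h (f \<otimes>\<^bsub>F\<^esub> g)"
      using fg IF by simp_all
    show "x \<otimes>\<^bsub>uea L\<^esub> a \<in> ?h ` free_ann" unfolding e(1) by (rule imageI[OF I.I_l_closed[OF fg(3,4)]])
    show "a \<otimes>\<^bsub>uea L\<^esub> x \<in> ?h ` free_ann" unfolding e(2) by (rule imageI[OF I.I_r_closed[OF fg(3,4)]])
  qed
  have "monomial 1 (replicate CHAR('k) x) \<ominus>\<^bsub>F\<^esub> monomial 1 [pmap L x] \<ominus>\<^bsub>F\<^esub> monomial (\<chi> x ^ CHAR('k)) [] \<in> free_ann"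
    if x: "x \<in> carrier L" for x
  proof -
    have rep: "replicate k x \<in> lists (carrier L)" for k by (induction k) (auto simp: x)
    have cl: "monomial (1::'k) (replicate CHAR('k) x) \<in> carrier F" "monomial (1::'k) [pmap L x] \<in> carrier F"
      "monomial (\<chi> x ^ CHAR('k)) [] \<in> carrier F"
      using pmap_closed'[OF x] monomial_closed[OF rep] by simp_all
    have f: "foldr (act M) (replicate k x) m = (act M x ^^ k) m" for k m by (induction k) auto
    have fc: "(act M x ^^ k) m \<in> carrier M" if "m \<in> carrier M" for k m
      using foldr_act_closed[OF LM rep that] by (simp add: f)
    have "free_act M (monomial 1 (replicate CHAR('k) x) \<ominus>\<^bsub>F\<^esub> monomial 1 [pmap L x]
        \<ominus>\<^bsub>F\<^esub> monomial (\<chi> x ^ CHAR('k)) []) m = \<zero>\<^bsub>M\<^esub>" if m: "m \<in> carrier M" for m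
    proof -
      have a: "free_act M (monomial 1 (replicate CHAR('k) x)) m = (act M x ^^ CHAR('k)) m"
        unfolding free_act_monomial[OF LM rep m] f by (rule vspD(2)[OF M.vectorspace_axioms fc[OF m]])
      have b: "free_act M (monomial 1 [pmap L x]) m = act M (pmap L x) m"
        using free_act_monomial[OF LM _ m, of "[pmap L x]" 1] pmap_closed'[OF x] act_closed[of "pmap L x" m] m
          vspD(2)[OF M.vectorspace_axioms, of "act M (pmap L x) m"] by simp
      have c: "free_act M (monomial (\<chi> x ^ CHAR('k)) []) m = \<chi> x ^ CHAR('k) \<odot>\<^bsub>M\<^esub> m"
        using free_act_monomial[OF LM _ m, of "[]"] by simp
      have d: "(act M x ^^ CHAR('k)) m \<ominus>\<^bsub>M\<^esub> act M (pmap L x) m = \<chi> x ^ CHAR('k) \<odot>\<^bsub>M\<^esub> m"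
        using pc x m unfolding has_p_character_def by blast
      show ?thesis
        unfolding free_act_minus[OF LM F.minus_closed[OF cl(1,2)] cl(3) m] free_act_minus[OF LM cl(1,2) m] a b c d
        by (rule minus_self) (use m in simp)
    qed
    then show ?thesis
      using F.minus_closed[OF F.minus_closed[OF cl(1,2)] cl(3)] unfolding free_ann_def by blast
  qed
  then show "{uea_gen L x [^]\<^bsub>uea L\<^esub> CHAR('k) \<ominus>\<^bsub>uea L\<^esub> uea_gen L (pmap L x)
        \<ominus>\<^bsub>uea L\<^esub> uea_scalar L (\<chi> x ^ CHAR('k)) | x. x \<in> carrier L} \<subseteq> ?h ` free_ann"
    using red_gen(1) by (intro subsetI; elim CollectE exE conjE; simp only:) (rule imageI)
qed

text \<open>Well-definedness of the action of u(L,chi). In U(L) the difference of two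
  representatives equals the image of some \<open>k\<close> in the annihilator, and in the free
  algebra it differs from \<open>k\<close> by an element of the first ideal, which annihilates M
  too.\<close>

lemma \<kappa>_free_act:
  assumes f: "f \<in> carrier F" and g: "g \<in> carrier F" and eq: "\<kappa> f = \<kappa> g" and m: "m \<in> carrier M"
  shows "free_act M f m = free_act M g m"
proof -
  interpret h: ring_hom_ring F "uea L" "(+>\<^bsub>F\<^esub>) (uea_ideal L)" by (rule uea_hom)
  let ?h = "(+>\<^bsub>F\<^esub>) (uea_ideal L)"
  have "?h f \<ominus>\<^bsub>uea L\<^esub> ?h g \<in> red_uea_ideal L \<chi>"
    using eq coset_eq_iff[OF red_uea_ideal h.hom_closed[OF f] h.hom_closed[OF g]] by (simp add: \<kappa>_def)
  then obtain k where k: "k \<in> free_ann" "?h f \<ominus>\<^bsub>uea L\<^esub> ?h g = ?h k" using red_uea_ideal_free_ann by blast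
  have kF: "k \<in> carrier F" using k by (simp add: free_ann_def)
  have "?h (f \<ominus>\<^bsub>F\<^esub> g) = ?h k" using k(2) f g by (simp add: a_minus_def)
  then have "f \<ominus>\<^bsub>F\<^esub> g \<ominus>\<^bsub>F\<^esub> k \<in> free_ann"
    using coset_eq_iff[OF uea_ideal F.minus_closed[OF f g] kF] uea_ideal_free_ann by blast
  then have "free_act M (f \<ominus>\<^bsub>F\<^esub> g \<ominus>\<^bsub>F\<^esub> k) m = \<zero>\<^bsub>M\<^esub>" using m by (simp add: free_ann_def)
  moreover have "free_act M k m = \<zero>\<^bsub>M\<^esub>" using k m by (simp add: free_ann_def)
  moreover have cl: "free_act M f m \<in> carrier M" "free_act M g m \<in> carrier M"
    using f g m free_act_closed[OF LM] by auto
  moreover have "\<ominus>\<^bsub>M\<^esub> \<zero>\<^bsub>M\<^esub> = \<zero>\<^bsub>M\<^esub>"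
    using minus_self[OF M.M.zero_closed] by (simp add: a_minus_def)
  ultimately have "free_act M f m \<ominus>\<^bsub>M\<^esub> free_act M g m = \<zero>\<^bsub>M\<^esub>"
    using M.M.minus_closed[OF cl]
    unfolding free_act_minus[OF LM F.minus_closed[OF f g] kF m] free_act_minus[OF LM f g m]
    by (simp only: a_minus_def[of M "_ \<ominus>\<^bsub>M\<^esub> _"] M.M.r_zero)
  from iffD1[OF M.M.minus_eq_iff[OF cl M.M.zero_closed] this] show ?thesis using cl by simp
qed

text \<open>All representatives act alike and there is at least one, so the set under
  \<open>the_elem\<close> is a singleton.\<close>

lemma red_smult:
  assumes f: "f \<in> carrier F" and m: "m \<in> carrier M"
  shows "\<kappa> f \<odot>\<^bsub>red_uea_module M\<^esub> m = free_act M f m"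
proof -
  let ?h = "(+>\<^bsub>F\<^esub>) (uea_ideal L)"
  have hc: "?h f \<in> carrier (uea L)" using f by (auto simp: uea_carrier)
  have "f \<in> ?h f" using mem_coset_iff[OF uea_ideal f, of f] f by blast
  moreover have "?h f \<in> \<kappa> f" unfolding \<kappa>_def using mem_coset_iff[OF red_uea_ideal hc, of "?h f"] hc by blast
  ultimately have e1: "f \<in> \<Union>(\<kappa> f)" by blast
  have e2: "free_act M f' m = free_act M f m" if "f' \<in> \<Union>(\<kappa> f)" for f'
  proof -
    obtain u where u: "f' \<in> u" "u \<in> red_uea_ideal L \<chi> +>\<^bsub>uea L\<^esub> ?h f" using \<open>f' \<in> \<Union>(\<kappa> f)\<close> by (auto simp: \<kappa>_def)
    then have u2: "u \<in> carrier (uea L)" "red_uea_ideal L \<chi> +>\<^bsub>uea L\<^esub> u = \<kappa> f"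
      using mem_coset_iff[OF red_uea_ideal hc, of u] by (simp_all add: \<kappa>_def)
    then obtain g where g: "g \<in> carrier F" "u = ?h g" by (auto simp: uea_carrier)
    then have f': "f' \<in> carrier F" "?h f' = u" using mem_coset_iff[OF uea_ideal g(1), of f'] u(1) by auto
    then have "\<kappa> f' = \<kappa> f" using u2(2) by (simp add: \<kappa>_def)
    then show ?thesis by (rule \<kappa>_free_act[OF f'(1) f _ m])
  qed
  have "(\<lambda>f. free_act M f m) ` \<Union>(\<kappa> f) = {free_act M f m}"
  proof
    show "(\<lambda>f. free_act M f m) ` \<Union>(\<kappa> f) \<subseteq> {free_act M f m}"
      by (rule image_subsetI, subst e2, assumption, rule singletonI)
  qed (rule iffD2[OF insert_subset], rule conjI, rule image_eqI[OF refl e1], rule empty_subsetI)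
  then show ?thesis by (simp add: red_uea_module_def)
qed

lemma red_module_simps:
  "carrier (red_uea_module M) = carrier M" "zero (red_uea_module M) = zero M" "add (red_uea_module M) = add M"
  by (simp_all add: red_uea_module_def)

lemma red_left_module: "left_module A (red_uea_module M)"
proof -
  have "abelian_group (red_uea_module M)"
  proof (rule abelian_groupI)
    fix x assume "x \<in> carrier (red_uea_module M)"
    then show "\<exists>y\<in>carrier (red_uea_module M). y \<oplus>\<^bsub>red_uea_module M\<^esub> x = \<zero>\<^bsub>red_uea_module M\<^esub>"
      by (intro bexI[of _ "\<ominus>\<^bsub>M\<^esub> x"]) (auto simp: red_module_simps M.M.l_neg)
  qed (auto simp: red_module_simps M.M.a_ac)
  then show ?thesis
  proof (intro left_module.intro left_module_axioms.intro A.ring_axioms)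
    fix a m assume a: "a \<in> carrier A" and m: "m \<in> carrier (red_uea_module M)"
    obtain f where f: "f \<in> carrier F" "a = \<kappa> f" using \<kappa>_surj[OF a] by blast
    have mM: "m \<in> carrier M" using m by (simp add: red_module_simps)
    show "a \<odot>\<^bsub>red_uea_module M\<^esub> m \<in> carrier (red_uea_module M)"
      unfolding f(2) red_smult[OF f(1) mM] red_module_simps by (rule free_act_closed[OF LM f(1) mM])
    show "a \<odot>\<^bsub>red_uea_module M\<^esub> (m \<oplus>\<^bsub>red_uea_module M\<^esub> m')
        = a \<odot>\<^bsub>red_uea_module M\<^esub> m \<oplus>\<^bsub>red_uea_module M\<^esub> a \<odot>\<^bsub>red_uea_module M\<^esub> m'"
      if "m' \<in> carrier (red_uea_module M)" for m'
      using f mM that free_act_linear[OF LM] by (simp add: red_smult red_module_simps)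
    fix b assume b: "b \<in> carrier A"
    obtain g where g: "g \<in> carrier F" "b = \<kappa> g" using \<kappa>_surj[OF b] by blast
    have "a \<oplus>\<^bsub>A\<^esub> b = \<kappa> (f \<oplus>\<^bsub>F\<^esub> g)" "a \<otimes>\<^bsub>A\<^esub> b = \<kappa> (f \<otimes>\<^bsub>F\<^esub> g)" using f g by simp_all
    then show "(a \<oplus>\<^bsub>A\<^esub> b) \<odot>\<^bsub>red_uea_module M\<^esub> m
        = a \<odot>\<^bsub>red_uea_module M\<^esub> m \<oplus>\<^bsub>red_uea_module M\<^esub> b \<odot>\<^bsub>red_uea_module M\<^esub> m"
      "(a \<otimes>\<^bsub>A\<^esub> b) \<odot>\<^bsub>red_uea_module M\<^esub> m = a \<odot>\<^bsub>red_uea_module M\<^esub> (b \<odot>\<^bsub>red_uea_module M\<^esub> m)"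
      using f g mM free_act_closed[OF LM g(1) mM] F.a_closed[OF f(1) g(1)] F.m_closed[OF f(1) g(1)]
      by (simp_all only: red_smult free_act_add[OF LM] free_act_mult[OF LM] red_module_simps)
  next
    fix m assume "m \<in> carrier (red_uea_module M)"
    then have m: "m \<in> carrier M" by (simp add: red_module_simps)
    have "\<one>\<^bsub>A\<^esub> = \<kappa> (monomial 1 [])" using \<kappa>.hom_one by (simp add: free_algebra_simps(4))
    then show "\<one>\<^bsub>A\<^esub> \<odot>\<^bsub>red_uea_module M\<^esub> m = m"
      using m red_smult[OF monomial_closed m, of "[]" 1] vspD(2)[OF M.vectorspace_axioms m]
      by (simp add: free_act_monomial[OF LM])
  qed
qed

text \<open>Going to the algebra and back recovers the original operations on the carrier;
  homomorphism sets can therefore be exchanged freely.\<close>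

lemma lie_of_red_module:
  assumes m: "m \<in> carrier M"
  shows "a \<odot>\<^bsub>lie_of (red_uea_module M)\<^esub> m = a \<odot>\<^bsub>M\<^esub> m"
    and "x \<in> carrier L \<Longrightarrow> act (lie_of (red_uea_module M)) x m = act M x m"
  using m act_closed vspD(2)[OF M.vectorspace_axioms]
  by (simp_all add: red_smult free_act_monomial[OF LM])

end

lemma lie_hom_cong:
  assumes "carrier M = carrier M'" "add M = add M'" "carrier N = carrier N'" "add N = add N'"
    and "\<And>a m. m \<in> carrier M' \<Longrightarrow> a \<odot>\<^bsub>M\<^esub> m = a \<odot>\<^bsub>M'\<^esub> m" "\<And>a m. m \<in> carrier N' \<Longrightarrow> a \<odot>\<^bsub>N\<^esub> m = a \<odot>\<^bsub>N'\<^esub> m"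
    and "\<And>x m. x \<in> carrier L \<Longrightarrow> m \<in> carrier M' \<Longrightarrow> act M x m = act M' x m"
      "\<And>x m. x \<in> carrier L \<Longrightarrow> m \<in> carrier N' \<Longrightarrow> act N x m = act N' x m"
  shows "lie_hom L M N = lie_hom L M' N'"
  unfolding lie_hom_def LinearCombinations.module_hom_def
  by (rule Collect_cong) (auto simp: assms Pi_iff)

lemma lie_hom_red_module:
  assumes "lie_module L M" "has_p_character L \<chi> M"
  shows "lie_hom L N (lie_of (red_uea_module M)) = lie_hom L N M"
    and "lie_hom L (lie_of (red_uea_module M)) N = lie_hom L M N"
proof -
  note s = lie_of_red_module[OF assms] red_module_simps[OF assms]
  interpret lie_module L M by (rule assms)
  have c: "act M x m \<in> carrier M" "a \<odot>\<^bsub>M\<^esub> m \<in> carrier M" if "x \<in> carrier L" "m \<in> carrier M" for x a m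
    using that act_closed by auto
  have eq: "carrier (lie_of (red_uea_module M)) = carrier M" "add (lie_of (red_uea_module M)) = add M"
    by (simp_all add: s)
  show "lie_hom L N (lie_of (red_uea_module M)) = lie_hom L N M"
    "lie_hom L (lie_of (red_uea_module M)) N = lie_hom L M N"
    by (rule lie_hom_cong; simp add: eq s del: lie_of_simps)+
qed

text \<open>\<open>projective_module_lift\<close> frees the lifting property from the types fixed in
  its definition. That is essential here, as the test modules include coinduced ones, whose elements
  are functions on words.\<close>

lemma projective_lift:
  fixes M :: "('k, 'l, 'm) lie_module" and N :: "('k, 'l, 'n) lie_module"
  assumes P: "projective_module A P"
    and M: "lie_module L M" "has_p_character L \<chi> M" and N: "lie_module L N" "has_p_character L \<chi> N"
    and g: "g \<in> lie_hom L M N" "g ` carrier M = carrier N" and f: "f \<in> lie_hom L (lie_of P) N"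
  shows "\<exists>h\<in>lie_hom L (lie_of P) M. \<forall>x\<in>carrier P. g (h x) = f x"
proof -
  have PM: "left_module A P" using P by (simp add: projective_module_def)
  note RM = red_left_module[OF M] and RN = red_left_module[OF N]
  have hom: "LinearCombinations.module_hom A (red_uea_module M) (red_uea_module N) = lie_hom L M N"
    "LinearCombinations.module_hom A P (red_uea_module N) = lie_hom L (lie_of P) N"
    "LinearCombinations.module_hom A P (red_uea_module M) = lie_hom L (lie_of P) M"
    by (simp_all add: module_hom_lie_hom[OF RM RN] module_hom_lie_hom[OF PM RM] module_hom_lie_hom[OF PM RN]
        lie_hom_red_module[OF M] lie_hom_red_module[OF N])
  show ?thesis
    using projective_module_lift[OF P RM RN, of g f] g f unfolding hom by (simp add: red_module_simps[OF M] red_module_simps[OF N])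
qed

text \<open>Everything used about a cover, in terms of L-modules. The identity map compares the
  vector space in the definition of the dimension with \<open>lie_of P\<close>; the finite dimension
  it asks for is established later for each of the three covers.\<close>

lemma projective_coverD:
  fixes S :: "('k, 'l, 's) lie_module"
  assumes S: "lie_module L S" "has_p_character L \<chi> S" and cov: "projective_cover A (red_uea_module S) P \<pi>"
  shows "projective_module A P" "lie_module L (lie_of P)" "has_p_character L \<chi> (lie_of P)"
    "\<pi> \<in> lie_hom L (lie_of P) S" "\<pi> ` carrier P = carrier S"
    "\<And>N. ssp N (lie_of P) \<Longrightarrow> (\<And>x m. x \<in> carrier L \<Longrightarrow> m \<in> N \<Longrightarrow> act (lie_of P) x m \<in> N)
       \<Longrightarrow> \<pi> ` N = carrier S \<Longrightarrow> N = carrier P"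
    "fdim (lie_of P) \<Longrightarrow> red_uea_module_dim L \<chi> P = vdim (lie_of P)"
proof -
  show P: "projective_module A P" using cov by (simp add: projective_cover_def)
  then have PM: "left_module A P" by (simp add: projective_module_def)
  show "lie_module L (lie_of P)" "has_p_character L \<chi> (lie_of P)"
    by (rule lie_of_lie_module[OF PM], rule lie_of_p_character[OF PM])
  show "\<pi> \<in> lie_hom L (lie_of P) S"
    using cov module_hom_lie_hom[OF PM red_left_module[OF S]]
    by (simp add: projective_cover_def lie_hom_red_module[OF S])
  show "\<pi> ` carrier P = carrier S" using cov by (simp add: projective_cover_def red_module_simps[OF S])
  show "N = carrier P" if "ssp N (lie_of P)" "\<And>x m. x \<in> carrier L \<Longrightarrow> m \<in> N \<Longrightarrow> act (lie_of P) x m \<in> N"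
      "\<pi> ` N = carrier S" for N
    using cov lie_of_submodule[OF PM that(1,2)] that(3) by (simp add: projective_cover_def red_module_simps[OF S])
  assume fd: "fdim (lie_of P)"
  let ?V = "restrict_scalars (red_uea_scalar L \<chi>) P"
  have sc: "red_uea_scalar L \<chi> a = \<kappa> (monomial a [])" for a
    by (simp add: red_uea_scalar_def uea_scalar_def \<kappa>_def)
  have V: "vsp ?V"
    by (rule vsp_cong[OF lie_of_vsp[OF PM]]) (simp_all add: restrict_scalars_def sc)
  have "vdim (lie_of P) = vdim ?V"
    by (rule vdim_iso[OF lie_of_vsp[OF PM] V _ _ fd, of "\<lambda>x. x"])
      (auto simp: LinearCombinations.module_hom_def restrict_scalars_def sc lie_of_vsp PM bij_betw_def
        left_module.smult_closed[OF PM] \<kappa>_monomial_closed)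
  then show "red_uea_module_dim L \<chi> P = vdim (lie_of P)" by (simp add: red_uea_module_dim_def)
qed

end

section \<open>Quotients by a $p$-ideal\<close>

lemma funpow_cong_on:
  assumes "\<And>m. m \<in> C \<Longrightarrow> f m = g m" "\<And>m. m \<in> C \<Longrightarrow> g m \<in> C" "m \<in> C"
  shows "(f ^^ k) m = (g ^^ k) m \<and> (g ^^ k) m \<in> C"
  by (induction k) (simp_all add: assms)

definition infl_lie_module ::
    "('k, 'l, 'x) lie_algebra_scheme \<Rightarrow> 'l set \<Rightarrow> ('k, 'l set, 'm) lie_module \<Rightarrow> ('k, 'l, 'm) lie_module" where
  "infl_lie_module L I N =
     \<lparr>carrier = carrier N, mult = mult N, one = one N, zero = zero N, add = add N,
      smult = smult N, act = (\<lambda>x. act N (I +>\<^bsub>L\<^esub> x))\<rparr>"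

lemma infl_lie_module_simps [simp]:
  "carrier (infl_lie_module L I N) = carrier N" "zero (infl_lie_module L I N) = zero N"
  "add (infl_lie_module L I N) = add N" "smult (infl_lie_module L I N) = smult N"
  "act (infl_lie_module L I N) x = act N (I +>\<^bsub>L\<^esub> x)"
  by (simp_all add: infl_lie_module_def)

lemma a_minus_cong: "carrier M = carrier N \<Longrightarrow> zero M = zero N \<Longrightarrow> add M = add N \<Longrightarrow> a_minus M = a_minus N"
  by (simp add: a_minus_def a_inv_def m_inv_def fun_eq_iff)

lemma quot_lie_module_simps [simp]:
  "carrier (quot_lie_module N) = carrier N" "zero (quot_lie_module N) = zero N"
  "add (quot_lie_module N) = add N" "smult (quot_lie_module N) = smult N"
  by (simp_all add: quot_lie_module_def)

locale p_ideal_quot = restricted_lie_algebra L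
  for L :: "('k::field, 'l, 'x) restricted_lie_algebra_scheme" (structure) +
  fixes I :: "'l set"
  assumes ideal: "p_ideal I L"
begin

abbreviation q :: "'l \<Rightarrow> 'l set" where "q x \<equiv> I +> x"
abbreviation LQ :: "('k, 'l set) restricted_lie_algebra" where "LQ \<equiv> quot_lie L I"

lemmas I_ssp = p_idealD(1)[OF ideal]

lemma I_carr: "y \<in> I \<Longrightarrow> y \<in> carrier L" using sspD(2)[OF I_ssp] by blast

lemma I_bracket: "x \<in> carrier L \<Longrightarrow> y \<in> I \<Longrightarrow> bracket L x y \<in> I" by (rule p_idealD(2)[OF ideal])

lemma I_bracket':
  assumes "y \<in> I" "x \<in> carrier L" shows "bracket L y x \<in> I"
proof -
  have "bracket L y x = \<ominus> bracket L x y"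
    using assms I_carr bracket_closed bracket_self[of "x \<oplus> y"] bracket_self[of x] bracket_self[of y]
    by (intro M.minus_equality[symmetric]) (simp_all add: bracket_add_left bracket_add_right M.a_ac)
  then show ?thesis
    using sspD(5)[OF I_ssp I_bracket[OF assms(2,1)], of "-1"]
      smult_minus_one[OF vectorspace_axioms, of "bracket L x y"] I_bracket[OF assms(2,1)] I_carr by simp
qed

lemma I_subgroup: "abelian_subgroup I L"
proof (rule abelian_subgroupI3)
  show "additive_subgroup I L"
  proof (rule additive_subgroup.intro, rule subgroup.intro)
    show "I \<subseteq> carrier (add_monoid L)" using I_carr by auto
    show "inv\<^bsub>add_monoid L\<^esub> x \<in> I" if "x \<in> I" for x
      using sspD(6)[OF I_ssp sspD(3)[OF I_ssp] that] I_carr[OF that] by (simp add: a_minus_def a_inv_def)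
  qed (use sspD(3,4)[OF I_ssp] in auto)
qed (rule M.abelian_group_axioms)

sublocale I: abelian_subgroup I L by (rule I_subgroup)

lemma q_zero: "q \<zero> = I"
  by (rule M.a_coset_join2) (use sspD(3)[OF I_ssp] I.a_subgroup in auto)

lemma q_absorb: "y \<in> I \<Longrightarrow> x \<in> carrier L \<Longrightarrow> q (y \<oplus> x) = q x"
  using M.a_coset_add_assoc[of I y x] M.a_coset_join2[of y I] I_carr I.a_subgroup I.a_subset by simp

lemma q_mem: "x' \<in> q x \<Longrightarrow> \<exists>y\<in>I. x' = y \<oplus> x"
  by (auto simp: a_r_coset_def')

lemma q_self: "x \<in> carrier L \<Longrightarrow> x \<in> q x" by (rule I.a_rcos_self)

text \<open>The operations of \<open>quot_lie\<close> are unions over representatives. Independence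
  of the representative makes all members equal, and the union collapses.\<close>

lemma UN_q:
  assumes "x \<in> carrier L" "\<And>y. y \<in> I \<Longrightarrow> g (y \<oplus> x) = C"
  shows "(\<Union>x'\<in>q x. g x') = C"
proof -
  have "g ` q x = {C}"
    using q_mem[of _ x] assms(2) q_self[OF assms(1)] assms(2)[OF sspD(3)[OF I_ssp]] assms(1)
    by (auto simp: image_iff)
  then show ?thesis by simp
qed

lemma quot_carrier: "carrier LQ = q ` carrier L"
  by (auto simp: quot_lie_def A_RCOSETS_def')

lemma quot_zero: "zero LQ = q \<zero>"
  by (simp add: quot_lie_def q_zero)

lemma quot_add: "x \<in> carrier L \<Longrightarrow> y \<in> carrier L \<Longrightarrow> q x \<oplus>\<^bsub>LQ\<^esub> q y = q (x \<oplus> y)"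
  by (simp add: quot_lie_def I.a_rcos_sum)

lemma quot_smult:
  assumes "x \<in> carrier L" shows "a \<odot>\<^bsub>LQ\<^esub> q x = q (a \<odot> x)"
  using assms I_carr sspD(5)[OF I_ssp]
  by (simp add: quot_lie_def, intro UN_q)
     (simp_all add: vspD(4)[OF vectorspace_axioms] q_absorb)

lemma quot_bracket:
  assumes x: "x \<in> carrier L" and y: "y \<in> carrier L" shows "bracket LQ (q x) (q y) = q (bracket L x y)"
proof -
  have inner: "(\<Union>y'\<in>q y. q (bracket L x' y')) = q (bracket L x' y)" if "x' \<in> carrier L" for x'
    using that y I_carr I_bracket bracket_closed
    by (intro UN_q[OF y]) (simp_all add: bracket_add_right q_absorb)
  have "(\<Union>x'\<in>q x. \<Union>y'\<in>q y. q (bracket L x' y')) = q (bracket L x y)"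
    using x y I_carr I_bracket' bracket_closed
    by (intro UN_q[OF x]) (simp_all add: inner bracket_add_left q_absorb)
  then show ?thesis by (simp add: quot_lie_def)
qed

text \<open>The p-map is not additive, but for y in I the iterated brackets defining s_i(y,x) start
  from y and so remain in the ideal. Hence y + x and x have p-maps in the same coset.\<close>

lemma quot_pmap:
  assumes x: "x \<in> carrier L" shows "pmap LQ (q x) = q (pmap L x)"
proof -
  have "q (pmap L (y \<oplus> x)) = q (pmap L x)" if y: "y \<in> I" for y
  proof -
    have ad: "ad_coeff L y x k j \<in> I" for k j
      using y x sspD(3,4)[OF I_ssp] I_bracket I_bracket' I_carr by (induction k arbitrary: j) auto
    have js: "jacobson_s L i y x \<in> I" for i using ad sspD(5)[OF I_ssp] by (simp add: jacobson_s_def)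
    have s: "(\<Oplus>i\<in>B. jacobson_s L i y x) \<in> I" for B :: "nat set"
    proof (induction B rule: infinite_finite_induct)
      case (insert i B)
      then show ?case using js I_carr sspD(4)[OF I_ssp] by (subst M.finsum_insert) auto
    qed (use sspD(3)[OF I_ssp] in auto)
    have p: "pmap L y \<in> I" "pmap L x \<in> carrier L" using p_idealD(3)[OF ideal y] pmap_closed[OF x] .
    have "pmap L (y \<oplus> x) = (pmap L y \<oplus> (\<Oplus>i\<in>{1..<CHAR('k)}. jacobson_s L i y x)) \<oplus> pmap L x"
      using pmap_add[OF I_carr[OF y] x] p I_carr[OF p(1)] I_carr[OF s] by (simp add: M.a_ac)
    then show ?thesis using q_absorb[OF sspD(4)[OF I_ssp p(1) s] p(2)] by simp
  qed
  then have "(\<Union>x'\<in>q x. q (pmap L x')) = q (pmap L x)" by (rule UN_q[OF x])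
  then show ?thesis by (simp add: quot_lie_def)
qed

lemmas quot_simps = quot_zero quot_add quot_smult quot_bracket quot_pmap

lemma quot_lie_algebra: "lie_algebra LQ"
proof (intro lie_algebra.intro lie_algebra_axioms.intro vspI)
  show "bracket LQ X (bracket LQ Y Z) \<oplus>\<^bsub>LQ\<^esub> bracket LQ Y (bracket LQ Z X) \<oplus>\<^bsub>LQ\<^esub> bracket LQ Z (bracket LQ X Y) = \<zero>\<^bsub>LQ\<^esub>"
    if "X \<in> carrier LQ" "Y \<in> carrier LQ" "Z \<in> carrier LQ" for X Y Z
    using that by (auto simp: quot_carrier quot_simps bracket_closed jacobi)
  show "\<exists>w\<in>carrier LQ. v \<oplus>\<^bsub>LQ\<^esub> w = \<zero>\<^bsub>LQ\<^esub>" if v: "v \<in> carrier LQ" for v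
  proof -
    obtain x where "v = q x" "x \<in> carrier L" using v unfolding quot_carrier by (rule imageE)
    then show ?thesis
      by (intro bexI[of _ "q (\<ominus> x)"]) (simp_all add: quot_carrier quot_simps M.r_neg)
  qed
qed (auto simp: quot_carrier quot_simps bracket_closed vspD[OF vectorspace_axioms] M.a_ac bracket_add_left
    bracket_add_right bracket_smult_left bracket_smult_right bracket_self)

lemma quot_pmap_closed: "X \<in> carrier LQ \<Longrightarrow> pmap LQ X \<in> carrier LQ"
  by (auto simp: quot_carrier quot_pmap pmap_closed)

lemma the_elem_q:
  assumes "x \<in> carrier L" "\<And>y. y \<in> I \<Longrightarrow> g (y \<oplus> x) = g x"
  shows "the_elem (g ` q x) = g x"
proof -
  have "g ` q x = {g x}" using q_mem[of _ x] q_self[OF assms(1)] assms(2) by fastforce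
  then show ?thesis by simp
qed

lemma quot_form:
  assumes "linear_form L \<chi>" "\<And>y. y \<in> I \<Longrightarrow> \<chi> y = 0" "x \<in> carrier L"
  shows "quot_form \<chi> (q x) = \<chi> x"
  unfolding quot_form_def
  by (rule the_elem_q[OF assms(3)]) (simp add: linear_formD(1)[OF assms(1)] assms(2,3) I_carr)

lemma quot_act:
  assumes "lie_module L M" "\<And>y m. y \<in> I \<Longrightarrow> m \<in> carrier M \<Longrightarrow> act M y m = \<zero>\<^bsub>M\<^esub>"
    and "x \<in> carrier L" "m \<in> carrier M"
  shows "act (quot_lie_module M) (q x) m = act M x m"
proof -
  interpret lie_module L M by fact
  show ?thesis unfolding quot_lie_module_def
    by (simp, rule the_elem_q[OF assms(3)])
      (simp add: act_add_left I_carr assms(2,3,4) act_closed)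
qed

lemma quot_lie_module:
  assumes LM: "lie_module L M" and IM: "\<And>y m. y \<in> I \<Longrightarrow> m \<in> carrier M \<Longrightarrow> act M y m = \<zero>\<^bsub>M\<^esub>"
  shows "lie_module LQ (quot_lie_module M)"
proof -
  interpret lie_module L M by (rule LM)
  note s = quot_act[OF LM IM]
  have v: "vsp (quot_lie_module M)" by (rule vsp_cong[OF M.vectorspace_axioms]) simp_all
  show ?thesis
    by (intro lie_module.intro quot_lie_algebra v lie_module_axioms.intro)
      (auto simp: quot_carrier s quot_simps act_closed act_add_left act_add_right act_smult_left act_smult_right
        act_bracket bracket_closed a_minus_cong[of "quot_lie_module M" M])
qed

lemma quot_p_character:
  assumes LM: "lie_module L M" and IM: "\<And>y m. y \<in> I \<Longrightarrow> m \<in> carrier M \<Longrightarrow> act M y m = \<zero>\<^bsub>M\<^esub>"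
    and pc: "has_p_character L \<chi> M" and \<chi>: "linear_form L \<chi>" "\<And>y. y \<in> I \<Longrightarrow> \<chi> y = 0"
  shows "has_p_character LQ (quot_form \<chi>) (quot_lie_module M)"
  unfolding has_p_character_def
proof (intro ballI)
  interpret lie_module L M by (rule LM)
  note s = quot_act[OF LM IM]
  fix X m assume "X \<in> carrier LQ" and m: "m \<in> carrier (quot_lie_module M)"
  then obtain x where x: "X = q x" "x \<in> carrier L" by (auto simp: quot_carrier)
  have f: "(act (quot_lie_module M) (q x) ^^ k) m = (act M x ^^ k) m" for k
    using funpow_cong_on[of "carrier M" "act (quot_lie_module M) (q x)" "act M x" m k] s[OF _ _ x(2)] act_closed[OF x(2)] m
    by simp
  show "(act (quot_lie_module M) X ^^ CHAR('k)) m \<ominus>\<^bsub>quot_lie_module M\<^esub> act (quot_lie_module M) (pmap LQ X) m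
      = quot_form \<chi> X ^ CHAR('k) \<odot>\<^bsub>quot_lie_module M\<^esub> m"
    using pc x(2) m unfolding x(1)
    by (simp add: f quot_form[OF \<chi>] quot_pmap s pmap_closed has_p_character_def
        a_minus_cong[of "quot_lie_module M" M])
qed

lemma infl_lie_module:
  assumes LN: "lie_module LQ N"
  shows "lie_module L (infl_lie_module L I N)"
proof -
  interpret N: lie_module LQ N by (rule LN)
  have v: "vsp (infl_lie_module L I N)" by (rule vsp_cong[OF N.M.vectorspace_axioms]) simp_all
  note m = a_minus_cong[of "infl_lie_module L I N" N, simplified]
  have c: "q x \<in> carrier LQ" if "x \<in> carrier L" for x using that by (simp add: quot_carrier)
  show ?thesis
    by (intro lie_module.intro lie_algebra_axioms v lie_module_axioms.intro)
      (simp_all add: c quot_add[symmetric] quot_smult[symmetric] quot_bracket[symmetric] N.act_closed N.act_add_left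
        N.act_add_right N.act_smult_left N.act_smult_right N.act_bracket m)
qed

lemma infl_p_character:
  assumes pc: "has_p_character LQ (quot_form \<chi>) N" and \<chi>: "linear_form L \<chi>" "\<And>y. y \<in> I \<Longrightarrow> \<chi> y = 0"
  shows "has_p_character L \<chi> (infl_lie_module L I N)"
  unfolding has_p_character_def
proof (intro ballI)
  fix x m assume x: "x \<in> carrier L" and m: "m \<in> carrier (infl_lie_module L I N)"
  have c: "q x \<in> carrier LQ" using x by (simp add: quot_carrier)
  have "act (infl_lie_module L I N) x = act N (q x)" by (rule ext) simp
  moreover have "act (infl_lie_module L I N) (pmap L x) m = act N (pmap LQ (q x)) m" using x by (simp add: quot_pmap)
  moreover have "a_minus (infl_lie_module L I N) = a_minus N" by (rule a_minus_cong) simp_all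
  moreover have "(act N (q x) ^^ CHAR('k)) m \<ominus>\<^bsub>N\<^esub> act N (pmap LQ (q x)) m = quot_form \<chi> (q x) ^ CHAR('k) \<odot>\<^bsub>N\<^esub> m"
    using pc c m by (simp add: has_p_character_def)
  ultimately show "(act (infl_lie_module L I N) x ^^ CHAR('k)) m \<ominus>\<^bsub>infl_lie_module L I N\<^esub>
      act (infl_lie_module L I N) (pmap L x) m = \<chi> x ^ CHAR('k) \<odot>\<^bsub>infl_lie_module L I N\<^esub> m"
    using quot_form[OF \<chi> x] by simp
qed

lemma infl_act_I:
  assumes "lie_module LQ N" "y \<in> I" "m \<in> carrier N"
  shows "act N (q y) m = \<zero>\<^bsub>N\<^esub>"
proof -
  interpret N: lie_module LQ N by fact
  have "q y = \<zero>\<^bsub>LQ\<^esub>" using q_absorb[OF assms(2) M.zero_closed] I_carr[OF assms(2)] by (simp add: quot_zero)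
  then show ?thesis using N.act_zero_left[OF assms(3)] by simp
qed

end

section \<open>Freeness over the ideal\<close>

lemma (in abelian_group) add_minus_cancel:
  assumes "a \<in> carrier G" "b \<in> carrier G"
  shows "b \<oplus> (a \<ominus> b) = a"
  using assms a_lcomm[of b a "\<ominus> b"] by (simp add: a_minus_def r_neg)

lemma (in abelian_group) minus_add_exchange:
  assumes "a \<in> carrier G" "b \<in> carrier G" "d \<in> carrier G"
  shows "(a \<ominus> (d \<ominus> b)) \<oplus> d = a \<oplus> b"
proof -
  let ?e = "d \<ominus> b"
  have e: "?e \<in> carrier G" using assms by simp
  have "\<ominus> ?e \<oplus> d = \<ominus> ?e \<oplus> (b \<oplus> ?e)" using add_minus_cancel[OF assms(3,2)] by simp
  also have "\<dots> = b \<oplus> (\<ominus> ?e \<oplus> ?e)" by (rule a_lcomm) (use e assms in auto)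
  also have "\<dots> = b" using e assms by (simp add: l_neg)
  finally show ?thesis using e assms by (simp add: a_minus_def[of G a] a_assoc)
qed

lemma ssp_sum:
  fixes V :: "('k::field, 'v, 'x) module_scheme"
  assumes A: "ssp A V" and B: "ssp B V"
  shows "ssp {a \<oplus>\<^bsub>V\<^esub> b | a b. a \<in> A \<and> b \<in> B} V"
proof (rule sspI[OF sspD(1)[OF A]])
  interpret vectorspace class_ring V by (rule sspD(1)[OF A])
  note c = sspD(7)[OF A] sspD(7)[OF B]
  show "{a \<oplus>\<^bsub>V\<^esub> b | a b. a \<in> A \<and> b \<in> B} \<subseteq> carrier V" using c by auto
  have "\<zero>\<^bsub>V\<^esub> = \<zero>\<^bsub>V\<^esub> \<oplus>\<^bsub>V\<^esub> \<zero>\<^bsub>V\<^esub>" by simp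
  then show "\<zero>\<^bsub>V\<^esub> \<in> {a \<oplus>\<^bsub>V\<^esub> b | a b. a \<in> A \<and> b \<in> B}" using sspD(3)[OF A] sspD(3)[OF B] by blast
  fix x y assume "x \<in> {a \<oplus>\<^bsub>V\<^esub> b | a b. a \<in> A \<and> b \<in> B}"
  then obtain a b where x: "x = a \<oplus>\<^bsub>V\<^esub> b" "a \<in> A" "b \<in> B" by auto
  have "r \<odot>\<^bsub>V\<^esub> x = r \<odot>\<^bsub>V\<^esub> a \<oplus>\<^bsub>V\<^esub> r \<odot>\<^bsub>V\<^esub> b" for r
    using x c vspD(4)[OF vectorspace_axioms] by simp
  then show "r \<odot>\<^bsub>V\<^esub> x \<in> {a \<oplus>\<^bsub>V\<^esub> b | a b. a \<in> A \<and> b \<in> B}" for r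
    using sspD(5)[OF A x(2)] sspD(5)[OF B x(3)] by blast
  assume "y \<in> {a \<oplus>\<^bsub>V\<^esub> b | a b. a \<in> A \<and> b \<in> B}"
  then obtain a' b' where y: "y = a' \<oplus>\<^bsub>V\<^esub> b'" "a' \<in> A" "b' \<in> B" by auto
  have "x \<oplus>\<^bsub>V\<^esub> y = (a \<oplus>\<^bsub>V\<^esub> a') \<oplus>\<^bsub>V\<^esub> (b \<oplus>\<^bsub>V\<^esub> b')" using x y c by (simp add: M.a_ac)
  then show "x \<oplus>\<^bsub>V\<^esub> y \<in> {a \<oplus>\<^bsub>V\<^esub> b | a b. a \<in> A \<and> b \<in> B}"
    using sspD(4)[OF A x(2) y(2)] sspD(4)[OF B x(3) y(3)] by blast
qed

lemma ssp_vimage: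
  fixes V :: "('k::field, 'v, 'x) module_scheme" and U :: "('k, 'u, 'y) module_scheme"
  assumes "vsp V" "g \<in> lhom V U" "ssp W U"
  shows "ssp {x \<in> carrier V. g x \<in> W} V"
proof (rule sspI[OF assms(1)])
  interpret vectorspace class_ring V by fact
  show "\<zero>\<^bsub>V\<^esub> \<in> {x \<in> carrier V. g x \<in> W}"
    using lhom_zero(1)[OF assms(1) sspD(1)[OF assms(3)] assms(2)] sspD(3)[OF assms(3)] by simp
  have "a \<odot>\<^bsub>V\<^esub> x \<in> carrier V" if "x \<in> carrier V" for a x using smult_closed[of a x] that by simp
  then show "a \<odot>\<^bsub>V\<^esub> x \<in> {x \<in> carrier V. g x \<in> W}" if "x \<in> {x \<in> carrier V. g x \<in> W}" for a x
    using that sspD(5)[OF assms(3)] by (simp add: lhomD(3)[OF assms(2)])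
  show "x \<oplus>\<^bsub>V\<^esub> y \<in> {x \<in> carrier V. g x \<in> W}" if "x \<in> {x \<in> carrier V. g x \<in> W}" "y \<in> {x \<in> carrier V. g x \<in> W}" for x y
    using that sspD(4)[OF assms(3)] by (simp add: lhomD(2)[OF assms(2)])
qed auto

lemma ssp_Int:
  fixes V :: "('k::field, 'v, 'x) module_scheme"
  assumes "ssp A V" "ssp B V" shows "ssp (A \<inter> B) V"
  using sspD[OF assms(1)] sspD[OF assms(2)] by (intro sspI) auto

lemma lhom_sub:
  fixes V :: "('k::field, 'v, 'x) module_scheme" and U :: "('k, 'u, 'y) module_scheme"
  assumes "g \<in> lhom V U" "ssp W V" shows "g \<in> lhom (V\<lparr>carrier := W\<rparr>) U"
  using lhomD[OF assms(1)] sspD(7)[OF assms(2)] by (intro lhomI) auto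

lemma sub_minus:
  fixes V :: "('k::field, 'v, 'x) module_scheme"
  assumes "ssp W V" "x \<in> W" "y \<in> W"
  shows "x \<ominus>\<^bsub>V\<lparr>carrier := W\<rparr>\<^esub> y = x \<ominus>\<^bsub>V\<^esub> y"
  using lhom_zero(2)[OF sspD(8)[OF assms(1)] sspD(1)[OF assms(1)], of "\<lambda>x. x" x y] assms sspD(7)[OF assms(1)]
  by (simp add: LinearCombinations.module_hom_def)

lemma vdim_trivial: "vdim (trivial_lie_module :: ('k::field, 'l, 'k) lie_module) = 1"
  and vsp_trivial: "vsp (trivial_lie_module :: ('k::field, 'l, 'k) lie_module)"
  and fdim_trivial: "fdim (trivial_lie_module :: ('k::field, 'l, 'k) lie_module)"
proof -
  let ?T = "trivial_lie_module :: ('k, 'l, 'k) lie_module"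
  have s: "carrier ?T = UNIV" "zero ?T = 0" "add ?T = (+)" "smult ?T = (*)" by (simp_all add: trivial_lie_module_def)
  show V: "vsp ?T"
  proof (rule vspI)
    show "\<exists>w\<in>carrier ?T. v \<oplus>\<^bsub>?T\<^esub> w = \<zero>\<^bsub>?T\<^esub>" for v by (rule bexI[of _ "- v"]) (simp_all add: s)
  qed (simp_all add: s algebra_simps)
  show fd: "fdim ?T"
  proof (rule fdimI[OF V, of "{1}"])
    fix W assume W: "ssp W ?T" "{1} \<subseteq> W"
    have "a \<in> W" for a using sspD(5)[OF W(1), of 1 a] W(2) by (simp add: s)
    then show "W = carrier ?T" by (auto simp: s)
  qed (simp_all add: s)
  interpret vectorspace class_ring ?T by (rule V)
  have Z: "ssp {\<zero>\<^bsub>?T\<^esub>} ?T" by (rule sspI[OF V]) (auto simp: s)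
  obtain r n :: nat and e co where b: "\<And>k. linear_form ?T (co k)"
    "\<And>i k. i < n \<Longrightarrow> k < n \<Longrightarrow> co k (e i) = (if k = i then 1 else 0)"
    "\<And>x. x \<in> carrier ?T \<Longrightarrow> x = (\<Oplus>\<^bsub>?T\<^esub>k\<in>{..<n}. co k x \<odot>\<^bsub>?T\<^esub> e k)" "vdim ?T = n"
    by (rule adapted_basis[OF V fd Z]) (rule that; assumption)
  have c: "co k x = x * co k 1" for k x using linear_formD(2)[OF b(1)[of k], of 1 x] by (simp add: s)
  have "n \<noteq> 0"
  proof
    assume "n = 0"
    then have "(1::'k) = 0" using b(3)[of 1] by (simp add: s)
    then show False by simp
  qed
  \<comment> \<open>Since \<open>co k x = x * co k 1\<close>, the duality relations for two basis
    vectors contradict each other.\<close>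
  moreover have "\<not> n \<ge> 2"
  proof
    assume n: "n \<ge> 2"
    have "e 0 * co 0 1 = 1" "e 1 * co 0 1 = 0" "e 1 * co 1 1 = 1"
      using b(2)[of 0 0] b(2)[of 1 0] b(2)[of 1 1] n c[of 0 "e 0"] c[of 0 "e 1"] c[of 1 "e 1"] by simp_all
    then show False by auto
  qed
  ultimately show "vdim ?T = 1" using b(4) by simp
qed

lemma trivial_lhom: "g \<in> lhom V (trivial_lie_module :: ('k::field, 'l, 'k) lie_module) \<longleftrightarrow> linear_form V g"
  by (auto simp: LinearCombinations.module_hom_def linear_form_def trivial_lie_module_def)

text \<open>The data on which freeness over I depends. \<open>essential\<close> says that proper
  I-submodules of Q lie in ker rho; \<open>split\<close> is projectivity of Q against I-submodules
  of P; \<open>lift\<close> is projectivity of P over I, tested on the trivial module;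
  \<open>generated\<close> encodes irreducibility of S, with \<open>g0\<close> carrying the
  generator \<open>q0\<close> of Q to a generator of P over L.\<close>

locale cover_pair =
  fixes L :: "('k::field, 'l, 'x) lie_algebra_scheme" and I :: "'l set"
    and P :: "('k, 'l, 'p, 'y) lie_module_scheme" and Q :: "('k, 'l, 'q, 'z) lie_module_scheme"
    and \<rho> :: "'q \<Rightarrow> 'k" and q0 :: 'q and g0 :: "'q \<Rightarrow> 'p"
  assumes LP: "lie_module L P" and fdP: "fdim P"
    and I_carr: "y \<in> I \<Longrightarrow> y \<in> carrier L"
    and I_bracket: "x \<in> carrier L \<Longrightarrow> y \<in> I \<Longrightarrow> bracket L x y \<in> I" "x \<in> carrier L \<Longrightarrow> y \<in> I \<Longrightarrow> bracket L y x \<in> I"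
    and VQ: "vsp Q" and fdQ: "fdim Q" and actQ: "y \<in> I \<Longrightarrow> u \<in> carrier Q \<Longrightarrow> act Q y u \<in> carrier Q"
    and \<rho>: "linear_form Q \<rho>" and \<rho>_act: "y \<in> I \<Longrightarrow> u \<in> carrier Q \<Longrightarrow> \<rho> (act Q y u) = 0"
    and q0: "q0 \<in> carrier Q" "\<rho> q0 = 1"
    and essential: "ssp U Q \<Longrightarrow> (\<And>y u. y \<in> I \<Longrightarrow> u \<in> U \<Longrightarrow> act Q y u \<in> U) \<Longrightarrow> u \<in> U \<Longrightarrow> \<rho> u = 1 \<Longrightarrow> U = carrier Q"
    and split: "ssp N P \<Longrightarrow> (\<And>y v. y \<in> I \<Longrightarrow> v \<in> N \<Longrightarrow> act P y v \<in> N) \<Longrightarrow>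
      h \<in> lie_hom (L\<lparr>carrier := I\<rparr>) (P\<lparr>carrier := N\<rparr>) Q \<Longrightarrow> h ` N = carrier Q \<Longrightarrow>
      \<exists>s\<in>lie_hom (L\<lparr>carrier := I\<rparr>) Q (P\<lparr>carrier := N\<rparr>). \<forall>v\<in>carrier Q. h (s v) = v"
    and lift: "linear_form P \<mu> \<Longrightarrow> (\<And>y v. y \<in> I \<Longrightarrow> v \<in> carrier P \<Longrightarrow> \<mu> (act P y v) = 0) \<Longrightarrow>
      \<exists>g\<in>lie_hom (L\<lparr>carrier := I\<rparr>) P Q. \<forall>v\<in>carrier P. \<rho> (g v) = \<mu> v"
    and g0: "g0 \<in> lie_hom (L\<lparr>carrier := I\<rparr>) Q P"
    and generated: "ssp W P \<Longrightarrow> (\<And>x v. x \<in> carrier L \<Longrightarrow> v \<in> W \<Longrightarrow> act P x v \<in> W) \<Longrightarrow> g0 q0 \<in> W \<Longrightarrow> W = carrier P"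
begin

sublocale lie_module L P by (rule LP)

definition stable :: "'p set \<Rightarrow> bool" where
  "stable N \<longleftrightarrow> ssp N P \<and> (\<forall>y\<in>I. \<forall>v\<in>N. act P y v \<in> N)"

lemma stableI: "ssp N P \<Longrightarrow> (\<And>y v. y \<in> I \<Longrightarrow> v \<in> N \<Longrightarrow> act P y v \<in> N) \<Longrightarrow> stable N"
  by (simp add: stable_def)

lemma stableD: "stable N \<Longrightarrow> ssp N P" "stable N \<Longrightarrow> y \<in> I \<Longrightarrow> v \<in> N \<Longrightarrow> act P y v \<in> N"
  by (simp_all add: stable_def)

lemma I_act: "y \<in> I \<Longrightarrow> v \<in> carrier P \<Longrightarrow> act P y v \<in> carrier P"
  by (rule act_closed[OF I_carr])

lemma essential':
  assumes W: "ssp W Q" "\<And>y v. y \<in> I \<Longrightarrow> v \<in> W \<Longrightarrow> act Q y v \<in> W" and v: "v \<in> W" "\<rho> v \<noteq> 0"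
  shows "W = carrier Q"
proof (rule essential[OF W])
  show "inverse (\<rho> v) \<odot>\<^bsub>Q\<^esub> v \<in> W" by (rule sspD(5)[OF W(1) v(1)])
  show "\<rho> (inverse (\<rho> v) \<odot>\<^bsub>Q\<^esub> v) = 1" using linear_formD(2)[OF \<rho> sspD(7)[OF W(1) v(1)]] v(2) by simp
qed

lemma ker_ssp: "ssp {v \<in> carrier Q. \<rho> v = 0} Q" and vdim_Q: "vdim Q = Suc (vdim (Q\<lparr>carrier := {v \<in> carrier Q. \<rho> v = 0}\<rparr>))"
proof -
  let ?T = "trivial_lie_module :: ('k, 'l, 'k) lie_module"
  have r: "\<rho> \<in> lhom Q ?T" using \<rho> by (simp add: trivial_lhom)
  have "\<rho> ` carrier Q = carrier ?T"
  proof
    show "carrier ?T \<subseteq> \<rho> ` carrier Q"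
    proof
      fix a
      interpret Q: vectorspace class_ring Q by (rule VQ)
      have "a = \<rho> (a \<odot>\<^bsub>Q\<^esub> q0)" using linear_formD(2)[OF \<rho> q0(1)] q0(2) by simp
      moreover have "a \<odot>\<^bsub>Q\<^esub> q0 \<in> carrier Q" using Q.smult_closed[of a q0] q0 by simp
      ultimately show "a \<in> \<rho> ` carrier Q" by (rule image_eqI)
    qed
  qed (simp add: trivial_lie_module_def)
  note d = vdim_surj[OF VQ vsp_trivial r this fdQ]
  have z: "zero ?T = 0" by (simp add: trivial_lie_module_def)
  show "ssp {v \<in> carrier Q. \<rho> v = 0} Q" "vdim Q = Suc (vdim (Q\<lparr>carrier := {v \<in> carrier Q. \<rho> v = 0}\<rparr>))"
    using d(1,3) by (simp_all add: z vdim_trivial)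
qed

text \<open>Together with \<open>\<rho>_act\<close> this gives ker rho = IQ. If z were outside W, a
  hyperplane containing W but not z would be an I-submodule, as it contains IQ; correcting
  \<open>q0\<close> by a multiple of z puts a vector with rho = 1 into it, against
  essentiality.\<close>

lemma ker_generated:
  assumes W: "ssp W Q" and act: "\<And>y v. y \<in> I \<Longrightarrow> v \<in> carrier Q \<Longrightarrow> act Q y v \<in> W"
    and z: "z \<in> carrier Q" "\<rho> z = 0"
  shows "z \<in> W"
proof (rule ccontr)
  assume "z \<notin> W"
  interpret Q: vectorspace class_ring Q by (rule VQ)
  obtain r n :: nat and e co where b: "\<And>k. linear_form Q (co k)"
    "\<And>x. x \<in> carrier Q \<Longrightarrow> x \<in> W \<longleftrightarrow> (\<forall>k. r \<le> k \<and> k < n \<longrightarrow> co k x = 0)"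
    by (rule adapted_basis[OF VQ fdQ W]) (rule that; assumption)
  obtain k where k: "r \<le> k" "k < n" "co k z \<noteq> 0" using b(2)[OF z(1)] \<open>z \<notin> W\<close> by auto
  let ?N = "{v \<in> carrier Q. co k v = 0}"
  have sm: "a \<odot>\<^bsub>Q\<^esub> v \<in> carrier Q" if "v \<in> carrier Q" for a v using Q.smult_closed[of a v] that by simp
  have N: "ssp ?N Q"
    by (rule sspI[OF VQ]) (auto simp: linear_formD[OF b(1)] linear_form_zero[OF VQ b(1)[of k]] sm)
  \<comment> \<open>The multiple of z is chosen to cancel coordinate k of \<open>q0\<close>; it
    leaves rho unchanged since rho z = 0.\<close>
  let ?v = "q0 \<ominus>\<^bsub>Q\<^esub> (co k q0 / co k z) \<odot>\<^bsub>Q\<^esub> z"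
  have c: "(co k q0 / co k z) \<odot>\<^bsub>Q\<^esub> z \<in> carrier Q" using sm z by blast
  have "co k ?v = 0" "\<rho> ?v = 1"
    using k(3) q0 z
    by (simp_all add: linear_form_diff(1)[OF VQ b(1) q0(1) c] linear_form_diff(1)[OF VQ \<rho> q0(1) c]
        linear_formD(2)[OF b(1)] linear_formD(2)[OF \<rho>])
  moreover have "?v \<in> carrier Q" using q0 c by simp
  moreover have "act Q y v \<in> ?N" if "y \<in> I" "v \<in> ?N" for y v
    using that act[of y v] actQ[of y v] b(2)[of "act Q y v"] k by auto
  ultimately have "?N = carrier Q" using N by (intro essential[of ?N ?v]) auto
  then show False using z(1) k(3) by auto
qed

text \<open>The subspace IN. For N = P it is the radical over I in the usual sense, because all
  simple I-quotients of P will turn out to be trivial.\<close>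

definition radical :: "'p set \<Rightarrow> 'p set" where
  "radical N = LinearCombinations.module.span class_ring P {act P y v | y v. y \<in> I \<and> v \<in> N}"

lemma radical:
  assumes "N \<subseteq> carrier P"
  shows "ssp (radical N) P" "y \<in> I \<Longrightarrow> v \<in> N \<Longrightarrow> act P y v \<in> radical N"
    "ssp W P \<Longrightarrow> (\<And>y v. y \<in> I \<Longrightarrow> v \<in> N \<Longrightarrow> act P y v \<in> W) \<Longrightarrow> radical N \<subseteq> W"
proof -
  have "{act P y v | y v. y \<in> I \<and> v \<in> N} \<subseteq> carrier P" using assms I_act by blast
  note s = span_ssp[OF M.vectorspace_axioms this]
  show "ssp (radical N) P" unfolding radical_def by (rule s)
  show "y \<in> I \<Longrightarrow> v \<in> N \<Longrightarrow> act P y v \<in> radical N" unfolding radical_def using s(2) by blast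
  show "ssp W P \<Longrightarrow> (\<And>y v. y \<in> I \<Longrightarrow> v \<in> N \<Longrightarrow> act P y v \<in> W) \<Longrightarrow> radical N \<subseteq> W"
    unfolding radical_def by (rule s(3)) blast+
qed

text \<open>Says that N lies in X + IN, by quantifying over the subspaces that contain X and IN; no
  sum of subspaces has to be formed.\<close>

definition supplements :: "'p set \<Rightarrow> 'p set \<Rightarrow> bool" where
  "supplements X N \<longleftrightarrow> (\<forall>Y. ssp Y P \<and> X \<subseteq> Y \<and> (\<forall>y\<in>I. \<forall>v\<in>N. act P y v \<in> Y) \<longrightarrow> N \<subseteq> Y)"

lemma supplementsD:
  "supplements X N \<Longrightarrow> ssp Y P \<Longrightarrow> X \<subseteq> Y \<Longrightarrow> (\<And>y v. y \<in> I \<Longrightarrow> v \<in> N \<Longrightarrow> act P y v \<in> Y) \<Longrightarrow> N \<subseteq> Y"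
  by (simp add: supplements_def)

text \<open>\<open>f\<close> stands for an I-map from Q to P/X. If it is nonzero, maximality gives P
  = X + f(Q), so IP lies in X + f(ker rho) and hence so does P. Writing f(q0) = x + f(u) with rho u
  = 0 puts q0 - u, on which rho is 1, into the preimage of X, which is therefore all of Q.\<close>

lemma image_in_maximal:
  assumes X: "stable X" "supplements X (carrier P)"
    and max: "\<And>Z. stable Z \<Longrightarrow> X \<subseteq> Z \<Longrightarrow> Z \<noteq> X \<Longrightarrow> Z = carrier P"
    and f: "f \<in> lhom Q P" and eq: "\<And>y v. y \<in> I \<Longrightarrow> v \<in> carrier Q \<Longrightarrow> f (act Q y v) \<ominus>\<^bsub>P\<^esub> act P y (f v) \<in> X"
    and v: "v \<in> carrier Q"
  shows "f v \<in> X"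
proof (rule ccontr)
  assume nX: "f v \<notin> X"
  interpret Q: vectorspace class_ring Q by (rule VQ)
  note Xs = stableD(1)[OF X(1)] and fD = lhomD[OF f]
  note X' = sspD[OF Xs]
  have VP: "vsp P" by (rule M.vectorspace_axioms)
  \<comment> \<open>As \<open>f\<close> commutes with \<open>y\<close> only modulo X, applying
    \<open>y\<close> to x + f(u) gives f(y u) plus a corrected element of X.\<close>
  have act_sum: "act P y (x \<oplus>\<^bsub>P\<^esub> f u) = (act P y x \<ominus>\<^bsub>P\<^esub> (f (act Q y u) \<ominus>\<^bsub>P\<^esub> act P y (f u))) \<oplus>\<^bsub>P\<^esub> f (act Q y u)"
    "act P y x \<ominus>\<^bsub>P\<^esub> (f (act Q y u) \<ominus>\<^bsub>P\<^esub> act P y (f u)) \<in> X" if "y \<in> I" "x \<in> X" "u \<in> carrier Q" for y x u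
  proof -
    have c: "act P y x \<in> carrier P" "act P y (f u) \<in> carrier P" "f (act Q y u) \<in> carrier P"
      "x \<in> carrier P" "f u \<in> carrier P"
      using that X'(7) fD(1) I_act actQ by auto
    show "act P y (x \<oplus>\<^bsub>P\<^esub> f u) = (act P y x \<ominus>\<^bsub>P\<^esub> (f (act Q y u) \<ominus>\<^bsub>P\<^esub> act P y (f u))) \<oplus>\<^bsub>P\<^esub> f (act Q y u)"
      unfolding act_add_right[OF I_carr[OF that(1)] c(4,5)] by (rule M.M.minus_add_exchange[OF c(1-3), symmetric])
    show "act P y x \<ominus>\<^bsub>P\<^esub> (f (act Q y u) \<ominus>\<^bsub>P\<^esub> act P y (f u)) \<in> X"
      by (rule X'(6)[OF stableD(2)[OF X(1) that(1,2)] eq[OF that(1,3)]])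
  qed
  have Qs: "ssp (carrier Q) Q" by (rule sspI[OF VQ]) (use Q.smult_closed in auto)
  let ?Z = "{x \<oplus>\<^bsub>P\<^esub> w | x w. x \<in> X \<and> w \<in> f ` carrier Q}"
  have "stable ?Z"
  proof (rule stableI)
    show "ssp ?Z P" by (rule ssp_sum[OF Xs image_ssp[OF VQ VP f Qs]])
    fix y z assume y: "y \<in> I" "z \<in> ?Z"
    then obtain x u where xu: "z = x \<oplus>\<^bsub>P\<^esub> f u" "x \<in> X" "u \<in> carrier Q" by auto
    show "act P y z \<in> ?Z" unfolding xu(1) using act_sum[OF y(1) xu(2,3)] actQ[OF y(1) xu(3)] by blast
  qed
  moreover have "X \<subseteq> ?Z"
  proof
    fix x assume x: "x \<in> X"
    have "x = x \<oplus>\<^bsub>P\<^esub> f \<zero>\<^bsub>Q\<^esub>" using x X'(7) lhom_zero(1)[OF VQ VP f] by simp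
    then show "x \<in> ?Z" using x by blast
  qed
  moreover have "?Z \<noteq> X"
  proof -
    have "f v = \<zero>\<^bsub>P\<^esub> \<oplus>\<^bsub>P\<^esub> f v" using fD(1)[OF v] by simp
    then have "f v \<in> ?Z" using X'(3) v by blast
    then show ?thesis using nX by blast
  qed
  ultimately have Z: "?Z = carrier P" by (rule max)
  let ?W = "{x \<oplus>\<^bsub>P\<^esub> w | x w. x \<in> X \<and> w \<in> f ` {u \<in> carrier Q. \<rho> u = 0}}"
  have "carrier P \<subseteq> ?W"
  proof (rule supplementsD[OF X(2)])
    show "ssp ?W P" by (rule ssp_sum[OF Xs image_ssp[OF VQ VP f ker_ssp]])
    show "X \<subseteq> ?W"
    proof
      fix x assume x: "x \<in> X"
      have "x = x \<oplus>\<^bsub>P\<^esub> f \<zero>\<^bsub>Q\<^esub>" using x X'(7) lhom_zero(1)[OF VQ VP f] by simp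
      then show "x \<in> ?W" using x sspD(3)[OF ker_ssp] by blast
    qed
    fix y z assume y: "y \<in> I" "z \<in> carrier P"
    then obtain x u where xu: "z = x \<oplus>\<^bsub>P\<^esub> f u" "x \<in> X" "u \<in> carrier Q" unfolding Z[symmetric] by auto
    show "act P y z \<in> ?W"
      unfolding xu(1) using act_sum[OF y(1) xu(2,3)] actQ[OF y(1) xu(3)] \<rho>_act[OF y(1) xu(3)] by blast
  qed
  then have "f q0 \<in> ?W" using fD(1)[OF q0(1)] by blast
  then obtain x u where xu: "f q0 = x \<oplus>\<^bsub>P\<^esub> f u" "x \<in> X" "u \<in> carrier Q" "\<rho> u = 0" by auto
  let ?N = "{u \<in> carrier Q. f u \<in> X}"
  have "?N = carrier Q"
  proof (rule essential[of ?N "q0 \<ominus>\<^bsub>Q\<^esub> u"])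
    show "ssp ?N Q" by (rule ssp_vimage[OF VQ f Xs])
    show "act Q y u \<in> ?N" if "y \<in> I" "u \<in> ?N" for y u
    proof -
      have u: "u \<in> carrier Q" "f u \<in> X" using that by auto
      have "f (act Q y u) = act P y (f u) \<oplus>\<^bsub>P\<^esub> (f (act Q y u) \<ominus>\<^bsub>P\<^esub> act P y (f u))"
        by (rule M.M.add_minus_cancel[symmetric]) (use that(1) u fD(1) I_act actQ in auto)
      also have "\<dots> \<in> X" by (rule X'(4)[OF stableD(2)[OF X(1) that(1) u(2)] eq[OF that(1) u(1)]])
      finally show ?thesis using actQ[OF that(1) u(1)] by simp
    qed
    have "f (q0 \<ominus>\<^bsub>Q\<^esub> u) = x"
      using lhom_zero(2)[OF VQ VP f q0(1) xu(3)] xu(1) X'(7)[OF xu(2)] fD(1)[OF xu(3)]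
      by (simp add: a_minus_def M.M.a_assoc M.M.r_neg)
    then show "q0 \<ominus>\<^bsub>Q\<^esub> u \<in> ?N" using xu(2) q0(1) xu(3) by simp
    show "\<rho> (q0 \<ominus>\<^bsub>Q\<^esub> u) = 1" using linear_form_diff(1)[OF VQ \<rho> q0(1) xu(3)] xu(4) q0(2) by simp
  qed
  then show False using v nX by blast
qed

lemma act_lhom: "x \<in> carrier L \<Longrightarrow> act P x \<in> lhom P P"
  by (rule lhomI) (simp_all add: act_closed act_add_right act_smult_right)

lemma carrier_ssp: "ssp (carrier P) P"
  by (rule sspI[OF M.vectorspace_axioms]) (use M.smult_closed in auto)

lemma vdim_le: "ssp Z P \<Longrightarrow> vdim (P\<lparr>carrier := Z\<rparr>) < Suc (vdim P)"
  using vdim_sub_mono(1)[OF fdP carrier_ssp, of Z] sspD(2)[of Z P] by simp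

text \<open>A counterexample is enlarged to a maximal proper I-submodule \<open>Y\<close>. Among the
  I-submodules D containing the image of Q and having no nonzero I-map to P/Y, one of largest
  dimension is shown to be L-stable, hence equal to P; then the identity of P forces P = Y.\<close>

lemma nakayama:
  assumes X: "stable X" "supplements X (carrier P)"
  shows "X = carrier P"
proof (rule ccontr)
  assume ne: "X \<noteq> carrier P"
  let ?d = "\<lambda>Z. vdim (P\<lparr>carrier := Z\<rparr>)"
  let ?ok = "\<lambda>Z. stable Z \<and> X \<subseteq> Z \<and> Z \<noteq> carrier P"
  have "\<exists>Y. ?ok Y \<and> (\<forall>Z. ?ok Z \<longrightarrow> ?d Z \<le> ?d Y)"
    by (rule ex_has_greatest_nat[of ?ok X ?d "Suc (vdim P)"]) (use X ne vdim_le stableD(1) less_imp_le in auto)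
  then obtain Y where Y: "stable Y" "X \<subseteq> Y" "Y \<noteq> carrier P" "\<And>Z. ?ok Z \<Longrightarrow> ?d Z \<le> ?d Y" by blast
  have Ymax: "Z = carrier P" if "stable Z" "Y \<subseteq> Z" "Z \<noteq> Y" for Z
  proof (rule ccontr)
    assume "Z \<noteq> carrier P"
    then have "?d Z \<le> ?d Y" using that Y(2) by (intro Y(4)) auto
    then have "?d Y = ?d Z"
      using vdim_sub_mono(1)[OF fdP stableD(1)[OF that(1)] stableD(1)[OF Y(1)] that(2)] by simp
    then show False
      using vdim_sub_mono(2)[OF fdP stableD(1)[OF that(1)] stableD(1)[OF Y(1)] that(2)] that(3) by simp
  qed
  have Ysup: "supplements Y (carrier P)"
    using X(2) Y(2) unfolding supplements_def by (meson order_trans)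
  note Ys = sspD[OF stableD(1)[OF Y(1)]]
  \<comment> \<open>The last clause is Hom_I(D, P/Y) = 0, with maps into P/Y represented by linear
    maps into P.\<close>
  define good where "good D \<longleftrightarrow> stable D \<and> g0 ` carrier Q \<subseteq> D \<and> (\<forall>f\<in>lhom (P\<lparr>carrier := D\<rparr>) P.
    (\<forall>y\<in>I. \<forall>v\<in>D. f (act P y v) \<ominus>\<^bsub>P\<^esub> act P y (f v) \<in> Y) \<longrightarrow> f ` D \<subseteq> Y)" for D
  interpret Q: vectorspace class_ring Q by (rule VQ)
  have Qs: "ssp (carrier Q) Q" by (rule sspI[OF VQ]) (use Q.smult_closed in auto)
  note g0D = lhomD[OF lie_homD(1)[OF g0]]
  have g0_act: "g0 (act Q y u) = act P y (g0 u)" if "y \<in> I" "u \<in> carrier Q" for y u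
    using lie_homD(2)[OF g0, of y u] that by simp
  have "good (g0 ` carrier Q)"
    unfolding good_def
  proof (intro conjI ballI impI stableI)
    show "ssp (g0 ` carrier Q) P" by (rule image_ssp[OF VQ M.vectorspace_axioms lie_homD(1)[OF g0] Qs])
    show "act P y v \<in> g0 ` carrier Q" if "y \<in> I" "v \<in> g0 ` carrier Q" for y v
      using that actQ by (auto simp: g0_act[symmetric])
    fix f assume f: "f \<in> lhom (P\<lparr>carrier := g0 ` carrier Q\<rparr>) P"
      and eq: "\<forall>y\<in>I. \<forall>v\<in>g0 ` carrier Q. f (act P y v) \<ominus>\<^bsub>P\<^esub> act P y (f v) \<in> Y"
    have fl: "(\<lambda>u. f (g0 u)) \<in> lhom Q P"
      by (rule lhomI) (use lhomD[OF f] g0D in auto)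
    have "f (g0 u) \<in> Y" if "u \<in> carrier Q" for u
      by (rule image_in_maximal[OF Y(1) Ysup Ymax fl]) (use eq that in \<open>auto simp: g0_act\<close>)
    then show "f ` g0 ` carrier Q \<subseteq> Y" by auto
  qed auto
  then have "\<exists>D. good D \<and> (\<forall>Z. good Z \<longrightarrow> ?d Z \<le> ?d D)"
    by (rule ex_has_greatest_nat[of good _ ?d "Suc (vdim P)"]) (auto simp: good_def intro!: less_imp_le vdim_le stableD(1))
  then obtain D where D: "good D" "\<And>Z. good Z \<Longrightarrow> ?d Z \<le> ?d D" by blast
  have Dst: "stable D" and Dg0: "g0 ` carrier Q \<subseteq> D" using D(1) by (auto simp: good_def)
  have Df: "f v \<in> Y" if "f \<in> lhom (P\<lparr>carrier := D\<rparr>) P" "\<And>y v. y \<in> I \<Longrightarrow> v \<in> D \<Longrightarrow> f (act P y v) \<ominus>\<^bsub>P\<^esub> act P y (f v) \<in> Y" "v \<in> D" for f v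
    using D(1) that unfolding good_def by blast
  note Ds = sspD[OF stableD(1)[OF Dst]]
  \<comment> \<open>The span is D + LD. It will be good again, so maximality of the dimension makes
    D stable under L.\<close>
  let ?G = "D \<union> {act P x v | x v. x \<in> carrier L \<and> v \<in> D}"
  let ?D = "LinearCombinations.module.span class_ring P ?G"
  have "?G \<subseteq> carrier P" using Ds(2) act_closed by blast
  note sp = span_ssp[OF M.vectorspace_axioms this]
  have LD: "act P x v \<in> ?D" if "x \<in> carrier L" "v \<in> D" for x v using sp(2) that by blast
  have DD: "D \<subseteq> ?D" using sp(2) by blast
  have swap: "act P x (act P y v) = act P y (act P x v) \<oplus>\<^bsub>P\<^esub> act P (bracket L x y) v"
    if "x \<in> carrier L" "y \<in> carrier L" "v \<in> carrier P" for x y v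
    unfolding act_bracket[OF that] using that
    by (intro M.M.add_minus_cancel[symmetric] act_closed)
  have Dst': "stable ?D"
  proof (rule stableI[OF sp(1)])
    fix y v assume y: "y \<in> I" and v: "v \<in> ?D"
    have "?D \<subseteq> {v \<in> carrier P. act P y v \<in> ?D}"
    proof (rule sp(3)[OF ssp_vimage[OF M.vectorspace_axioms act_lhom[OF I_carr[OF y]] sp(1)]], rule subsetI)
      fix v assume "v \<in> ?G"
      then consider "v \<in> D" | x w where "v = act P x w" "x \<in> carrier L" "w \<in> D" by blast
      then show "v \<in> {v \<in> carrier P. act P y v \<in> ?D}"
      proof cases
        case 1
        then show ?thesis using stableD(2)[OF Dst y] DD Ds(7) by blast
      next
        case 2
        note w = Ds(7)[OF 2(3)]
        have "act P y v = act P x (act P y w) \<oplus>\<^bsub>P\<^esub> act P (bracket L y x) w"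
          unfolding 2(1) by (rule swap[OF I_carr[OF y] 2(2) w])
        also have "\<dots> \<in> ?D"
          using sspD(4)[OF sp(1) LD[OF 2(2) stableD(2)[OF Dst y 2(3)]]
              subsetD[OF DD stableD(2)[OF Dst I_bracket(2)[OF 2(2) y] 2(3)]]] .
        finally show ?thesis using 2 w act_closed by simp
      qed
    qed
    then show "act P y v \<in> ?D" using v by blast
  qed
  have "good ?D"
    unfolding good_def
  proof (intro conjI ballI impI Dst')
    show "g0 ` carrier Q \<subseteq> ?D" using Dg0 DD by blast
    fix f assume f: "f \<in> lhom (P\<lparr>carrier := ?D\<rparr>) P"
      and eq: "\<forall>y\<in>I. \<forall>v\<in>?D. f (act P y v) \<ominus>\<^bsub>P\<^esub> act P y (f v) \<in> Y"
    have fD: "f v \<in> carrier P" "f (a \<odot>\<^bsub>P\<^esub> v) = a \<odot>\<^bsub>P\<^esub> f v" if "v \<in> ?D" for v a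
      using lhomD[OF f, of v] that by auto
    have fA: "f (v \<oplus>\<^bsub>P\<^esub> w) = f v \<oplus>\<^bsub>P\<^esub> f w" if "v \<in> ?D" "w \<in> ?D" for v w
      using lhomD(2)[OF f, of v w] that by simp
    have fl: "f \<in> lhom (P\<lparr>carrier := D\<rparr>) P"
    proof (rule lhomI)
      fix v w a assume "v \<in> carrier (P\<lparr>carrier := D\<rparr>)" and w: "w \<in> carrier (P\<lparr>carrier := D\<rparr>)"
      then have v: "v \<in> ?D" "w \<in> ?D" using DD by auto
      show "f v \<in> carrier P" "f (v \<oplus>\<^bsub>P\<lparr>carrier := D\<rparr>\<^esub> w) = f v \<oplus>\<^bsub>P\<^esub> f w" "f (a \<odot>\<^bsub>P\<lparr>carrier := D\<rparr>\<^esub> v) = a \<odot>\<^bsub>P\<^esub> f v"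
        using fD[OF v(1)] fA[OF v] by simp_all
    qed
    have f1: "f v \<in> Y" if "v \<in> D" for v using that eq DD by (intro Df[OF fl]) auto
    \<comment> \<open>On D the map v -> f(x v) is I-linear modulo Y as well: its defect is f([x,y]
      v), and [x,y] v lies in D, where \<open>f\<close> already has values in Y.\<close>
    have f2: "f (act P x v) \<in> Y" if x: "x \<in> carrier L" and v: "v \<in> D" for x v
    proof (rule Df[of "\<lambda>v. f (act P x v)", OF _ _ v])
      show "(\<lambda>v. f (act P x v)) \<in> lhom (P\<lparr>carrier := D\<rparr>) P"
        by (rule lhomI)
          (simp_all add: Ds(7) fA[OF LD[OF x] LD[OF x]] fD[OF LD[OF x]] act_add_right[OF x] act_smult_right[OF x])
      fix y v assume y: "y \<in> I" and v: "v \<in> D"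
      have m: "act P y (act P x v) \<in> ?D" "act P (bracket L x y) v \<in> D"
        using stableD(2)[OF Dst' y LD[OF x v]] stableD(2)[OF Dst I_bracket(1)[OF x y] v] .
      let ?a = "f (act P y (act P x v))" and ?b = "f (act P (bracket L x y) v)" and ?c = "act P y (f (act P x v))"
      have c: "?a \<in> carrier P" "?b \<in> carrier P" "?c \<in> carrier P"
        by (rule fD(1)[OF m(1)], rule Ys(7)[OF f1[OF m(2)]], rule I_act[OF y fD(1)[OF LD[OF x v]]])
      have "f (act P x (act P y v)) = ?a \<oplus>\<^bsub>P\<^esub> ?b"
        unfolding swap[OF x I_carr[OF y] Ds(7)[OF v]] by (rule fA[OF m(1) subsetD[OF DD m(2)]])
      then have "f (act P x (act P y v)) \<ominus>\<^bsub>P\<^esub> ?c = (?a \<ominus>\<^bsub>P\<^esub> ?c) \<oplus>\<^bsub>P\<^esub> ?b"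
        using M.M.add.m_assoc[OF c(1) c(2) M.M.a_inv_closed[OF c(3)]] M.M.add.m_assoc[OF c(1) M.M.a_inv_closed[OF c(3)] c(2)]
          M.M.a_comm[OF c(2) M.M.a_inv_closed[OF c(3)]] by (simp only: a_minus_def)
      also have "\<dots> \<in> Y" by (rule Ys(4)[OF bspec[OF bspec[OF eq y] LD[OF x v]] f1[OF m(2)]])
      finally show "f (act P x (act P y v)) \<ominus>\<^bsub>P\<^esub> ?c \<in> Y" .
    qed
    have "ssp {v \<in> carrier (P\<lparr>carrier := ?D\<rparr>). f v \<in> Y} (P\<lparr>carrier := ?D\<rparr>)"
      by (rule ssp_vimage[OF sspD(8)[OF sp(1)] f stableD(1)[OF Y(1)]])
    then have "ssp {v \<in> ?D. f v \<in> Y} P" using ssp_sub_iff[OF sp(1)] by simp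
    then have "?D \<subseteq> {v \<in> ?D. f v \<in> Y}" by (rule sp(3)) (use f1 f2 sp(2) in blast)
    then show "f ` ?D \<subseteq> Y" by blast
  qed
  then have "?d ?D \<le> ?d D" by (rule D(2))
  then have "?d D = ?d ?D" using vdim_sub_mono(1)[OF fdP sp(1) stableD(1)[OF Dst] DD] by simp
  then have "D = ?D" by (rule vdim_sub_mono(2)[OF fdP sp(1) stableD(1)[OF Dst] DD])
  then have "act P x v \<in> D" if "x \<in> carrier L" "v \<in> D" for x v using LD[OF that] by simp
  then have DP: "D = carrier P" using Dg0 q0(1) by (intro generated[OF stableD(1)[OF Dst]]) auto
  have "v \<in> Y" if v: "v \<in> carrier P" for v
  proof (rule Df[of "\<lambda>v. v"])
    show "(\<lambda>v. v) \<in> lhom (P\<lparr>carrier := D\<rparr>) P" by (rule lhomI) (simp_all add: DP)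
    show "act P y v \<ominus>\<^bsub>P\<^esub> act P y v \<in> Y" if "y \<in> I" "v \<in> D" for y v
      using I_act[OF that(1), of v] that(2) Ys(3) by (simp add: DP a_minus_def M.M.r_neg)
  qed (simp add: DP v)
  then show False using Y(3) Ys(2) by blast
qed

text \<open>Induction over I-submodules. Lifting of I-invariant forms to Q and the Nakayama property
  are the two features of P that pass to the kernel of a split map onto Q. Splitting off Q lowers
  dim N by dim Q and dim IN by dim Q - 1, so it raises c by one.\<close>

lemma free_rank:
  assumes "stable N"
    and "\<And>\<mu>. linear_form (P\<lparr>carrier := N\<rparr>) \<mu> \<Longrightarrow> (\<And>y v. y \<in> I \<Longrightarrow> v \<in> N \<Longrightarrow> \<mu> (act P y v) = 0) \<Longrightarrow>
      \<exists>g\<in>lie_hom (L\<lparr>carrier := I\<rparr>) (P\<lparr>carrier := N\<rparr>) Q. \<forall>v\<in>N. \<rho> (g v) = \<mu> v"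
    and "\<And>X. stable X \<Longrightarrow> X \<subseteq> N \<Longrightarrow> supplements X N \<Longrightarrow> X = N"
  shows "\<exists>c. vdim (P\<lparr>carrier := N\<rparr>) = vdim Q * c \<and> vdim (P\<lparr>carrier := N\<rparr>) = c + vdim (P\<lparr>carrier := radical N\<rparr>)"
  using assms
proof (induction "vdim (P\<lparr>carrier := N\<rparr>)" arbitrary: N rule: less_induct)
  case (less N)
  let ?PN = "P\<lparr>carrier := N\<rparr>"
  note Nst = less.prems(1) and N = stableD(1)[OF less.prems(1)]
  note Ns = sspD[OF N]
  note rad = radical[OF Ns(2)]
  have VP: "vsp P" by (rule M.vectorspace_axioms)
  show ?case
  proof (cases "N = {\<zero>\<^bsub>P\<^esub>}")
    case True
    have "radical N \<subseteq> N" by (rule rad(3)[OF N stableD(2)[OF Nst]])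
    then have "radical N = N" using sspD(3)[OF rad(1)] True by auto
    then show ?thesis using vdim_zero[OF VP] True by (intro exI[of _ 0]) simp
  next
    case False
    interpret Q: vectorspace class_ring Q by (rule VQ)
    have Qs: "ssp (carrier Q) Q" by (rule sspI[OF VQ]) (use Q.smult_closed in auto)
    have "ssp {\<zero>\<^bsub>P\<^esub>} P" by (rule sspI[OF VP]) auto
    then have "stable {\<zero>\<^bsub>P\<^esub>}" by (rule stableI) (use act_zero_right I_carr in auto)
    \<comment> \<open>The Nakayama property at X = 0 shows that IN is proper in N. A coordinate form
      that vanishes on IN lifts to \<open>g\<close>, and \<open>g\<close> is onto because rho is
      nonzero on its image.\<close>
    then have "\<not> supplements {\<zero>\<^bsub>P\<^esub>} N" using less.prems(3)[of "{\<zero>\<^bsub>P\<^esub>}"] False Ns(3) by blast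
    then obtain Y where Y: "ssp Y P" "\<And>y v. y \<in> I \<Longrightarrow> v \<in> N \<Longrightarrow> act P y v \<in> Y" "\<not> N \<subseteq> Y"
      unfolding supplements_def by blast
    then obtain n0 where n0: "n0 \<in> N" "n0 \<notin> Y" by blast
    have W: "ssp (Y \<inter> N) ?PN" using ssp_Int[OF Y(1) N] ssp_sub_iff[OF N] by simp
    obtain r n :: nat and e co where b: "\<And>k. linear_form ?PN (co k)"
      "\<And>x. x \<in> carrier ?PN \<Longrightarrow> x \<in> Y \<inter> N \<longleftrightarrow> (\<forall>k. r \<le> k \<and> k < n \<longrightarrow> co k x = 0)"
      by (rule adapted_basis[OF Ns(8) fdim_sub[OF fdP N] W]) (rule that; assumption)
    obtain k where k: "r \<le> k" "k < n" "co k n0 \<noteq> 0" using b(2)[of n0] n0 by auto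
    have "co k (act P y v) = 0" if "y \<in> I" "v \<in> N" for y v
      using b(2)[of "act P y v"] Y(2)[OF that] stableD(2)[OF Nst that] k by auto
    then obtain g where g: "g \<in> lie_hom (L\<lparr>carrier := I\<rparr>) ?PN Q" "\<And>v. v \<in> N \<Longrightarrow> \<rho> (g v) = co k v"
      using less.prems(2)[OF b(1)] by blast
    have gl: "g \<in> lhom ?PN Q" by (rule lie_homD(1)[OF g(1)])
    have gD: "g v \<in> carrier Q" "g (a \<odot>\<^bsub>P\<^esub> v) = a \<odot>\<^bsub>Q\<^esub> g v" "y \<in> I \<Longrightarrow> g (act P y v) = act Q y (g v)"
      if "v \<in> N" for v a y
      using lhomD[OF gl, of v] lie_homD(2)[OF g(1), of y v] that by auto
    have gA: "g (v \<oplus>\<^bsub>P\<^esub> w) = g v \<oplus>\<^bsub>Q\<^esub> g w" "g (v \<ominus>\<^bsub>P\<^esub> w) = g v \<ominus>\<^bsub>Q\<^esub> g w" if "v \<in> N" "w \<in> N" for v w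
      using lhomD(2)[OF gl, of v w] that lhom_zero(2)[OF Ns(8) VQ gl, of v w] sub_minus[OF N, of v w] by simp_all
    have NPN: "ssp N ?PN" by (rule ssp_sub[OF N N]) simp
    have gsurj: "g ` N = carrier Q"
    proof (rule essential')
      show "ssp (g ` N) Q" by (rule image_ssp[OF Ns(8) VQ gl NPN])
      show "act Q y u \<in> g ` N" if y: "y \<in> I" and u: "u \<in> g ` N" for y u
      proof -
        obtain v where v: "u = g v" "v \<in> N" using u by auto
        show ?thesis unfolding v(1) gD(3)[OF v(2) y, symmetric] by (rule imageI[OF stableD(2)[OF Nst y v(2)]])
      qed
      show "g n0 \<in> g ` N" using n0(1) by (rule imageI)
      show "\<rho> (g n0) \<noteq> 0" using k(3) g(2)[OF n0(1)] by simp
    qed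
    obtain s where s: "s \<in> lie_hom (L\<lparr>carrier := I\<rparr>) Q ?PN" "\<And>u. u \<in> carrier Q \<Longrightarrow> g (s u) = u"
      using split[OF N stableD(2)[OF Nst] g(1) gsurj] by blast
    have sl: "s \<in> lhom Q ?PN" by (rule lie_homD(1)[OF s(1)])
    have sD: "s u \<in> N" "s (a \<odot>\<^bsub>Q\<^esub> u) = a \<odot>\<^bsub>P\<^esub> s u" "y \<in> I \<Longrightarrow> s (act Q y u) = act P y (s u)"
      if "u \<in> carrier Q" for u a y
      using lhomD[OF sl, of u] lie_homD(2)[OF s(1), of y u] that by auto
    have sA: "s (u \<oplus>\<^bsub>Q\<^esub> w) = s u \<oplus>\<^bsub>P\<^esub> s w" if "u \<in> carrier Q" "w \<in> carrier Q" for u w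
      using lhomD(2)[OF sl that] by simp
    have s0: "s \<zero>\<^bsub>Q\<^esub> = \<zero>\<^bsub>P\<^esub>" using lhom_zero(1)[OF VQ Ns(8) sl] by simp
    \<comment> \<open>The I-linear projection of N onto \<open>?K\<close> along the image of
      \<open>s\<close>. It transports forms and submodules between N and the kernel.\<close>
    define t where "t v = v \<ominus>\<^bsub>P\<^esub> s (g v)" for v
    have sgN: "s (g v) \<in> N" if "v \<in> N" for v using sD(1) gD(1) that by blast
    have tN: "t v \<in> N" if "v \<in> N" for v unfolding t_def by (rule Ns(6)[OF that sgN[OF that]])
    have tg: "g (t v) = \<zero>\<^bsub>Q\<^esub>" if "v \<in> N" for v
      unfolding t_def gA(2)[OF that sgN[OF that]] s(2)[OF gD(1)[OF that]]
      using gD(1)[OF that] by (simp add: a_minus_def Q.M.r_neg)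
    have t_add: "t (v \<oplus>\<^bsub>P\<^esub> w) = t v \<oplus>\<^bsub>P\<^esub> t w" if "v \<in> N" "w \<in> N" for v w
      using that Ns(7) sgN by (simp add: t_def gD(1) gA(1) sA a_minus_def M.M.minus_add M.M.a_ac)
    have t_smult: "t (a \<odot>\<^bsub>P\<^esub> v) = a \<odot>\<^bsub>P\<^esub> t v" if "v \<in> N" for v a
    proof -
      have "t (a \<odot>\<^bsub>P\<^esub> v) = a \<odot>\<^bsub>P\<^esub> v \<ominus>\<^bsub>P\<^esub> a \<odot>\<^bsub>P\<^esub> s (g v)"
        using that by (simp add: t_def gD(1,2) sD(2))
      also have "\<dots> = a \<odot>\<^bsub>P\<^esub> (v \<ominus>\<^bsub>P\<^esub> s (g v))"
        using Ns(7)[OF that] Ns(7)[OF sgN[OF that]] M.smult_r_minus[of a "s (g v)"]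
        by (simp add: a_minus_def vspD(4)[OF VP])
      finally show ?thesis by (simp add: t_def)
    qed
    have t_act: "t (act P y v) = act P y (t v)" if "y \<in> I" "v \<in> N" for y v
      using lhom_zero(2)[OF VP VP act_lhom[OF I_carr[OF that(1)]] Ns(7)[OF that(2)] Ns(7)[OF sgN[OF that(2)]]] that
      by (simp add: t_def gD(1,3) sD(3))
    have tl: "t \<in> lhom ?PN ?PN" by (rule lhomI) (simp_all add: tN t_add t_smult)
    let ?K = "{v \<in> N. g v = \<zero>\<^bsub>Q\<^esub>}"
    have tK: "t v = v" if "v \<in> ?K" for v
      using that Ns(7)[of v] by (simp add: t_def s0 a_minus_def)
    note dK = vdim_surj[OF Ns(8) VQ gl _ fdim_sub[OF fdP N], simplified, OF gsurj]
    have Kst: "stable ?K"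
    proof (rule stableI)
      show "ssp ?K P" using dK(3) ssp_sub_iff[OF N] by simp
      show "act P y v \<in> ?K" if "y \<in> I" "v \<in> ?K" for y v
        using that stableD(2)[OF Nst that(1), of v] t_act[OF that(1), of v] tg[of "act P y v"] tK[of v] by simp
    qed
    note Ks = sspD[OF stableD(1)[OF Kst]]
    have KN: "?K \<subseteq> N" by auto
    have "vdim (P\<lparr>carrier := ?K\<rparr>) < vdim ?PN" using dK(1) vdim_Q by simp
    then have "\<exists>c. vdim (P\<lparr>carrier := ?K\<rparr>) = vdim Q * c \<and>
        vdim (P\<lparr>carrier := ?K\<rparr>) = c + vdim (P\<lparr>carrier := radical ?K\<rparr>)"
    proof (rule less.hyps[OF _ Kst])
      fix \<mu> assume mu: "linear_form (P\<lparr>carrier := ?K\<rparr>) \<mu>" "\<And>y v. y \<in> I \<Longrightarrow> v \<in> ?K \<Longrightarrow> \<mu> (act P y v) = 0"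
      have tc: "t v \<in> ?K" if "v \<in> N" for v using tN[OF that] tg[OF that] by simp
      have "linear_form ?PN (\<lambda>v. \<mu> (t v))"
        unfolding linear_form_def
        using linear_formD[OF mu(1)] tc by (simp add: t_add t_smult)
      moreover have "\<mu> (t (act P y v)) = 0" if "y \<in> I" "v \<in> N" for y v
        using mu(2)[OF that(1) tc[OF that(2)]] t_act[OF that] by simp
      ultimately obtain h where h: "h \<in> lie_hom (L\<lparr>carrier := I\<rparr>) ?PN Q" "\<And>v. v \<in> N \<Longrightarrow> \<rho> (h v) = \<mu> (t v)"
        using less.prems(2)[of "\<lambda>v. \<mu> (t v)"] by blast
      have "h \<in> lie_hom (L\<lparr>carrier := I\<rparr>) (P\<lparr>carrier := ?K\<rparr>) Q"
        using lhom_sub[OF lie_homD(1)[OF h(1)] dK(3)] lie_homD(2)[OF h(1)] by (simp add: lie_hom_def)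
      moreover have "\<rho> (h v) = \<mu> v" if "v \<in> ?K" for v using h(2)[of v] that tK[OF that] by simp
      ultimately show "\<exists>g\<in>lie_hom (L\<lparr>carrier := I\<rparr>) (P\<lparr>carrier := ?K\<rparr>) Q. \<forall>v\<in>?K. \<rho> (g v) = \<mu> v" by blast
    next
      fix X assume X: "stable X" "X \<subseteq> ?K" "supplements X ?K"
      note Xs = stableD(1)[OF X(1)]
      \<comment> \<open>This preimage contains the image of \<open>s\<close>, so X + IK = K implies
        ?X + IN = N, and the Nakayama property of N applies.\<close>
      let ?X = "{v \<in> N. t v \<in> X}"
      have X': "ssp ?X P"
        using ssp_vimage[OF Ns(8) tl, of X] ssp_sub[OF N Xs] X(2) ssp_sub_iff[OF N] by auto
      have XX: "X \<subseteq> ?X" using X(2) tK by fastforce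
      have "?X = N"
      proof (rule less.prems(3))
        show "stable ?X"
          by (rule stableI[OF X']) (use stableD(2)[OF Nst] stableD(2)[OF X(1)] t_act in auto)
        show "supplements ?X N"
          unfolding supplements_def
        proof (intro allI impI subsetI, elim conjE)
          fix Y v assume Y: "ssp Y P" "?X \<subseteq> Y" "\<forall>y\<in>I. \<forall>v\<in>N. act P y v \<in> Y" and v: "v \<in> N"
          have "?K \<subseteq> Y" by (rule supplementsD[OF X(3) Y(1)]) (use XX Y in auto)
          then have "t v \<in> Y" using tN[OF v] tg[OF v] by blast
          moreover have "s (g v) \<in> Y"
          proof -
            have gv: "g v \<in> carrier Q" by (rule gD(1)[OF v])
            have "t (s (g v)) = \<zero>\<^bsub>P\<^esub>"
              using Ns(7)[OF sgN[OF v]] by (simp add: t_def s(2)[OF gv] a_minus_def M.M.r_neg)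
            then have "s (g v) \<in> ?X" using sgN[OF v] sspD(3)[OF Xs] by simp
            then show ?thesis using Y(2) by blast
          qed
          moreover have "v = s (g v) \<oplus>\<^bsub>P\<^esub> t v"
            unfolding t_def by (rule M.M.add_minus_cancel[symmetric, OF Ns(7)[OF v] Ns(7)[OF sgN[OF v]]])
          ultimately show "v \<in> Y" using sspD(4)[OF Y(1)] by metis
        qed
      qed auto
      then show "X = ?K" using X(2) tK by fastforce
    qed
    then obtain c where c: "vdim (P\<lparr>carrier := ?K\<rparr>) = vdim Q * c"
      "vdim (P\<lparr>carrier := ?K\<rparr>) = c + vdim (P\<lparr>carrier := radical ?K\<rparr>)" by blast
    have radN: "radical N \<subseteq> N" by (rule rad(3)[OF N stableD(2)[OF Nst]])
    note radK = radical[OF Ks(2)]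
    let ?Q0 = "{u \<in> carrier Q. \<rho> u = 0}"
    have Q0: "vsp (Q\<lparr>carrier := ?Q0\<rparr>)" by (rule sspD(8)[OF ker_ssp])
    have radR: "ssp (radical N) ?PN" by (rule ssp_sub[OF N rad(1) radN])
    have im: "g ` radical N = ?Q0"
    proof
      have "ssp {v \<in> N. g v \<in> ?Q0} P" using ssp_vimage[OF Ns(8) gl ker_ssp] ssp_sub_iff[OF N] by simp
      then have "radical N \<subseteq> {v \<in> N. g v \<in> ?Q0}"
        by (rule rad(3)) (use stableD(2)[OF Nst] gD(1,3) actQ \<rho>_act in auto)
      then show "g ` radical N \<subseteq> ?Q0" by blast
      show "?Q0 \<subseteq> g ` radical N"
      proof
        fix z assume "z \<in> ?Q0"
        then have z: "z \<in> carrier Q" "\<rho> z = 0" by auto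
        show "z \<in> g ` radical N"
        proof (rule ker_generated[OF image_ssp[OF Ns(8) VQ gl radR] _ z])
          fix y u assume y: "y \<in> I" and "u \<in> carrier Q"
          then obtain v where v: "u = g v" "v \<in> N" using gsurj by blast
          show "act Q y u \<in> g ` radical N"
            unfolding v(1) gD(3)[OF v(2) y, symmetric] by (rule imageI[OF rad(2)[OF y v(2)]])
        qed
      qed
    qed
    \<comment> \<open>The intersection of IN with the kernel K is IK: \<open>t\<close> maps IN into
      IK and fixes the vectors of K.\<close>
    have "{v \<in> radical N. g v = \<zero>\<^bsub>Q\<^esub>} = radical ?K"
    proof
      show "{v \<in> radical N. g v = \<zero>\<^bsub>Q\<^esub>} \<subseteq> radical ?K"
      proof
        fix v assume v: "v \<in> {v \<in> radical N. g v = \<zero>\<^bsub>Q\<^esub>}"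
        have rKK: "radical ?K \<subseteq> ?K" by (rule radK(3)[OF stableD(1)[OF Kst] stableD(2)[OF Kst]])
        have "ssp {v \<in> N. t v \<in> radical ?K} P"
          using ssp_vimage[OF Ns(8) tl, of "radical ?K"] ssp_sub[OF N radK(1)] rKK ssp_sub_iff[OF N] by auto
        then have "radical N \<subseteq> {v \<in> N. t v \<in> radical ?K}"
        proof (rule rad(3))
          show "act P y v \<in> {v \<in> N. t v \<in> radical ?K}" if "y \<in> I" "v \<in> N" for y v
            using radK(2)[OF that(1), of "t v"] tN[OF that(2)] tg[OF that(2)] stableD(2)[OF Nst that]
            by (simp add: t_act[OF that])
        qed
        then have "t v \<in> radical ?K" using v by blast
        moreover have "t v = v" using v radN by (intro tK) auto
        ultimately show "v \<in> radical ?K" by simp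
      qed
      have "radical ?K \<subseteq> radical N" by (rule radK(3)[OF rad(1)]) (use rad(2) in auto)
      moreover have "radical ?K \<subseteq> ?K" by (rule radK(3)[OF stableD(1)[OF Kst] stableD(2)[OF Kst]])
      ultimately show "radical ?K \<subseteq> {v \<in> radical N. g v = \<zero>\<^bsub>Q\<^esub>}" by blast
    qed
    moreover have "vdim (P\<lparr>carrier := radical N\<rparr>) = vdim (Q\<lparr>carrier := ?Q0\<rparr>)
        + vdim (P\<lparr>carrier := {v \<in> radical N. g v = \<zero>\<^bsub>Q\<^esub>}\<rparr>)"
    proof -
      have h: "g \<in> lhom (P\<lparr>carrier := radical N\<rparr>) (Q\<lparr>carrier := ?Q0\<rparr>)"
        using lhomD[OF lhom_sub[OF gl radR]] im by (intro lhomI) auto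
      show ?thesis
        using vdim_surj(1)[OF sspD(8)[OF rad(1)] Q0 h _ fdim_sub[OF fdP rad(1)]] im by simp
    qed
    ultimately have "vdim (P\<lparr>carrier := radical N\<rparr>) = vdim (Q\<lparr>carrier := ?Q0\<rparr>) + vdim (P\<lparr>carrier := radical ?K\<rparr>)"
      by simp
    moreover have "vdim ?PN = vdim Q + vdim (P\<lparr>carrier := ?K\<rparr>)" by (rule dK(1))
    \<comment> \<open>Here q = dim Q and z = dim ker rho = q - 1; the witness for the new
      multiplicity is c + 1.\<close>
    moreover have "\<exists>c'. a = q * c' \<and> a = c' + r" if "r = z + rk" "a = q + k" "k = q * c" "k = c + rk" "q = Suc z"
      for a q k r z rk :: nat
    proof (intro exI conjI)
      show "a = q * Suc c" using that(2,3) by simp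
      show "a = Suc c + r" using that(1,2,4,5) by linarith
    qed
    ultimately show ?thesis using c vdim_Q by blast
  qed
qed

theorem vdim_cover:
  "\<exists>c. vdim P = vdim Q * c \<and> vdim P = c + vdim (P\<lparr>carrier := radical (carrier P)\<rparr>)"
proof -
  have P: "P\<lparr>carrier := carrier P\<rparr> = P" by simp
  have "\<exists>c. vdim (P\<lparr>carrier := carrier P\<rparr>) = vdim Q * c \<and>
      vdim (P\<lparr>carrier := carrier P\<rparr>) = c + vdim (P\<lparr>carrier := radical (carrier P)\<rparr>)"
  proof (rule free_rank)
    show "stable (carrier P)" by (rule stableI[OF carrier_ssp I_act])
  qed (use lift nakayama in \<open>simp_all add: P\<close>)
  then show ?thesis by (simp only: P)
qed

end

section \<open>The cover over the quotient\<close>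

text \<open>A substitute for the quotient V/W: the image of \<open>pr\<close> is isomorphic to it
  but keeps the element type, so that assumptions about modules on that type can be applied to
  it.\<close>

lemma projection_along:
  fixes V :: "('k::field, 'v, 'x) module_scheme"
  assumes V: "vsp V" and fd: "fdim V" and W: "ssp W V"
  obtains pr where "pr \<in> lhom V V" "\<And>x. x \<in> W \<Longrightarrow> pr x = \<zero>\<^bsub>V\<^esub>" "\<And>x. x \<in> carrier V \<Longrightarrow> x \<ominus>\<^bsub>V\<^esub> pr x \<in> W"
proof -
  interpret vectorspace class_ring V by fact
  obtain r n :: nat and e co where b: "\<And>i. i < n \<Longrightarrow> e i \<in> carrier V" "\<And>k. linear_form V (co k)"
    "\<And>i k. i < n \<Longrightarrow> k < n \<Longrightarrow> co k (e i) = (if k = i then 1 else 0)"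
    "\<And>x. x \<in> carrier V \<Longrightarrow> x \<in> W \<longleftrightarrow> (\<forall>k. r \<le> k \<and> k < n \<longrightarrow> co k x = 0)"
    by (rule adapted_basis[OF V fd W]) (rule that; assumption)
  have sm: "a \<odot>\<^bsub>V\<^esub> e i \<in> carrier V" if "i < n" for a i using smult_closed[of a "e i"] b(1)[OF that] by simp
  \<comment> \<open>Keeps the coordinates with index at least r, which are those that vanish on
    W.\<close>
  define pr where "pr x = (\<Oplus>\<^bsub>V\<^esub>k\<in>{r..<n}. co k x \<odot>\<^bsub>V\<^esub> e k)" for x
  have f: "(\<lambda>k. co k x \<odot>\<^bsub>V\<^esub> e k) \<in> {r..<n} \<rightarrow> carrier V" for x using sm by auto
  have prc: "pr x \<in> carrier V" for x unfolding pr_def by (rule M.finsum_closed[OF f])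
  have co: "co j (pr x) = co j x" if j: "r \<le> j" "j < n" for j x
  proof -
    have "co j (pr x) = (\<Sum>k\<in>{r..<n}. co j (co k x \<odot>\<^bsub>V\<^esub> e k))"
      unfolding pr_def by (rule linear_form_finsum[OF V b(2)]) (use f in auto)
    also have "\<dots> = (\<Sum>k\<in>{r..<n}. if k = j then co j x else 0)"
      by (rule sum.cong) (use j in \<open>auto simp: linear_formD(2)[OF b(2) b(1)] b(3)\<close>)
    finally show ?thesis using j by simp
  qed
  show thesis
  proof (rule that)
    show "pr \<in> lhom V V"
    proof (rule lhomI[OF prc])
      fix x assume x: "x \<in> carrier V"
      have "pr (a \<odot>\<^bsub>V\<^esub> x) = (\<Oplus>\<^bsub>V\<^esub>k\<in>{r..<n}. a \<odot>\<^bsub>V\<^esub> (co k x \<odot>\<^bsub>V\<^esub> e k))" for a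
        unfolding pr_def
        by (rule M.finsum_cong') (use x sm vspD(1)[OF V b(1)] smult_closed in \<open>auto simp: linear_formD(2)[OF b(2)]\<close>)
      then show "pr (a \<odot>\<^bsub>V\<^esub> x) = a \<odot>\<^bsub>V\<^esub> pr x" for a
        using finsum_smult[OF _ f[of x], of a] by (simp add: pr_def)
      fix y assume y: "y \<in> carrier V"
      have "pr (x \<oplus>\<^bsub>V\<^esub> y) = (\<Oplus>\<^bsub>V\<^esub>k\<in>{r..<n}. co k x \<odot>\<^bsub>V\<^esub> e k \<oplus>\<^bsub>V\<^esub> co k y \<odot>\<^bsub>V\<^esub> e k)"
        unfolding pr_def
        by (rule M.finsum_cong') (use x y sm vspD(3)[OF V b(1)] in \<open>auto simp: linear_formD(1)[OF b(2)]\<close>)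
      then show "pr (x \<oplus>\<^bsub>V\<^esub> y) = pr x \<oplus>\<^bsub>V\<^esub> pr y"
        using M.finsum_addf[OF f f, of x y] by (simp add: pr_def)
    qed
    show "pr x = \<zero>\<^bsub>V\<^esub>" if "x \<in> W" for x
    proof -
      have "co k x = 0" if "k \<in> {r..<n}" for k using b(4)[OF sspD(7)[OF W \<open>x \<in> W\<close>]] \<open>x \<in> W\<close> that by auto
      then have "pr x = (\<Oplus>\<^bsub>V\<^esub>k\<in>{r..<n}. \<zero>\<^bsub>V\<^esub>)"
        unfolding pr_def by (intro M.finsum_cong') (use smult_zero(1)[OF V b(1)] in auto)
      then show ?thesis by (simp add: M.finsum_zero)
    qed
    show "x \<ominus>\<^bsub>V\<^esub> pr x \<in> W" if x: "x \<in> carrier V" for x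
      using b(4)[of "x \<ominus>\<^bsub>V\<^esub> pr x"] x prc by (auto simp: linear_form_diff(1)[OF V b(2) x prc] co)
  qed
qed

context p_ideal_quot
begin

lemma lie_hom_infl:
  assumes LS: "lie_module L S" "\<And>y s. y \<in> I \<Longrightarrow> s \<in> carrier S \<Longrightarrow> act S y s = \<zero>\<^bsub>S\<^esub>"
    and h: "h \<in> lie_hom LQ R (quot_lie_module S)"
  shows "h \<in> lie_hom L (infl_lie_module L I R) S"
proof -
  note hD = lhomD[OF lie_homD(1)[OF h]]
  have "h (act R (q x) m) = act S x (h m)" if "x \<in> carrier L" "m \<in> carrier R" for x m
    using lie_homD(2)[OF h, of "q x" m] quot_act[OF LS that(1), of "h m"] hD(1)[OF that(2)] that
    by (simp add: quot_carrier)
  moreover have "h \<in> lhom (infl_lie_module L I R) S" by (rule lhomI) (use hD in auto)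
  ultimately show ?thesis by (simp add: lie_hom_def)
qed

lemma lie_hom_quot:
  assumes LM: "lie_module L M" "\<And>y m. y \<in> I \<Longrightarrow> m \<in> carrier M \<Longrightarrow> act M y m = \<zero>\<^bsub>M\<^esub>"
    and LN: "lie_module L N" "\<And>y m. y \<in> I \<Longrightarrow> m \<in> carrier N \<Longrightarrow> act N y m = \<zero>\<^bsub>N\<^esub>"
    and h: "h \<in> lie_hom L M N"
  shows "h \<in> lie_hom LQ (quot_lie_module M) (quot_lie_module N)"
proof -
  note hD = lhomD[OF lie_homD(1)[OF h]]
  have "h \<in> lhom (quot_lie_module M) (quot_lie_module N)" by (rule lhomI) (use hD in auto)
  then show ?thesis
    using lie_homD(2)[OF h] hD(1)
    by (auto simp: lie_hom_def quot_carrier quot_act[OF LM] quot_act[OF LN])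
qed

text \<open>R and P/IP dominate each other. Lifting pi through sigma gives a map from P onto R, by
  essentiality of sigma, that kills IP; lifting sigma through P/IP gives a map from R onto P/IP, by
  essentiality of pi. \<open>W\<close> is IP, described by its universal property.\<close>

lemma vdim_quotient_cover:
  fixes P :: "('k, 'l, 'p) lie_module" and S :: "('k, 'l, 's) lie_module" and R :: "('k, 'l set, 'r) lie_module"
  assumes LP: "lie_module L P" and fdP: "fdim P" and pcP: "has_p_character L \<chi> P"
    and LS: "lie_module L S" and IS: "\<And>y s. y \<in> I \<Longrightarrow> s \<in> carrier S \<Longrightarrow> act S y s = \<zero>\<^bsub>S\<^esub>"
    and \<pi>: "\<pi> \<in> lie_hom L P S" "\<pi> ` carrier P = carrier S"
    and essP: "\<And>U. ssp U P \<Longrightarrow> (\<And>x v. x \<in> carrier L \<Longrightarrow> v \<in> U \<Longrightarrow> act P x v \<in> U) \<Longrightarrow> \<pi> ` U = carrier S \<Longrightarrow> U = carrier P"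
    and LR: "lie_module LQ R"
    and \<sigma>: "\<sigma> ` carrier R = carrier S"
    and essR: "\<And>U. ssp U R \<Longrightarrow> (\<And>X v. X \<in> carrier LQ \<Longrightarrow> v \<in> U \<Longrightarrow> act R X v \<in> U) \<Longrightarrow> \<sigma> ` U = carrier S \<Longrightarrow> U = carrier R"
    and liftP: "\<exists>a\<in>lie_hom L P (infl_lie_module L I R). \<forall>v\<in>carrier P. \<sigma> (a v) = \<pi> v"
    and liftR: "\<And>C :: ('k, 'l, 'p) lie_module. lie_module L C \<Longrightarrow> has_p_character L \<chi> C \<Longrightarrow>
      (\<And>y v. y \<in> I \<Longrightarrow> v \<in> carrier C \<Longrightarrow> act C y v = \<zero>\<^bsub>C\<^esub>) \<Longrightarrow> \<pi> \<in> lie_hom L C S \<Longrightarrow> \<pi> ` carrier C = carrier S \<Longrightarrow>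
      \<exists>b\<in>lie_hom LQ R (quot_lie_module C). \<forall>v\<in>carrier R. \<pi> (b v) = \<sigma> v"
    and W: "ssp W P" "\<And>y v. y \<in> I \<Longrightarrow> v \<in> carrier P \<Longrightarrow> act P y v \<in> W"
      "\<And>U. ssp U P \<Longrightarrow> (\<And>y v. y \<in> I \<Longrightarrow> v \<in> carrier P \<Longrightarrow> act P y v \<in> U) \<Longrightarrow> W \<subseteq> U"
  shows "fdim R \<and> vdim P = vdim R + vdim (P\<lparr>carrier := W\<rparr>)"
proof -
  interpret P: lie_module L P by (rule LP)
  interpret S: lie_module L S by (rule LS)
  interpret R: lie_module LQ R by (rule LR)
  note VP = P.M.vectorspace_axioms and VS = S.M.vectorspace_axioms and VR = R.M.vectorspace_axioms
  note Ws = sspD[OF W(1)]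
  have act_lhom: "act P x \<in> lhom P P" if "x \<in> carrier L" for x
    by (rule lhomI) (simp_all add: that P.act_closed P.act_add_right P.act_smult_right)
  have Ps: "ssp (carrier P) P" by (rule sspI[OF VP]) (use P.M.smult_closed in auto)
  obtain a where a: "a \<in> lie_hom L P (infl_lie_module L I R)" "\<And>v. v \<in> carrier P \<Longrightarrow> \<sigma> (a v) = \<pi> v" using liftP by blast
  have al: "a \<in> lhom P R" using lhomD[OF lie_homD(1)[OF a(1)]] by (intro lhomI) auto
  have a_act: "a (act P x v) = act R (q x) (a v)" if "x \<in> carrier L" "v \<in> carrier P" for x v
    using lie_homD(2)[OF a(1) that] by simp
  have aP: "a ` carrier P = carrier R"
  proof (rule essR)
    show "ssp (a ` carrier P) R" by (rule image_ssp[OF VP VR al Ps])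
    show "act R X v \<in> a ` carrier P" if "X \<in> carrier LQ" "v \<in> a ` carrier P" for X v
      using that P.act_closed by (auto simp: quot_carrier a_act[symmetric])
    have "(\<lambda>v. \<sigma> (a v)) ` carrier P = \<pi> ` carrier P" by (rule image_cong[OF refl a(2)])
    then show "\<sigma> ` a ` carrier P = carrier S" by (simp add: image_image \<pi>(2))
  qed
  note da = vdim_surj[OF VP VR al aP fdP]
  have fdR: "fdim R" by (rule da(2))
  have "W \<subseteq> {v \<in> carrier P. a v = \<zero>\<^bsub>R\<^esub>}"
  proof (rule W(3)[OF da(3)])
    fix y v assume y: "y \<in> I" and v: "v \<in> carrier P"
    show "act P y v \<in> {v \<in> carrier P. a v = \<zero>\<^bsub>R\<^esub>}"
      using a_act[OF I_carr[OF y] v] infl_act_I[OF LR y lhomD(1)[OF al v]] P.act_closed[OF I_carr[OF y] v] by simp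
  qed
  then have "vdim (P\<lparr>carrier := W\<rparr>) \<le> vdim (P\<lparr>carrier := {v \<in> carrier P. a v = \<zero>\<^bsub>R\<^esub>}\<rparr>)"
    by (rule vdim_sub_mono(1)[OF fdP da(3) W(1)])
  then have le: "vdim R + vdim (P\<lparr>carrier := W\<rparr>) \<le> vdim P" using da(1) by simp

  \<comment> \<open>IP is an L-submodule since I is an ideal: x y v = y x v + [x,y] v.\<close>
  have W_L: "act P x w \<in> W" if x: "x \<in> carrier L" and w: "w \<in> W" for x w
  proof -
    have "W \<subseteq> {v \<in> carrier P. act P x v \<in> W}"
    proof (rule W(3)[OF ssp_vimage[OF VP act_lhom[OF x] W(1)]])
      fix y v assume y: "y \<in> I" and v: "v \<in> carrier P"
      have "act P x (act P y v) = act P y (act P x v) \<oplus>\<^bsub>P\<^esub> act P (bracket L x y) v"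
        unfolding P.act_bracket[OF x I_carr[OF y] v]
        by (intro P.M.M.add_minus_cancel[symmetric] P.act_closed x v I_carr[OF y])
      also have "\<dots> \<in> W" by (rule Ws(4)[OF W(2)[OF y P.act_closed[OF x v]] W(2)[OF I_bracket[OF x y] v]])
      finally show "act P y v \<in> {v \<in> carrier P. act P x v \<in> W}" using P.act_closed[OF I_carr[OF y] v] by simp
    qed
    then show ?thesis using w by blast
  qed
  obtain pr where pr: "pr \<in> lhom P P" "\<And>v. v \<in> W \<Longrightarrow> pr v = \<zero>\<^bsub>P\<^esub>" "\<And>v. v \<in> carrier P \<Longrightarrow> v \<ominus>\<^bsub>P\<^esub> pr v \<in> W"
    by (rule projection_along[OF VP fdP W(1)]) (rule that; assumption)
  note prD = lhomD[OF pr(1)]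
  \<comment> \<open>P/W with its L-action, realised on the complement: act in P, then project. It is
    a module because W is L-stable, so that v and \<open>pr v\<close> give the same result
    (\<open>act_pr\<close>).\<close>
  let ?C = "P\<lparr>carrier := pr ` carrier P, act := \<lambda>x v. pr (act P x v)\<rparr>"
  have Cs: "ssp (pr ` carrier P) P" by (rule image_ssp[OF VP VP pr(1) Ps])
  have VC: "vsp ?C" by (rule vsp_cong[OF sspD(8)[OF Cs]]) simp_all
  have prC: "pr \<in> lhom P ?C" by (rule lhomI) (simp_all add: prD)
  have act_pr: "pr (act P x (pr v)) = pr (act P x v)" if x: "x \<in> carrier L" and v: "v \<in> carrier P" for x v
  proof -
    have "act P x (v \<ominus>\<^bsub>P\<^esub> pr v) = act P x v \<ominus>\<^bsub>P\<^esub> act P x (pr v)"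
      by (rule lhom_zero(2)[OF VP VP act_lhom[OF x] v prD(1)[OF v]])
    then have "pr (act P x v \<ominus>\<^bsub>P\<^esub> act P x (pr v)) = \<zero>\<^bsub>P\<^esub>" using pr(2)[OF W_L[OF x pr(3)[OF v]]] by simp
    moreover have "pr (act P x v \<ominus>\<^bsub>P\<^esub> act P x (pr v)) = pr (act P x v) \<ominus>\<^bsub>P\<^esub> pr (act P x (pr v))"
      by (rule lhom_zero(2)[OF VP VP pr(1) P.act_closed[OF x v] P.act_closed[OF x prD(1)[OF v]]])
    ultimately have "pr (act P x v) \<ominus>\<^bsub>P\<^esub> pr (act P x (pr v)) = \<zero>\<^bsub>P\<^esub>" by simp
    moreover have "pr (act P x v) \<in> carrier P" "pr (act P x (pr v)) \<in> carrier P"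
      using prD(1) P.act_closed[OF x] v by simp_all
    ultimately have "pr (act P x (pr v)) \<oplus>\<^bsub>P\<^esub> \<zero>\<^bsub>P\<^esub> = pr (act P x v)"
      using P.M.M.add_minus_cancel[of "pr (act P x v)" "pr (act P x (pr v))"] by simp
    then show ?thesis using prD(1)[OF P.act_closed[OF x prD(1)[OF v]]] by simp
  qed
  have LC: "lie_module L ?C"
  proof (intro lie_module.intro lie_algebra_axioms VC lie_module_axioms.intro)
    fix x y v assume x: "x \<in> carrier L" "y \<in> carrier L" and "v \<in> carrier ?C"
    then obtain u where u: "v = pr u" "u \<in> carrier P" by auto
    have "act ?C (bracket L x y) v = pr (act P x (act P y u) \<ominus>\<^bsub>P\<^esub> act P y (act P x u))"
      using x u by (simp add: act_pr bracket_closed P.act_bracket)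
    also have "\<dots> = pr (act P x (act P y u)) \<ominus>\<^bsub>?C\<^esub> pr (act P y (act P x u))"
      by (rule lhom_zero(2)[OF VP VC prC]) (simp_all add: x u P.act_closed)
    also have "\<dots> = act ?C x (act ?C y v) \<ominus>\<^bsub>?C\<^esub> act ?C y (act ?C x v)"
      using x u by (simp add: act_pr P.act_closed)
    finally show "act ?C (bracket L x y) v = act ?C x (act ?C y v) \<ominus>\<^bsub>?C\<^esub> act ?C y (act ?C x v)" .
  qed (auto simp: prD P.act_closed P.act_add_left P.act_add_right P.act_smult_left P.act_smult_right)
  have fp: "(act ?C x ^^ k) (pr v) = pr ((act P x ^^ k) v) \<and> (act P x ^^ k) v \<in> carrier P"
    if x: "x \<in> carrier L" and v: "v \<in> carrier P" for x v k
    by (induction k) (simp_all add: v x act_pr P.act_closed)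
  have pcC: "has_p_character L \<chi> ?C"
    unfolding has_p_character_def
  proof (intro ballI)
    fix x v assume x: "x \<in> carrier L" and "v \<in> carrier ?C"
    then obtain u where u: "v = pr u" "u \<in> carrier P" by auto
    note px = pmap_closed[OF x]
    have "(act ?C x ^^ CHAR('k)) v \<ominus>\<^bsub>?C\<^esub> act ?C (pmap L x) v
        = pr ((act P x ^^ CHAR('k)) u) \<ominus>\<^bsub>?C\<^esub> pr (act P (pmap L x) u)"
      using conjunct1[OF fp[OF x u(2), of "CHAR('k)"]] act_pr[OF px u(2)] by (simp add: u(1))
    also have "\<dots> = pr ((act P x ^^ CHAR('k)) u \<ominus>\<^bsub>P\<^esub> act P (pmap L x) u)"
      by (rule lhom_zero(2)[OF VP VC prC, symmetric]) (use fp[OF x u(2)] P.act_closed[OF px u(2)] in auto)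
    also have "\<dots> = pr (\<chi> x ^ CHAR('k) \<odot>\<^bsub>P\<^esub> u)" using pcP x u(2) by (simp add: has_p_character_def)
    finally show "(act ?C x ^^ CHAR('k)) v \<ominus>\<^bsub>?C\<^esub> act ?C (pmap L x) v = \<chi> x ^ CHAR('k) \<odot>\<^bsub>?C\<^esub> v"
      using u by (simp add: prD)
  qed
  have IC: "act ?C y v = \<zero>\<^bsub>?C\<^esub>" if y: "y \<in> I" and v: "v \<in> carrier ?C" for y v
  proof -
    obtain u where u: "v = pr u" "u \<in> carrier P" using v by auto
    show ?thesis using pr(2)[OF W(2)[OF y prD(1)[OF u(2)]]] u(1) by simp
  qed
  note \<pi>l = lie_homD(1)[OF \<pi>(1)]
  have "ssp {v \<in> carrier P. \<pi> v = \<zero>\<^bsub>S\<^esub>} P" using vdim_surj(3)[OF VP VS \<pi>l \<pi>(2) fdP] .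
  then have "W \<subseteq> {v \<in> carrier P. \<pi> v = \<zero>\<^bsub>S\<^esub>}"
    by (rule W(3)) (use lie_homD(2)[OF \<pi>(1)] I_carr IS lhomD(1)[OF \<pi>l] P.act_closed in auto)
  then have \<pi>W: "\<pi> w = \<zero>\<^bsub>S\<^esub>" if "w \<in> W" for w using that by blast
  have \<pi>pr: "\<pi> (pr v) = \<pi> v" if v: "v \<in> carrier P" for v
  proof -
    have "\<pi> (pr v \<oplus>\<^bsub>P\<^esub> (v \<ominus>\<^bsub>P\<^esub> pr v)) = \<pi> (pr v) \<oplus>\<^bsub>S\<^esub> \<pi> (v \<ominus>\<^bsub>P\<^esub> pr v)"
      by (rule lhomD(2)[OF \<pi>l prD(1)[OF v] Ws(7)[OF pr(3)[OF v]]])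
    then show ?thesis
      using P.M.M.add_minus_cancel[OF v prD(1)[OF v]] \<pi>W[OF pr(3)[OF v]] lhomD(1)[OF \<pi>l prD(1)[OF v]] by simp
  qed
  have "\<pi> \<in> lhom ?C S" by (rule lhomI) (use lhomD[OF \<pi>l] prD(1) in auto)
  then have \<pi>C: "\<pi> \<in> lie_hom L ?C S"
    using lie_homD(2)[OF \<pi>(1)] by (auto simp: lie_hom_def \<pi>pr P.act_closed prD(1))
  have "\<pi> ` carrier ?C = carrier S" using \<pi>(2) \<pi>pr by (auto simp: image_image)
  then obtain b where b: "b \<in> lie_hom LQ R (quot_lie_module ?C)" "\<And>v. v \<in> carrier R \<Longrightarrow> \<pi> (b v) = \<sigma> v"
    using liftR[OF LC pcC IC \<pi>C] by blast
  have bl: "b \<in> lhom R ?C" using lhomD[OF lie_homD(1)[OF b(1)]] by (intro lhomI) simp_all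
  have Rs: "ssp (carrier R) R" by (rule sspI[OF VR]) (use R.M.smult_closed in auto)
  \<comment> \<open>The preimage in P of the image of \<open>b\<close>. It maps onto S, so by
    essentiality it is P, and \<open>b\<close> is onto.\<close>
  let ?B = "{v \<in> carrier P. pr v \<in> b ` carrier R}"
  have "?B = carrier P"
  proof (rule essP)
    show "ssp ?B P" by (rule ssp_vimage[OF VP prC image_ssp[OF VR VC bl Rs]])
    show "act P x v \<in> ?B" if x: "x \<in> carrier L" and v: "v \<in> ?B" for x v
    proof -
      obtain u where u: "pr v = b u" "u \<in> carrier R" and vP: "v \<in> carrier P" using v by auto
      have qx: "q x \<in> carrier LQ" using x by (simp add: quot_carrier)
      have "b (act R (q x) u) = act ?C x (b u)"
        using lie_homD(2)[OF b(1) qx u(2)] quot_act[OF LC IC x, of "b u"] lhomD(1)[OF bl u(2)] by simp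
      also have "\<dots> = pr (act P x v)" unfolding u(1)[symmetric] using act_pr[OF x vP] by simp
      finally have "pr (act P x v) \<in> b ` carrier R" by (rule image_eqI[OF sym R.act_closed[OF qx u(2)]])
      then show ?thesis using P.act_closed[OF x vP] by simp
    qed
    show "\<pi> ` ?B = carrier S"
    proof
      show "\<pi> ` ?B \<subseteq> carrier S" using lhomD(1)[OF \<pi>l] by auto
      show "carrier S \<subseteq> \<pi> ` ?B"
      proof
        fix s assume "s \<in> carrier S"
        then obtain u where u: "s = \<sigma> u" "u \<in> carrier R" using \<sigma> by blast
        obtain v where v: "b u = pr v" "v \<in> carrier P" using lhomD(1)[OF bl u(2)] by auto
        have "s = \<pi> v" using b(2)[OF u(2)] \<pi>pr[OF v(2)] u(1) v(1) by simp
        moreover have "v \<in> ?B" using v(2) imageI[OF u(2), of b] by (simp add: v(1))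
        ultimately show "s \<in> \<pi> ` ?B" by (rule image_eqI)
      qed
    qed
  qed
  then have "b ` carrier R = carrier ?C" using lhomD(1)[OF bl] by auto
  then have "vdim ?C \<le> vdim R" using vdim_surj(1)[OF VR VC bl _ fdR] by simp
  moreover have "vdim P = vdim ?C + vdim (P\<lparr>carrier := {v \<in> carrier P. pr v = \<zero>\<^bsub>P\<^esub>}\<rparr>)"
    using vdim_surj(1)[OF VP VC prC _ fdP] by simp
  moreover have "{v \<in> carrier P. pr v = \<zero>\<^bsub>P\<^esub>} = W"
  proof
    show "{v \<in> carrier P. pr v = \<zero>\<^bsub>P\<^esub>} \<subseteq> W"
    proof
      fix v assume v: "v \<in> {v \<in> carrier P. pr v = \<zero>\<^bsub>P\<^esub>}"
      then have w: "v \<ominus>\<^bsub>P\<^esub> \<zero>\<^bsub>P\<^esub> \<in> W" using pr(3)[of v] by simp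
      then show "v \<in> W" using P.M.M.add_minus_cancel[of v "\<zero>\<^bsub>P\<^esub>"] v Ws(7)[OF w] by simp
    qed
    show "W \<subseteq> {v \<in> carrier P. pr v = \<zero>\<^bsub>P\<^esub>}" using pr(2) Ws(7) by auto
  qed
  ultimately show ?thesis using le fdR by simp
qed

end

section \<open>The dimension formula\<close>

lemma lie_module_restrict:
  fixes M :: "('k::field, 'l, 'm) lie_module" and L :: "('k, 'l, 'x) restricted_lie_algebra_scheme"
  assumes RL: "restricted_lie_algebra L" and I: "p_ideal I L" and LM: "lie_module L M" and N: "ssp N M"
    and st: "\<And>y v. y \<in> I \<Longrightarrow> v \<in> N \<Longrightarrow> act M y v \<in> N"
  shows "lie_module (L\<lparr>carrier := I\<rparr>) (M\<lparr>carrier := N\<rparr>)"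
    and "has_p_character L \<chi> M \<Longrightarrow> (\<And>y. y \<in> I \<Longrightarrow> \<chi> y = 0) \<Longrightarrow>
      has_p_character (L\<lparr>carrier := I\<rparr>) (\<lambda>_. 0) (M\<lparr>carrier := N\<rparr>)"
proof -
  interpret M: lie_module L M by (rule LM)
  interpret R: restricted_lie_algebra "L\<lparr>carrier := I\<rparr>" by (rule restricted_lie_algebra_ideal[OF RL I])
  note I1 = p_idealD[OF I] and Nc = sspD(7)[OF N]
  have Ic: "y \<in> I \<Longrightarrow> y \<in> carrier L" for y using sspD(7)[OF I1(1)] .
  show "lie_module (L\<lparr>carrier := I\<rparr>) (M\<lparr>carrier := N\<rparr>)"
    by (intro lie_module.intro R.lie_algebra_axioms sspD(8)[OF N] lie_module_axioms.intro)
      (simp_all add: st Ic Nc M.act_add_left M.act_add_right M.act_smult_left M.act_smult_right M.act_bracket sub_minus[OF N])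
  assume pc: "has_p_character L \<chi> M" and \<chi>: "\<And>y. y \<in> I \<Longrightarrow> \<chi> y = 0"
  show "has_p_character (L\<lparr>carrier := I\<rparr>) (\<lambda>_. 0) (M\<lparr>carrier := N\<rparr>)"
    unfolding has_p_character_def
  proof (intro ballI)
    fix y v assume "y \<in> carrier (L\<lparr>carrier := I\<rparr>)" "v \<in> carrier (M\<lparr>carrier := N\<rparr>)"
    then have y: "y \<in> I" and v: "v \<in> N" by auto
    have "(act M y ^^ k) v \<in> N" for k by (induction k) (simp_all add: v st[OF y])
    then show "(act (M\<lparr>carrier := N\<rparr>) y ^^ CHAR('k)) v \<ominus>\<^bsub>M\<lparr>carrier := N\<rparr>\<^esub>
        act (M\<lparr>carrier := N\<rparr>) (pmap (L\<lparr>carrier := I\<rparr>) y) v = 0 ^ CHAR('k) \<odot>\<^bsub>M\<lparr>carrier := N\<rparr>\<^esub> v"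
      using pc y v Ic[OF y] Nc[OF v] \<chi>[OF y] I1(3)[OF y]
      by (simp add: has_p_character_def sub_minus[OF N] st)
  qed
qed

lemma trivial_lie_module:
  fixes L :: "('k::field, 'l, 'x) restricted_lie_algebra_scheme"
  assumes RL: "restricted_lie_algebra L"
  shows "lie_module L (trivial_lie_module :: ('k, 'l, 'k) lie_module)"
    and "has_p_character L (\<lambda>_. 0) (trivial_lie_module :: ('k, 'l, 'k) lie_module)"
proof -
  let ?T = "trivial_lie_module :: ('k, 'l, 'k) lie_module"
  interpret L: restricted_lie_algebra L by (rule RL)
  interpret T: vectorspace class_ring ?T by (rule vsp_trivial)
  have s: "carrier ?T = UNIV" "zero ?T = 0" "add ?T = (+)" "smult ?T = (*)" "act ?T = (\<lambda>x m. 0)"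
    by (simp_all add: trivial_lie_module_def)
  have m: "(0::'k) \<ominus>\<^bsub>?T\<^esub> 0 = 0" using T.M.r_neg[of 0] by (simp add: a_minus_def s)
  show "lie_module L ?T"
    by (intro lie_module.intro L.lie_algebra_axioms vsp_trivial lie_module_axioms.intro) (simp_all add: s m)
  obtain k where k: "CHAR('k) = Suc k" using prime_gt_0_nat[OF L.char_prime] by (cases "CHAR('k)") auto
  have f: "(act ?T x ^^ CHAR('k)) v = act ?T x ((act ?T x ^^ k) v)" for x v unfolding k by simp
  show "has_p_character L (\<lambda>_. 0) ?T"
    unfolding has_p_character_def f by (simp add: s m k)
qed

theorem theorem1p5:
  fixes L :: "('k::field, 'l) restricted_lie_algebra"
    and \<chi> :: "'l \<Rightarrow> 'k"
    and I :: "'l set"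
    and S :: "('k, 'l, 's) lie_module"
    and P :: "(('l list \<Rightarrow> 'k) set set, 'p) module" and \<pi> :: "'p \<Rightarrow> 's"
    and Q :: "(('l list \<Rightarrow> 'k) set set, 'q) module" and \<rho> :: "'q \<Rightarrow> 'k"
    and R :: "(('l set list \<Rightarrow> 'k) set set, 'r) module" and \<sigma> :: "'r \<Rightarrow> 's"
  assumes "restricted_lie_algebra L"
    and "vectorspace.fin_dim class_ring L"
    and "linear_form L \<chi>"
    and "p_ideal I L"
    and "irreducible_lie_module L S"
    and "has_p_character L \<chi> S"
    and "\<forall>x\<in>I. \<forall>s\<in>carrier S. act S x s = \<zero>\<^bsub>S\<^esub>"
    \<comment> \<open>\<open>P = P\<^sub>L(S)\<close>\<close>
    and "projective_cover (red_uea L \<chi>) (red_uea_module S) P \<pi>"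
    \<comment> \<open>\<open>Q = P\<^sub>I(F)\<close>\<close>
    and "projective_cover (red_uea (L\<lparr>carrier := I\<rparr>) (\<lambda>x. 0)) (red_uea_module trivial_lie_module) Q \<rho>"
    \<comment> \<open>\<open>R = P\<^sub>L\<^sub>/\<^sub>I(S)\<close>\<close>
    and "projective_cover (red_uea (quot_lie L I) (quot_form \<chi>))
           (red_uea_module (quot_lie_module S)) R \<sigma>"
  shows "red_uea_module_dim L \<chi> P =
    red_uea_module_dim (L\<lparr>carrier := I\<rparr>) (\<lambda>x. 0) Q *
    red_uea_module_dim (quot_lie L I) (quot_form \<chi>) R"
proof -
  note RL = assms(1) and fdL = assms(2) and \<chi> = assms(3) and ideal = assms(4) and pcS = assms(6)
  let ?LI = "L\<lparr>carrier := I\<rparr>" and ?T = "trivial_lie_module :: ('k, 'l, 'k) lie_module"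
  interpret L: restricted_lie_algebra L by (rule RL)
  interpret LQ: p_ideal_quot L I by (intro p_ideal_quot.intro p_ideal_quot_axioms.intro RL ideal)
  interpret LI: restricted_lie_algebra ?LI by (rule restricted_lie_algebra_ideal[OF RL ideal])
  have LS: "lie_module L S" using assms(5) by (simp add: irreducible_lie_module_def)
  interpret S: lie_module L S by (rule LS)
  note VS = S.M.vectorspace_axioms
  have IS: "act S y s = \<zero>\<^bsub>S\<^esub>" if "y \<in> I" "s \<in> carrier S" for y s using assms(7) that by blast
  \<comment> \<open>Any nonzero vector generates the irreducible module S; a preimage of it in P
    will generate P.\<close>
  obtain s0 where s0: "s0 \<in> carrier S" "s0 \<noteq> \<zero>\<^bsub>S\<^esub>"
    using assms(5) S.M.M.zero_closed unfolding irreducible_lie_module_def by blast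
  have irr: "U = carrier S" if "ssp U S" "\<And>x u. x \<in> carrier L \<Longrightarrow> u \<in> U \<Longrightarrow> act S x u \<in> U" "s0 \<in> U" for U
  proof -
    have "U = {\<zero>\<^bsub>S\<^esub>} \<or> U = carrier S" using assms(5) that(1,2) unfolding irreducible_lie_module_def by blast
    then show ?thesis using that(3) s0(2) by blast
  qed
  \<comment> \<open>Both y and its p-map annihilate S, so the p-character equation at s0 reads 0 =
    chi(y)^p s0.\<close>
  have \<chi>0: "\<chi> y = 0" if y: "y \<in> I" for y
  proof -
    obtain k where k: "CHAR('k) = Suc k" using prime_gt_0_nat[OF L.char_prime] by (cases "CHAR('k)") auto
    have "(act S y ^^ j) \<zero>\<^bsub>S\<^esub> = \<zero>\<^bsub>S\<^esub>" for j
      by (induction j) (simp_all add: S.act_zero_right[OF LQ.I_carr[OF y]])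
    then have "(act S y ^^ CHAR('k)) s0 = \<zero>\<^bsub>S\<^esub>" unfolding k funpow_Suc_right by (simp add: IS[OF y s0(1)])
    moreover have "act S (pmap L y) s0 = \<zero>\<^bsub>S\<^esub>" by (rule IS[OF p_idealD(3)[OF ideal y] s0(1)])
    moreover have "(act S y ^^ CHAR('k)) s0 \<ominus>\<^bsub>S\<^esub> act S (pmap L y) s0 = \<chi> y ^ CHAR('k) \<odot>\<^bsub>S\<^esub> s0"
      using pcS LQ.I_carr[OF y] s0(1) unfolding has_p_character_def by blast
    ultimately have z: "\<chi> y ^ CHAR('k) \<odot>\<^bsub>S\<^esub> s0 = \<zero>\<^bsub>S\<^esub>"
      using S.M.M.r_neg[OF S.M.M.zero_closed] by (simp add: a_minus_def)
    show "\<chi> y = 0"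
    proof (rule ccontr)
      let ?a = "\<chi> y ^ CHAR('k)"
      assume "\<chi> y \<noteq> 0"
      then have "inverse ?a * ?a = 1" by simp
      then have "s0 = inverse ?a \<odot>\<^bsub>S\<^esub> (?a \<odot>\<^bsub>S\<^esub> s0)"
        using vspD(1)[OF VS s0(1), of "inverse ?a" ?a] vspD(2)[OF VS s0(1)] by simp
      then show False using z s0 S.M.smult_r_null[of "inverse ?a"] by simp
    qed
  qed
  obtain r n :: nat and e co where b: "r \<le> n" "\<And>i. i < n \<Longrightarrow> e i \<in> carrier L" "\<And>k. linear_form L (co k)"
    "\<And>i k. i < n \<Longrightarrow> k < n \<Longrightarrow> co k (e i) = (if k = i then 1 else 0)"
    "\<And>x. x \<in> carrier L \<Longrightarrow> x = (\<Oplus>\<^bsub>L\<^esub>k\<in>{..<n}. co k x \<odot>\<^bsub>L\<^esub> e k)"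
    "\<And>i. i < r \<Longrightarrow> e i \<in> I" "\<And>x. x \<in> carrier L \<Longrightarrow> x \<in> I \<longleftrightarrow> (\<forall>k. r \<le> k \<and> k < n \<longrightarrow> co k x = 0)"
    by (rule adapted_basis[OF L.vectorspace_axioms fdL LQ.I_ssp]) (rule that; assumption)
  interpret B: lie_basis_ideal L \<chi> n e co "CHAR('k)" I r
  proof (intro lie_basis_ideal.intro lie_basis.intro lie_basis_axioms.intro lie_basis_ideal_axioms.intro RL \<chi> ideal refl)
    show "e i \<in> carrier L" if "i < n" for i by (rule b(2)[OF that])
    show "linear_form L (co k)" for k by (rule b(3))
    show "co k (e i) = (if k = i then 1 else 0)" if "k < n" "i < n" for k i by (rule b(4)[OF that(2,1)])
    show "x = (\<Oplus>\<^bsub>L\<^esub>k\<in>{..<n}. co k x \<odot>\<^bsub>L\<^esub> e k)" if "x \<in> carrier L" for x by (rule b(5)[OF that])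
    show "r \<le> n" by (rule b(1))
    show "e i \<in> I" if "i < r" for i by (rule b(6)[OF that])
    show "x \<in> I \<longleftrightarrow> (\<forall>k. r \<le> k \<and> k < n \<longrightarrow> co k x = 0)" if "x \<in> carrier L" for x by (rule b(7)[OF that])
    show "\<chi> x = 0" if "x \<in> I" for x by (rule \<chi>0[OF that])
  qed
  interpret A: red_algebra L \<chi>
    by (intro red_algebra.intro red_algebra_axioms.intro L.lie_algebra_axioms L.pmap_closed)
  interpret AI: red_algebra ?LI "\<lambda>x. 0"
    by (intro red_algebra.intro red_algebra_axioms.intro LI.lie_algebra_axioms LI.pmap_closed)
  interpret AQ: red_algebra "quot_lie L I" "quot_form \<chi>"
    by (intro red_algebra.intro red_algebra_axioms.intro LQ.quot_lie_algebra LQ.quot_pmap_closed)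
  note T = trivial_lie_module[OF LI.restricted_lie_algebra_axioms]
  have QS: "lie_module (quot_lie L I) (quot_lie_module S)"
    "has_p_character (quot_lie L I) (quot_form \<chi>) (quot_lie_module S)"
    by (rule LQ.quot_lie_module[OF LS IS], assumption+) (rule LQ.quot_p_character[OF LS IS pcS \<chi> \<chi>0], assumption+)
  note cP = A.projective_coverD[OF LS pcS assms(8)]
  note cQ = AI.projective_coverD[OF T assms(9)]
  note cR = AQ.projective_coverD[OF QS assms(10)]
  let ?P = "A.lie_of P" and ?Q = "AI.lie_of Q" and ?R = "AQ.lie_of R"
  interpret MP: lie_module L ?P by (rule cP(2))
  interpret MQ: lie_module ?LI ?Q by (rule cQ(2))
  note VP = MP.M.vectorspace_axioms and VQ = MQ.M.vectorspace_axioms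
  have Tc: "carrier ?T = UNIV" and Ta: "act ?T x m = 0" for x m by (simp_all add: trivial_lie_module_def)
  have \<rho>l: "linear_form ?Q \<rho>" using lie_homD(1)[OF cQ(4)] by (simp add: trivial_lhom)
  have \<rho>_act: "\<rho> (act ?Q y u) = 0" if "y \<in> I" "u \<in> carrier Q" for y u
    using lie_homD(2)[OF cQ(4), of y u] that unfolding Ta by simp
  obtain q0 where q0: "q0 \<in> carrier Q" "\<rho> q0 = 1"
    using cQ(5) unfolding Tc by (metis UNIV_I imageE)
  \<comment> \<open>A submodule containing a vector with rho = 1 maps onto the one-dimensional
    trivial module, so the essential epimorphism rho forces it to be Q.\<close>
  have essQ: "U = carrier Q" if "ssp U ?Q" "\<And>y u. y \<in> I \<Longrightarrow> u \<in> U \<Longrightarrow> act ?Q y u \<in> U" "u \<in> U" "\<rho> u = 1" for U u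
  proof (rule cQ(6)[OF that(1)])
    show "act ?Q x m \<in> U" if "x \<in> carrier ?LI" "m \<in> U" for x m
      by (rule \<open>\<And>y u. y \<in> I \<Longrightarrow> u \<in> U \<Longrightarrow> act ?Q y u \<in> U\<close>) (use that in simp_all)
    have "a \<in> \<rho> ` U" for a
    proof (rule image_eqI)
      show "a \<odot>\<^bsub>?Q\<^esub> u \<in> U" by (rule sspD(5)[OF that(1,3)])
      show "a = \<rho> (a \<odot>\<^bsub>?Q\<^esub> u)" using linear_formD(2)[OF \<rho>l sspD(7)[OF that(1,3)], of a] that(4) by simp
    qed
    then show "\<rho> ` U = carrier ?T" unfolding Tc by blast
  qed
  \<comment> \<open>By \<open>essQ\<close> the module Q is generated by \<open>q0\<close>, hence
    finite-dimensional.\<close>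
  have fdQ: "fdim ?Q"
    by (rule B.I.fdim_generated[OF cQ(2,3)], unfold A.lie_of_simps AI.lie_of_simps(1), rule q0(1), rule essQ[OF _ _ _ q0(2)]) auto
  have resP: "lie_module ?LI (?P\<lparr>carrier := N\<rparr>)" "has_p_character ?LI (\<lambda>_. 0) (?P\<lparr>carrier := N\<rparr>)"
    if "ssp N ?P" "\<And>y v. y \<in> I \<Longrightarrow> v \<in> N \<Longrightarrow> act ?P y v \<in> N" for N
    by (rule lie_module_restrict(1)[OF RL ideal cP(2) that], assumption+)
      (rule lie_module_restrict(2)[OF RL ideal cP(2) that cP(3) \<chi>0], assumption+)
  note \<pi>l = lie_homD(1)[OF cP(4)] and \<pi>act = lie_homD(2)[OF cP(4)]
  \<comment> \<open>The multiples of s0 form a trivial I-module. Over its preimage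
    \<open>?PS\<close> in P, projectivity of Q lifts u -> rho(u) s0 along pi; the lift is
    \<open>g0\<close>, and \<open>g0 q0\<close> lies over s0.\<close>
  let ?SS = "range (\<lambda>a. a \<odot>\<^bsub>S\<^esub> s0)"
  have S0: "ssp ?SS S"
  proof (rule sspI[OF VS])
    have sm: "a \<odot>\<^bsub>S\<^esub> s0 \<in> carrier S" for a using S.M.smult_closed[of a s0] s0(1) by simp
    then show "?SS \<subseteq> carrier S" by blast
    show "\<zero>\<^bsub>S\<^esub> \<in> ?SS" by (rule range_eqI[of _ _ 0]) (simp add: smult_zero(1)[OF VS s0(1)])
    fix x assume "x \<in> ?SS"
    then obtain a where a: "x = a \<odot>\<^bsub>S\<^esub> s0" by blast
    show "c \<odot>\<^bsub>S\<^esub> x \<in> ?SS" for c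
      by (rule range_eqI[of _ _ "c * a"]) (simp add: a vspD(1)[OF VS s0(1)])
    fix y assume "y \<in> ?SS"
    then obtain a' where a': "y = a' \<odot>\<^bsub>S\<^esub> s0" by blast
    show "x \<oplus>\<^bsub>S\<^esub> y \<in> ?SS"
      by (rule range_eqI[of _ _ "a + a'"]) (simp add: a a' vspD(3)[OF VS s0(1)])
  qed
  let ?PS = "{v \<in> carrier ?P. \<pi> v \<in> ?SS}"
  have P0: "ssp ?PS ?P" by (rule ssp_vimage[OF VP \<pi>l S0])
  have P0st: "act ?P y v \<in> ?PS" if "y \<in> I" "v \<in> ?PS" for y v
    using \<pi>act[OF LQ.I_carr[OF that(1)], of v] MP.act_closed[OF LQ.I_carr[OF that(1)], of v] that
      IS[OF that(1) lhomD(1)[OF \<pi>l, of v]] sspD(3)[OF S0] by (simp del: A.lie_of_simps)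
  have S0st: "act S y s \<in> ?SS" if "y \<in> I" "s \<in> ?SS" for y s
    using IS[OF that(1) sspD(7)[OF S0 that(2)]] sspD(3)[OF S0] by simp
  note resS = lie_module_restrict(1)[OF RL ideal LS S0 S0st] lie_module_restrict(2)[OF RL ideal LS S0 S0st pcS \<chi>0]
  have "\<exists>g\<in>lie_hom ?LI ?Q (?P\<lparr>carrier := ?PS\<rparr>). \<forall>u\<in>carrier Q. \<pi> (g u) = \<rho> u \<odot>\<^bsub>S\<^esub> s0"
  proof (rule AI.projective_lift[OF cQ(1) resP[OF P0 P0st] resS])
    show "\<pi> \<in> lie_hom ?LI (?P\<lparr>carrier := ?PS\<rparr>) (S\<lparr>carrier := ?SS\<rparr>)"
      unfolding lie_hom_def
    proof (intro CollectI conjI ballI)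
      show "\<pi> \<in> lhom (?P\<lparr>carrier := ?PS\<rparr>) (S\<lparr>carrier := ?SS\<rparr>)"
        by (rule lhomI) (use lhomD[OF \<pi>l] in \<open>auto simp del: A.lie_of_simps(4,5)\<close>)
    qed (use \<pi>act LQ.I_carr in \<open>auto simp del: A.lie_of_simps\<close>)
    show "\<pi> ` carrier (?P\<lparr>carrier := ?PS\<rparr>) = carrier (S\<lparr>carrier := ?SS\<rparr>)"
    proof (intro subset_antisym subsetI)
      fix t assume "t \<in> carrier (S\<lparr>carrier := ?SS\<rparr>)"
      then have t: "t \<in> ?SS" by simp
      then have "t \<in> \<pi> ` carrier P" unfolding cP(5) by (rule sspD(7)[OF S0])
      then obtain v where v: "t = \<pi> v" "v \<in> carrier P" by (rule imageE)
      have "v \<in> ?PS" using v t by simp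
      then show "t \<in> \<pi> ` carrier (?P\<lparr>carrier := ?PS\<rparr>)" using v(1) by simp
    qed auto
    have 0: "\<zero>\<^bsub>S\<^esub> = 0 \<odot>\<^bsub>S\<^esub> s0" using smult_zero(1)[OF VS s0(1)] by simp
    show "(\<lambda>u. \<rho> u \<odot>\<^bsub>S\<^esub> s0) \<in> lie_hom ?LI ?Q (S\<lparr>carrier := ?SS\<rparr>)"
      unfolding lie_hom_def
    proof (intro CollectI conjI ballI)
      show "(\<lambda>u. \<rho> u \<odot>\<^bsub>S\<^esub> s0) \<in> lhom ?Q (S\<lparr>carrier := ?SS\<rparr>)"
        by (rule lhomI) (simp_all add: linear_formD[OF \<rho>l] vspD(1,3)[OF VS s0(1)] del: AI.lie_of_simps)
      fix y u assume y: "y \<in> carrier ?LI" and u: "u \<in> carrier ?Q"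
      have "\<rho> (act ?Q y u) = 0" using \<rho>_act y u by simp
      moreover have "act S y (\<rho> u \<odot>\<^bsub>S\<^esub> s0) = \<zero>\<^bsub>S\<^esub>"
        by (rule IS) (use y sspD(7)[OF S0] in auto)
      ultimately show "\<rho> (act ?Q y u) \<odot>\<^bsub>S\<^esub> s0 = act (S\<lparr>carrier := ?SS\<rparr>) y (\<rho> u \<odot>\<^bsub>S\<^esub> s0)"
        using 0 by (simp del: AI.lie_of_simps)
    qed
  qed
  then obtain g0 where g0: "g0 \<in> lie_hom ?LI ?Q (?P\<lparr>carrier := ?PS\<rparr>)" "\<And>u. u \<in> carrier Q \<Longrightarrow> \<pi> (g0 u) = \<rho> u \<odot>\<^bsub>S\<^esub> s0"
    by blast
  have g0P: "g0 \<in> lie_hom ?LI ?Q ?P"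
    unfolding lie_hom_def
  proof (intro CollectI conjI ballI)
    show "g0 \<in> lhom ?Q ?P"
      by (rule lhomI) (use lhomD[OF lie_homD(1)[OF g0(1)]] in \<open>auto simp del: A.lie_of_simps(4,5) AI.lie_of_simps(4,5)\<close>)
  qed (use lie_homD(2)[OF g0(1)] in \<open>auto simp del: A.lie_of_simps(4,5) AI.lie_of_simps(4,5)\<close>)
  have g0q: "g0 q0 \<in> carrier ?P" "\<pi> (g0 q0) = s0"
    using lhomD(1)[OF lie_homD(1)[OF g0P], of q0] g0(2)[OF q0(1)] q0 vspD(2)[OF VS s0(1)] by simp_all
  \<comment> \<open>The image in S contains s0, hence is S by irreducibility, and essentiality of pi
    gives P. In particular P is cyclic, which yields its finite dimension.\<close>
  have genP: "U = carrier ?P"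
    if U: "ssp U ?P" and st: "\<And>x v. x \<in> carrier L \<Longrightarrow> v \<in> U \<Longrightarrow> act ?P x v \<in> U" and g: "g0 q0 \<in> U" for U
  proof -
    have "\<pi> ` U = carrier S"
    proof (rule irr)
      show "ssp (\<pi> ` U) S" by (rule image_ssp[OF VP VS \<pi>l U])
      show "s0 \<in> \<pi> ` U" using imageI[OF g, of \<pi>] g0q(2) by simp
      fix x u assume x: "x \<in> carrier L" and "u \<in> \<pi> ` U"
      then obtain v where v: "u = \<pi> v" "v \<in> U" by blast
      show "act S x u \<in> \<pi> ` U"
        unfolding v(1) \<pi>act[OF x sspD(7)[OF U v(2)], symmetric] by (rule imageI[OF st[OF x v(2)]])
    qed
    then show ?thesis using cP(6)[OF U st] by simp
  qed
  have fdP: "fdim ?P" by (rule B.fdim_generated[OF cP(2,3) g0q(1)]) (rule genP; assumption)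
  interpret C: cover_pair L I ?P ?Q \<rho> q0 g0
  proof (unfold_locales)
    show "fdim ?P" "fdim ?Q" "linear_form ?Q \<rho>" "\<rho> q0 = 1" "g0 \<in> lie_hom ?LI ?Q ?P"
      by (fact fdP fdQ \<rho>l q0(2) g0P)+
    show "q0 \<in> carrier ?Q" using q0(1) by simp
    show "y \<in> carrier L" if "y \<in> I" for y by (rule LQ.I_carr[OF that])
    show "bracket L x y \<in> I" "bracket L y x \<in> I" if "x \<in> carrier L" "y \<in> I" for x y
      using LQ.I_bracket[OF that] LQ.I_bracket'[OF that(2,1)] .
    show "act ?Q y u \<in> carrier ?Q" "\<rho> (act ?Q y u) = 0" if "y \<in> I" "u \<in> carrier ?Q" for y u
      using MQ.act_closed[of y u] \<rho>_act[of y u] that by simp_all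
    show "U = carrier ?Q" if "ssp U ?Q" "\<And>y u. y \<in> I \<Longrightarrow> u \<in> U \<Longrightarrow> act ?Q y u \<in> U" "u \<in> U" "\<rho> u = 1" for U u
      using essQ[OF that] by simp
    show "U = carrier ?P"
      if "ssp U ?P" "\<And>x v. x \<in> carrier L \<Longrightarrow> v \<in> U \<Longrightarrow> act ?P x v \<in> U" "g0 q0 \<in> U" for U
      by (rule genP[OF that])
    show "\<exists>s\<in>lie_hom ?LI ?Q (?P\<lparr>carrier := N\<rparr>). \<forall>v\<in>carrier ?Q. h (s v) = v"
      if N: "ssp N ?P" "\<And>y v. y \<in> I \<Longrightarrow> v \<in> N \<Longrightarrow> act ?P y v \<in> N"
        and h: "h \<in> lie_hom ?LI (?P\<lparr>carrier := N\<rparr>) ?Q" "h ` N = carrier ?Q" for N h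
    proof -
      have "(\<lambda>v. v) \<in> lie_hom ?LI ?Q ?Q" by (simp add: lie_hom_def LinearCombinations.module_hom_def)
      then show ?thesis
        using AI.projective_lift[OF cQ(1) resP[OF N] cQ(2,3) h(1), of "\<lambda>v. v"] h(2) by simp
    qed
    \<comment> \<open>A form vanishing on IP is an I-map to the trivial module, to be lifted along
      rho. The problem is passed to the coinduced modules of Q and of the trivial module, where P is
      projective.\<close>
    show "\<exists>g\<in>lie_hom ?LI ?P ?Q. \<forall>v\<in>carrier ?P. \<rho> (g v) = \<mu> v"
      if \<mu>: "linear_form ?P \<mu>" "\<And>y v. y \<in> I \<Longrightarrow> v \<in> carrier ?P \<Longrightarrow> \<mu> (act ?P y v) = 0" for \<mu>
    proof (rule B.frobenius_lift[OF cQ(2) fdim_separated[OF VQ fdQ] T(1) fdim_separated[OF vsp_trivial fdim_trivial] cQ(3,4) _ cP(2,3)])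
      show "\<rho> ` carrier ?Q = carrier ?T" using cQ(5) by simp
      show "\<mu> \<in> lie_hom ?LI ?P ?T" using \<mu> by (simp add: lie_hom_def trivial_lhom Ta del: A.lie_of_simps(4,5))
      let ?cQ = "B.coind ?Q" and ?cT = "B.coind ?T"
      note q = cQ(2) fdim_separated[OF VQ fdQ] and t = T(1) fdim_separated[OF vsp_trivial fdim_trivial]
      fix G F assume "G \<in> lie_hom L ?cQ ?cT" "G ` carrier ?cQ = carrier ?cT" "F \<in> lie_hom L ?P ?cT"
      from A.projective_lift[OF cP(1) B.coind_lie_module[OF q] B.coind_p_character[OF q]
          B.coind_lie_module[OF t] B.coind_p_character[OF t] this]
      show "\<exists>H\<in>lie_hom L ?P ?cQ. \<forall>x\<in>carrier ?P. G (H x) = F x" by simp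
    qed
  qed
  obtain c where c: "vdim ?P = vdim ?Q * c" "vdim ?P = c + vdim (?P\<lparr>carrier := C.radical (carrier ?P)\<rparr>)"
    using C.vdim_cover by blast
  have \<sigma>: "\<sigma> ` carrier ?R = carrier S" using cR(5) by simp
  \<comment> \<open>With \<open>W\<close> = IP, comparison with the second equation for c leaves c =
    dim R.\<close>
  have "fdim ?R \<and> vdim ?P = vdim ?R + vdim (?P\<lparr>carrier := C.radical (carrier ?P)\<rparr>)"
  proof (rule LQ.vdim_quotient_cover[OF cP(2) fdP cP(3) LS IS cP(4) _ _ cR(2) \<sigma>])
    show "\<pi> ` carrier ?P = carrier S" using cP(5) by simp
    show "U = carrier ?P"
      if "ssp U ?P" "\<And>x v. x \<in> carrier L \<Longrightarrow> v \<in> U \<Longrightarrow> act ?P x v \<in> U" "\<pi> ` U = carrier S" for U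
      using cP(6)[OF that] by simp
    show "U = carrier ?R"
      if "ssp U ?R" "\<And>X v. X \<in> carrier (quot_lie L I) \<Longrightarrow> v \<in> U \<Longrightarrow> act ?R X v \<in> U" "\<sigma> ` U = carrier S" for U
      using cR(6)[OF that(1,2)] that(3) by simp
    have inf: "lie_module L (infl_lie_module L I ?R)" "has_p_character L \<chi> (infl_lie_module L I ?R)"
      "\<sigma> \<in> lie_hom L (infl_lie_module L I ?R) S"
      by (rule LQ.infl_lie_module[OF cR(2)], rule LQ.infl_p_character[OF cR(3) \<chi> \<chi>0], assumption,
          rule LQ.lie_hom_infl[OF LS IS cR(4)])
    have "\<sigma> ` carrier (infl_lie_module L I ?R) = carrier S" using \<sigma> by simp
    from A.projective_lift[OF cP(1) inf(1,2) LS pcS inf(3) this cP(4)]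
    show "\<exists>a\<in>lie_hom L ?P (infl_lie_module L I ?R). \<forall>v\<in>carrier ?P. \<sigma> (a v) = \<pi> v"
      by (simp only: A.lie_of_simps(1))
    \<comment> \<open>An L-module killed by I is a module over L/I with the induced form, where the
      cover R of S is projective.\<close>
    show "\<exists>b\<in>lie_hom (quot_lie L I) ?R (quot_lie_module D). \<forall>v\<in>carrier ?R. \<pi> (b v) = \<sigma> v"
      if D: "lie_module L D" "has_p_character L \<chi> D" "\<And>y v. y \<in> I \<Longrightarrow> v \<in> carrier D \<Longrightarrow> act D y v = \<zero>\<^bsub>D\<^esub>"
        "\<pi> \<in> lie_hom L D S" "\<pi> ` carrier D = carrier S" for D :: "('k, 'l, 'p) lie_module"
    proof -
      have quot: "lie_module (quot_lie L I) (quot_lie_module D)"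
        by (rule LQ.quot_lie_module[OF D(1,3)])
      have quot': "has_p_character (quot_lie L I) (quot_form \<chi>) (quot_lie_module D)"
        by (rule LQ.quot_p_character[OF D(1,3,2) \<chi> \<chi>0])
      have hom: "\<pi> \<in> lie_hom (quot_lie L I) (quot_lie_module D) (quot_lie_module S)"
        by (rule LQ.lie_hom_quot[OF D(1,3) LS IS D(4)])
      have "\<pi> ` carrier (quot_lie_module D) = carrier (quot_lie_module S)" using D(5) by simp
      from AQ.projective_lift[OF cR(1) quot quot' QS hom this cR(4)]
      show ?thesis by (simp only: AQ.lie_of_simps(1))
    qed
    show "ssp (C.radical (carrier ?P)) ?P" by (rule C.radical(1)) simp
    show "act ?P y v \<in> C.radical (carrier ?P)" if "y \<in> I" "v \<in> carrier ?P" for y v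
      by (rule C.radical(2)[OF subset_refl that])
    show "C.radical (carrier ?P) \<subseteq> U"
      if "ssp U ?P" "\<And>y v. y \<in> I \<Longrightarrow> v \<in> carrier ?P \<Longrightarrow> act ?P y v \<in> U" for U
      by (rule C.radical(3)[OF subset_refl that])
  qed
  then show ?thesis
    using c cP(7)[OF fdP] cQ(7)[OF fdQ] cR(7) by simp
qed

end
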